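(* Let $D(a,\sigma)$ be a generalized Weyl algebra of rank $n$ which is the $n$-fold tensor power of a single rank $1$ generalized Weyl algebra, whose base ring $D$ is an affine commutative domain over $\mathsf{k}$, and let $G\leq S_n$ act on $D(a,\sigma)$ by permuting the tensor factors. For each $\mathfrak{m}\in\operatorname{Specm}D$ there exists an irreducible $D(a,\sigma)*G$-module $T_{\mathfrak{m}}$ which is a Harish-Chandra module (with respect to $D$) with $\mathfrak{m}$ in its support. If $D(a,\sigma)$ is a simple tensorial generalized Weyl algebra of classical or quantum type, then $T_{\mathfrak{m}}$ is holonomic, and in this case $T_{\mathfrak{m}}^G$ is a simple Harish-Chandra module for $D(a,\sigma)^G$ (with respect to $D^G$) that is also holonomic.
   Context: $\mathsf{k}$ is an algebraically closed field of characteristic zero; $\otimes=\otimes_{\mathsf{k}}$; affine means finitely generated as a $\mathsf{k}$-algebra. A rank $1$ generalized Weyl algebra $B(b,s)$ ($B$ a commutative domain, $s\in\operatorname{Aut}_{\mathsf{k}}B$, $b\in B$ regular) is generated over $B$ by $X^+,X^-$ with relations $X^+d=s(d)X^+$, $X^-d=s^{-1}(d)X^-$, $X^-X^+=b$, $X^+X^-=s(b)$. Its tensor power $B(b,s)^{\otimes n}$ is the rank $n$ generalized Weyl algebra $D(a,\sigma)$ with base ring $D=B^{\otimes n}$, with $X_i^\pm,a_i,\sigma_i$ denoting $X^\pm,b,s$ in the $i$-th factor. It is called tensorial if moreover $s$ has infinite order. The rank $1$ algebra is of classical type if $B=\mathsf{k}[h]$, $s(h)=h-1$, and of quantum type if $B=\mathsf{k}[h^{\pm1}]$,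 $s(h)=\lambda h$ with $\lambda\in\mathsf{k}\setminus\{0\}$ not a root of unity; "simple tensorial of classical or quantum type" means that the tensor power is a simple ring and the rank $1$ factor is of classical or quantum type. $\pi\in S_n$ acts by $\pi X_i^\pm=X_{\pi(i)}^\pm$ and by moving the $i$-th tensor factor of $D=B^{\otimes n}$ to position $\pi(i)$; $D(a,\sigma)*G$ is the skew group ring. A subalgebra $\Gamma\subset U$ is a Harish-Chandra subalgebra if $\Gamma u\Gamma$ is a finitely generated left and right $\Gamma$-module for all $u\in U$ and $\operatorname{Ext}^1_\Gamma$ between simple modules attached to distinct maximal ideals of finite codimension vanishes (automatic for commutative $\Gamma$). A Harish-Chandra module for $(U,\Gamma)$ is a finitely generated $U$-module $M$ with $M=\bigoplus_{\mathfrak{n}}M(\mathfrak{n})$, the sum over the maximal ideals $\mathfrak{n}$ of $\Gamma$ of finite codimension, where $M(\mathfrak{n})=\{x\in M:\mathfrak{n}^{N}x=0\text{ for some }N>0\}$; its support is $\{\mathfrak{n}:M(\mathfrak{n})\neq0\}$. For $D(a,\sigma)$ simple tensorial of classical or quantum type of rank $n$, every nonzero finitely generated module over $D(a,\sigma)*G$ or $D(a,\sigma)^G$ has Gelfand-Kirillov dimension at least $n$; a finitely generated module is holonomic if it is zero or has Gelfand-Kirillov dimension exactly $n$. *)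

theory Defs
  imports
    "HOL-Algebra.Algebra"
    "HOL-Computational_Algebra.Polynomial"
    "HOL-Library.Extended_Real"
    "HOL-Library.Liminf_Limsup"
    "Jordan_Normal_Form.VS_Connect"
begin

section \<open>Algebras over the ground field\<close>

text \<open>
  The ground field is a type \<open>'k\<close>, made into a record by \<open>class_ring\<close>.  An algebra is a
  \<^typ>\<open>('k, 'a) module\<close> record: a ring together with a scalar multiplication.
\<close>

definition k_algebra :: "('k::field, 'a) module \<Rightarrow> bool" where
  "k_algebra A \<longleftrightarrow> vectorspace (class_ring :: 'k ring) A \<and> ring A \<and>
     (\<forall>c. \<forall>x\<in>carrier A. \<forall>y\<in>carrier A.
        (c \<odot>\<^bsub>A\<^esub> x) \<otimes>\<^bsub>A\<^esub> y = c \<odot>\<^bsub>A\<^esub> (x \<otimes>\<^bsub>A\<^esub> y) \<and>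
        x \<otimes>\<^bsub>A\<^esub> (c \<odot>\<^bsub>A\<^esub> y) = c \<odot>\<^bsub>A\<^esub> (x \<otimes>\<^bsub>A\<^esub> y))"

definition alg_iso :: "('k::field, 'a) module \<Rightarrow> ('k, 'b) module \<Rightarrow> ('a \<Rightarrow> 'b) set" where
  "alg_iso A B = {f \<in> ring_iso A B. \<forall>c. \<forall>x\<in>carrier A. f (c \<odot>\<^bsub>A\<^esub> x) = c \<odot>\<^bsub>B\<^esub> f x}"

definition affine_algebra :: "('k::field, 'a) module \<Rightarrow> bool" where
  "affine_algebra A \<longleftrightarrow> (\<exists>S. finite S \<and> S \<subseteq> carrier A \<and>
     generate_ring A (S \<union> range (\<lambda>c. c \<odot>\<^bsub>A\<^esub> \<one>\<^bsub>A\<^esub>)) = carrier A)"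

definition simple_ring :: "('a, 'm) ring_scheme \<Rightarrow> bool" where
  "simple_ring R \<longleftrightarrow> ring R \<and> carrier R \<noteq> {\<zero>\<^bsub>R\<^esub>} \<and>
     (\<forall>I. ideal I R \<longrightarrow> I = {\<zero>\<^bsub>R\<^esub>} \<or> I = carrier R)"

definition quot_alg :: "('k::field, 'a) module \<Rightarrow> 'a set \<Rightarrow> ('k, 'a set) module" where
  "quot_alg A I = \<lparr>carrier = carrier (A Quot I), monoid.mult = monoid.mult (A Quot I),
     one = \<one>\<^bsub>A Quot I\<^esub>, ring.zero = \<zero>\<^bsub>A Quot I\<^esub>, add = add (A Quot I),
     smult = (\<lambda>c C. \<Union>x\<in>C. I +>\<^bsub>A\<^esub> (c \<odot>\<^bsub>A\<^esub> x))\<rparr>"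

text \<open>The monoid algebra: finitely supported functions on the monoid, under convolution.\<close>

definition mon_elt :: "'m \<Rightarrow> 'm \<Rightarrow> 'k::field" where
  "mon_elt x = (\<lambda>y. if y = x then 1 else 0)"

definition monoid_alg :: "('m, 'z) monoid_scheme \<Rightarrow> ('k::field, 'm \<Rightarrow> 'k) module" where
  "monoid_alg M = \<lparr>
     carrier = {f. finite {x. f x \<noteq> 0} \<and> {x. f x \<noteq> 0} \<subseteq> carrier M},
     monoid.mult = (\<lambda>f g z. \<Sum>(x, y)\<in>{(x, y). f x \<noteq> 0 \<and> g y \<noteq> 0 \<and> x \<otimes>\<^bsub>M\<^esub> y = z}. f x * g y),
     one = mon_elt \<one>\<^bsub>M\<^esub>, ring.zero = (\<lambda>_. 0), add = (\<lambda>f g x. f x + g x),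
     smult = (\<lambda>c f x. c * f x)\<rparr>"

text \<open>The linear extension of a map of monoid elements.\<close>

definition push :: "('m \<Rightarrow> 'l) \<Rightarrow> ('m \<Rightarrow> 'k::field) \<Rightarrow> 'l \<Rightarrow> 'k" where
  "push h f = (\<lambda>y. \<Sum>x | f x \<noteq> 0 \<and> h x = y. f x)"

definition free_monoid :: "'g set \<Rightarrow> 'g list monoid" where
  "free_monoid S = \<lparr>carrier = lists S, monoid.mult = (@), one = []\<rparr>"

abbreviation free_algebra :: "'g set \<Rightarrow> ('k::field, 'g list \<Rightarrow> 'k) module" where
  "free_algebra S \<equiv> monoid_alg (free_monoid S)"

section \<open>Tensor powers\<close>

text \<open>
  The \<open>n\<close>-th tensor power of an algebra is the space with basis the \<open>n\<close>-tuples (indexed by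
  \<open>{1..n}\<close>) modulo multilinearity, with componentwise multiplication of tuples.  A multiple by a
  tuple of a multilinearity relation is again such a relation, so the ideal they generate is
  their linear span.
\<close>

abbreviation tuples :: "nat \<Rightarrow> ('k::field, 'a) module \<Rightarrow> (nat \<Rightarrow> 'a) monoid" where
  "tuples n A \<equiv> product_group {1..n} (\<lambda>_. A)"

definition multilinear_relations ::
    "nat \<Rightarrow> ('k::field, 'a) module \<Rightarrow> ((nat \<Rightarrow> 'a) \<Rightarrow> 'k) set" where
  "multilinear_relations n A = (let F = monoid_alg (tuples n A) in
     {mon_elt (x(i := u \<oplus>\<^bsub>A\<^esub> v)) \<ominus>\<^bsub>F\<^esub> (mon_elt (x(i := u)) \<oplus>\<^bsub>F\<^esub> mon_elt (x(i := v))) | x i u v.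
        x \<in> carrier (tuples n A) \<and> i \<in> {1..n} \<and> u \<in> carrier A \<and> v \<in> carrier A} \<union>
     {mon_elt (x(i := c \<odot>\<^bsub>A\<^esub> u)) \<ominus>\<^bsub>F\<^esub> (c \<odot>\<^bsub>F\<^esub> mon_elt (x(i := u))) | x i c u.
        x \<in> carrier (tuples n A) \<and> i \<in> {1..n} \<and> u \<in> carrier A})"

definition tensor_ideal :: "nat \<Rightarrow> ('k::field, 'a) module \<Rightarrow> ((nat \<Rightarrow> 'a) \<Rightarrow> 'k) set" where
  "tensor_ideal n A = Idl\<^bsub>(monoid_alg (tuples n A) :: ('k, _) module)\<^esub> multilinear_relations n A"

type_synonym ('k, 'a) tensor = "((nat \<Rightarrow> 'a) \<Rightarrow> 'k) set"

definition tensor_power ::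
    "nat \<Rightarrow> ('k::field, 'a) module \<Rightarrow> ('k, ('k, 'a) tensor) module" where
  "tensor_power n A = quot_alg (monoid_alg (tuples n A)) (tensor_ideal n A)"

text \<open>
  The map of \<open>n\<close>-th tensor powers induced by a homomorphism \<open>f\<close> with values in \<open>A\<close>.  All cosets in
  the union coincide.
\<close>

definition tensor_map ::
    "nat \<Rightarrow> ('k::field, 'a) module \<Rightarrow> ('b \<Rightarrow> 'a) \<Rightarrow> ('k, 'b) tensor \<Rightarrow> ('k, 'a) tensor" where
  "tensor_map n A f C = (\<Union>t\<in>C. tensor_ideal n A +>\<^bsub>(monoid_alg (tuples n A) :: ('k, _) module)\<^esub>
     push (\<lambda>x. \<lambda>i\<in>{1..n}. f (x i)) t)"

text \<open>
  A permutation \<open>\<pi>\<close> moves the \<open>i\<close>-th factor to position \<open>\<pi> i\<close>, i.e. it sends the tuple \<open>x\<close>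
  to the tuple \<open>x \<circ> \<pi>\<inverse>\<close>.  The tensor ideal is stable under this, so the image of a coset
  is a coset.
\<close>

definition perm_act :: "(nat \<Rightarrow> nat) \<Rightarrow> ('k::field, 'a) tensor \<Rightarrow> ('k, 'a) tensor" where
  "perm_act \<pi> C = push (\<lambda>x. x \<circ> inv_into UNIV \<pi>) ` C"

section \<open>Generalized Weyl algebras\<close>

datatype 'b gwa_gen = Base 'b | Xplus | Xminus

definition gwa_gens :: "('k::field, 'b) module \<Rightarrow> 'b gwa_gen set" where
  "gwa_gens B = Base ` carrier B \<union> {Xplus, Xminus}"

text \<open>
  The first four families of relations make \<^const>\<open>Base\<close> a homomorphism of algebras from \<open>B\<close>;
  the others are the relations of \<open>B(b,s)\<close>.
\<close>

definition gwa_relations ::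
    "('k::field, 'b) module \<Rightarrow> ('b \<Rightarrow> 'b) \<Rightarrow> 'b \<Rightarrow> ('b gwa_gen list \<Rightarrow> 'k) set" where
  "gwa_relations B s b = (let F = free_algebra (gwa_gens B) in
     {mon_elt [Base (x \<oplus>\<^bsub>B\<^esub> y)] \<ominus>\<^bsub>F\<^esub> (mon_elt [Base x] \<oplus>\<^bsub>F\<^esub> mon_elt [Base y]) | x y.
        x \<in> carrier B \<and> y \<in> carrier B} \<union>
     {mon_elt [Base (c \<odot>\<^bsub>B\<^esub> x)] \<ominus>\<^bsub>F\<^esub> (c \<odot>\<^bsub>F\<^esub> mon_elt [Base x]) | c x. x \<in> carrier B} \<union>
     {mon_elt [Base (x \<otimes>\<^bsub>B\<^esub> y)] \<ominus>\<^bsub>F\<^esub> mon_elt [Base x, Base y] | x y.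
        x \<in> carrier B \<and> y \<in> carrier B} \<union>
     {mon_elt [Base \<one>\<^bsub>B\<^esub>] \<ominus>\<^bsub>F\<^esub> \<one>\<^bsub>F\<^esub>} \<union>
     {mon_elt [Xplus, Base d] \<ominus>\<^bsub>F\<^esub> mon_elt [Base (s d), Xplus] | d. d \<in> carrier B} \<union>
     {mon_elt [Xminus, Base d] \<ominus>\<^bsub>F\<^esub> mon_elt [Base (inv_into (carrier B) s d), Xminus] | d.
        d \<in> carrier B} \<union>
     {mon_elt [Xminus, Xplus] \<ominus>\<^bsub>F\<^esub> mon_elt [Base b]} \<union>
     {mon_elt [Xplus, Xminus] \<ominus>\<^bsub>F\<^esub> mon_elt [Base (s b)]})"

definition gwa_ideal ::
    "('k::field, 'b) module \<Rightarrow> ('b \<Rightarrow> 'b) \<Rightarrow> 'b \<Rightarrow> ('b gwa_gen list \<Rightarrow> 'k) set" where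
  "gwa_ideal B s b = Idl\<^bsub>(free_algebra (gwa_gens B) :: ('k, _) module)\<^esub> gwa_relations B s b"

type_synonym ('k, 'b) gwa_elt = "('b gwa_gen list \<Rightarrow> 'k) set"

definition gwa ::
    "('k::field, 'b) module \<Rightarrow> ('b \<Rightarrow> 'b) \<Rightarrow> 'b \<Rightarrow> ('k, ('k, 'b) gwa_elt) module" where
  "gwa B s b = quot_alg (free_algebra (gwa_gens B)) (gwa_ideal B s b)"

definition gwa_base ::
    "('k::field, 'b) module \<Rightarrow> ('b \<Rightarrow> 'b) \<Rightarrow> 'b \<Rightarrow> 'b \<Rightarrow> ('k, 'b) gwa_elt" where
  "gwa_base B s b d =
     gwa_ideal B s b +>\<^bsub>(free_algebra (gwa_gens B) :: ('k, _) module)\<^esub> mon_elt [Base d]"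

text \<open>
  The rank \<open>n\<close> algebra \<open>D(a,\<sigma>)\<close> is the tensor power of \<open>B(b,s)\<close>; its base ring \<open>D\<close> is
  \<open>tensor_power n B\<close>, mapped into it by \<open>gwa_power_base\<close>.
\<close>

type_synonym ('k, 'b) gwa_power_elt = "('k, ('k, 'b) gwa_elt) tensor"

definition gwa_power :: "nat \<Rightarrow> ('k::field, 'b) module \<Rightarrow> ('b \<Rightarrow> 'b) \<Rightarrow> 'b \<Rightarrow>
    ('k, ('k, 'b) gwa_power_elt) module" where
  "gwa_power n B s b = tensor_power n (gwa B s b)"

definition gwa_power_base :: "nat \<Rightarrow> ('k::field, 'b) module \<Rightarrow> ('b \<Rightarrow> 'b) \<Rightarrow> 'b \<Rightarrow>
    ('k, 'b) tensor \<Rightarrow> ('k, 'b) gwa_power_elt" where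
  "gwa_power_base n B s b = tensor_map n (gwa B s b) (gwa_base B s b)"

definition poly_alg :: "('k::field, 'k poly) module" where
  "poly_alg = \<lparr>carrier = UNIV, monoid.mult = (*), one = 1, ring.zero = 0, add = (+),
     smult = Polynomial.smult\<rparr>"

text \<open>Laurent polynomials, as the group algebra of the integers; the variable is \<open>mon_elt 1\<close>.\<close>

definition laurent_alg :: "('k::field, int \<Rightarrow> 'k) module" where
  "laurent_alg = monoid_alg \<lparr>carrier = UNIV, monoid.mult = (+), one = 0\<rparr>"

definition classical_type :: "('k::field, 'b) module \<Rightarrow> ('b \<Rightarrow> 'b) \<Rightarrow> bool" where
  "classical_type B s \<longleftrightarrow> (\<exists>f\<in>alg_iso poly_alg B.
     let h = f (monom 1 1) in s h = h \<ominus>\<^bsub>B\<^esub> \<one>\<^bsub>B\<^esub>)"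

definition quantum_type :: "('k::field, 'b) module \<Rightarrow> ('b \<Rightarrow> 'b) \<Rightarrow> bool" where
  "quantum_type B s \<longleftrightarrow> (\<exists>f\<in>alg_iso laurent_alg B. \<exists>q :: 'k.
     let h = f (mon_elt 1) in q \<noteq> 0 \<and> (\<forall>m>0. q ^ m \<noteq> 1) \<and> s h = q \<odot>\<^bsub>B\<^esub> h)"

definition infinite_order_on :: "'b set \<Rightarrow> ('b \<Rightarrow> 'b) \<Rightarrow> bool" where
  "infinite_order_on S s \<longleftrightarrow> (\<forall>m>0. \<exists>x\<in>S. (s ^^ m) x \<noteq> x)"

definition simple_tensorial_classical_or_quantum ::
    "nat \<Rightarrow> ('k::field, 'b) module \<Rightarrow> ('b \<Rightarrow> 'b) \<Rightarrow> 'b \<Rightarrow> bool" where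
  "simple_tensorial_classical_or_quantum n B s b \<longleftrightarrow>
     infinite_order_on (carrier B) s \<and> simple_ring (gwa_power n B s b) \<and>
     (classical_type B s \<or> quantum_type B s)"

section \<open>Skew group rings and invariants\<close>

definition skew_elt ::
    "('k::field, 'a) module \<Rightarrow> ('g, 'z) monoid_scheme \<Rightarrow> 'a \<Rightarrow> 'g \<Rightarrow> 'g \<Rightarrow> 'a" where
  "skew_elt A G a g = (\<lambda>p\<in>carrier G. if p = g then a else \<zero>\<^bsub>A\<^esub>)"

text \<open>
  An element \<open>f\<close> stands for the sum of the \<open>f g * g\<close>; the product is determined by
  \<open>(a * p) * (c * q) = a * p(c) * pq\<close>.
\<close>

definition skew_group_ring :: "('k::field, 'a) module \<Rightarrow> ('g, 'z) monoid_scheme \<Rightarrow>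
    ('g \<Rightarrow> 'a \<Rightarrow> 'a) \<Rightarrow> ('k, 'g \<Rightarrow> 'a) module" where
  "skew_group_ring A G act = \<lparr>
     carrier = {f \<in> carrier G \<rightarrow>\<^sub>E carrier A. finite {g \<in> carrier G. f g \<noteq> \<zero>\<^bsub>A\<^esub>}},
     monoid.mult = (\<lambda>f h. \<lambda>g\<in>carrier G. \<Oplus>\<^bsub>A\<^esub>p\<in>{p \<in> carrier G. f p \<noteq> \<zero>\<^bsub>A\<^esub>}.
        f p \<otimes>\<^bsub>A\<^esub> act p (h (inv\<^bsub>G\<^esub> p \<otimes>\<^bsub>G\<^esub> g))),
     one = skew_elt A G \<one>\<^bsub>A\<^esub> \<one>\<^bsub>G\<^esub>,
     ring.zero = (\<lambda>g\<in>carrier G. \<zero>\<^bsub>A\<^esub>),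
     add = (\<lambda>f h. \<lambda>g\<in>carrier G. f g \<oplus>\<^bsub>A\<^esub> h g),
     smult = (\<lambda>c f. \<lambda>g\<in>carrier G. c \<odot>\<^bsub>A\<^esub> f g)\<rparr>"

definition invariant_alg :: "('k::field, 'a) module \<Rightarrow> ('g, 'z) monoid_scheme \<Rightarrow>
    ('g \<Rightarrow> 'a \<Rightarrow> 'a) \<Rightarrow> ('k, 'a) module" where
  "invariant_alg A G act = A\<lparr>carrier := {a \<in> carrier A. \<forall>g\<in>carrier G. act g a = a}\<rparr>"

section \<open>Modules\<close>

text \<open>
  \<^locale>\<open>module\<close> requires a commutative ring of scalars, so left modules over an arbitrary ring
  are introduced here, on the same records (whose \<open>mult\<close> and \<open>one\<close> fields play no role).
\<close>

locale left_module = R?: ring R + M?: abelian_group M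
  for R :: "('u, 'z) ring_scheme" and M :: "('u, 'm) module" +
  assumes smult_closed:
      "\<lbrakk>a \<in> carrier R; x \<in> carrier M\<rbrakk> \<Longrightarrow> a \<odot>\<^bsub>M\<^esub> x \<in> carrier M"
    and smult_l_distr: "\<lbrakk>a \<in> carrier R; b \<in> carrier R; x \<in> carrier M\<rbrakk> \<Longrightarrow>
      (a \<oplus>\<^bsub>R\<^esub> b) \<odot>\<^bsub>M\<^esub> x = a \<odot>\<^bsub>M\<^esub> x \<oplus>\<^bsub>M\<^esub> b \<odot>\<^bsub>M\<^esub> x"
    and smult_r_distr: "\<lbrakk>a \<in> carrier R; x \<in> carrier M; y \<in> carrier M\<rbrakk> \<Longrightarrow>
      a \<odot>\<^bsub>M\<^esub> (x \<oplus>\<^bsub>M\<^esub> y) = a \<odot>\<^bsub>M\<^esub> x \<oplus>\<^bsub>M\<^esub> a \<odot>\<^bsub>M\<^esub> y"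
    and smult_assoc: "\<lbrakk>a \<in> carrier R; b \<in> carrier R; x \<in> carrier M\<rbrakk> \<Longrightarrow>
      (a \<otimes>\<^bsub>R\<^esub> b) \<odot>\<^bsub>M\<^esub> x = a \<odot>\<^bsub>M\<^esub> (b \<odot>\<^bsub>M\<^esub> x)"
    and smult_one: "x \<in> carrier M \<Longrightarrow> \<one>\<^bsub>R\<^esub> \<odot>\<^bsub>M\<^esub> x = x"

definition left_submodule ::
    "('u, 'z) ring_scheme \<Rightarrow> 'm set \<Rightarrow> ('u, 'm) module \<Rightarrow> bool" where
  "left_submodule R N M \<longleftrightarrow>
     additive_subgroup N M \<and> (\<forall>a\<in>carrier R. \<forall>x\<in>N. a \<odot>\<^bsub>M\<^esub> x \<in> N)"

definition fin_gen_module :: "('u, 'z) ring_scheme \<Rightarrow> ('u, 'm) module \<Rightarrow> bool" where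
  "fin_gen_module R M \<longleftrightarrow> (\<exists>S. finite S \<and> S \<subseteq> carrier M \<and>
     (\<forall>N. left_submodule R N M \<and> S \<subseteq> N \<longrightarrow> N = carrier M))"

definition irreducible_module :: "('u, 'z) ring_scheme \<Rightarrow> ('u, 'm) module \<Rightarrow> bool" where
  "irreducible_module R M \<longleftrightarrow> left_module R M \<and> carrier M \<noteq> {\<zero>\<^bsub>M\<^esub>} \<and>
     (\<forall>N. left_submodule R N M \<longrightarrow> N = {\<zero>\<^bsub>M\<^esub>} \<or> N = carrier M)"

definition restrict_scalars :: "('r \<Rightarrow> 'u) \<Rightarrow> ('u, 'm) module \<Rightarrow> ('r, 'm) module" where
  "restrict_scalars f M = \<lparr>carrier = carrier M, monoid.mult = monoid.mult M, one = \<one>\<^bsub>M\<^esub>,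
     ring.zero = \<zero>\<^bsub>M\<^esub>, add = add M, smult = (\<lambda>r x. f r \<odot>\<^bsub>M\<^esub> x)\<rparr>"

definition internal_direct_sum :: "('u, 'm) module \<Rightarrow> 'i set \<Rightarrow> ('i \<Rightarrow> 'm set) \<Rightarrow> bool" where
  "internal_direct_sum M I N \<longleftrightarrow> (\<forall>i\<in>I. additive_subgroup (N i) M) \<and>
     (\<forall>x\<in>carrier M. \<exists>!f. f \<in> (\<Pi>\<^sub>E i\<in>I. N i) \<and> finite {i \<in> I. f i \<noteq> \<zero>\<^bsub>M\<^esub>} \<and>
        x = (\<Oplus>\<^bsub>M\<^esub>i\<in>{i \<in> I. f i \<noteq> \<zero>\<^bsub>M\<^esub>}. f i))"

section \<open>Harish-Chandra modules\<close>

definition ideal_power :: "('c, 'z) ring_scheme \<Rightarrow> 'c set \<Rightarrow> nat \<Rightarrow> 'c set" where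
  "ideal_power R I N = (ideal_prod R I ^^ N) (carrier R)"

definition cofinite_maximal_ideals :: "('k::field, 'c) module \<Rightarrow> 'c set set" where
  "cofinite_maximal_ideals \<Gamma> = {\<nn>. maximalideal \<nn> \<Gamma> \<and>
     vectorspace.fin_dim (class_ring :: 'k ring) (quot_alg \<Gamma> \<nn>)}"

definition generalized_weight_space ::
    "('c, 'z) ring_scheme \<Rightarrow> ('c, 'm) module \<Rightarrow> 'c set \<Rightarrow> 'm set" where
  "generalized_weight_space \<Gamma> M \<nn> =
     {x \<in> carrier M. \<exists>N>0. \<forall>c\<in>ideal_power \<Gamma> \<nn> N. c \<odot>\<^bsub>M\<^esub> x = \<zero>\<^bsub>M\<^esub>}"

text \<open>In the next two definitions \<open>\<Gamma>\<close> is regarded as a subalgebra of \<open>U\<close> by means of \<open>\<iota>\<close>.\<close>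

definition harish_chandra_module ::
    "('k::field, 'u) module \<Rightarrow> ('k, 'c) module \<Rightarrow> ('c \<Rightarrow> 'u) \<Rightarrow> ('u, 'm) module \<Rightarrow> bool" where
  "harish_chandra_module U \<Gamma> \<iota> M \<longleftrightarrow> left_module U M \<and> fin_gen_module U M \<and>
     internal_direct_sum M (cofinite_maximal_ideals \<Gamma>)
       (generalized_weight_space \<Gamma> (restrict_scalars \<iota> M))"

definition hc_support ::
    "('k::field, 'c) module \<Rightarrow> ('c \<Rightarrow> 'u) \<Rightarrow> ('u, 'm) module \<Rightarrow> 'c set set" where
  "hc_support \<Gamma> \<iota> M = {\<nn> \<in> cofinite_maximal_ideals \<Gamma>.
     generalized_weight_space \<Gamma> (restrict_scalars \<iota> M) \<nn> \<noteq> {\<zero>\<^bsub>M\<^esub>}}"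

section \<open>Gelfand-Kirillov dimension\<close>

definition underlying_space :: "('k::field, 'u) module \<Rightarrow> ('u, 'm) module \<Rightarrow> ('k, 'm) module" where
  "underlying_space U M = restrict_scalars (\<lambda>c. c \<odot>\<^bsub>U\<^esub> \<one>\<^bsub>U\<^esub>) M"

text \<open>\<open>power_space U M V F N\<close> is the subspace \<open>V\<^sup>N F\<close> of \<open>M\<close>.\<close>

primrec power_space :: "('k::field, 'u) module \<Rightarrow> ('u, 'm) module \<Rightarrow> 'u set \<Rightarrow> 'm set \<Rightarrow> nat \<Rightarrow>
    'm set" where
  "power_space U M V F 0 = F"
| "power_space U M V F (Suc N) = module.span (class_ring :: 'k ring) (underlying_space U M)
     {v \<odot>\<^bsub>M\<^esub> x | v x. v \<in> V \<and> x \<in> power_space U M V F N}"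

definition fin_dim_subspaces :: "('k::field, 'v) module \<Rightarrow> 'v set set" where
  "fin_dim_subspaces E = {W. subspace (class_ring :: 'k ring) W E \<and>
     vectorspace.fin_dim (class_ring :: 'k ring) (E\<lparr>carrier := W\<rparr>)}"

definition GK_dim :: "('k::field, 'u) module \<Rightarrow> ('u, 'm) module \<Rightarrow> ereal" where
  "GK_dim U M = (SUP (V, F)\<in>{V \<in> fin_dim_subspaces U. \<one>\<^bsub>U\<^esub> \<in> V} \<times>
       fin_dim_subspaces (underlying_space U M).
     limsup (\<lambda>N. ereal (log (real N) (real (vectorspace.dim (class_ring :: 'k ring)
       ((underlying_space U M)\<lparr>carrier := power_space U M V F N\<rparr>))))))"

definition holonomic :: "nat \<Rightarrow> ('k::field, 'u) module \<Rightarrow> ('u, 'm) module \<Rightarrow> bool" where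
  "holonomic n U M \<longleftrightarrow> left_module U M \<and> fin_gen_module U M \<and>
     (carrier M = {\<zero>\<^bsub>M\<^esub>} \<or> GK_dim U M = ereal (real n))"

section \<open>The algebras and modules of the theorem\<close>

abbreviation perm_group :: "nat \<Rightarrow> (nat \<Rightarrow> nat) set \<Rightarrow> (nat \<Rightarrow> nat) monoid" where
  "perm_group n G \<equiv> (sym_group n)\<lparr>carrier := G\<rparr>"

type_synonym ('k, 'b) gwa_skew_elt = "(nat \<Rightarrow> nat) \<Rightarrow> ('k, 'b) gwa_power_elt"

definition gwa_skew :: "nat \<Rightarrow> ('k::field, 'b) module \<Rightarrow> ('b \<Rightarrow> 'b) \<Rightarrow> 'b \<Rightarrow> (nat \<Rightarrow> nat) set \<Rightarrow>
    ('k, ('k, 'b) gwa_skew_elt) module" where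
  "gwa_skew n B s b G = skew_group_ring (gwa_power n B s b) (perm_group n G) perm_act"

definition gwa_to_skew :: "nat \<Rightarrow> ('k::field, 'b) module \<Rightarrow> ('b \<Rightarrow> 'b) \<Rightarrow> 'b \<Rightarrow> (nat \<Rightarrow> nat) set \<Rightarrow>
    ('k, 'b) gwa_power_elt \<Rightarrow> ('k, 'b) gwa_skew_elt" where
  "gwa_to_skew n B s b G a =
     skew_elt (gwa_power n B s b) (perm_group n G) a \<one>\<^bsub>perm_group n G\<^esub>"

text \<open>
  For a module \<open>T\<close> over \<open>D(a,\<sigma>) * G\<close>, the subgroup of vectors fixed by the elements of \<open>G\<close>,
  on which the invariant ring acts through \<open>D(a,\<sigma>)\<close>.
\<close>

definition fixed_module :: "nat \<Rightarrow> ('k::field, 'b) module \<Rightarrow> ('b \<Rightarrow> 'b) \<Rightarrow> 'b \<Rightarrow> (nat \<Rightarrow> nat) set \<Rightarrow>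
    (('k, 'b) gwa_skew_elt, 'm) module \<Rightarrow> (('k, 'b) gwa_power_elt, 'm) module" where
  "fixed_module n B s b G T = (restrict_scalars (gwa_to_skew n B s b G) T)
     \<lparr>carrier := {t \<in> carrier T. \<forall>g\<in>G.
        skew_elt (gwa_power n B s b) (perm_group n G) \<one>\<^bsub>gwa_power n B s b\<^esub> g \<odot>\<^bsub>T\<^esub> t = t}\<rparr>"

end

theory Submission
  imports Defs
begin

text \<open>
  By the Nullstellensatz \<open>\<mm>\<close> is the kernel of a character \<open>\<chi>\<close> of \<open>D\<close>.  A tensor product of matrix
  coefficients of weight representations of the rank one factors is a functional \<open>\<phi>\<close> on \<open>D(a,\<sigma>)\<close>
  with \<open>\<phi>(1) = 1\<close> and \<open>\<phi>(a d) = \<phi>(a) \<chi>(d)\<close>, so the left ideal of \<open>D(a,\<sigma>) * G\<close> generated by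
  \<open>\<mm>\<close> is proper; \<open>T\<close> is the quotient by a maximal left ideal above it.  It is spanned by the vectors
  \<open>Y\<^sup>J g v\<close> with \<open>J \<in> \<int>\<^sup>n\<close>, \<open>g \<in> G\<close>, where \<open>Y\<^sup>J\<close> is a monomial in the \<open>X\<^sub>i\<^sup>\<plusminus>\<close>; these are weight
  vectors, and counting those in the box \<open>\<bar>J\<^sub>i\<bar> \<le> N\<close> bounds the Gelfand-Kirillov dimension by \<open>n\<close>.

  If \<open>D(a,\<sigma>)\<close> is simple, \<open>b\<close> has at most one zero on every orbit of \<open>s\<close> on the characters of \<open>B\<close>:
  two zeros would give a finite dimensional representation of the rank one factor, and its matrix
  coefficients a proper nonzero ideal.  Hence in every slot the powers of one of \<open>X\<^sup>+\<close>, \<open>X\<^sup>-\<close> never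
  kill \<open>v\<close>, and the resulting \<open>N\<^sup>n\<close> vectors have distinct weights, so the dimension is exactly \<open>n\<close>.
  Averaging over \<open>G\<close> makes \<open>T\<^sup>G\<close> irreducible once it is nonzero; that it is nonzero, and grows as fast
  as \<open>T\<close>, follows from an expression \<open>1 = \<Sum> u\<^sub>i e w\<^sub>i\<close> with \<open>e = \<Sum>\<^bsub>g\<in>G\<^esub> g\<close>, which simplicity provides.
\<close>

section \<open>Algebras and their quotients\<close>

text \<open>All algebras here are sets of cosets in monoid algebras, and no basis of
  \<open>gwa\<close> or of its tensor powers is established. Spanning sets are enough for upper
  bounds. Nonvanishing is certified by functionals: they are computed on words or tuples and shown
  to respect the relations. For this reason the weight representations of rank one enter the tensor
  power only through matrix coefficients, whose slotwise products are defined there at once.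

  The character \<chi> belonging to \<mm> may be fixed by part of G, so it cannot be used to place 1
  in the ideal generated by the sum over G. A second character in general position serves for that:
  one rank one character is shifted by a different power of s in each slot, so that no nontrivial
  permutation fixes the result.

  The study of T and of its fixed vectors is carried out over abstract data: two rings, a group,
  monomials \<open>Y J\<close> and two spanning rules. Cosets of tensors return only when these data
  are instantiated.\<close>

lemma (in ring) ideal_criterion:
  assumes "I \<subseteq> carrier R" "\<zero> \<in> I" "\<And>x y. x \<in> I \<Longrightarrow> y \<in> I \<Longrightarrow> x \<oplus> y \<in> I"
    and "\<And>x a. x \<in> I \<Longrightarrow> a \<in> carrier R \<Longrightarrow> a \<otimes> x \<in> I"
    and "\<And>x a. x \<in> I \<Longrightarrow> a \<in> carrier R \<Longrightarrow> x \<otimes> a \<in> I"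
  shows "ideal I R"
proof (rule idealI[OF ring_axioms])
  show "subgroup I (add_monoid R)"
  proof (rule add.subgroupI)
    fix x assume x: "x \<in> I"
    then have "\<ominus> \<one> \<otimes> x = \<ominus> x" using assms(1) by (auto simp: l_minus)
    then show "\<ominus> x \<in> I" using assms(4)[OF x, of "\<ominus> \<one>"] by simp
  qed (use assms in auto)
qed (use assms in auto)

lemma k_algebraI:
  fixes A :: "('k::field, 'a) module"
  assumes "ring A"
    and "\<And>c x. x \<in> carrier A \<Longrightarrow> c \<odot>\<^bsub>A\<^esub> x \<in> carrier A"
    and "\<And>c d x. x \<in> carrier A \<Longrightarrow> (c + d) \<odot>\<^bsub>A\<^esub> x = c \<odot>\<^bsub>A\<^esub> x \<oplus>\<^bsub>A\<^esub> d \<odot>\<^bsub>A\<^esub> x"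
    and "\<And>c x y. x \<in> carrier A \<Longrightarrow> y \<in> carrier A \<Longrightarrow> c \<odot>\<^bsub>A\<^esub> (x \<oplus>\<^bsub>A\<^esub> y) = c \<odot>\<^bsub>A\<^esub> x \<oplus>\<^bsub>A\<^esub> c \<odot>\<^bsub>A\<^esub> y"
    and "\<And>c d x. x \<in> carrier A \<Longrightarrow> (c * d) \<odot>\<^bsub>A\<^esub> x = c \<odot>\<^bsub>A\<^esub> (d \<odot>\<^bsub>A\<^esub> x)"
    and "\<And>x. x \<in> carrier A \<Longrightarrow> 1 \<odot>\<^bsub>A\<^esub> x = x"
    and "\<And>c x y. x \<in> carrier A \<Longrightarrow> y \<in> carrier A \<Longrightarrow> (c \<odot>\<^bsub>A\<^esub> x) \<otimes>\<^bsub>A\<^esub> y = c \<odot>\<^bsub>A\<^esub> (x \<otimes>\<^bsub>A\<^esub> y)"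
    and "\<And>c x y. x \<in> carrier A \<Longrightarrow> y \<in> carrier A \<Longrightarrow> x \<otimes>\<^bsub>A\<^esub> (c \<odot>\<^bsub>A\<^esub> y) = c \<odot>\<^bsub>A\<^esub> (x \<otimes>\<^bsub>A\<^esub> y)"
  shows "k_algebra A"
proof -
  interpret ring A by fact
  have "module (class_ring :: 'k ring) A"
    by (intro Module.moduleI) (use assms in \<open>auto simp: class_ring_simps class_cring.cring_axioms abelian_group_axioms\<close>)
  then have "vectorspace (class_ring :: 'k ring) A"
    by (simp add: vectorspace_def class_field.field_axioms)
  then show ?thesis using assms by (auto simp: k_algebra_def)
qed

locale kalg =
  fixes A :: "('k::field, 'a) module" (structure)
  assumes k_algebra: "k_algebra A"
begin

sublocale ring A
  using k_algebra by (simp add: k_algebra_def)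

lemma vectorspace: "vectorspace (class_ring :: 'k ring) A"
  using k_algebra by (simp add: k_algebra_def)

lemma module: "module (class_ring :: 'k ring) A"
  using vectorspace by (simp add: vectorspace_def)

lemma sm_closed [simp, intro]: "x \<in> carrier A \<Longrightarrow> c \<odot> x \<in> carrier A"
  using module.smult_closed[OF module, of c x] by simp

lemma sm_l_distr: "x \<in> carrier A \<Longrightarrow> (c + d) \<odot> x = c \<odot> x \<oplus> d \<odot> x"
  using module.smult_l_distr[OF module, of c d x] by simp

lemma sm_r_distr: "x \<in> carrier A \<Longrightarrow> y \<in> carrier A \<Longrightarrow> c \<odot> (x \<oplus> y) = c \<odot> x \<oplus> c \<odot> y"
  using module.smult_r_distr[OF module, of c x y] by simp

lemma sm_assoc: "x \<in> carrier A \<Longrightarrow> c \<odot> (d \<odot> x) = (c * d) \<odot> x"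
  using module.smult_assoc1[OF module, of c d x] by simp

lemma sm_one [simp]: "x \<in> carrier A \<Longrightarrow> 1 \<odot> x = x"
  using module.smult_one[OF module, of x] by simp

lemma sm_zero [simp]: "x \<in> carrier A \<Longrightarrow> 0 \<odot> x = \<zero>"
  using module.lmult_0[OF module, of x] by simp

lemma sm_zero_right [simp]: "c \<odot> \<zero> = \<zero>"
  using module.rmult_0[OF module, of c] by simp

lemma sm_mult_left: "x \<in> carrier A \<Longrightarrow> y \<in> carrier A \<Longrightarrow> (c \<odot> x) \<otimes> y = c \<odot> (x \<otimes> y)"
  and sm_mult_right: "x \<in> carrier A \<Longrightarrow> y \<in> carrier A \<Longrightarrow> x \<otimes> (c \<odot> y) = c \<odot> (x \<otimes> y)"
  using k_algebra by (auto simp: k_algebra_def)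

lemma sm_minus: "x \<in> carrier A \<Longrightarrow> (- c) \<odot> x = \<ominus> (c \<odot> x)"
  using sm_l_distr[of x "- c" c] by (intro minus_equality[symmetric]) auto

lemma sm_minus_right: "x \<in> carrier A \<Longrightarrow> c \<odot> (\<ominus> x) = \<ominus> (c \<odot> x)"
  using sm_r_distr[of "\<ominus> x" x c] by (intro minus_equality[symmetric]) (auto simp: l_neg)

lemma sm_one_mult: "x \<in> carrier A \<Longrightarrow> (c \<odot> \<one>) \<otimes> x = c \<odot> x"
  by (simp add: sm_mult_left)

lemma sm_cancel:
  assumes "c \<odot> x = c \<odot> y" "c \<noteq> 0" "x \<in> carrier A" "y \<in> carrier A" shows "x = y"
proof -
  have "inverse c \<odot> (c \<odot> x) = inverse c \<odot> (c \<odot> y)" by (simp add: assms)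
  then show ?thesis unfolding sm_assoc[OF assms(3)] sm_assoc[OF assms(4)] using assms by simp
qed

end

lemma kalgI: "k_algebra A \<Longrightarrow> kalg A"
  by (simp add: kalg_def)

locale kalg_ideal = kalg A for A :: "('k::field, 'a) module" (structure) +
  fixes I assumes ideal: "ideal I A"
begin

abbreviation "Q \<equiv> quot_alg A I"

sublocale I: ideal I A by (fact ideal)

lemma sm_ideal: "x \<in> I \<Longrightarrow> c \<odot> x \<in> I"
  using I.I_l_closed[of x "c \<odot> \<one>"] by (simp add: sm_one_mult I.Icarr)

lemma coset_eq_iff: "x \<in> carrier A \<Longrightarrow> y \<in> carrier A \<Longrightarrow> I +> x = I +> y \<longleftrightarrow> x \<ominus> y \<in> I"
  by (simp add: quotient_eq_iff_same_a_r_cos[OF I.is_ideal])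

lemma quot_cases: "C \<in> carrier Q \<Longrightarrow> (\<And>x. x \<in> carrier A \<Longrightarrow> C = I +> x \<Longrightarrow> P) \<Longrightarrow> P"
  by (auto simp: quot_alg_def FactRing_def A_RCOSETS_def')

lemma coset_closed: "x \<in> carrier A \<Longrightarrow> I +> x \<in> carrier Q"
  by (auto simp: quot_alg_def FactRing_def A_RCOSETS_def')

lemma coset_add: "x \<in> carrier A \<Longrightarrow> y \<in> carrier A \<Longrightarrow> (I +> x) \<oplus>\<^bsub>Q\<^esub> (I +> y) = I +> (x \<oplus> y)"
  by (simp add: quot_alg_def FactRing_def I.a_rcos_sum)

lemma coset_mult: "x \<in> carrier A \<Longrightarrow> y \<in> carrier A \<Longrightarrow> (I +> x) \<otimes>\<^bsub>Q\<^esub> (I +> y) = I +> (x \<otimes> y)"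
  by (simp add: quot_alg_def FactRing_def I.rcoset_mult_add)

lemma coset_one: "\<one>\<^bsub>Q\<^esub> = I +> \<one>"
  by (simp add: quot_alg_def FactRing_def)

lemma coset_zero: "\<zero>\<^bsub>Q\<^esub> = I +> \<zero>"
  by (simp add: quot_alg_def FactRing_def I.a_rcos_const)

text \<open>\<open>quot_alg\<close> defines a scalar multiple as a union over all representatives.
  An ideal is stable under scalars because c x = (c 1) x, so the members of this union
  coincide.\<close>

lemma sm_coset:
  assumes x: "x \<in> carrier A" shows "c \<odot>\<^bsub>Q\<^esub> (I +> x) = I +> (c \<odot> x)"
proof -
  have "I +> (c \<odot> y) = I +> (c \<odot> x)" if "y \<in> I +> x" for y
  proof -
    have y: "y \<in> carrier A" using that x I.a_elemrcos_carrier by blast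
    have "y \<ominus> x \<in> I" using that x y by (simp add: I.a_rcos_module_imp a_minus_def)
    then have "c \<odot> (y \<ominus> x) \<in> I" by (rule sm_ideal)
    then show ?thesis using x y by (simp add: coset_eq_iff a_minus_def sm_r_distr sm_minus_right)
  qed
  moreover have "x \<in> I +> x" using x by (rule I.a_rcos_self)
  ultimately have "(\<Union>y\<in>I +> x. I +> (c \<odot> y)) = I +> (c \<odot> x)"
    by (metis (no_types, lifting) SUP_eq_const empty_iff)
  then show ?thesis by (simp add: quot_alg_def)
qed

lemma quot_ring: "ring Q"
proof (rule ringI)
  show "abelian_group Q"
  proof (rule abelian_groupI)
    fix C assume "C \<in> carrier Q"
    then obtain x where x: "x \<in> carrier A" "C = I +> x" by (rule quot_cases)
    then show "\<exists>D\<in>carrier Q. D \<oplus>\<^bsub>Q\<^esub> C = \<zero>\<^bsub>Q\<^esub>"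
      by (intro bexI[of _ "I +> (\<ominus> x)"]) (auto simp: coset_add coset_zero coset_closed l_neg)
  qed (auto elim!: quot_cases simp: coset_add coset_closed coset_zero a_ac)
  show "Group.monoid Q"
    by (rule monoidI) (auto elim!: quot_cases simp: coset_mult coset_closed coset_one m_assoc)
qed (auto elim!: quot_cases simp: coset_add coset_mult coset_closed l_distr r_distr)

lemma quot_k_algebra: "k_algebra Q"
proof (rule k_algebraI)
  show "ring Q" by (rule quot_ring)
qed (auto elim!: quot_cases simp: coset_add coset_mult sm_coset coset_closed sm_l_distr sm_r_distr
    sm_assoc sm_mult_left sm_mult_right)

lemma coset_eq_zero_iff: "x \<in> carrier A \<Longrightarrow> I +> x = \<zero>\<^bsub>Q\<^esub> \<longleftrightarrow> x \<in> I"
  by (simp add: coset_zero coset_eq_iff a_minus_def)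

end

text \<open>Evaluates \<open>f\<close> at an arbitrary representative, hence has the intended value
  only where \<open>f\<close> is constant on cosets. Product functionals on tensor powers and the
  weight representations are obtained in this way.\<close>

definition descend :: "('a \<Rightarrow> 'c) \<Rightarrow> 'a set \<Rightarrow> 'c" where
  "descend f C = f (SOME x. x \<in> C)"

lemma (in kalg_ideal) descend_coset:
  assumes "\<And>x y. x \<in> carrier A \<Longrightarrow> y \<in> carrier A \<Longrightarrow> x \<ominus> y \<in> I \<Longrightarrow> f x = f y" and x: "x \<in> carrier A"
  shows "descend f (I +> x) = f x"
proof -
  have "x \<in> I +> x" using x by (rule I.a_rcos_self)
  then have *: "(SOME y. y \<in> I +> x) \<in> I +> x" by (rule someI)
  define y where "y = (SOME y. y \<in> I +> x)"
  have y: "y \<in> carrier A" using * x I.a_elemrcos_carrier unfolding y_def by blast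
  have "y \<ominus> x \<in> I" using * x y unfolding y_def by (simp add: I.a_rcos_module_imp a_minus_def)
  then show ?thesis using assms y by (auto simp: descend_def y_def)
qed

section \<open>Monoid algebras\<close>

text \<open>The pairing of a finitely supported \<open>f\<close> with an arbitrary function on the
  monoid, that is, the linear extension of \<open>\<phi>\<close> evaluated at \<open>f\<close>. It
  is the main working tool for monoid algebras: it turns convolution into iterated evaluation and
  needs no structure on \<open>\<phi>\<close>.\<close>

definition lin :: "('m \<Rightarrow> 'k::field) \<Rightarrow> ('m \<Rightarrow> 'k) \<Rightarrow> 'k" where
  "lin \<phi> f = (\<Sum>x | f x \<noteq> 0. f x * \<phi> x)"

lemma lin_superset:
  assumes "finite S" "{x. f x \<noteq> 0} \<subseteq> S" shows "lin \<phi> f = (\<Sum>x\<in>S. f x * \<phi> x)"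
  unfolding lin_def by (rule sum.mono_neutral_left) (use assms in auto)

lemma lin_add:
  assumes "finite {x. f x \<noteq> 0}" "finite {x. g x \<noteq> 0}"
  shows "lin \<phi> (\<lambda>x. f x + g x) = lin \<phi> f + lin \<phi> g"
proof -
  let ?S = "{x. f x \<noteq> 0} \<union> {x. g x \<noteq> 0}"
  have "finite ?S" using assms by auto
  then show ?thesis
    by (subst (1 2 3) lin_superset[of ?S]) (auto simp: sum.distrib distrib_right)
qed

lemma lin_scale: "lin \<phi> (\<lambda>x. c * f x) = c * lin \<phi> f"
  by (cases "c = 0") (auto simp: lin_def sum_distrib_left mult.assoc)

lemma lin_uminus: "lin \<phi> (\<lambda>x. - f x) = - lin \<phi> f"
  using lin_scale[of \<phi> "-1" f] by simp

lemma lin_mon [simp]: "lin \<phi> (mon_elt x) = \<phi> x"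
  by (subst lin_superset[of "{x}"]) (auto simp: mon_elt_def)

lemma lin_zero [simp]: "lin \<phi> (\<lambda>_. 0) = 0" and lin_zero' [simp]: "lin (\<lambda>_. 0) f = 0"
  by (simp_all add: lin_def)

lemma finite_supp_scale: "finite {y. f y \<noteq> 0} \<Longrightarrow> finite {y. c * f y \<noteq> (0::'k::field)}"
  by (rule finite_subset[of _ "{y. f y \<noteq> 0}"]) auto

lemma finite_supp_add: "finite {y. f y \<noteq> 0} \<Longrightarrow> finite {y. g y \<noteq> 0} \<Longrightarrow> finite {y. f y + g y \<noteq> (0::'k::field)}"
  by (rule finite_subset[of _ "{y. f y \<noteq> 0} \<union> {y. g y \<noteq> 0}"]) auto

locale mon_alg = monoid M for M :: "('m, 'z) monoid_scheme" (structure)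
begin

abbreviation F :: "('k::field, 'm \<Rightarrow> 'k) module" where "F \<equiv> monoid_alg M"

lemma F_simps: "carrier F = {f. finite {x. f x \<noteq> 0} \<and> {x. f x \<noteq> 0} \<subseteq> carrier M}"
  "\<one>\<^bsub>F\<^esub> = mon_elt \<one>" "\<zero>\<^bsub>F\<^esub> = (\<lambda>_. 0)" "f \<oplus>\<^bsub>F\<^esub> g = (\<lambda>x. f x + g x)" "c \<odot>\<^bsub>F\<^esub> f = (\<lambda>x. c * f x)"
  by (simp_all add: monoid_alg_def)

lemma F_mult_eq:
  assumes "finite {x. f x \<noteq> 0}" "finite {x. g x \<noteq> 0}"
  shows "(f \<otimes>\<^bsub>F\<^esub> g) z = lin (\<lambda>x. lin (\<lambda>y. if x \<otimes> y = z then 1 else 0) g) f"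
proof -
  have "(\<Sum>(x, y)\<in>{(x, y). f x \<noteq> 0 \<and> g y \<noteq> 0 \<and> x \<otimes> y = z}. f x * g y) =
     (\<Sum>(x, y)\<in>{x. f x \<noteq> 0} \<times> {y. g y \<noteq> 0}. if x \<otimes> y = z then f x * g y else 0)"
    using assms by (intro sum.mono_neutral_cong_left) (auto split: if_splits)
  also have "\<dots> = (\<Sum>x | f x \<noteq> 0. \<Sum>y | g y \<noteq> 0. if x \<otimes> y = z then f x * g y else 0)"
    by (simp add: sum.cartesian_product)
  also have "\<dots> = (\<Sum>x | f x \<noteq> 0. f x * (\<Sum>y | g y \<noteq> 0. g y * (if x \<otimes> y = z then 1 else 0)))"
    by (auto simp: sum_distrib_left intro!: sum.cong)
  finally show ?thesis by (simp add: monoid_alg_def lin_def)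
qed

lemma lin_add': "f \<in> carrier F \<Longrightarrow> g \<in> carrier F \<Longrightarrow> lin \<phi> (f \<oplus>\<^bsub>F\<^esub> g) = lin \<phi> f + lin \<phi> g"
  by (simp add: F_simps lin_add)

lemma lin_scale': "lin \<phi> (c \<odot>\<^bsub>F\<^esub> f) = c * lin \<phi> f"
  by (simp add: F_simps lin_scale)

lemma F_supp_mult: "{z. (f \<otimes>\<^bsub>F\<^esub> g) z \<noteq> 0} \<subseteq> (\<lambda>(x, y). x \<otimes> y) ` ({x. f x \<noteq> 0} \<times> {y. g y \<noteq> 0})"
proof
  fix z assume "z \<in> {z. (f \<otimes>\<^bsub>F\<^esub> g) z \<noteq> 0}"
  then have "{(x, y). f x \<noteq> 0 \<and> g y \<noteq> 0 \<and> x \<otimes> y = z} \<noteq> {}"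
    by (force simp: monoid_alg_def)
  then show "z \<in> (\<lambda>(x, y). x \<otimes> y) ` ({x. f x \<noteq> 0} \<times> {y. g y \<noteq> 0})" by force
qed

lemma F_mult_closed: "f \<in> carrier F \<Longrightarrow> g \<in> carrier F \<Longrightarrow> f \<otimes>\<^bsub>F\<^esub> g \<in> carrier F"
proof -
  assume fg: "f \<in> carrier F" "g \<in> carrier F"
  then have "finite {z. (f \<otimes>\<^bsub>F\<^esub> g) z \<noteq> 0}"
    using F_supp_mult[of f g] by (rule_tac finite_subset) (auto simp: F_simps)
  moreover have "{z. (f \<otimes>\<^bsub>F\<^esub> g) z \<noteq> 0} \<subseteq> carrier M"
    using F_supp_mult[of f g] fg by (auto simp: F_simps dest!: subsetD)
  ultimately show ?thesis by (simp add: F_simps)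
qed

text \<open>Expanding the coefficients of the product introduces a sum over the possible products z;
  each pair (x, y) contributes to exactly one of them, so interchanging the sums collapses it.
  Associativity of convolution is thereby reduced to associativity in the monoid.\<close>

lemma lin_mult:
  assumes f: "f \<in> carrier F" and g: "g \<in> carrier F"
  shows "lin \<phi> (f \<otimes>\<^bsub>F\<^esub> g) = lin (\<lambda>x. lin (\<lambda>y. \<phi> (x \<otimes> y)) g) f"
proof -
  let ?S = "{x. f x \<noteq> 0}" let ?T = "{y. g y \<noteq> 0}"
  have fin: "finite ?S" "finite ?T" using f g by (auto simp: F_simps)
  let ?P = "(\<lambda>(x, y). x \<otimes> y) ` (?S \<times> ?T)"
  have "lin \<phi> (f \<otimes>\<^bsub>F\<^esub> g) = (\<Sum>z\<in>?P. (f \<otimes>\<^bsub>F\<^esub> g) z * \<phi> z)"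
    using fin F_supp_mult by (intro lin_superset) auto
  also have "\<dots> = (\<Sum>z\<in>?P. \<Sum>x\<in>?S. \<Sum>y\<in>?T. f x * g y * (if x \<otimes> y = z then \<phi> z else 0))"
    unfolding F_mult_eq[OF fin] lin_def
    by (auto simp: sum_distrib_left sum_distrib_right intro!: sum.cong)
  also have "\<dots> = (\<Sum>x\<in>?S. \<Sum>z\<in>?P. \<Sum>y\<in>?T. f x * g y * (if x \<otimes> y = z then \<phi> z else 0))"
    by (rule sum.swap)
  also have "\<dots> = (\<Sum>x\<in>?S. \<Sum>y\<in>?T. \<Sum>z\<in>?P. f x * g y * (if x \<otimes> y = z then \<phi> z else 0))"
    by (rule sum.cong[OF refl], rule sum.swap)
  also have "\<dots> = (\<Sum>x\<in>?S. \<Sum>y\<in>?T. f x * g y * \<phi> (x \<otimes> y))"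
  proof (intro sum.cong refl)
    fix x y assume "x \<in> ?S" "y \<in> ?T"
    then have "x \<otimes> y \<in> ?P" by auto
    then have "(\<Sum>z\<in>?P. (if x \<otimes> y = z then \<phi> z else 0)) = \<phi> (x \<otimes> y)"
      using fin by (subst sum.delta') auto
    then show "(\<Sum>z\<in>?P. f x * g y * (if x \<otimes> y = z then \<phi> z else 0)) = f x * g y * \<phi> (x \<otimes> y)"
      by (simp add: sum_distrib_left[symmetric])
  qed
  finally show ?thesis by (simp add: lin_def sum_distrib_left mult.assoc)
qed

lemma lin_cong: "f \<in> carrier F \<Longrightarrow> (\<And>x. x \<in> carrier M \<Longrightarrow> \<phi> x = \<psi> x) \<Longrightarrow> lin \<phi> f = lin \<psi> f"
  unfolding lin_def by (intro sum.cong) (auto simp: F_simps)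

text \<open>Pairing with the indicator of a point recovers the coefficient there, so functionals
  separate elements. The laws of multiplication in the monoid algebra are all proved by this
  test.\<close>

lemma F_eqI: "(\<And>\<phi>. lin \<phi> f = lin \<phi> g) \<Longrightarrow> finite {x. f x \<noteq> 0} \<Longrightarrow> finite {x. g x \<noteq> 0} \<Longrightarrow> f = (g :: 'm \<Rightarrow> 'k::field)"
proof
  fix x assume *: "\<And>\<phi>. lin \<phi> f = lin \<phi> g" and fin: "finite {x. f x \<noteq> 0}" "finite {x. g x \<noteq> 0}"
  have "h y * (if y = x then 1 else 0) = (if y = x then h y else 0)" for y and h :: "'m \<Rightarrow> 'k" by simp
  then have **: "lin (\<lambda>y. if y = x then 1 else 0) h = h x" if "finite {x. h x \<noteq> 0}" for h :: "'m \<Rightarrow> 'k"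
    by (subst lin_superset[of "insert x {x. h x \<noteq> 0}"]) (use that in auto)
  show "f x = g x" using *[of "\<lambda>y. if y = x then 1 else 0"] ** fin by simp
qed

lemma F_eqI': "f \<in> carrier F \<Longrightarrow> g \<in> carrier F \<Longrightarrow> (\<And>\<phi>. lin \<phi> f = lin \<phi> g) \<Longrightarrow> f = g"
  by (rule F_eqI) (auto simp: F_simps)

lemma mon_closed [simp]: "x \<in> carrier M \<Longrightarrow> mon_elt x \<in> carrier F"
  by (auto simp: F_simps mon_elt_def)

lemma F_add_closed: "f \<in> carrier F \<Longrightarrow> g \<in> carrier F \<Longrightarrow> f \<oplus>\<^bsub>F\<^esub> g \<in> carrier F"
proof -
  assume *: "f \<in> carrier F" "g \<in> carrier F"
  then have "finite {x. f x + g x \<noteq> 0}" by (intro finite_supp_add) (auto simp: F_simps)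
  moreover have "{x. f x + g x \<noteq> 0} \<subseteq> {x. f x \<noteq> 0} \<union> {x. g x \<noteq> 0}" by auto
  ultimately show ?thesis using * by (auto simp: F_simps)
qed

lemma F_sm_closed: "f \<in> carrier F \<Longrightarrow> c \<odot>\<^bsub>F\<^esub> f \<in> carrier F"
  using finite_supp_scale[of f c] by (auto simp: F_simps)

lemma F_ring: "ring (F :: ('k::field, 'm \<Rightarrow> 'k) module)"
proof (rule ringI)
  show "abelian_group (F :: ('k::field, 'm \<Rightarrow> 'k) module)"
  proof (rule abelian_groupI)
    fix f :: "'m \<Rightarrow> 'k" assume "f \<in> carrier F"
    then show "\<exists>g\<in>carrier F. g \<oplus>\<^bsub>F\<^esub> f = \<zero>\<^bsub>F\<^esub>"
      by (intro bexI[of _ "(-1) \<odot>\<^bsub>F\<^esub> f"] F_sm_closed) (auto simp: F_simps)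
  qed (auto simp: F_add_closed, auto simp: F_simps ac_simps)
  show "monoid (F :: ('k::field, 'm \<Rightarrow> 'k) module)"
  proof (rule monoidI)
    fix f g h :: "'m \<Rightarrow> 'k" assume *: "f \<in> carrier F" "g \<in> carrier F" "h \<in> carrier F"
    show "f \<otimes>\<^bsub>F\<^esub> g \<otimes>\<^bsub>F\<^esub> h = f \<otimes>\<^bsub>F\<^esub> (g \<otimes>\<^bsub>F\<^esub> h)"
      using * by (intro F_eqI') (auto simp: F_mult_closed lin_mult m_assoc intro!: lin_cong)
  next
    fix f :: "'m \<Rightarrow> 'k" assume *: "f \<in> carrier F"
    have 1: "\<one>\<^bsub>F\<^esub> \<in> carrier F" by (subst F_simps(2), rule mon_closed) simp
    show "\<one>\<^bsub>F\<^esub> \<otimes>\<^bsub>F\<^esub> f = f" "f \<otimes>\<^bsub>F\<^esub> \<one>\<^bsub>F\<^esub> = f"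
      using * 1 by (auto intro!: F_eqI' simp: F_mult_closed lin_mult F_simps(2) intro!: lin_cong)
  qed (auto simp: F_mult_closed F_simps(2))
  fix f g h :: "'m \<Rightarrow> 'k" assume *: "f \<in> carrier F" "g \<in> carrier F" "h \<in> carrier F"
  show "(f \<oplus>\<^bsub>F\<^esub> g) \<otimes>\<^bsub>F\<^esub> h = f \<otimes>\<^bsub>F\<^esub> h \<oplus>\<^bsub>F\<^esub> g \<otimes>\<^bsub>F\<^esub> h"
    using * by (intro F_eqI') (auto simp: F_mult_closed F_add_closed lin_mult lin_add')
  have lin_add2: "lin (\<lambda>x. \<phi> x + \<psi> x) k = lin \<phi> k + lin \<psi> k" for \<phi> \<psi> k :: "'m \<Rightarrow> 'k"
    by (simp add: lin_def sum.distrib distrib_left)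
  show "h \<otimes>\<^bsub>F\<^esub> (f \<oplus>\<^bsub>F\<^esub> g) = h \<otimes>\<^bsub>F\<^esub> f \<oplus>\<^bsub>F\<^esub> h \<otimes>\<^bsub>F\<^esub> g"
    using * by (intro F_eqI') (auto simp: F_mult_closed F_add_closed lin_mult lin_add' lin_add2)
qed

lemma F_k_algebra: "k_algebra (F :: ('k::field, 'm \<Rightarrow> 'k) module)"
proof (rule k_algebraI[OF F_ring])
  fix c :: 'k and f g :: "'m \<Rightarrow> 'k" assume *: "f \<in> carrier F" "g \<in> carrier F"
  have lin_sc2: "lin (\<lambda>x. c * \<psi> x) k = c * lin \<psi> k" for \<psi> k :: "'m \<Rightarrow> 'k"
    by (simp add: lin_def sum_distrib_left algebra_simps)
  show "(c \<odot>\<^bsub>F\<^esub> f) \<otimes>\<^bsub>F\<^esub> g = c \<odot>\<^bsub>F\<^esub> (f \<otimes>\<^bsub>F\<^esub> g)"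
    using * by (intro F_eqI') (auto simp: F_mult_closed F_sm_closed lin_mult lin_scale')
  show "f \<otimes>\<^bsub>F\<^esub> (c \<odot>\<^bsub>F\<^esub> g) = c \<odot>\<^bsub>F\<^esub> (f \<otimes>\<^bsub>F\<^esub> g)"
    using * by (intro F_eqI') (auto simp: F_mult_closed F_sm_closed lin_mult lin_scale' lin_sc2)
qed (auto simp: F_sm_closed, auto simp: F_simps algebra_simps)

sublocale F: kalg "F :: ('k::field, 'm \<Rightarrow> 'k) module"
  by (rule kalgI, rule F_k_algebra)

lemma mon_mult: "x \<in> carrier M \<Longrightarrow> y \<in> carrier M \<Longrightarrow> mon_elt x \<otimes>\<^bsub>F\<^esub> mon_elt y = mon_elt (x \<otimes> y)"
  by (rule F_eqI') (auto simp: lin_mult F_mult_closed)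

lemma F_minus: "f \<in> carrier F \<Longrightarrow> \<ominus>\<^bsub>F\<^esub> f = (\<lambda>x. - f x)"
  using F.sm_minus[of f 1] by (simp add: F_simps(5))

lemma lin_minus: "f \<in> carrier F \<Longrightarrow> g \<in> carrier F \<Longrightarrow> lin \<phi> (f \<ominus>\<^bsub>F\<^esub> g) = lin \<phi> f - lin \<phi> g"
  using lin_add'[of f "\<ominus>\<^bsub>F\<^esub> g" \<phi>] F.a_inv_closed[of g]
  by (simp add: a_minus_def F_minus lin_uminus del: F.a_inv_closed)

lemma F_induct [consumes 1, case_names mon add]:
  assumes f: "f \<in> carrier F"
    and mon: "\<And>c x. x \<in> carrier M \<Longrightarrow> P (c \<odot>\<^bsub>F\<^esub> mon_elt x)"
    and add: "\<And>f g. f \<in> carrier F \<Longrightarrow> g \<in> carrier F \<Longrightarrow> P f \<Longrightarrow> P g \<Longrightarrow> P (f \<oplus>\<^bsub>F\<^esub> g)"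
  shows "P f"
proof -
  have "finite S \<Longrightarrow> S \<subseteq> carrier M \<Longrightarrow> f \<in> carrier F \<Longrightarrow> {x. f x \<noteq> 0} \<subseteq> S \<Longrightarrow> P f" for S f
  proof (induction S arbitrary: f rule: finite_induct)
    case empty
    then have "f = 0 \<odot>\<^bsub>F\<^esub> mon_elt \<one>" by (auto simp: F_simps)
    with mon[of \<one> 0] show ?case by simp
  next
    case (insert x S)
    let ?g = "f(x := 0)"
    have "finite {y. ?g y \<noteq> 0}" by (rule finite_subset[of _ S]) (use insert in auto)
    then have g: "?g \<in> carrier F" using insert by (auto simp: F_simps)
    have "P ?g" by (rule insert.IH[OF _ g]) (use insert.prems in auto)
    moreover have "f = (f x \<odot>\<^bsub>F\<^esub> mon_elt x) \<oplus>\<^bsub>F\<^esub> ?g" by (auto simp: F_simps mon_elt_def)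
    moreover have "P (f x \<odot>\<^bsub>F\<^esub> mon_elt x)" using insert.prems by (intro mon) auto
    moreover have "f x \<odot>\<^bsub>F\<^esub> mon_elt x \<in> carrier F" using insert.prems by (intro F_sm_closed) auto
    ultimately show ?case using add g by metis
  qed
  from this[of "{x. f x \<noteq> 0}" f] f show ?thesis by (auto simp: F_simps)
qed

text \<open>A functional that kills all translates of the relations kills the ideal they generate, even
  though it need not be multiplicative.\<close>
lemma lin_genideal_zero:
  fixes \<phi> :: "'m \<Rightarrow> 'k::field"
  assumes R: "R \<subseteq> carrier F"
    and 0: "\<And>\<rho> u w. \<rho> \<in> R \<Longrightarrow> u \<in> carrier M \<Longrightarrow> w \<in> carrier M \<Longrightarrow> lin (\<lambda>x. \<phi> (u \<otimes> x \<otimes> w)) \<rho> = 0"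
    and f: "f \<in> Idl\<^bsub>F\<^esub> R"
  shows "lin \<phi> f = 0"
proof -
  \<comment> \<open>The largest two-sided ideal in the kernel of the functional: asking for all
    translates by monoid elements is what makes it an ideal.\<close>
  let ?I = "{f \<in> carrier F. \<forall>u\<in>carrier M. \<forall>w\<in>carrier M. lin (\<lambda>x. \<phi> (u \<otimes> x \<otimes> w)) f = 0}"
  have "ideal ?I F"
  proof (rule F.ideal_criterion)
    show "\<zero>\<^bsub>F\<^esub> \<in> ?I" using F.zero_closed by (auto simp: F_simps(3) simp del: F.zero_closed)
    show "f \<oplus>\<^bsub>F\<^esub> g \<in> ?I" if "f \<in> ?I" "g \<in> ?I" for f g
      using that by (simp add: lin_add' F_add_closed)
  next
    fix a g :: "'m \<Rightarrow> 'k" assume a: "a \<in> ?I" and g: "g \<in> carrier F"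
    have "lin (\<lambda>x. \<phi> (u \<otimes> x \<otimes> w)) (g \<otimes>\<^bsub>F\<^esub> a) = 0" if "u \<in> carrier M" "w \<in> carrier M" for u w
    proof -
      have "lin (\<lambda>x. \<phi> (u \<otimes> x \<otimes> w)) (g \<otimes>\<^bsub>F\<^esub> a) = lin (\<lambda>x. lin (\<lambda>y. \<phi> (u \<otimes> (x \<otimes> y) \<otimes> w)) a) g"
        using a g that by (simp add: lin_mult)
      also have "\<dots> = lin (\<lambda>x. lin (\<lambda>y. \<phi> ((u \<otimes> x) \<otimes> y \<otimes> w)) a) g"
        using a g that by (intro lin_cong) (auto intro!: lin_cong simp: m_assoc)
      also have "\<dots> = lin (\<lambda>_. 0) g"
        using a g that by (intro lin_cong) auto
      finally show ?thesis by simp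
    qed
    then show "g \<otimes>\<^bsub>F\<^esub> a \<in> ?I" using a g by (simp add: F_mult_closed)
    have "lin (\<lambda>x. \<phi> (u \<otimes> x \<otimes> w)) (a \<otimes>\<^bsub>F\<^esub> g) = 0" if "u \<in> carrier M" "w \<in> carrier M" for u w
    proof -
      \<comment> \<open>In a right multiple the member of \<open>?I\<close> is the outer variable.
        Exchanging the two finite sums brings it inside, where it sits between fixed monoid
        elements.\<close>
      have swap: "lin (\<lambda>x. lin (\<lambda>y. \<psi> x y) g) a = lin (\<lambda>y. lin (\<lambda>x. \<psi> x y) a) g" for \<psi> :: "'m \<Rightarrow> 'm \<Rightarrow> 'k"
        unfolding lin_def sum_distrib_left by (subst sum.swap) (simp add: mult.left_commute)
      have "lin (\<lambda>x. \<phi> (u \<otimes> x \<otimes> w)) (a \<otimes>\<^bsub>F\<^esub> g) = lin (\<lambda>x. lin (\<lambda>y. \<phi> (u \<otimes> (x \<otimes> y) \<otimes> w)) g) a"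
        using a g that by (simp add: lin_mult)
      also have "\<dots> = lin (\<lambda>y. lin (\<lambda>x. \<phi> (u \<otimes> (x \<otimes> y) \<otimes> w)) a) g" by (rule swap)
      also have "\<dots> = lin (\<lambda>y. lin (\<lambda>x. \<phi> (u \<otimes> x \<otimes> (y \<otimes> w))) a) g"
        using a g that by (intro lin_cong) (auto intro!: lin_cong simp: m_assoc)
      also have "\<dots> = lin (\<lambda>_. 0) g"
        using a g that by (intro lin_cong) auto
      finally show ?thesis by simp
    qed
    then show "a \<otimes>\<^bsub>F\<^esub> g \<in> ?I" using a g by (simp add: F_mult_closed)
  qed blast
  moreover have "R \<subseteq> ?I" using R 0 by auto
  ultimately have "Idl\<^bsub>F\<^esub> R \<subseteq> ?I" by (rule F.genideal_minimal)
  with f have *: "f \<in> ?I" by auto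
  then have "lin (\<lambda>x. \<phi> (\<one> \<otimes> x \<otimes> \<one>)) f = 0" by blast
  moreover have "lin (\<lambda>x. \<phi> (\<one> \<otimes> x \<otimes> \<one>)) f = lin \<phi> f" using * by (intro lin_cong) auto
  ultimately show ?thesis by simp
qed

end

declare One_nat_def [simp del]

text \<open>Two instances are used: applying an algebra map in every slot of a tuple, and permuting
  the slots. The laws of \<open>push h\<close> again follow by pairing, because pairing with
  \<open>push h f\<close> amounts to composing the functional with \<open>h\<close>.\<close>

locale mon_alg_hom = M: mon_alg M + N: mon_alg N for M :: "('m, 'z) monoid_scheme" and N :: "('l, 'y) monoid_scheme" +
  fixes h :: "'m \<Rightarrow> 'l"
  assumes h_closed: "x \<in> carrier M \<Longrightarrow> h x \<in> carrier N"
    and h_mult: "x \<in> carrier M \<Longrightarrow> y \<in> carrier M \<Longrightarrow> h (x \<otimes>\<^bsub>M\<^esub> y) = h x \<otimes>\<^bsub>N\<^esub> h y"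
    and h_one: "h \<one>\<^bsub>M\<^esub> = \<one>\<^bsub>N\<^esub>"
begin

lemma push_supp: "{y. push h f y \<noteq> 0} \<subseteq> h ` {x. f x \<noteq> 0}"
proof
  fix y assume "y \<in> {y. push h f y \<noteq> 0}"
  then have ne: "push h f y \<noteq> 0" by simp
  have "{x. f x \<noteq> 0 \<and> h x = y} \<noteq> {}"
  proof
    assume e: "{x. f x \<noteq> 0 \<and> h x = y} = {}"
    have "push h f y = 0" unfolding push_def e by (rule sum.empty)
    with ne show False by contradiction
  qed
  then show "y \<in> h ` {x. f x \<noteq> 0}" by auto
qed

lemma push_closed: "f \<in> carrier M.F \<Longrightarrow> push h f \<in> carrier N.F"
proof -
  assume f: "f \<in> carrier M.F"
  then have "finite {y. push h f y \<noteq> 0}"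
    using push_supp[of f] by (rule_tac finite_subset) (auto simp: M.F_simps)
  moreover have "{y. push h f y \<noteq> 0} \<subseteq> carrier N"
    using push_supp[of f] f h_closed by (force simp: M.F_simps)
  ultimately show ?thesis by (simp add: N.F_simps)
qed

lemma lin_push: "f \<in> carrier M.F \<Longrightarrow> lin \<phi> (push h f) = lin (\<lambda>x. \<phi> (h x)) f"
proof -
  assume f: "f \<in> carrier M.F"
  then have fin: "finite {x. f x \<noteq> 0}" by (simp add: M.F_simps)
  have "lin \<phi> (push h f) = (\<Sum>y\<in>h ` {x. f x \<noteq> 0}. push h f y * \<phi> y)"
    using fin push_supp by (intro lin_superset) auto
  also have "\<dots> = (\<Sum>y\<in>h ` {x. f x \<noteq> 0}. \<Sum>x | x \<in> {x. f x \<noteq> 0} \<and> h x = y. f x * \<phi> (h x))"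
    by (auto simp: push_def sum_distrib_right intro!: sum.cong)
  also have "\<dots> = lin (\<lambda>x. \<phi> (h x)) f"
    unfolding lin_def using fin by (rule sum.image_gen[symmetric])
  finally show ?thesis .
qed

lemma push_add: "f \<in> carrier M.F \<Longrightarrow> g \<in> carrier M.F \<Longrightarrow> push h (f \<oplus>\<^bsub>M.F\<^esub> g) = push h f \<oplus>\<^bsub>N.F\<^esub> push h g"
  by (rule N.F_eqI') (simp_all add: push_closed lin_push M.lin_add' N.lin_add')

lemma push_scale: "f \<in> carrier M.F \<Longrightarrow> push h (c \<odot>\<^bsub>M.F\<^esub> f) = c \<odot>\<^bsub>N.F\<^esub> push h f"
  by (rule N.F_eqI') (simp_all add: push_closed lin_push M.lin_scale' N.lin_scale')

lemma push_mon: "x \<in> carrier M \<Longrightarrow> push h (mon_elt x) = mon_elt (h x)"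
  by (rule N.F_eqI') (simp_all add: push_closed lin_push h_closed)

lemma push_mult: "f \<in> carrier M.F \<Longrightarrow> g \<in> carrier M.F \<Longrightarrow> push h (f \<otimes>\<^bsub>M.F\<^esub> g) = push h f \<otimes>\<^bsub>N.F\<^esub> push h g"
  by (rule N.F_eqI') (auto simp: push_closed lin_push M.lin_mult N.lin_mult h_mult intro!: M.lin_cong)

lemma push_one: "push h \<one>\<^bsub>M.F\<^esub> = \<one>\<^bsub>N.F\<^esub>"
  by (simp add: M.F_simps(2) N.F_simps(2) push_mon h_one)

lemma push_zero: "push h \<zero>\<^bsub>M.F\<^esub> = \<zero>\<^bsub>N.F\<^esub>"
  by (simp add: M.F_simps(3) N.F_simps(3) push_def)

lemma push_minus: "f \<in> carrier M.F \<Longrightarrow> g \<in> carrier M.F \<Longrightarrow> push h (f \<ominus>\<^bsub>M.F\<^esub> g) = push h f \<ominus>\<^bsub>N.F\<^esub> push h g"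
  by (rule N.F_eqI') (simp_all add: push_closed lin_push M.lin_minus N.lin_minus)

text \<open>The preimage of \<open>J\<close> is an ideal, so it contains everything generated by
  \<open>R\<close> once it contains \<open>R\<close>. Maps between tensor powers therefore need to
  be checked on the multilinearity relations only.\<close>

lemma push_ideal:
  fixes R :: "('m \<Rightarrow> 'k::field) set"
  assumes R: "R \<subseteq> carrier M.F" and J: "ideal J N.F" and RJ: "\<And>\<rho>. \<rho> \<in> R \<Longrightarrow> push h \<rho> \<in> J"
    and f: "f \<in> Idl\<^bsub>M.F\<^esub> R"
  shows "push h f \<in> J"
proof -
  interpret J: ideal J "N.F :: ('k, _) module" by fact
  have "ideal {f \<in> carrier M.F. push h f \<in> J} M.F"
    by (rule M.F.ideal_criterion)
      (auto simp: push_zero push_add push_mult push_closed J.I_l_closed J.I_r_closed J.a_closed)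
  moreover have "R \<subseteq> {f \<in> carrier M.F. push h f \<in> J}" using R RJ by auto
  ultimately have "Idl\<^bsub>M.F\<^esub> R \<subseteq> {f \<in> carrier M.F. push h f \<in> J}" by (rule M.F.genideal_minimal)
  then show ?thesis using f by auto
qed

end

text \<open>Evaluates a map that is given as a union over a coset, as \<open>tensor_map\<close> is,
  at any chosen representative.\<close>

lemma kalg_ideal_union_coset:
  assumes "kalg_ideal A I" and x: "x \<in> carrier A"
    and const: "\<And>y. y \<in> carrier A \<Longrightarrow> y \<ominus>\<^bsub>A\<^esub> x \<in> I \<Longrightarrow> g y = g x"
  shows "(\<Union>y\<in>I +>\<^bsub>A\<^esub> x. g y) = g x"
proof -
  interpret kalg_ideal A I by fact
  have "g y = g x" if "y \<in> I +>\<^bsub>A\<^esub> x" for y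
  proof -
    have y: "y \<in> carrier A" using that x I.a_elemrcos_carrier by blast
    moreover have "y \<ominus>\<^bsub>A\<^esub> x \<in> I" using that x y by (simp add: I.a_rcos_module_imp a_minus_def)
    ultimately show ?thesis by (rule const)
  qed
  moreover have "x \<in> I +>\<^bsub>A\<^esub> x" using x by (rule I.a_rcos_self)
  ultimately show ?thesis by (metis (no_types, lifting) SUP_eq_const empty_iff)
qed

section \<open>Tensor powers\<close>

definition pure :: "nat \<Rightarrow> ('k::field, 'a) module \<Rightarrow> (nat \<Rightarrow> 'a) \<Rightarrow> ('k, 'a) tensor" where
  "pure n A x = tensor_ideal n A +>\<^bsub>(monoid_alg (tuples n A) :: ('k, _) module)\<^esub> mon_elt x"

lemma (in kalg) tuples_monoid: "Group.monoid (tuples n A)"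
  by (rule monoidI) (auto simp: PiE_iff extensional_def fun_eq_iff m_assoc)

locale tensor_pow = kalg A for A :: "('k::field, 'a) module" (structure) + fixes n :: nat
begin

abbreviation TF :: "('k, (nat \<Rightarrow> 'a) \<Rightarrow> 'k) module" where "TF \<equiv> monoid_alg (tuples n A)"

abbreviation TP :: "('k, ('k, 'a) tensor) module" where "TP \<equiv> tensor_power n A"

abbreviation tup :: "(nat \<Rightarrow> 'a) set" where "tup \<equiv> {1..n} \<rightarrow>\<^sub>E carrier A"

sublocale Tm: mon_alg "tuples n A"
  unfolding mon_alg_def by (rule tuples_monoid)

lemma tup_upd: "x \<in> tup \<Longrightarrow> i \<in> {1..n} \<Longrightarrow> u \<in> carrier A \<Longrightarrow> x(i := u) \<in> tup"
  by (auto simp: PiE_iff extensional_def)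

lemma relations_closed: "multilinear_relations n A \<subseteq> carrier TF"
  unfolding multilinear_relations_def Let_def
  using tup_upd by (auto intro!: Tm.F.minus_closed Tm.F.a_closed Tm.F.sm_closed Tm.mon_closed)

sublocale Tq: kalg_ideal TF "tensor_ideal n A"
  by (simp add: kalg_ideal_def kalg_ideal_axioms_def Tm.F.kalg_axioms tensor_ideal_def
      Tm.F.genideal_ideal[OF relations_closed])

lemma TP_eq: "TP = Tq.Q"
  by (simp add: tensor_power_def)

sublocale TP: kalg TP
  unfolding TP_eq by (rule kalgI, rule Tq.quot_k_algebra)

lemma relation_ideal: "r \<in> multilinear_relations n A \<Longrightarrow> r \<in> tensor_ideal n A"
  unfolding tensor_ideal_def using Tm.F.genideal_self[OF relations_closed] by auto

lemma relation_addI: "x \<in> tup \<Longrightarrow> i \<in> {1..n} \<Longrightarrow> u \<in> carrier A \<Longrightarrow> v \<in> carrier A \<Longrightarrow>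
    mon_elt (x(i := u \<oplus> v)) \<ominus>\<^bsub>TF\<^esub> (mon_elt (x(i := u)) \<oplus>\<^bsub>TF\<^esub> mon_elt (x(i := v))) \<in> multilinear_relations n A"
  and relation_smultI: "x \<in> tup \<Longrightarrow> i \<in> {1..n} \<Longrightarrow> u \<in> carrier A \<Longrightarrow>
    mon_elt (x(i := c \<odot> u)) \<ominus>\<^bsub>TF\<^esub> (c \<odot>\<^bsub>TF\<^esub> mon_elt (x(i := u))) \<in> multilinear_relations n A"
  unfolding multilinear_relations_def Let_def by auto

lemma pure_closed [simp]: "x \<in> tup \<Longrightarrow> pure n A x \<in> carrier TP"
  by (simp add: pure_def TP_eq Tq.coset_closed)

lemma pure_one: "\<one>\<^bsub>TP\<^esub> = pure n A (\<lambda>i\<in>{1..n}. \<one>)"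
  by (simp add: pure_def TP_eq Tq.coset_one Tm.F_simps(2))

lemma pure_mult: "x \<in> tup \<Longrightarrow> y \<in> tup \<Longrightarrow> pure n A x \<otimes>\<^bsub>TP\<^esub> pure n A y = pure n A (\<lambda>i\<in>{1..n}. x i \<otimes> y i)"
  by (simp add: pure_def TP_eq Tq.coset_mult Tm.mon_mult)

lemma pure_add:
  assumes "x \<in> tup" "i \<in> {1..n}" "u \<in> carrier A" "v \<in> carrier A"
  shows "pure n A (x(i := u \<oplus> v)) = pure n A (x(i := u)) \<oplus>\<^bsub>TP\<^esub> pure n A (x(i := v))"
proof -
  have "mon_elt (x(i := u \<oplus> v)) \<ominus>\<^bsub>TF\<^esub> (mon_elt (x(i := u)) \<oplus>\<^bsub>TF\<^esub> mon_elt (x(i := v))) \<in> multilinear_relations n A"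
    unfolding multilinear_relations_def Let_def using assms by auto
  then show ?thesis
    using assms tup_upd unfolding pure_def TP_eq
    by (subst Tq.coset_add, simp, simp, subst Tq.coset_eq_iff) (auto intro!: relation_ideal Tm.F.a_closed)
qed

lemma pure_smult:
  assumes "x \<in> tup" "i \<in> {1..n}" "u \<in> carrier A"
  shows "pure n A (x(i := c \<odot> u)) = c \<odot>\<^bsub>TP\<^esub> pure n A (x(i := u))"
proof -
  have "mon_elt (x(i := c \<odot> u)) \<ominus>\<^bsub>TF\<^esub> (c \<odot>\<^bsub>TF\<^esub> mon_elt (x(i := u))) \<in> multilinear_relations n A"
    unfolding multilinear_relations_def Let_def using assms by auto
  then show ?thesis
    using assms tup_upd unfolding pure_def TP_eq
    by (subst Tq.sm_coset, simp, subst Tq.coset_eq_iff) (auto intro!: relation_ideal Tm.F.sm_closed)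
qed

lemma TP_induct [consumes 1, case_names pure add]:
  assumes t: "t \<in> carrier TP"
    and pure: "\<And>c x. x \<in> tup \<Longrightarrow> P (c \<odot>\<^bsub>TP\<^esub> pure n A x)"
    and add: "\<And>s t. s \<in> carrier TP \<Longrightarrow> t \<in> carrier TP \<Longrightarrow> P s \<Longrightarrow> P t \<Longrightarrow> P (s \<oplus>\<^bsub>TP\<^esub> t)"
  shows "P t"
proof -
  from t obtain f where f: "f \<in> carrier TF" "t = tensor_ideal n A +>\<^bsub>TF\<^esub> f"
    unfolding TP_eq by (rule Tq.quot_cases)
  from f(1) have "P (tensor_ideal n A +>\<^bsub>TF\<^esub> f)"
  proof (induction rule: Tm.F_induct)
    case (mon c x)
    then show ?case using pure[of x c] by (simp add: pure_def TP_eq Tq.sm_coset)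
  next
    case (add f g)
    then show ?case
      using assms(3)[of "tensor_ideal n A +>\<^bsub>TF\<^esub> f" "tensor_ideal n A +>\<^bsub>TF\<^esub> g"]
      by (simp add: TP_eq Tq.coset_add Tq.coset_closed)
  qed
  then show ?thesis using f by simp
qed

end

text \<open>The product functional f_1 tensor ... tensor f_n. It descends to the tensor power when
  every \<open>f i\<close> is linear; multiplicativity is not involved, which is what admits matrix
  coefficients as factors.\<close>

definition tensor_fun :: "nat \<Rightarrow> (nat \<Rightarrow> 'a \<Rightarrow> 'k) \<Rightarrow> ('k::field, 'a) tensor \<Rightarrow> 'k" where
  "tensor_fun n f = descend (lin (\<lambda>x. \<Prod>i\<in>{1..n}. f i (x i)))"

definition (in kalg) linear_fun :: "('a \<Rightarrow> 'k) \<Rightarrow> bool" where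
  "linear_fun f \<longleftrightarrow> (\<forall>x\<in>carrier A. \<forall>y\<in>carrier A. f (x \<oplus> y) = f x + f y) \<and>
     (\<forall>c. \<forall>x\<in>carrier A. f (c \<odot> x) = c * f x)"

lemma (in kalg) linear_funD:
  assumes "linear_fun f"
  shows "x \<in> carrier A \<Longrightarrow> y \<in> carrier A \<Longrightarrow> f (x \<oplus> y) = f x + f y"
    and "x \<in> carrier A \<Longrightarrow> f (c \<odot> x) = c * f x"
    and "f \<zero> = 0"
    and "x \<in> carrier A \<Longrightarrow> f (\<ominus> x) = - f x"
proof -
  show *: "x \<in> carrier A \<Longrightarrow> f (c \<odot> x) = c * f x" for x c using assms by (auto simp: linear_fun_def)
  show "f \<zero> = 0" using *[of \<zero> 0] by simp
  show "x \<in> carrier A \<Longrightarrow> f (\<ominus> x) = - f x" using *[of x "-1"] by (simp add: sm_minus)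
qed (use assms in \<open>auto simp: linear_fun_def\<close>)

context tensor_pow
begin

context
  fixes f :: "nat \<Rightarrow> 'a \<Rightarrow> 'k"
  assumes f: "\<And>i. i \<in> {1..n} \<Longrightarrow> linear_fun (f i)"
begin

lemma tensor_fun_coset:
  assumes t: "t \<in> carrier TF"
  shows "tensor_fun n f (tensor_ideal n A +>\<^bsub>TF\<^esub> t) = lin (\<lambda>x. \<Prod>i\<in>{1..n}. f i (x i)) t"
  unfolding tensor_fun_def
proof (rule Tq.descend_coset[OF _ t])
  let ?\<phi> = "\<lambda>x. \<Prod>i\<in>{1..n}. f i (x i)"
  \<comment> \<open>All tuples occurring in a translated relation agree outside slot
    \<open>i\<close>. The other factors form a common scalar, and linearity of \<open>f i\<close>
    does the rest.\<close>
  have upd: "?\<phi> (x \<otimes>\<^bsub>tuples n A\<^esub> (y(i := u)) \<otimes>\<^bsub>tuples n A\<^esub> z) =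
     f i (x i \<otimes> u \<otimes> z i) * (\<Prod>j\<in>{1..n} - {i}. f j (x j \<otimes> y j \<otimes> z j))"
    if "i \<in> {1..n}" for x y z i u
    using that by (subst prod.remove[of _ i]) (auto intro!: prod.cong)
  fix s t assume st: "s \<in> carrier TF" "t \<in> carrier TF" "s \<ominus>\<^bsub>TF\<^esub> t \<in> tensor_ideal n A"
  have "lin ?\<phi> (s \<ominus>\<^bsub>TF\<^esub> t) = 0"
  proof (rule Tm.lin_genideal_zero[OF relations_closed])
    show "s \<ominus>\<^bsub>TF\<^esub> t \<in> Idl\<^bsub>TF\<^esub> (multilinear_relations n A)" using st by (simp add: tensor_ideal_def)
    fix \<rho> x z assume \<rho>: "\<rho> \<in> multilinear_relations n A"
      and xz: "x \<in> carrier (tuples n A)" "z \<in> carrier (tuples n A)"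
    let ?\<psi> = "\<lambda>y. ?\<phi> (x \<otimes>\<^bsub>tuples n A\<^esub> y \<otimes>\<^bsub>tuples n A\<^esub> z)"
    have cl: "x i \<in> carrier A" "z i \<in> carrier A" if "i \<in> {1..n}" for i
      using xz that by (auto simp: PiE_iff)
    from \<rho> consider (a) y i u v where "\<rho> = mon_elt (y(i := u \<oplus> v)) \<ominus>\<^bsub>TF\<^esub> (mon_elt (y(i := u)) \<oplus>\<^bsub>TF\<^esub> mon_elt (y(i := v)))"
        "y \<in> tup" "i \<in> {1..n}" "u \<in> carrier A" "v \<in> carrier A"
      | (s) y i c u where "\<rho> = mon_elt (y(i := c \<odot> u)) \<ominus>\<^bsub>TF\<^esub> (c \<odot>\<^bsub>TF\<^esub> mon_elt (y(i := u)))"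
        "y \<in> tup" "i \<in> {1..n}" "u \<in> carrier A"
      unfolding multilinear_relations_def Let_def by auto
    then show "lin ?\<psi> \<rho> = 0"
    proof cases
      case a
      have "y(i := u \<oplus> v) \<in> tup" "y(i := u) \<in> tup" "y(i := v) \<in> tup"
        using a by (auto intro!: tup_upd)
      then have "lin ?\<psi> \<rho> = ?\<psi> (y(i := u \<oplus> v)) - (?\<psi> (y(i := u)) + ?\<psi> (y(i := v)))"
        unfolding a by (subst Tm.lin_minus; (subst Tm.lin_add')?) (auto intro!: Tm.F.a_closed simp del: mult_product_group)
      also have "\<dots> = 0"
        unfolding upd[OF a(3)] using a cl[OF a(3)] f[OF a(3)]
        by (simp add: l_distr r_distr linear_funD algebra_simps)
      finally show ?thesis .
    next
      case s
      have "y(i := c \<odot> u) \<in> tup" "y(i := u) \<in> tup"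
        using s by (auto intro!: tup_upd)
      then have "lin ?\<psi> \<rho> = ?\<psi> (y(i := c \<odot> u)) - c * ?\<psi> (y(i := u))"
        unfolding s by (subst Tm.lin_minus; (subst Tm.lin_scale')?) (auto intro!: Tm.F.sm_closed simp del: mult_product_group)
      also have "\<dots> = 0"
        unfolding upd[OF s(3)] using s cl[OF s(3)] f[OF s(3)]
        by (simp add: sm_mult_left sm_mult_right linear_funD)
      finally show ?thesis .
    qed
  qed
  then show "lin ?\<phi> s = lin ?\<phi> t" using st by (simp add: Tm.lin_minus)
qed

lemma tensor_fun_pure: "x \<in> tup \<Longrightarrow> tensor_fun n f (pure n A x) = (\<Prod>i\<in>{1..n}. f i (x i))"
  by (simp add: pure_def tensor_fun_coset)

lemma tensor_fun_linear: "TP.linear_fun (tensor_fun n f)"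
  unfolding TP.linear_fun_def
  by (auto simp: TP_eq elim!: Tq.quot_cases)
    (auto simp: TP_eq Tq.coset_add Tq.sm_coset tensor_fun_coset Tm.lin_add' Tm.lin_scale')

end

end

section \<open>Algebra homomorphisms and the maps they induce on tensor powers\<close>

definition alg_hom :: "('k::field, 'a) module \<Rightarrow> ('k, 'b) module \<Rightarrow> ('a \<Rightarrow> 'b) \<Rightarrow> bool" where
  "alg_hom A B f \<longleftrightarrow> f \<in> Ring.ring_hom A B \<and> (\<forall>c. \<forall>x\<in>carrier A. f (c \<odot>\<^bsub>A\<^esub> x) = c \<odot>\<^bsub>B\<^esub> f x)"

lemma alg_homD:
  assumes "alg_hom A B f"
  shows "x \<in> carrier A \<Longrightarrow> f x \<in> carrier B"
    and "x \<in> carrier A \<Longrightarrow> y \<in> carrier A \<Longrightarrow> f (x \<oplus>\<^bsub>A\<^esub> y) = f x \<oplus>\<^bsub>B\<^esub> f y"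
    and "x \<in> carrier A \<Longrightarrow> y \<in> carrier A \<Longrightarrow> f (x \<otimes>\<^bsub>A\<^esub> y) = f x \<otimes>\<^bsub>B\<^esub> f y"
    and "f \<one>\<^bsub>A\<^esub> = \<one>\<^bsub>B\<^esub>"
    and "x \<in> carrier A \<Longrightarrow> f (c \<odot>\<^bsub>A\<^esub> x) = c \<odot>\<^bsub>B\<^esub> f x"
  using assms by (auto simp: alg_hom_def Ring.ring_hom_def)

lemma alg_homI:
  assumes "\<And>x. x \<in> carrier A \<Longrightarrow> f x \<in> carrier B"
    and "\<And>x y. x \<in> carrier A \<Longrightarrow> y \<in> carrier A \<Longrightarrow> f (x \<oplus>\<^bsub>A\<^esub> y) = f x \<oplus>\<^bsub>B\<^esub> f y"
    and "\<And>x y. x \<in> carrier A \<Longrightarrow> y \<in> carrier A \<Longrightarrow> f (x \<otimes>\<^bsub>A\<^esub> y) = f x \<otimes>\<^bsub>B\<^esub> f y"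
    and "f \<one>\<^bsub>A\<^esub> = \<one>\<^bsub>B\<^esub>"
    and "\<And>c x. x \<in> carrier A \<Longrightarrow> f (c \<odot>\<^bsub>A\<^esub> x) = c \<odot>\<^bsub>B\<^esub> f x"
  shows "alg_hom A B f"
  using assms by (auto simp: alg_hom_def Ring.ring_hom_def)

locale tensor_pow_hom = B: tensor_pow B n + A: tensor_pow A n
  for B :: "('k::field, 'b) module" and A :: "('k, 'a) module" and n +
  fixes f assumes f: "alg_hom B A f"
begin

sublocale p: mon_alg_hom "tuples n B" "tuples n A" "\<lambda>x. \<lambda>i\<in>{1..n}. f (x i)"
  by unfold_locales (auto simp: alg_homD[OF f] fun_eq_iff PiE_iff)

lemma f_upd: "i \<in> {1..n} \<Longrightarrow> (\<lambda>j\<in>{1..n}. f ((x(i := u)) j)) = (\<lambda>j\<in>{1..n}. f (x j))(i := f u)"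
  by auto

lemma push_tensor_ideal:
  assumes "t \<in> tensor_ideal n B"
  shows "push (\<lambda>x. \<lambda>i\<in>{1..n}. f (x i)) t \<in> tensor_ideal n A"
proof (rule p.push_ideal[OF B.relations_closed A.Tq.ideal])
  show "t \<in> Idl\<^bsub>B.TF\<^esub> multilinear_relations n B" using assms by (simp add: tensor_ideal_def)
  fix \<rho> :: "_ \<Rightarrow> 'k" assume "\<rho> \<in> multilinear_relations n B"
  then consider (a) y i u v where "\<rho> = mon_elt (y(i := u \<oplus>\<^bsub>B\<^esub> v)) \<ominus>\<^bsub>B.TF\<^esub> (mon_elt (y(i := u)) \<oplus>\<^bsub>B.TF\<^esub> mon_elt (y(i := v)))"
      "y \<in> B.tup" "i \<in> {1..n}" "u \<in> carrier B" "v \<in> carrier B"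
    | (s) y i c u where "\<rho> = mon_elt (y(i := c \<odot>\<^bsub>B\<^esub> u)) \<ominus>\<^bsub>B.TF\<^esub> (c \<odot>\<^bsub>B.TF\<^esub> mon_elt (y(i := u)))"
      "y \<in> B.tup" "i \<in> {1..n}" "u \<in> carrier B"
    unfolding multilinear_relations_def Let_def by auto
  then have "push (\<lambda>x. \<lambda>i\<in>{1..n}. f (x i)) \<rho> \<in> multilinear_relations n A"
  proof cases
    case a
    have "y(i := u \<oplus>\<^bsub>B\<^esub> v) \<in> B.tup" "y(i := u) \<in> B.tup" "y(i := v) \<in> B.tup"
      using a by (auto intro!: B.tup_upd)
    moreover have "(\<lambda>i\<in>{1..n}. f (y i)) \<in> A.tup" using a by (auto simp: alg_homD[OF f] PiE_iff)
    ultimately show ?thesis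
      unfolding a using a A.relation_addI[of "\<lambda>i\<in>{1..n}. f (y i)" i "f u" "f v"]
      by (simp add: p.push_minus p.push_add p.push_mon B.Tm.F.a_closed f_upd alg_homD[OF f] del: fun_upd_apply restrict_apply)
  next
    case s
    have "y(i := c \<odot>\<^bsub>B\<^esub> u) \<in> B.tup" "y(i := u) \<in> B.tup"
      using s by (auto intro!: B.tup_upd)
    moreover have "(\<lambda>i\<in>{1..n}. f (y i)) \<in> A.tup" using s by (auto simp: alg_homD[OF f] PiE_iff)
    ultimately show ?thesis
      unfolding s using s A.relation_smultI[of "\<lambda>i\<in>{1..n}. f (y i)" i "f u" c]
      by (simp add: p.push_minus p.push_scale p.push_mon B.Tm.F.sm_closed f_upd alg_homD[OF f] del: fun_upd_apply restrict_apply)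
  qed
  then show "push (\<lambda>x. \<lambda>i\<in>{1..n}. f (x i)) \<rho> \<in> tensor_ideal n A" by (rule A.relation_ideal)
qed

lemma tensor_map_coset:
  assumes t: "t \<in> carrier B.TF"
  shows "tensor_map n A f (tensor_ideal n B +>\<^bsub>B.TF\<^esub> t) =
     tensor_ideal n A +>\<^bsub>A.TF\<^esub> push (\<lambda>x. \<lambda>i\<in>{1..n}. f (x i)) t"
  unfolding tensor_map_def
proof (rule kalg_ideal_union_coset[OF B.Tq.kalg_ideal_axioms t])
  fix s assume "s \<in> carrier B.TF" "s \<ominus>\<^bsub>B.TF\<^esub> t \<in> tensor_ideal n B"
  then show "tensor_ideal n A +>\<^bsub>A.TF\<^esub> push (\<lambda>x. \<lambda>i\<in>{1..n}. f (x i)) s =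
     tensor_ideal n A +>\<^bsub>A.TF\<^esub> push (\<lambda>x. \<lambda>i\<in>{1..n}. f (x i)) t"
    using t push_tensor_ideal[of "s \<ominus>\<^bsub>B.TF\<^esub> t"] by (simp add: A.Tq.coset_eq_iff p.push_closed p.push_minus)
qed

lemma tensor_map_pure: "x \<in> B.tup \<Longrightarrow> tensor_map n A f (pure n B x) = pure n A (\<lambda>i\<in>{1..n}. f (x i))"
  by (simp add: pure_def tensor_map_coset p.push_mon)

lemma tensor_map_hom: "alg_hom B.TP A.TP (tensor_map n A f)"
  unfolding B.TP_eq A.TP_eq
  by (rule alg_homI; (elim B.Tq.quot_cases)?; simp add: B.Tq.coset_add B.Tq.coset_mult B.Tq.coset_one B.Tq.sm_coset
      tensor_map_coset A.Tq.coset_add A.Tq.coset_mult A.Tq.coset_one A.Tq.sm_coset A.Tq.coset_closed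
      p.push_closed p.push_add p.push_mult p.push_one p.push_scale del: carrier_product_group)

end

section \<open>Permutations of the tensor factors\<close>

locale tensor_perm = tensor_pow A n for A :: "('k::field, 'a) module" (structure) and n +
  fixes \<pi> assumes \<pi>: "\<pi> permutes {1..n}"
begin

lemma inv_bij: "i \<in> {1..n} \<Longrightarrow> inv_into UNIV \<pi> i \<in> {1..n}" "i \<notin> {1..n} \<Longrightarrow> inv_into UNIV \<pi> i \<notin> {1..n}"
  using permutes_in_image[OF permutes_inv[OF \<pi>], of i] by auto

lemma comp_inv_tup: "x \<in> tup \<Longrightarrow> x \<circ> inv_into UNIV \<pi> \<in> tup"
  using inv_bij by (auto simp: PiE_iff extensional_def)

sublocale p: mon_alg_hom "tuples n A" "tuples n A" "\<lambda>x. x \<circ> inv_into UNIV \<pi>"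
  by unfold_locales (use comp_inv_tup inv_bij in \<open>auto simp: fun_eq_iff\<close>)

text \<open>Altering slot i before the permutation is altering slot \<open>\<pi> i\<close> after it.
  This is why a multilinearity relation in slot i is sent to one in slot
  \<open>\<pi> i\<close>.\<close>

lemma upd_comp: "(x(i := u)) \<circ> inv_into UNIV \<pi> = (x \<circ> inv_into UNIV \<pi>)(\<pi> i := u)"
  using permutes_inverses[OF \<pi>] by (auto simp: fun_eq_iff)

lemma push_perm_ideal:
  assumes "t \<in> tensor_ideal n A"
  shows "push (\<lambda>x. x \<circ> inv_into UNIV \<pi>) t \<in> tensor_ideal n A"
proof (rule p.push_ideal[OF relations_closed Tq.ideal])
  show "t \<in> Idl\<^bsub>TF\<^esub> multilinear_relations n A" using assms by (simp add: tensor_ideal_def)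
  fix \<rho> :: "_ \<Rightarrow> 'k" assume "\<rho> \<in> multilinear_relations n A"
  then consider (a) y i u v where "\<rho> = mon_elt (y(i := u \<oplus> v)) \<ominus>\<^bsub>TF\<^esub> (mon_elt (y(i := u)) \<oplus>\<^bsub>TF\<^esub> mon_elt (y(i := v)))"
      "y \<in> tup" "i \<in> {1..n}" "u \<in> carrier A" "v \<in> carrier A"
    | (s) y i c u where "\<rho> = mon_elt (y(i := c \<odot> u)) \<ominus>\<^bsub>TF\<^esub> (c \<odot>\<^bsub>TF\<^esub> mon_elt (y(i := u)))"
      "y \<in> tup" "i \<in> {1..n}" "u \<in> carrier A"
    unfolding multilinear_relations_def Let_def by auto
  then have "push (\<lambda>x. x \<circ> inv_into UNIV \<pi>) \<rho> \<in> multilinear_relations n A"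
  proof cases
    case a
    have "y(i := u \<oplus> v) \<in> tup" "y(i := u) \<in> tup" "y(i := v) \<in> tup" "\<pi> i \<in> {1..n}"
      using a permutes_in_image[OF \<pi>] by (auto intro!: tup_upd)
    moreover have "y \<circ> inv_into UNIV \<pi> \<in> tup" using a comp_inv_tup by simp
    ultimately show ?thesis
      unfolding a using a relation_addI[of "y \<circ> inv_into UNIV \<pi>" "\<pi> i" u v]
      by (simp add: p.push_minus p.push_add p.push_mon Tm.F.a_closed upd_comp del: fun_upd_apply o_apply)
  next
    case s
    have "y(i := c \<odot> u) \<in> tup" "y(i := u) \<in> tup" "\<pi> i \<in> {1..n}"
      using s permutes_in_image[OF \<pi>] by (auto intro!: tup_upd)
    moreover have "y \<circ> inv_into UNIV \<pi> \<in> tup" using s comp_inv_tup by simp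
    ultimately show ?thesis
      unfolding s using s relation_smultI[of "y \<circ> inv_into UNIV \<pi>" "\<pi> i" u c]
      by (simp add: p.push_minus p.push_scale p.push_mon Tm.F.sm_closed upd_comp del: fun_upd_apply o_apply)
  qed
  then show "push (\<lambda>x. x \<circ> inv_into UNIV \<pi>) \<rho> \<in> tensor_ideal n A" by (rule relation_ideal)
qed

lemma push_inverse:
  assumes "t \<in> carrier TF"
  shows "push (\<lambda>x. x \<circ> inv_into UNIV \<pi>) (push (\<lambda>x. x \<circ> inv_into UNIV (inv_into UNIV \<pi>)) t) = t"
proof -
  interpret q: tensor_perm A n "inv_into UNIV \<pi>"
    by unfold_locales (rule permutes_inv[OF \<pi>])
  have "(x \<circ> inv_into UNIV (inv_into UNIV \<pi>)) \<circ> inv_into UNIV \<pi> = x" for x :: "nat \<Rightarrow> 'a"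
    using permutes_inverses[OF \<pi>] inv_inv_eq[OF permutes_bij[OF \<pi>]] by (auto simp: fun_eq_iff)
  then show ?thesis
    using assms by (intro Tm.F_eqI') (simp_all add: p.push_closed q.p.push_closed p.lin_push q.p.lin_push)
qed

text \<open>\<open>perm_act\<close> is an image of a set, so a coset has a full coset as its image
  only if the tensor ideal is mapped onto itself. Surjectivity comes from the stability of the ideal
  under the inverse permutation.\<close>

lemma perm_act_coset:
  assumes t: "t \<in> carrier TF"
  shows "perm_act \<pi> (tensor_ideal n A +>\<^bsub>TF\<^esub> t) =
     tensor_ideal n A +>\<^bsub>TF\<^esub> push (\<lambda>x. x \<circ> inv_into UNIV \<pi>) t"
proof -
  interpret q: tensor_perm A n "inv_into UNIV \<pi>"
    by unfold_locales (rule permutes_inv[OF \<pi>])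
  have coset: "tensor_ideal n A +>\<^bsub>TF\<^esub> t = (\<lambda>i. i \<oplus>\<^bsub>TF\<^esub> t) ` tensor_ideal n A" for t
    by (auto simp: a_r_coset_def r_coset_def)
  let ?p = "push (\<lambda>x. x \<circ> inv_into UNIV \<pi>)"
  have "?p ` tensor_ideal n A = tensor_ideal n A"
  proof
    show "?p ` tensor_ideal n A \<subseteq> tensor_ideal n A" using push_perm_ideal by auto
    show "tensor_ideal n A \<subseteq> ?p ` tensor_ideal n A"
    proof
      fix t assume t: "t \<in> tensor_ideal n A"
      then have "t = ?p (push (\<lambda>x. x \<circ> inv_into UNIV (inv_into UNIV \<pi>)) t)"
        by (intro push_inverse[symmetric]) (rule Tq.I.Icarr)
      then show "t \<in> ?p ` tensor_ideal n A" using q.push_perm_ideal[OF t] by (rule image_eqI)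
    qed
  qed
  moreover have "?p ` (\<lambda>i. i \<oplus>\<^bsub>TF\<^esub> t) ` tensor_ideal n A = (\<lambda>i. i \<oplus>\<^bsub>TF\<^esub> ?p t) ` (?p ` tensor_ideal n A)"
    unfolding image_image using t by (intro image_cong) (auto simp: p.push_add Tq.I.Icarr)
  ultimately show ?thesis unfolding perm_act_def coset by simp
qed

lemma perm_act_pure: "x \<in> tup \<Longrightarrow> perm_act \<pi> (pure n A x) = pure n A (x \<circ> inv_into UNIV \<pi>)"
  by (simp add: pure_def perm_act_coset p.push_mon)

lemma perm_act_hom: "alg_hom TP TP (perm_act \<pi>)"
  unfolding TP_eq
  by (rule alg_homI; (elim Tq.quot_cases)?; simp add: Tq.coset_add Tq.coset_mult Tq.coset_one Tq.sm_coset
      perm_act_coset Tq.coset_closed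
      p.push_closed p.push_add p.push_mult p.push_one p.push_scale del: carrier_product_group)

end

context tensor_pow
begin

lemma perm_act_id:
  assumes t: "t \<in> carrier TP" shows "perm_act id t = t"
proof -
  have "perm_act \<pi> t = t" if \<pi>: "\<pi> = id" for \<pi>
  proof -
    interpret p: tensor_perm A n \<pi> by unfold_locales (simp add: \<pi> permutes_id)
    note h = alg_homD[OF p.perm_act_hom]
    have *: "x \<circ> inv_into UNIV \<pi> = x" for x :: "nat \<Rightarrow> 'a" by (simp add: \<pi>)
    from t show ?thesis
      by (induction rule: TP_induct) (simp_all add: h p.perm_act_pure *)
  qed
  then show ?thesis by blast
qed

lemma perm_act_comp:
  assumes "\<pi> permutes {1..n}" "\<rho> permutes {1..n}" and t: "t \<in> carrier TP"
  shows "perm_act (\<pi> \<circ> \<rho>) t = perm_act \<pi> (perm_act \<rho> t)"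
proof -
  interpret p: tensor_perm A n \<pi> by unfold_locales fact
  interpret q: tensor_perm A n \<rho> by unfold_locales fact
  have "perm_act \<tau> t = perm_act \<pi> (perm_act \<rho> t)" if \<tau>: "\<tau> = \<pi> \<circ> \<rho>" for \<tau>
  proof -
    interpret pq: tensor_perm A n \<tau> by unfold_locales (simp only: \<tau> assms permutes_compose)
    note h = alg_homD[OF p.perm_act_hom] alg_homD[OF q.perm_act_hom] alg_homD[OF pq.perm_act_hom]
    have "inv_into UNIV \<tau> = inv_into UNIV \<rho> \<circ> inv_into UNIV \<pi>"
      unfolding \<tau> using assms by (simp add: o_inv_distrib permutes_bij)
    then have *: "x \<circ> inv_into UNIV \<rho> \<circ> inv_into UNIV \<pi> = x \<circ> inv_into UNIV \<tau>" for x :: "nat \<Rightarrow> 'a"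
      by (simp only: o_assoc)
    from t show ?thesis
      by (induction rule: TP_induct)
        (simp_all add: h p.perm_act_pure q.perm_act_pure pq.perm_act_pure q.comp_inv_tup *)
  qed
  then show ?thesis by blast
qed

end

lemma (in tensor_pow_hom) tensor_map_perm_act:
  assumes \<pi>: "\<pi> permutes {1..n}" and t: "t \<in> carrier B.TP"
  shows "tensor_map n A f (perm_act \<pi> t) = perm_act \<pi> (tensor_map n A f t)"
proof -
  interpret p: tensor_perm A n \<pi> by unfold_locales fact
  interpret q: tensor_perm B n \<pi> by unfold_locales fact
  note h = alg_homD[OF p.perm_act_hom] alg_homD[OF q.perm_act_hom] alg_homD[OF tensor_map_hom]
  from t show ?thesis
  proof (induction rule: B.TP_induct)
    case (pure c x)
    have "(\<lambda>i\<in>{1..n}. f ((x \<circ> inv_into UNIV \<pi>) i)) = (\<lambda>i\<in>{1..n}. f (x i)) \<circ> inv_into UNIV \<pi>"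
      using q.inv_bij by (auto simp: fun_eq_iff)
    moreover have "(\<lambda>i\<in>{1..n}. f (x i)) \<in> A.tup" using pure by (auto simp: PiE_iff alg_homD[OF f])
    ultimately show ?case using pure
      by (simp add: h tensor_map_pure q.perm_act_pure p.perm_act_pure q.comp_inv_tup)
  qed (simp add: h)
qed

section \<open>Characters of an algebra\<close>

definition (in kalg) character :: "('a \<Rightarrow> 'k) \<Rightarrow> bool" where
  "character \<chi> \<longleftrightarrow> linear_fun \<chi> \<and> \<chi> \<one> = 1 \<and> (\<forall>x\<in>carrier A. \<forall>y\<in>carrier A. \<chi> (x \<otimes> y) = \<chi> x * \<chi> y)"

lemma (in kalg) characterD:
  assumes "character \<chi>"
  shows "x \<in> carrier A \<Longrightarrow> y \<in> carrier A \<Longrightarrow> \<chi> (x \<oplus> y) = \<chi> x + \<chi> y"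
    and "x \<in> carrier A \<Longrightarrow> y \<in> carrier A \<Longrightarrow> \<chi> (x \<otimes> y) = \<chi> x * \<chi> y"
    and "x \<in> carrier A \<Longrightarrow> \<chi> (c \<odot> x) = c * \<chi> x"
    and "\<chi> \<one> = 1" and "\<chi> \<zero> = 0" and "x \<in> carrier A \<Longrightarrow> \<chi> (\<ominus> x) = - \<chi> x"
  using assms linear_funD[of \<chi>] by (auto simp: character_def)

lemma (in kalg) character_alg_hom:
  assumes "character \<chi>" "alg_hom D A f" "k_algebra D"
  shows "kalg.character D (\<lambda>x. \<chi> (f x))"
proof -
  interpret D: kalg D using assms(3) by (rule kalgI)
  show ?thesis
    using assms by (auto simp: D.character_def D.linear_fun_def alg_homD[OF assms(2)] characterD[OF assms(1)])
qed

section \<open>Generalized Weyl algebras of rank one\<close>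

locale gwa1 = B: kalg B for B :: "('k::field, 'b) module" + fixes s :: "'b \<Rightarrow> 'b" and b :: 'b
  assumes s: "s \<in> alg_iso B B" and b: "b \<in> carrier B"
begin

abbreviation s' :: "'b \<Rightarrow> 'b" where "s' \<equiv> inv_into (carrier B) s"

lemma s_hom: "alg_hom B B s" and s_bij: "bij_betw s (carrier B) (carrier B)"
  using s by (auto simp: alg_iso_def ring_iso_def alg_hom_def)

lemma s_s' [simp]: "d \<in> carrier B \<Longrightarrow> s (s' d) = d" "d \<in> carrier B \<Longrightarrow> s' (s d) = d"
  using s_bij by (auto simp: bij_betw_def f_inv_into_f)

lemma s'_hom: "alg_hom B B s'"
proof (rule alg_homI)
  have cl: "s' x \<in> carrier B" if "x \<in> carrier B" for x
    using s_bij that by (metis bij_betw_def inv_into_into)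
  show "x \<in> carrier B \<Longrightarrow> s' x \<in> carrier B" for x by (rule cl)
  note h = alg_homD[OF s_hom]
  show "s' (x \<oplus>\<^bsub>B\<^esub> y) = s' x \<oplus>\<^bsub>B\<^esub> s' y" if "x \<in> carrier B" "y \<in> carrier B" for x y
    using s_s'(2)[of "s' x \<oplus>\<^bsub>B\<^esub> s' y"] that cl by (simp add: h)
  show "s' (x \<otimes>\<^bsub>B\<^esub> y) = s' x \<otimes>\<^bsub>B\<^esub> s' y" if "x \<in> carrier B" "y \<in> carrier B" for x y
    using s_s'(2)[of "s' x \<otimes>\<^bsub>B\<^esub> s' y"] that cl by (simp add: h)
  show "s' (c \<odot>\<^bsub>B\<^esub> x) = c \<odot>\<^bsub>B\<^esub> s' x" if "x \<in> carrier B" for x c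
    using s_s'(2)[of "c \<odot>\<^bsub>B\<^esub> s' x"] that cl by (simp add: h)
  show "s' \<one>\<^bsub>B\<^esub> = \<one>\<^bsub>B\<^esub>" using s_s'(2)[of "\<one>\<^bsub>B\<^esub>"] by (simp add: h)
qed

text \<open>The integer powers of the automorphism. As \<open>s'\<close> inverts \<open>s\<close> on
  the carrier only, the laws for exponents are confined to elements of the carrier.\<close>

definition sz :: "int \<Rightarrow> 'b \<Rightarrow> 'b" where
  "sz j = (if j \<ge> 0 then s ^^ nat j else s' ^^ nat (- j))"

lemma funpow_hom: "alg_hom B B f \<Longrightarrow> alg_hom B B (f ^^ k)"
proof (induction k)
  case (Suc k)
  note h = alg_homD[OF Suc.IH[OF Suc.prems]] alg_homD[OF Suc.prems]
  show ?case by (rule alg_homI) (simp_all add: h)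
qed (auto intro!: alg_homI)

lemma sz_hom: "alg_hom B B (sz j)"
  by (simp add: sz_def funpow_hom s_hom s'_hom)

lemmas sz_homD = alg_homD[OF sz_hom]

lemma sz_0 [simp]: "sz 0 d = d"
  by (simp add: sz_def)

lemma sz_succ: "d \<in> carrier B \<Longrightarrow> sz (j + 1) d = s (sz j d)"
proof (cases "j \<ge> 0")
  case True
  then have "nat (j + 1) = Suc (nat j)" by simp
  then show ?thesis using True by (simp add: sz_def)
next
  case False
  assume d: "d \<in> carrier B"
  define m where "m = nat (- (j + 1))"
  have m: "nat (- j) = Suc m" "m = nat (- (j + 1))" using False by (auto simp: m_def)
  have cl: "(s' ^^ m) d \<in> carrier B" using alg_homD(1)[OF funpow_hom[OF s'_hom] d] .
  show ?thesis
  proof (cases "j = -1")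
    case True then show ?thesis using d by (simp add: sz_def)
  next
    case f: False
    then show ?thesis using False m cl by (simp add: sz_def)
  qed
qed

lemma sz_pred: "d \<in> carrier B \<Longrightarrow> sz (j - 1) d = s' (sz j d)"
  using sz_succ[of d "j - 1"] by (simp add: sz_homD)

lemma sz_succ': "d \<in> carrier B \<Longrightarrow> sz (j + 1) d = sz j (s d)"
proof (induction j rule: int_induct[where k = 0])
  case (step1 i)
  then show ?case using sz_succ[of d "i + 1"] sz_succ[of "s d" i] alg_homD(1)[OF s_hom, of d] by simp
next
  case (step2 i)
  then show ?case using sz_pred[of d "i + 1"] sz_pred[of "s d" i] alg_homD(1)[OF s_hom, of d] by simp
qed (use sz_succ[of d 0] in simp)

lemma sz_pred': "d \<in> carrier B \<Longrightarrow> sz (j - 1) d = sz j (s' d)"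
  using sz_succ'[of "s' d" "j - 1"] by (simp add: alg_homD(1)[OF s'_hom])

lemma sz_add: "d \<in> carrier B \<Longrightarrow> sz (i + j) d = sz i (sz j d)"
proof (induction i rule: int_induct[where k = 0])
  case (step1 i)
  then show ?case using sz_succ[of d "i + j"] sz_succ[of "sz j d" i] by (simp add: sz_homD algebra_simps)
next
  case (step2 i)
  then show ?case using sz_pred[of d "i + j"] sz_pred[of "sz j d" i] by (simp add: sz_homD algebra_simps)
qed simp

subsection \<open>Words and the spanning monomials\<close>

sublocale W: mon_alg "free_monoid (gwa_gens B)"
  by unfold_locales (auto simp: free_monoid_def)

abbreviation FB :: "('k, 'b gwa_gen list \<Rightarrow> 'k) module" where "FB \<equiv> free_algebra (gwa_gens B)"

abbreviation words where "words \<equiv> lists (gwa_gens B)"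

lemma W_simps [simp]: "carrier (free_monoid (gwa_gens B)) = words"
  "u \<otimes>\<^bsub>free_monoid (gwa_gens B)\<^esub> w = u @ w" "\<one>\<^bsub>free_monoid (gwa_gens B)\<^esub> = []"
  by (simp_all add: free_monoid_def)

lemma gens [simp]: "Base d \<in> gwa_gens B \<longleftrightarrow> d \<in> carrier B" "Xplus \<in> gwa_gens B" "Xminus \<in> gwa_gens B"
  by (auto simp: gwa_gens_def)

lemma relations_closed: "gwa_relations B s b \<subseteq> carrier FB"
proof -
  note [simp] = b alg_homD(1)[OF s_hom] alg_homD(1)[OF s'_hom]
  show ?thesis
    unfolding gwa_relations_def Let_def
    by (intro Un_least subsetI; clarify?; simp?)
qed

sublocale Rq: kalg_ideal FB "gwa_ideal B s b"
  by (simp add: kalg_ideal_def kalg_ideal_axioms_def W.F.kalg_axioms gwa_ideal_def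
      W.F.genideal_ideal[OF relations_closed])

abbreviation R where "R \<equiv> gwa B s b"

lemma R_eq: "R = Rq.Q"
  by (simp add: gwa_def)

sublocale R: kalg R
  unfolding R_eq by (rule kalgI, rule Rq.quot_k_algebra)

lemma relation_ideal: "r \<in> gwa_relations B s b \<Longrightarrow> r \<in> gwa_ideal B s b"
  unfolding gwa_ideal_def using W.F.genideal_self[OF relations_closed] by auto

definition wd :: "'b gwa_gen list \<Rightarrow> ('k, 'b) gwa_elt" where
  "wd w = gwa_ideal B s b +>\<^bsub>FB\<^esub> mon_elt w"

lemma wd_closed [simp]: "w \<in> words \<Longrightarrow> wd w \<in> carrier R"
  by (simp add: wd_def R_eq Rq.coset_closed)

lemma wd_append: "u \<in> words \<Longrightarrow> w \<in> words \<Longrightarrow> wd (u @ w) = wd u \<otimes>\<^bsub>R\<^esub> wd w"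
  by (simp add: wd_def R_eq Rq.coset_mult W.mon_mult)

lemma wd_Nil: "wd [] = \<one>\<^bsub>R\<^esub>"
  by (simp add: wd_def R_eq Rq.coset_one W.F_simps(2))

lemma wd_Cons: "g \<in> gwa_gens B \<Longrightarrow> w \<in> words \<Longrightarrow> wd (g # w) = wd [g] \<otimes>\<^bsub>R\<^esub> wd w"
  using wd_append[of "[g]" w] by simp

lemma base_wd: "gwa_base B s b d = wd [Base d]"
  by (simp add: gwa_base_def wd_def)

abbreviation \<beta> where "\<beta> \<equiv> gwa_base B s b"
abbreviation Xp where "Xp \<equiv> wd [Xplus]"
abbreviation Xm where "Xm \<equiv> wd [Xminus]"

lemma base_hom: "alg_hom B R \<beta>"
proof (rule alg_homI)
  note rel = relation_ideal[unfolded gwa_relations_def Let_def]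
  show "d \<in> carrier B \<Longrightarrow> \<beta> d \<in> carrier R" for d by (simp add: base_wd)
  show "\<beta> (x \<oplus>\<^bsub>B\<^esub> y) = \<beta> x \<oplus>\<^bsub>R\<^esub> \<beta> y" if "x \<in> carrier B" "y \<in> carrier B" for x y
    unfolding base_wd wd_def R_eq using that
    by (subst Rq.coset_add, simp, simp, subst Rq.coset_eq_iff) (auto intro!: rel W.F.a_closed)
  show "\<beta> (x \<otimes>\<^bsub>B\<^esub> y) = \<beta> x \<otimes>\<^bsub>R\<^esub> \<beta> y" if "x \<in> carrier B" "y \<in> carrier B" for x y
    unfolding base_wd wd_def R_eq using that
    by (subst Rq.coset_mult, simp, simp, subst W.mon_mult, simp, simp, subst Rq.coset_eq_iff) (auto intro!: rel)
  show "\<beta> \<one>\<^bsub>B\<^esub> = \<one>\<^bsub>R\<^esub>"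
    unfolding base_wd wd_def R_eq
    by (subst Rq.coset_one, subst Rq.coset_eq_iff) (auto intro!: rel)
  show "\<beta> (c \<odot>\<^bsub>B\<^esub> x) = c \<odot>\<^bsub>R\<^esub> \<beta> x" if "x \<in> carrier B" for c x
    unfolding base_wd wd_def R_eq using that
    by (subst Rq.sm_coset, simp, subst Rq.coset_eq_iff) (auto intro!: rel W.F.sm_closed)
qed

lemmas base_homD = alg_homD[OF base_hom]

lemma wd_eqI: "u \<in> words \<Longrightarrow> w \<in> words \<Longrightarrow> mon_elt u \<ominus>\<^bsub>FB\<^esub> mon_elt w \<in> gwa_relations B s b \<Longrightarrow> wd u = wd w"
  unfolding wd_def by (simp add: Rq.coset_eq_iff relation_ideal)

lemma X_base: "d \<in> carrier B \<Longrightarrow> Xp \<otimes>\<^bsub>R\<^esub> \<beta> d = \<beta> (s d) \<otimes>\<^bsub>R\<^esub> Xp"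
  "d \<in> carrier B \<Longrightarrow> Xm \<otimes>\<^bsub>R\<^esub> \<beta> d = \<beta> (s' d) \<otimes>\<^bsub>R\<^esub> Xm"
  "Xm \<otimes>\<^bsub>R\<^esub> Xp = \<beta> b" "Xp \<otimes>\<^bsub>R\<^esub> Xm = \<beta> (s b)"
proof -
  note cl = b alg_homD(1)[OF s_hom] alg_homD(1)[OF s'_hom]
  show "d \<in> carrier B \<Longrightarrow> Xp \<otimes>\<^bsub>R\<^esub> \<beta> d = \<beta> (s d) \<otimes>\<^bsub>R\<^esub> Xp"
    using wd_append[of "[Xplus]" "[Base d]"] wd_append[of "[Base (s d)]" "[Xplus]"]
      wd_eqI[of "[Xplus, Base d]" "[Base (s d), Xplus]"] cl
    by (simp add: base_wd) (auto simp: gwa_relations_def Let_def)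
  show "d \<in> carrier B \<Longrightarrow> Xm \<otimes>\<^bsub>R\<^esub> \<beta> d = \<beta> (s' d) \<otimes>\<^bsub>R\<^esub> Xm"
    using wd_append[of "[Xminus]" "[Base d]"] wd_append[of "[Base (s' d)]" "[Xminus]"]
      wd_eqI[of "[Xminus, Base d]" "[Base (s' d), Xminus]"] cl
    by (simp add: base_wd) (auto simp: gwa_relations_def Let_def)
  show "Xm \<otimes>\<^bsub>R\<^esub> Xp = \<beta> b"
    using wd_append[of "[Xminus]" "[Xplus]"] wd_eqI[of "[Xminus, Xplus]" "[Base b]"] cl
    by (simp add: base_wd) (auto simp: gwa_relations_def Let_def)
  show "Xp \<otimes>\<^bsub>R\<^esub> Xm = \<beta> (s b)"
    using wd_append[of "[Xplus]" "[Xminus]"] wd_eqI[of "[Xplus, Xminus]" "[Base (s b)]"] cl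
    by (simp add: base_wd) (auto simp: gwa_relations_def Let_def)
qed

section \<open>Powers of the generators and products of such powers\<close>

definition Yp :: "int \<Rightarrow> ('k, 'b) gwa_elt" where
  "Yp j = (if j \<ge> 0 then Xp [^]\<^bsub>R\<^esub> nat j else Xm [^]\<^bsub>R\<^esub> nat (- j))"

lemma X_closed [simp]: "Xp \<in> carrier R" "Xm \<in> carrier R"
  by simp_all

lemma Yp_closed [simp]: "Yp j \<in> carrier R"
  unfolding Yp_def by (cases "j \<ge> 0") (simp_all only: if_True if_False R.nat_pow_closed X_closed)

lemma neg_Suc: "- int (Suc r) = - int r - 1"
  by simp

lemma Yp_0: "Yp 0 = \<one>\<^bsub>R\<^esub>"
  by (simp add: Yp_def)

lemma Yp_succ: "j \<ge> 0 \<Longrightarrow> Yp (j + 1) = Xp \<otimes>\<^bsub>R\<^esub> Yp j"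
  and Yp_succ_right: "j \<ge> 0 \<Longrightarrow> Yp (j + 1) = Yp j \<otimes>\<^bsub>R\<^esub> Xp"
proof -
  assume j: "j \<ge> 0"
  then have "nat (j + 1) = Suc (nat j)" by simp
  then show "Yp (j + 1) = Xp \<otimes>\<^bsub>R\<^esub> Yp j" "Yp (j + 1) = Yp j \<otimes>\<^bsub>R\<^esub> Xp"
    using j R.nat_pow_Suc2[of Xp "nat j"] by (simp_all add: Yp_def)
qed

lemma Yp_pred: "j \<le> 0 \<Longrightarrow> Yp (j - 1) = Xm \<otimes>\<^bsub>R\<^esub> Yp j"
  and Yp_pred_right: "j \<le> 0 \<Longrightarrow> Yp (j - 1) = Yp j \<otimes>\<^bsub>R\<^esub> Xm"
proof -
  assume j: "j \<le> 0"
  then have "nat (- (j - 1)) = Suc (nat (- j))" by linarith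
  then show "Yp (j - 1) = Xm \<otimes>\<^bsub>R\<^esub> Yp j" "Yp (j - 1) = Yp j \<otimes>\<^bsub>R\<^esub> Xm"
    using j R.nat_pow_Suc2[of Xm "nat (- j)"] by (cases "j = 0"; simp add: Yp_def)+
qed

lemma Yp_base_nat: "d \<in> carrier B \<Longrightarrow> Yp (int r) \<otimes>\<^bsub>R\<^esub> \<beta> d = \<beta> (sz (int r) d) \<otimes>\<^bsub>R\<^esub> Yp (int r)
   \<and> Yp (- int r) \<otimes>\<^bsub>R\<^esub> \<beta> d = \<beta> (sz (- int r) d) \<otimes>\<^bsub>R\<^esub> Yp (- int r)"
proof (induction r)
  case (Suc r)
  note cl = base_homD(1) sz_homD(1) alg_homD(1)[OF s_hom] alg_homD(1)[OF s'_hom]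
  have 1: "Yp (int (Suc r)) = Xp \<otimes>\<^bsub>R\<^esub> Yp (int r)" using Yp_succ[of "int r"] by (simp add: add.commute)
  have 2: "Yp (- int (Suc r)) = Xm \<otimes>\<^bsub>R\<^esub> Yp (- int r)" unfolding neg_Suc using Yp_pred[of "- int r"] by simp
  have 3: "sz (int (Suc r)) d = s (sz (int r) d)" using sz_succ[OF Suc.prems, of "int r"] by (simp add: add.commute)
  have 4: "sz (- int (Suc r)) d = s' (sz (- int r) d)" unfolding neg_Suc using sz_pred[OF Suc.prems, of "- int r"] by simp
  have "Xp \<otimes>\<^bsub>R\<^esub> Yp (int r) \<otimes>\<^bsub>R\<^esub> \<beta> d = Xp \<otimes>\<^bsub>R\<^esub> \<beta> (sz (int r) d) \<otimes>\<^bsub>R\<^esub> Yp (int r)"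
    using Suc by (simp add: R.m_assoc cl del: wd_closed)
  moreover have "Xm \<otimes>\<^bsub>R\<^esub> Yp (- int r) \<otimes>\<^bsub>R\<^esub> \<beta> d = Xm \<otimes>\<^bsub>R\<^esub> \<beta> (sz (- int r) d) \<otimes>\<^bsub>R\<^esub> Yp (- int r)"
    using Suc by (simp add: R.m_assoc cl)
  ultimately show ?case using Suc.prems unfolding 1 2 3 4
    by (simp add: X_base cl R.m_assoc)
qed (simp add: Yp_0 base_homD)

lemma Yp_base: "d \<in> carrier B \<Longrightarrow> Yp j \<otimes>\<^bsub>R\<^esub> \<beta> d = \<beta> (sz j d) \<otimes>\<^bsub>R\<^esub> Yp j"
  using Yp_base_nat[of d "nat j"] Yp_base_nat[of d "nat (- j)"] by (cases "j \<ge> 0") auto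

lemma base_Yp: "d \<in> carrier B \<Longrightarrow> \<beta> d \<otimes>\<^bsub>R\<^esub> Yp j = Yp j \<otimes>\<^bsub>R\<^esub> \<beta> (sz (- j) d)"
  using Yp_base[of "sz (- j) d" j] sz_add[of d j "- j"] by (simp add: sz_homD)

text \<open>A generator that moves the exponent away from 0 extends the power with coefficient 1.
  Otherwise it meets an opposite generator, and the pair becomes the base element b or s(b).\<close>

lemma X_Yp: "\<exists>c\<in>carrier B. Xp \<otimes>\<^bsub>R\<^esub> Yp j = \<beta> c \<otimes>\<^bsub>R\<^esub> Yp (j + 1)"
  "\<exists>c\<in>carrier B. Xm \<otimes>\<^bsub>R\<^esub> Yp j = \<beta> c \<otimes>\<^bsub>R\<^esub> Yp (j - 1)"
proof -
  note cl = base_homD(1) b alg_homD(1)[OF s_hom b]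
  show "\<exists>c\<in>carrier B. Xp \<otimes>\<^bsub>R\<^esub> Yp j = \<beta> c \<otimes>\<^bsub>R\<^esub> Yp (j + 1)"
  proof (cases "j \<ge> 0")
    case True then show ?thesis
      by (intro bexI[of _ "\<one>\<^bsub>B\<^esub>"]) (simp_all add: Yp_succ base_homD)
  next
    case False
    then have "Yp j = Xm \<otimes>\<^bsub>R\<^esub> Yp (j + 1)" using Yp_pred[of "j + 1"] by simp
    then have "Xp \<otimes>\<^bsub>R\<^esub> Yp j = \<beta> (s b) \<otimes>\<^bsub>R\<^esub> Yp (j + 1)"
      by (simp add: R.m_assoc[symmetric] X_base)
    then show ?thesis using cl by blast
  qed
  show "\<exists>c\<in>carrier B. Xm \<otimes>\<^bsub>R\<^esub> Yp j = \<beta> c \<otimes>\<^bsub>R\<^esub> Yp (j - 1)"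
  proof (cases "j \<le> 0")
    case True then show ?thesis
      by (intro bexI[of _ "\<one>\<^bsub>B\<^esub>"]) (simp_all add: Yp_pred base_homD)
  next
    case False
    then have "Yp j = Xp \<otimes>\<^bsub>R\<^esub> Yp (j - 1)" using Yp_succ[of "j - 1"] by simp
    then have "Xm \<otimes>\<^bsub>R\<^esub> Yp j = \<beta> b \<otimes>\<^bsub>R\<^esub> Yp (j - 1)"
      by (simp add: R.m_assoc[symmetric] X_base)
    then show ?thesis using cl by blast
  qed
qed

text \<open>The leftmost generator of the word is absorbed into a monomial already in normal form:
  it passes the base coefficient at the price of applying s or its inverse, and then
  \<open>X_Yp\<close> applies.\<close>

lemma wd_monomial: "w \<in> words \<Longrightarrow> \<exists>d\<in>carrier B. \<exists>j. wd w = \<beta> d \<otimes>\<^bsub>R\<^esub> Yp j"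
proof (induction w)
  case Nil
  then show ?case by (intro bexI[of _ "\<one>\<^bsub>B\<^esub>"] exI[of _ 0]) (simp_all add: wd_Nil Yp_0 base_homD)
next
  case (Cons g w)
  then obtain d j where dj: "d \<in> carrier B" "wd w = \<beta> d \<otimes>\<^bsub>R\<^esub> Yp j" by auto
  have eq: "wd (g # w) = wd [g] \<otimes>\<^bsub>R\<^esub> \<beta> d \<otimes>\<^bsub>R\<^esub> Yp j"
    using Cons.prems dj wd_Cons[of g w] by (simp add: R.m_assoc base_homD)
  from Cons.prems consider x where "x \<in> carrier B" "g = Base x" | "g = Xplus" | "g = Xminus"
    by (auto simp: gwa_gens_def)
  then show ?case
  proof cases
    case (1 x)
    have "wd (g # w) = \<beta> (x \<otimes>\<^bsub>B\<^esub> d) \<otimes>\<^bsub>R\<^esub> Yp j" using eq 1 dj by (simp add: base_wd[symmetric] base_homD)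
    then show ?thesis using 1 dj by blast
  next
    case 2
    obtain c where c: "c \<in> carrier B" "Xp \<otimes>\<^bsub>R\<^esub> Yp j = \<beta> c \<otimes>\<^bsub>R\<^esub> Yp (j + 1)" using X_Yp(1) by blast
    have sd: "s d \<in> carrier B" using dj by (simp add: alg_homD(1)[OF s_hom])
    have "wd (g # w) = \<beta> (s d) \<otimes>\<^bsub>R\<^esub> (Xp \<otimes>\<^bsub>R\<^esub> Yp j)"
      using eq 2 dj sd by (simp add: X_base R.m_assoc base_homD)
    also have "\<dots> = \<beta> (s d \<otimes>\<^bsub>B\<^esub> c) \<otimes>\<^bsub>R\<^esub> Yp (j + 1)"
      using c sd by (simp add: base_homD R.m_assoc)
    finally show ?thesis using c sd by blast
  next
    case 3
    obtain c where c: "c \<in> carrier B" "Xm \<otimes>\<^bsub>R\<^esub> Yp j = \<beta> c \<otimes>\<^bsub>R\<^esub> Yp (j - 1)" using X_Yp(2) by blast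
    have sd: "s' d \<in> carrier B" using dj by (simp add: alg_homD(1)[OF s'_hom])
    have "wd (g # w) = \<beta> (s' d) \<otimes>\<^bsub>R\<^esub> (Xm \<otimes>\<^bsub>R\<^esub> Yp j)"
      using eq 3 dj sd by (simp add: X_base R.m_assoc base_homD)
    also have "\<dots> = \<beta> (s' d \<otimes>\<^bsub>B\<^esub> c) \<otimes>\<^bsub>R\<^esub> Yp (j - 1)"
      using c sd by (simp add: base_homD R.m_assoc)
    finally show ?thesis using c sd by blast
  qed
qed

lemma R_induct [consumes 1, case_names monomial add]:
  assumes r: "r \<in> carrier R"
    and mon: "\<And>d j. d \<in> carrier B \<Longrightarrow> P (\<beta> d \<otimes>\<^bsub>R\<^esub> Yp j)"
    and add: "\<And>x y. x \<in> carrier R \<Longrightarrow> y \<in> carrier R \<Longrightarrow> P x \<Longrightarrow> P y \<Longrightarrow> P (x \<oplus>\<^bsub>R\<^esub> y)"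
  shows "P r"
proof -
  from r obtain f where f: "f \<in> carrier FB" "r = gwa_ideal B s b +>\<^bsub>FB\<^esub> f"
    unfolding R_eq by (rule Rq.quot_cases)
  from f(1) have "P (gwa_ideal B s b +>\<^bsub>FB\<^esub> f)"
  proof (induction rule: W.F_induct)
    case (mon c w)
    then obtain d j where d: "d \<in> carrier B" "wd w = \<beta> d \<otimes>\<^bsub>R\<^esub> Yp j" using wd_monomial[of w] by auto
    have "gwa_ideal B s b +>\<^bsub>FB\<^esub> (c \<odot>\<^bsub>FB\<^esub> mon_elt w) = c \<odot>\<^bsub>R\<^esub> wd w"
      using mon by (simp add: wd_def R_eq Rq.sm_coset)
    also have "\<dots> = \<beta> (c \<odot>\<^bsub>B\<^esub> d) \<otimes>\<^bsub>R\<^esub> Yp j" using d by (simp add: base_homD R.sm_mult_left)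
    finally show ?case using assms(2)[of "c \<odot>\<^bsub>B\<^esub> d" j] d by simp
  next
    case (add f g)
    then show ?case
      using assms(3)[of "gwa_ideal B s b +>\<^bsub>FB\<^esub> f" "gwa_ideal B s b +>\<^bsub>FB\<^esub> g"]
      by (simp add: R_eq Rq.coset_add Rq.coset_closed)
  qed
  then show ?thesis using f by simp
qed

lemma X_beta_Yp:
  assumes "Z = Xp \<and> e = 1 \<or> Z = Xm \<and> e = -1" "c \<in> carrier B"
  shows "\<exists>d\<in>carrier B. Z \<otimes>\<^bsub>R\<^esub> (\<beta> c \<otimes>\<^bsub>R\<^esub> Yp j) = \<beta> d \<otimes>\<^bsub>R\<^esub> Yp (j + e)"
proof -
  from assms obtain c1 where c1: "c1 \<in> carrier B" "Z \<otimes>\<^bsub>R\<^esub> \<beta> c = \<beta> c1 \<otimes>\<^bsub>R\<^esub> Z"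
    using X_base alg_homD(1)[OF s_hom] alg_homD(1)[OF s'_hom] by metis
  from assms obtain c2 where c2: "c2 \<in> carrier B" "Z \<otimes>\<^bsub>R\<^esub> Yp j = \<beta> c2 \<otimes>\<^bsub>R\<^esub> Yp (j + e)"
    using X_Yp[of j] by auto
  have Z: "Z \<in> carrier R" using assms by auto
  have "Z \<otimes>\<^bsub>R\<^esub> (\<beta> c \<otimes>\<^bsub>R\<^esub> Yp j) = Z \<otimes>\<^bsub>R\<^esub> \<beta> c \<otimes>\<^bsub>R\<^esub> Yp j" using Z assms by (simp add: base_homD R.m_assoc)
  also have "\<dots> = \<beta> c1 \<otimes>\<^bsub>R\<^esub> (Z \<otimes>\<^bsub>R\<^esub> Yp j)" using Z c1 by (simp add: base_homD R.m_assoc)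
  also have "\<dots> = \<beta> (c1 \<otimes>\<^bsub>B\<^esub> c2) \<otimes>\<^bsub>R\<^esub> Yp (j + e)" using c1 c2 by (simp add: base_homD R.m_assoc)
  finally show ?thesis using c1 c2 by blast
qed

lemma Yp_mult_nat: "\<exists>c\<in>carrier B. Yp (int r) \<otimes>\<^bsub>R\<^esub> Yp j = \<beta> c \<otimes>\<^bsub>R\<^esub> Yp (int r + j)"
  "\<exists>c\<in>carrier B. Yp (- int r) \<otimes>\<^bsub>R\<^esub> Yp j = \<beta> c \<otimes>\<^bsub>R\<^esub> Yp (- int r + j)"
proof (induction r)
  case 0
  show "\<exists>c\<in>carrier B. Yp (int 0) \<otimes>\<^bsub>R\<^esub> Yp j = \<beta> c \<otimes>\<^bsub>R\<^esub> Yp (int 0 + j)"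
    "\<exists>c\<in>carrier B. Yp (- int 0) \<otimes>\<^bsub>R\<^esub> Yp j = \<beta> c \<otimes>\<^bsub>R\<^esub> Yp (- int 0 + j)"
    by (auto intro!: bexI[of _ "\<one>\<^bsub>B\<^esub>"] simp: Yp_0 base_homD)
next
  case (Suc r)
  have 1: "Yp (int (Suc r)) = Xp \<otimes>\<^bsub>R\<^esub> Yp (int r)" using Yp_succ[of "int r"] by (simp add: add.commute)
  have 2: "Yp (- int (Suc r)) = Xm \<otimes>\<^bsub>R\<^esub> Yp (- int r)" unfolding neg_Suc using Yp_pred[of "- int r"] by simp
  from Suc obtain c where c: "c \<in> carrier B" "Yp (int r) \<otimes>\<^bsub>R\<^esub> Yp j = \<beta> c \<otimes>\<^bsub>R\<^esub> Yp (int r + j)" by blast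
  show "\<exists>c\<in>carrier B. Yp (int (Suc r)) \<otimes>\<^bsub>R\<^esub> Yp j = \<beta> c \<otimes>\<^bsub>R\<^esub> Yp (int (Suc r) + j)"
    unfolding 1 using c X_beta_Yp[of Xp 1 c "int r + j"] by (simp add: R.m_assoc algebra_simps)
  from Suc obtain c where c: "c \<in> carrier B" "Yp (- int r) \<otimes>\<^bsub>R\<^esub> Yp j = \<beta> c \<otimes>\<^bsub>R\<^esub> Yp (- int r + j)" by blast
  show "\<exists>c\<in>carrier B. Yp (- int (Suc r)) \<otimes>\<^bsub>R\<^esub> Yp j = \<beta> c \<otimes>\<^bsub>R\<^esub> Yp (- int (Suc r) + j)"
    unfolding 2 using c X_beta_Yp[of Xm "-1" c "- int r + j"] by (simp add: R.m_assoc algebra_simps)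
qed

lemma Yp_mult: "\<exists>c\<in>carrier B. Yp i \<otimes>\<^bsub>R\<^esub> Yp j = \<beta> c \<otimes>\<^bsub>R\<^esub> Yp (i + j)"
  using Yp_mult_nat[of "nat i" j] Yp_mult_nat[of "nat (- i)" j] by (cases "i \<ge> 0") auto

lemma Yp_mult_same_sign:
  assumes "e = 1 \<or> e = -1"
  shows "Yp (e * int p) \<otimes>\<^bsub>R\<^esub> Yp (e * int q) = Yp (e * int (p + q))"
proof (cases "e = 1")
  case True then show ?thesis by (simp add: Yp_def R.nat_pow_mult nat_add_distrib flip: of_nat_add)
next
  case False
  have "Yp (- int r) = Xm [^]\<^bsub>R\<^esub> r" for r by (cases "r = 0") (auto simp: Yp_def)
  moreover have "e = -1" using False assms by auto
  ultimately show ?thesis by (simp add: R.nat_pow_mult flip: of_nat_add minus_add_distrib)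
qed

text \<open>The element c is the product of the s^(-t)(b) for t < r: the innermost pair X- X+ equals
  b, and moving b out through (X-)^r applies s^(-r) to it. Its character is nonzero as soon as that
  of every factor is.\<close>

lemma Yp_inverse_pos:
  assumes "B.character \<chi>" and nz: "\<And>t. t < r \<Longrightarrow> \<chi> (sz (- int t) b) \<noteq> 0"
  shows "\<exists>c\<in>carrier B. Yp (- int r) \<otimes>\<^bsub>R\<^esub> Yp (int r) = \<beta> c \<and> \<chi> c \<noteq> 0"
  using nz
proof (induction r)
  case 0
  then show ?case using assms(1) by (intro bexI[of _ "\<one>\<^bsub>B\<^esub>"]) (auto simp: Yp_0 base_homD B.character_def)
next
  case (Suc r)
  then obtain c where c: "c \<in> carrier B" "Yp (- int r) \<otimes>\<^bsub>R\<^esub> Yp (int r) = \<beta> c" "\<chi> c \<noteq> 0" by auto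
  have 1: "Yp (int (Suc r)) = Xp \<otimes>\<^bsub>R\<^esub> Yp (int r)" using Yp_succ[of "int r"] by (simp add: add.commute)
  have 2: "Yp (- int (Suc r)) = Yp (- int r) \<otimes>\<^bsub>R\<^esub> Xm" unfolding neg_Suc using Yp_pred_right[of "- int r"] by simp
  have "Yp (- int (Suc r)) \<otimes>\<^bsub>R\<^esub> Yp (int (Suc r)) = Yp (- int r) \<otimes>\<^bsub>R\<^esub> (Xm \<otimes>\<^bsub>R\<^esub> Xp) \<otimes>\<^bsub>R\<^esub> Yp (int r)"
    unfolding 1 2 by (simp add: R.m_assoc)
  also have "\<dots> = \<beta> (sz (- int r) b) \<otimes>\<^bsub>R\<^esub> (Yp (- int r) \<otimes>\<^bsub>R\<^esub> Yp (int r))"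
    using b by (simp add: X_base Yp_base R.m_assoc base_homD sz_homD)
  also have "\<dots> = \<beta> (sz (- int r) b \<otimes>\<^bsub>B\<^esub> c)"
    using b c by (simp add: base_homD sz_homD)
  finally show ?case using c b assms(1) Suc.prems[of r]
    by (intro bexI[of _ "sz (- int r) b \<otimes>\<^bsub>B\<^esub> c"]) (auto simp: B.character_def sz_homD)
qed

text \<open>As in the positive case, but the innermost pair is now X+ X- = s(b) instead of b. Hence
  the factors are s^(t+1)(b), with exponents starting at 1 and not at 0.\<close>

lemma Yp_inverse_neg:
  assumes "B.character \<chi>" and nz: "\<And>t. t < r \<Longrightarrow> \<chi> (sz (int t + 1) b) \<noteq> 0"
  shows "\<exists>c\<in>carrier B. Yp (int r) \<otimes>\<^bsub>R\<^esub> Yp (- int r) = \<beta> c \<and> \<chi> c \<noteq> 0"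
  using nz
proof (induction r)
  case 0
  then show ?case using assms(1) by (intro bexI[of _ "\<one>\<^bsub>B\<^esub>"]) (auto simp: Yp_0 base_homD B.character_def)
next
  case (Suc r)
  then obtain c where c: "c \<in> carrier B" "Yp (int r) \<otimes>\<^bsub>R\<^esub> Yp (- int r) = \<beta> c" "\<chi> c \<noteq> 0" by auto
  have sb: "s b \<in> carrier B" using b by (simp add: alg_homD(1)[OF s_hom])
  have 1: "Yp (int (Suc r)) = Yp (int r) \<otimes>\<^bsub>R\<^esub> Xp" using Yp_succ_right[of "int r"] by (simp add: add.commute)
  have 2: "Yp (- int (Suc r)) = Xm \<otimes>\<^bsub>R\<^esub> Yp (- int r)" unfolding neg_Suc using Yp_pred[of "- int r"] by simp
  have "Yp (int (Suc r)) \<otimes>\<^bsub>R\<^esub> Yp (- int (Suc r)) = Yp (int r) \<otimes>\<^bsub>R\<^esub> (Xp \<otimes>\<^bsub>R\<^esub> Xm) \<otimes>\<^bsub>R\<^esub> Yp (- int r)"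
    unfolding 1 2 by (simp add: R.m_assoc)
  also have "\<dots> = \<beta> (sz (int r) (s b)) \<otimes>\<^bsub>R\<^esub> (Yp (int r) \<otimes>\<^bsub>R\<^esub> Yp (- int r))"
    using sb by (simp add: X_base Yp_base R.m_assoc base_homD sz_homD)
  also have "\<dots> = \<beta> (sz (int r + 1) b \<otimes>\<^bsub>B\<^esub> c)"
    using sb b c by (simp add: base_homD sz_homD sz_succ')
  finally show ?case using c b assms(1) Suc.prems[of r]
    by (intro bexI[of _ "sz (int r + 1) b \<otimes>\<^bsub>B\<^esub> c"]) (auto simp: B.character_def sz_homD)
qed

end

subsection \<open>Weight representations\<close>

text \<open>The representation on functions on the integers: the basis vector at \<open>j\<close> has weight
  \<open>\<chi> \<circ> s\<^sup>-\<^sup>j\<close>, and \<open>p j\<close>, \<open>q j\<close> are the matrix entries of \<open>X\<^sup>+\<close> from \<open>j\<close> to \<open>j + 1\<close> and of \<open>X\<^sup>-\<close> back.\<close>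
locale gwa1_rep = gwa1 B s b for B :: "('k::field, 'b) module" and s b +
  fixes \<chi> :: "'b \<Rightarrow> 'k" and p q :: "int \<Rightarrow> 'k"
  assumes \<chi>: "B.character \<chi>" and pq: "q j * p j = \<chi> (sz (- j) b)"
begin

lemmas \<chi>D = B.characterD[OF \<chi>]

fun gact :: "'b gwa_gen \<Rightarrow> (int \<Rightarrow> 'k) \<Rightarrow> int \<Rightarrow> 'k" where
  "gact (Base d) v = (\<lambda>j. \<chi> (sz (- j) d) * v j)"
| "gact Xplus v = (\<lambda>j. p (j - 1) * v (j - 1))"
| "gact Xminus v = (\<lambda>j. q j * v (j + 1))"

definition act :: "'b gwa_gen list \<Rightarrow> (int \<Rightarrow> 'k) \<Rightarrow> int \<Rightarrow> 'k" where
  "act w = foldr gact w"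

lemma act_append: "act (u @ w) v = act u (act w v)"
  by (simp add: act_def)

lemma act_simps [simp]: "act [] v = v" "act (g # w) v = gact g (act w v)"
  by (simp_all add: act_def)

lemma act_sum: "finite S \<Longrightarrow> act w (\<lambda>j. \<Sum>x\<in>S. a x * V x j) i = (\<Sum>x\<in>S. a x * act w (V x) i)"
proof (induction w arbitrary: i)
  case (Cons g w)
  then have "act w (\<lambda>j. \<Sum>x\<in>S. a x * V x j) = (\<lambda>i. \<Sum>x\<in>S. a x * act w (V x) i)" by auto
  then show ?case by (cases g) (simp_all add: sum_distrib_left mult.left_commute)
qed simp

lemma act_lin: "f \<in> carrier FB \<Longrightarrow> act w (\<lambda>j. lin (\<lambda>x. V x j) f) i = lin (\<lambda>x. act w (V x) i) f"
  unfolding lin_def by (rule act_sum) (simp add: W.F_simps)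

lemma act_zero: "act w (\<lambda>_. 0) = (\<lambda>_. 0)"
  by (induction w) (auto simp: act_def intro!: ext split: gwa_gen.splits, case_tac a, auto)

lemma lin_relation:
  assumes "\<rho> \<in> gwa_relations B s b" shows "lin (\<lambda>x. act x v j) \<rho> = 0"
proof -
  note cl = b alg_homD(1)[OF s_hom] alg_homD(1)[OF s'_hom]
  have szs: "sz (- j) (s d) = sz (- (j - 1)) d" if "d \<in> carrier B" for d
    using sz_succ'[OF that, of "- j"] by simp
  have szs': "sz (- j) (s' d) = sz (- (j + 1)) d" if "d \<in> carrier B" for d
    using sz_pred'[OF that, of "- j"] by simp
  note [simp] = W.F.a_closed W.F.sm_closed W.F.one_closed
  \<comment> \<open>The relation for X+ X- at position j runs through the edge between j - 1 and j,
    whereas \<open>pq\<close> at j concerns the edge between j and j + 1.\<close>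
  have pq': "p (j - 1) * q (j - 1) = \<chi> (sz (1 - j) b)" using pq[of "j - 1"] by (simp add: mult.commute)
  show ?thesis
    using assms unfolding gwa_relations_def Let_def
    by (elim UnE; clarify?; simp?; (elim exE conjE)?; simp?)
      (use cl pq[of j] pq' in \<open>simp_all add: W.lin_minus W.lin_add' W.lin_scale' W.F_simps(2) sz_homD \<chi>D szs szs' b distrib_right\<close>)
qed

text \<open>The action is descended one coordinate at a time, since \<open>lin\<close> and the
  vanishing criterion for generated ideals deal with scalar functionals.\<close>

definition rho :: "('k, 'b) gwa_elt \<Rightarrow> (int \<Rightarrow> 'k) \<Rightarrow> int \<Rightarrow> 'k" where
  "rho r v i = descend (lin (\<lambda>w. act w v i)) r"

lemma rho_coset: "f \<in> carrier FB \<Longrightarrow> rho (gwa_ideal B s b +>\<^bsub>FB\<^esub> f) v i = lin (\<lambda>w. act w v i) f"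
  unfolding rho_def
proof (rule Rq.descend_coset)
  fix f g assume fg: "f \<in> carrier FB" "g \<in> carrier FB" "f \<ominus>\<^bsub>FB\<^esub> g \<in> gwa_ideal B s b"
  have "lin (\<lambda>w. act w v i) (f \<ominus>\<^bsub>FB\<^esub> g) = 0"
  proof (rule W.lin_genideal_zero[OF relations_closed])
    show "f \<ominus>\<^bsub>FB\<^esub> g \<in> Idl\<^bsub>FB\<^esub> gwa_relations B s b" using fg by (simp add: gwa_ideal_def)
    fix \<rho> u w assume \<rho>: "\<rho> \<in> gwa_relations B s b"
    have "lin (\<lambda>x. act (u \<otimes>\<^bsub>free_monoid (gwa_gens B)\<^esub> x \<otimes>\<^bsub>free_monoid (gwa_gens B)\<^esub> w) v i) \<rho> =
      act u (\<lambda>j. lin (\<lambda>x. act x (act w v) j) \<rho>) i"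
      using \<rho> relations_closed by (subst act_lin) (auto simp: act_append)
    then show "lin (\<lambda>x. act (u \<otimes>\<^bsub>free_monoid (gwa_gens B)\<^esub> x \<otimes>\<^bsub>free_monoid (gwa_gens B)\<^esub> w) v i) \<rho> = 0"
      using lin_relation[OF \<rho>] by (simp add: act_zero)
  qed
  then show "lin (\<lambda>w. act w v i) f = lin (\<lambda>w. act w v i) g" using fg by (simp add: W.lin_minus)
qed

lemma rho_wd: "w \<in> words \<Longrightarrow> rho (wd w) v = act w v"
  by (rule ext) (simp add: wd_def rho_coset)

lemma rho_linear: "R.linear_fun (\<lambda>r. rho r v i)"
  unfolding R.linear_fun_def unfolding R_eq
  by (auto elim!: Rq.quot_cases simp: Rq.coset_add Rq.sm_coset rho_coset W.lin_add' W.lin_scale')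

lemma rho_mult: "r \<in> carrier R \<Longrightarrow> r' \<in> carrier R \<Longrightarrow> rho (r \<otimes>\<^bsub>R\<^esub> r') v = rho r (rho r' v)"
proof -
  assume "r \<in> carrier R" "r' \<in> carrier R"
  then obtain f g where fg: "f \<in> carrier FB" "r = gwa_ideal B s b +>\<^bsub>FB\<^esub> f"
      "g \<in> carrier FB" "r' = gwa_ideal B s b +>\<^bsub>FB\<^esub> g"
    unfolding R_eq by (elim Rq.quot_cases)
  have "rho (gwa_ideal B s b +>\<^bsub>FB\<^esub> g) v = (\<lambda>j. lin (\<lambda>y. act y v j) g)"
    using fg by (simp add: rho_coset fun_eq_iff)
  then show ?thesis
    using fg by (intro ext) (simp add: R_eq Rq.coset_mult rho_coset W.lin_mult W.F_mult_closed act_append act_lin)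
qed

lemma rho_base: "d \<in> carrier B \<Longrightarrow> rho (\<beta> d) v = (\<lambda>j. \<chi> (sz (- j) d) * v j)"
  by (simp add: base_wd rho_wd)

lemma rho_X: "rho Xp v = (\<lambda>j. p (j - 1) * v (j - 1))" "rho Xm v = (\<lambda>j. q j * v (j + 1))"
  by (simp_all add: rho_wd)

lemma rho_one: "rho \<one>\<^bsub>R\<^esub> v = v"
  by (simp add: wd_Nil[symmetric] rho_wd)

lemma rho_scale: "r \<in> carrier R \<Longrightarrow> rho r (\<lambda>j. c * v j) = (\<lambda>j. c * rho r v j)"
proof -
  assume r: "r \<in> carrier R"
  have "act w (\<lambda>j. c * v j) i = c * act w v i" for w i
    using act_sum[of "{()}" w "\<lambda>_. c" "\<lambda>_. v" i] by simp
  then have "lin (\<lambda>w. act w (\<lambda>j. c * v j) i) f = c * lin (\<lambda>w. act w v i) f" for f i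
    by (simp add: lin_def sum_distrib_left mult.left_commute)
  then show ?thesis using r unfolding R_eq by (auto elim!: Rq.quot_cases simp: rho_coset)
qed

end

definition basis_fun :: "int \<Rightarrow> int \<Rightarrow> 'k::field" where
  "basis_fun i = (\<lambda>j. if j = i then 1 else 0)"

context gwa1
begin

context
  fixes \<chi> assumes \<chi>: "B.character \<chi>"
begin

interpretation U: gwa1_rep B s b \<chi> "\<lambda>_. 1" "\<lambda>j. \<chi> (sz (- j) b)"
  by unfold_locales (use \<chi> in simp_all)

text \<open>The functional is the diagonal matrix coefficient at the basis vector of position 0.
  That vector has weight \<chi>, so a base element on the right rescales it before \<open>r\<close>
  acts.\<close>

lemma weight_functional_exists:
  "\<exists>f. R.linear_fun f \<and> f \<one>\<^bsub>R\<^esub> = 1 \<and> (\<forall>r\<in>carrier R. \<forall>d\<in>carrier B. f (r \<otimes>\<^bsub>R\<^esub> \<beta> d) = f r * \<chi> d)"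
proof (intro exI[of _ "\<lambda>r. U.rho r (basis_fun 0) 0"] conjI ballI)
  fix r d assume rd: "r \<in> carrier R" "d \<in> carrier B"
  have "U.rho (\<beta> d) (basis_fun 0) = (\<lambda>j. \<chi> d * basis_fun 0 j)"
    using rd by (auto simp: U.rho_base basis_fun_def)
  then show "U.rho (r \<otimes>\<^bsub>R\<^esub> \<beta> d) (basis_fun 0) 0 = U.rho r (basis_fun 0) 0 * \<chi> d"
    using rd by (simp add: U.rho_mult base_homD U.rho_scale)
qed (use U.rho_linear in \<open>auto simp: U.rho_one basis_fun_def\<close>)

text \<open>In this representation all entries of X+ are 1, so (X+)^m carries the basis vector at 0
  to the one at m whatever the zeros of b are. It serves to show that a monomial of the tensor power
  is nonzero.\<close>

lemma Yp_functional_exists: "\<exists>f. R.linear_fun f \<and> f (Yp (int m)) = 1"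
proof (intro exI[of _ "\<lambda>r. U.rho r (basis_fun 0) (int m)"] conjI)
  have "U.rho (Yp (int m)) (basis_fun 0) = basis_fun (int m)"
  proof (induction m)
    case (Suc m)
    have "Yp (int (Suc m)) = Xp \<otimes>\<^bsub>R\<^esub> Yp (int m)" using Yp_succ[of "int m"] by (simp add: add.commute)
    then show ?case by (simp add: U.rho_mult Suc U.rho_X) (auto simp: basis_fun_def)
  qed (simp add: Yp_0 U.rho_one)
  then show "U.rho (Yp (int m)) (basis_fun 0) (int m) = 1" by (simp add: basis_fun_def)
qed (rule U.rho_linear)

end

text \<open>If \<open>b\<close> vanishes at two places of an orbit, the weight spaces in between span a finite
  dimensional module, on which a power of \<open>X\<^sup>+\<close> is zero; \<open>f\<close> is one of its matrix coefficients.\<close>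
lemma nilpotent_functional_exists:
  assumes \<chi>: "B.character \<chi>" and j: "j0 < j1" "\<chi> (sz (- j0) b) = 0" "\<chi> (sz (- j1) b) = 0"
  shows "\<exists>f m. R.linear_fun f \<and> f \<one>\<^bsub>R\<^esub> = 1 \<and>
    (\<forall>r\<in>carrier R. \<forall>r'\<in>carrier R. f (r \<otimes>\<^bsub>R\<^esub> Yp (int m) \<otimes>\<^bsub>R\<^esub> r') = 0)"
proof -
  \<comment> \<open>Only the product of the two entries at a place is prescribed. Where it vanishes
    both entries are taken to be zero, so that X+ cannot leave the interval at \<open>j1\<close> nor
    X- at \<open>j0\<close>.\<close>
  interpret U: gwa1_rep B s b \<chi> "\<lambda>j. if \<chi> (sz (- j) b) = 0 then 0 else 1" "\<lambda>j. \<chi> (sz (- j) b)"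
    by unfold_locales (use \<chi> in simp_all)
  \<comment> \<open>Functions supported on the interval (i, j1]. \<open>V j0\<close> is the
    invariant subspace between the two zeros, and X+ raises the lower end of the support by
    one.\<close>
  define V where "V i = {v :: int \<Rightarrow> 'k. \<forall>j. \<not> (i < j \<and> j \<le> j1) \<longrightarrow> v j = 0}" for i
  have act_V: "U.act w v \<in> V j0" if "v \<in> V j0" for w v
    using that
  proof (induction w)
    case (Cons g w)
    then have v: "U.act w v \<in> V j0" by simp
    have "U.act w v (j1 + 1) = 0" "U.act w v j0 = 0" using v by (auto simp: V_def)
    have "U.gact g (U.act w v) \<in> V j0"
    proof (cases g)
      case (Base d) then show ?thesis using v by (auto simp: V_def)
    next
      case Xplus
      have "(if \<chi> (sz (- (j - 1)) b) = 0 then 0 else 1) * U.act w v (j - 1) = 0" if "\<not> (j0 < j \<and> j \<le> j1)" for j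
        using v that j(3) by (cases "j = j1 + 1") (auto simp: V_def)
      then show ?thesis using Xplus by (auto simp: V_def)
    next
      case Xminus
      have "\<chi> (sz (- j) b) * U.act w v (j + 1) = 0" if "\<not> (j0 < j \<and> j \<le> j1)" for j
        using v that j(2) by (cases "j = j0") (auto simp: V_def)
      then show ?thesis using Xminus by (auto simp: V_def)
    qed
    then show ?case by simp
  qed simp
  have rho_V: "U.rho r v \<in> V j0" if "v \<in> V j0" "r \<in> carrier R" for r v
  proof -
    obtain f where f: "f \<in> carrier FB" "r = gwa_ideal B s b +>\<^bsub>FB\<^esub> f"
      using \<open>r \<in> carrier R\<close> unfolding R_eq by (rule Rq.quot_cases)
    have "lin (\<lambda>w. U.act w v j) f = 0" if "\<not> (j0 < j \<and> j \<le> j1)" for j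
      using act_V[OF \<open>v \<in> V j0\<close>] that by (simp add: V_def)
    then show ?thesis using f by (simp add: V_def U.rho_coset)
  qed
  have Xp_V: "U.rho (Yp (int m)) v \<in> V (j0 + int m)" if "v \<in> V j0" for m v
    using that
  proof (induction m)
    case (Suc m)
    have "Yp (int (Suc m)) = Xp \<otimes>\<^bsub>R\<^esub> Yp (int m)" using Yp_succ[of "int m"] by (simp add: add.commute)
    then have eq: "U.rho (Yp (int (Suc m))) v =
        (\<lambda>j. (if \<chi> (sz (- (j - 1)) b) = 0 then 0 else 1) * U.rho (Yp (int m)) v (j - 1))"
      by (simp add: U.rho_mult U.rho_X)
    have "(if \<chi> (sz (- (j - 1)) b) = 0 then 0 else 1) * U.rho (Yp (int m)) v (j - 1) = 0"
      if "\<not> (j0 + int (Suc m) < j \<and> j \<le> j1)" for j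
      using Suc that j(3) by (cases "j = j1 + 1") (auto simp: V_def)
    then show ?case unfolding eq by (auto simp: V_def)
  qed (simp add: Yp_0 U.rho_one)
  \<comment> \<open>After j1 - j0 steps the interval (j0 + m, j1] is empty.\<close>
  define m where "m = nat (j1 - j0)"
  have zero: "U.rho (Yp (int m)) v = (\<lambda>_. 0)" if "v \<in> V j0" for v
    using Xp_V[OF that, of m] j(1) by (auto simp: V_def m_def)
  have z0: "U.rho r (\<lambda>_. 0) = (\<lambda>_. 0)" if "r \<in> carrier R" for r
    using U.rho_scale[OF that, of 0 "\<lambda>_. 0"] by simp
  have e: "basis_fun j1 \<in> V j0" using j by (auto simp: V_def basis_fun_def)
  show ?thesis
  proof (intro exI[of _ "\<lambda>r. U.rho r (basis_fun j1) j1"] exI[of _ m] conjI ballI)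
    fix r r' assume "r \<in> carrier R" "r' \<in> carrier R"
    then show "U.rho (r \<otimes>\<^bsub>R\<^esub> Yp (int m) \<otimes>\<^bsub>R\<^esub> r') (basis_fun j1) j1 = 0"
      by (simp add: U.rho_mult zero rho_V e z0)
  qed (use U.rho_linear in \<open>auto simp: U.rho_one basis_fun_def\<close>)
qed

end

section \<open>Characters of affine algebras\<close>

lemma exists_nonroot:
  fixes c :: "nat \<Rightarrow> 'k::field_char_0"
  assumes "c m \<noteq> 0"
  shows "\<exists>x. (\<Sum>i\<le>m. c i * x ^ i) \<noteq> 0"
proof -
  define p where "p = (\<Sum>i\<le>m. Polynomial.monom (c i) i)"
  have "Polynomial.coeff p m = c m" by (simp add: p_def coeff_sum if_distrib cong: if_cong)
  then have "p \<noteq> 0" using assms by auto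
  then have "finite {x. poly p x = 0}" by (rule poly_roots_finite)
  then obtain x where "poly p x \<noteq> 0"
    using infinite_UNIV_char_0[where 'a = 'k] ex_new_if_finite by blast
  then show ?thesis by (auto simp: p_def poly_sum poly_monom)
qed

abbreviation subalg :: "('a, 'z) ring_scheme \<Rightarrow> 'a set \<Rightarrow> ('a, 'z) ring_scheme" where
  "subalg L S \<equiv> L\<lparr>carrier := S\<rparr>"

lemma (in UP_cring) eval_class_ring:
  assumes "p \<in> carrier P"
  shows "UnivPoly.eval R (class_ring :: 'k::field ring) \<phi> \<xi> p = (\<Sum>i\<le>deg R p. \<phi> (up_ring.coeff P p i) * \<xi> ^ i)"
  unfolding eval_on_carrier[OF assms] class_ring_simps by simp

text \<open>Pseudo-division shows that a generic zero of a minimal polynomial of \<open>x\<close> is a zero of all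
  polynomial relations of \<open>x\<close>, and that the value \<open>r\<close> of \<open>g\<close> divides a nonzero constant modulo these
  relations.\<close>
lemma extend_hom_step:
  fixes L (structure)
  assumes "domain L" and S: "subring S L" and x: "x \<in> carrier L"
    and r: "r \<in> UnivPoly.eval (subalg L S) L id x ` carrier (UP (subalg L S))" "r \<noteq> \<zero>"
  shows "\<exists>t\<in>S. t \<noteq> \<zero> \<and> (\<forall>\<phi> \<in> Ring.ring_hom (subalg L S) (class_ring :: 'k::{alg_closed_field,field_char_0} ring).
    \<phi> t \<noteq> 0 \<longrightarrow> (\<exists>\<xi>. (\<forall>q\<in>carrier (UP (subalg L S)). UnivPoly.eval (subalg L S) L id x q = \<zero> \<longrightarrow>
        UnivPoly.eval (subalg L S) class_ring \<phi> \<xi> q = 0) \<and>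
      (\<forall>g\<in>carrier (UP (subalg L S)). UnivPoly.eval (subalg L S) L id x g = r \<longrightarrow>
        UnivPoly.eval (subalg L S) class_ring \<phi> \<xi> g \<noteq> 0)))"
proof -
  interpret L: domain L by fact
  define RS where "RS = subalg L S"
  interpret RS: domain RS unfolding RS_def by (rule L.subring_is_domain[OF S])
  have SL: "S \<subseteq> carrier L" by (rule subringE(1)[OF S])
  interpret U: UP_domain RS "UP RS" by unfold_locales simp
  have id: "id \<in> Ring.ring_hom RS L" using SL by (auto simp: RS_def intro!: ring_hom_memI)
  interpret eL: UP_univ_prop RS L id "UP RS" x "UnivPoly.eval RS L id x"
    unfolding UP_univ_prop_def UP_univ_prop_axioms_def
    using UP_pre_univ_propI[OF RS.is_cring L.is_cring id] x by simp
  define ev where "ev = UnivPoly.eval RS L id x"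
  have ev_add: "ev (p \<oplus>\<^bsub>UP RS\<^esub> q) = ev p \<oplus> ev q" if "p \<in> carrier (UP RS)" "q \<in> carrier (UP RS)" for p q
    unfolding ev_def using that by (rule eL.hom_add)
  have ev_mult: "ev (p \<otimes>\<^bsub>UP RS\<^esub> q) = ev p \<otimes> ev q" if "p \<in> carrier (UP RS)" "q \<in> carrier (UP RS)" for p q
    unfolding ev_def using that by (rule eL.hom_mult)
  have ev_closed: "ev p \<in> carrier L" if "p \<in> carrier (UP RS)" for p
    unfolding ev_def using that by (rule eL.hom_closed)
  have ev_smult: "ev (c \<odot>\<^bsub>UP RS\<^esub> p) = c \<otimes> ev p" if "p \<in> carrier (UP RS)" "c \<in> S" for p c
    unfolding ev_def using eL.Eval_smult[of c p] that by (simp add: RS_def)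
  have ev_const: "ev (up_ring.monom (UP RS) c 0) = c" if "c \<in> S" for c
    unfolding ev_def using eL.eval_const[of x c] that x by (simp add: RS_def)
  have ev0: "ev \<zero>\<^bsub>UP RS\<^esub> = \<zero>" unfolding ev_def by (rule eL.hom_zero)
  have RSz: "\<zero>\<^bsub>RS\<^esub> = \<zero>" and RSc: "carrier RS = S" by (simp_all add: RS_def)
  have lc: "U.lcoeff p \<in> S" if "p \<in> carrier (UP RS)" for p using U.lcoeff_closed[OF that] RSc by simp
  have hom: "ring_hom_cring (UP RS) (class_ring :: 'k ring) (UnivPoly.eval RS class_ring \<phi> \<xi>)
       \<and> UP_univ_prop RS (class_ring :: 'k ring) \<phi> \<xi>"
    if "\<phi> \<in> Ring.ring_hom RS (class_ring :: 'k ring)" for \<phi> and \<xi> :: 'k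
  proof -
    have *: "UP_univ_prop RS (class_ring :: 'k ring) \<phi> \<xi>"
      unfolding UP_univ_prop_def UP_univ_prop_axioms_def
      using UP_pre_univ_propI[OF RS.is_cring class_cring.cring_axioms that] by simp
    interpret ek: UP_univ_prop RS "class_ring :: 'k ring" \<phi> "UP RS" \<xi> "UnivPoly.eval RS class_ring \<phi> \<xi>"
      using * by simp
    show ?thesis using * ek.ring_hom_cring_axioms by simp
  qed
  obtain g where g: "g \<in> carrier (UP RS)" "ev g = r" using r unfolding ev_def RS_def by auto
  define rel where "rel q \<longleftrightarrow> q \<in> carrier (UP RS) \<and> ev q = \<zero>" for q
  have main: "\<exists>t\<in>S. t \<noteq> \<zero> \<and> (\<forall>\<phi> \<in> Ring.ring_hom RS (class_ring :: 'k ring). \<phi> t \<noteq> 0 \<longrightarrow>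
     (\<exists>\<xi>. (\<forall>q. rel q \<longrightarrow> UnivPoly.eval RS class_ring \<phi> \<xi> q = 0) \<and> UnivPoly.eval RS class_ring \<phi> \<xi> g \<noteq> 0))"
  proof (cases "\<forall>q. rel q \<longrightarrow> q = \<zero>\<^bsub>UP RS\<^esub>")
    \<comment> \<open>Here x satisfies no polynomial relation, so any value may be assigned to it.
      If the leading coefficient of \<open>g\<close> survives under \<phi>, a value that is not a
      root of the image of \<open>g\<close> exists because the field is infinite.\<close>
    case True
    have gz: "g \<noteq> \<zero>\<^bsub>UP RS\<^esub>" using g r ev0 by auto
    then have "U.lcoeff g \<noteq> \<zero>" using U.lcoeff_nonzero2[OF g(1)] RSz by simp
    moreover have "\<exists>\<xi>. (\<forall>q. rel q \<longrightarrow> UnivPoly.eval RS class_ring \<phi> \<xi> q = 0) \<and> UnivPoly.eval RS class_ring \<phi> \<xi> g \<noteq> 0"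
      if \<phi>: "\<phi> \<in> Ring.ring_hom RS (class_ring :: 'k ring)" and nz: "\<phi> (U.lcoeff g) \<noteq> 0" for \<phi>
    proof -
      obtain \<xi> where \<xi>: "(\<Sum>i\<le>deg RS g. \<phi> (up_ring.coeff (UP RS) g i) * \<xi> ^ i) \<noteq> 0"
        using exists_nonroot[of "\<lambda>i. \<phi> (up_ring.coeff (UP RS) g i)", OF nz] by blast
      interpret ek: ring_hom_cring "UP RS" "class_ring :: 'k ring" "UnivPoly.eval RS class_ring \<phi> \<xi>"
        using hom[OF \<phi>] by blast
      have "UnivPoly.eval RS class_ring \<phi> \<xi> g \<noteq> 0" unfolding U.eval_class_ring[OF g(1)] by (rule \<xi>)
      then show ?thesis using True ek.hom_zero by (intro exI[of _ \<xi>]) auto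
    qed
    ultimately show ?thesis using lc[OF g(1)] by blast
  next
    case False
    then have "\<exists>p. rel p \<and> p \<noteq> \<zero>\<^bsub>UP RS\<^esub>" by auto
    then obtain p where p: "rel p" "p \<noteq> \<zero>\<^bsub>UP RS\<^esub>"
      and pmin: "\<And>q. rel q \<Longrightarrow> q \<noteq> \<zero>\<^bsub>UP RS\<^esub> \<Longrightarrow> deg RS p \<le> deg RS q"
      using ex_has_least_nat[of "\<lambda>p. rel p \<and> p \<noteq> \<zero>\<^bsub>UP RS\<^esub>" _ "deg RS"] by metis
    have pc: "p \<in> carrier (UP RS)" and evp: "ev p = \<zero>" using p by (auto simp: rel_def)
    define a where "a = U.lcoeff p"
    have a: "a \<in> S" "a \<noteq> \<zero>" using lc[OF pc] U.lcoeff_nonzero2[OF pc p(2)] RSz by (auto simp: a_def)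
    \<comment> \<open>The remainder of the pseudo-division is again a relation of x, of degree below
      the least one, hence zero.\<close>
    have div_p: "\<exists>u\<in>carrier (UP RS). \<exists>m::nat. (a [^]\<^bsub>RS\<^esub> m) \<odot>\<^bsub>UP RS\<^esub> q = p \<otimes>\<^bsub>UP RS\<^esub> u" if q: "rel q" for q
    proof -
      have qc: "q \<in> carrier (UP RS)" using q by (simp add: rel_def)
      from U.long_div_theorem[OF pc qc p(2)] obtain u w m where u: "u \<in> carrier (UP RS)" "w \<in> carrier (UP RS)"
        "(a [^]\<^bsub>RS\<^esub> (m::nat)) \<odot>\<^bsub>UP RS\<^esub> q = p \<otimes>\<^bsub>UP RS\<^esub> u \<oplus>\<^bsub>UP RS\<^esub> w" "w = \<zero>\<^bsub>UP RS\<^esub> \<or> deg RS w < deg RS p"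
        unfolding a_def by blast
      have am: "a [^]\<^bsub>RS\<^esub> m \<in> S" using RS.nat_pow_closed[of a m] a RSc by simp
      have "a [^]\<^bsub>RS\<^esub> m \<otimes> \<zero> = \<zero> \<otimes> ev u \<oplus> ev w"
        using arg_cong[OF u(3), of ev] u(1,2) qc pc am q evp
        by (simp add: ev_add ev_mult ev_smult rel_def)
      then have "ev w = \<zero>" using u ev_closed am SL by auto
      then have "rel w" using u by (simp add: rel_def)
      then have "w = \<zero>\<^bsub>UP RS\<^esub>" using pmin[of w] u(4) by (meson not_le)
      then show ?thesis using u pc by auto
    qed
    \<comment> \<open>The ideal generated by \<open>g\<close> and \<open>p\<close>. A nonzero member
      \<open>k\<close> of least degree divides both of them up to powers of its leading coefficient,
      and it turns out to be a constant.\<close>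
    define J where "J h \<longleftrightarrow> (\<exists>v\<in>carrier (UP RS). \<exists>u\<in>carrier (UP RS). h = v \<otimes>\<^bsub>UP RS\<^esub> g \<oplus>\<^bsub>UP RS\<^esub> u \<otimes>\<^bsub>UP RS\<^esub> p)" for h
    have J_closed: "h \<in> carrier (UP RS)" if "J h" for h using that g pc by (auto simp: J_def)
    have J_p: "J p" unfolding J_def
      using g pc by (intro bexI[of _ "\<zero>\<^bsub>UP RS\<^esub>"] bexI[of _ "\<one>\<^bsub>UP RS\<^esub>"]) auto
    have J_g: "J g" unfolding J_def
      using g pc by (intro bexI[of _ "\<zero>\<^bsub>UP RS\<^esub>"] bexI[of _ "\<one>\<^bsub>UP RS\<^esub>"]) auto
    have J_comb: "J (h \<ominus>\<^bsub>UP RS\<^esub> k \<otimes>\<^bsub>UP RS\<^esub> w)" if hk: "J h" "J k" and w: "w \<in> carrier (UP RS)" for h k w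
    proof -
      from hk obtain v u v' u' where *: "v \<in> carrier (UP RS)" "u \<in> carrier (UP RS)" "v' \<in> carrier (UP RS)" "u' \<in> carrier (UP RS)"
        "h = v \<otimes>\<^bsub>UP RS\<^esub> g \<oplus>\<^bsub>UP RS\<^esub> u \<otimes>\<^bsub>UP RS\<^esub> p" "k = v' \<otimes>\<^bsub>UP RS\<^esub> g \<oplus>\<^bsub>UP RS\<^esub> u' \<otimes>\<^bsub>UP RS\<^esub> p"
        unfolding J_def by blast
      have "h \<ominus>\<^bsub>UP RS\<^esub> k \<otimes>\<^bsub>UP RS\<^esub> w = (v \<ominus>\<^bsub>UP RS\<^esub> v' \<otimes>\<^bsub>UP RS\<^esub> w) \<otimes>\<^bsub>UP RS\<^esub> g \<oplus>\<^bsub>UP RS\<^esub> (u \<ominus>\<^bsub>UP RS\<^esub> u' \<otimes>\<^bsub>UP RS\<^esub> w) \<otimes>\<^bsub>UP RS\<^esub> p"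
        unfolding *(5,6) using *(1-4) w g(1) pc by algebra
      then show ?thesis unfolding J_def using * w by blast
    qed
    have J_smult: "J (c \<odot>\<^bsub>UP RS\<^esub> h)" if h: "J h" and c: "c \<in> S" for c h
    proof -
      from h obtain v u where *: "v \<in> carrier (UP RS)" "u \<in> carrier (UP RS)"
        "h = v \<otimes>\<^bsub>UP RS\<^esub> g \<oplus>\<^bsub>UP RS\<^esub> u \<otimes>\<^bsub>UP RS\<^esub> p" unfolding J_def by blast
      have "c \<odot>\<^bsub>UP RS\<^esub> h = (c \<odot>\<^bsub>UP RS\<^esub> v) \<otimes>\<^bsub>UP RS\<^esub> g \<oplus>\<^bsub>UP RS\<^esub> (c \<odot>\<^bsub>UP RS\<^esub> u) \<otimes>\<^bsub>UP RS\<^esub> p"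
        using * c g(1) pc RSc by (simp add: U.smult_r_distr U.smult_assoc2)
      then show ?thesis unfolding J_def using * c RSc by blast
    qed
    obtain k where k: "J k" "k \<noteq> \<zero>\<^bsub>UP RS\<^esub>"
      and kmin: "\<And>q. J q \<Longrightarrow> q \<noteq> \<zero>\<^bsub>UP RS\<^esub> \<Longrightarrow> deg RS k \<le> deg RS q"
      using ex_has_least_nat[of "\<lambda>p. J p \<and> p \<noteq> \<zero>\<^bsub>UP RS\<^esub>" p "deg RS"] J_p p(2) by metis
    have kc: "k \<in> carrier (UP RS)" using k J_closed by blast
    define c where "c = U.lcoeff k"
    have c: "c \<in> S" "c \<noteq> \<zero>" using lc[OF kc] U.lcoeff_nonzero2[OF kc k(2)] RSz by (auto simp: c_def)
    have div_k: "\<exists>u\<in>carrier (UP RS). \<exists>m::nat. (c [^]\<^bsub>RS\<^esub> m) \<odot>\<^bsub>UP RS\<^esub> q = k \<otimes>\<^bsub>UP RS\<^esub> u" if q: "J q" for q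
    proof -
      have qc: "q \<in> carrier (UP RS)" using q J_closed by blast
      from U.long_div_theorem[OF kc qc k(2)] obtain u w m where u: "u \<in> carrier (UP RS)" "w \<in> carrier (UP RS)"
        "(c [^]\<^bsub>RS\<^esub> (m::nat)) \<odot>\<^bsub>UP RS\<^esub> q = k \<otimes>\<^bsub>UP RS\<^esub> u \<oplus>\<^bsub>UP RS\<^esub> w" "w = \<zero>\<^bsub>UP RS\<^esub> \<or> deg RS w < deg RS k"
        unfolding c_def by blast
      have cm: "c [^]\<^bsub>RS\<^esub> m \<in> S" using RS.nat_pow_closed[of c m] c RSc by simp
      have "(c [^]\<^bsub>RS\<^esub> m) \<odot>\<^bsub>UP RS\<^esub> q \<ominus>\<^bsub>UP RS\<^esub> k \<otimes>\<^bsub>UP RS\<^esub> u = w"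
        unfolding u(3) using u kc by algebra
      then have "J w" using J_comb[OF J_smult[OF q cm] k(1) u(1)] by simp
      then have "w = \<zero>\<^bsub>UP RS\<^esub>" using kmin[of w] u(4) by (meson not_le)
      then show ?thesis using u kc by auto
    qed
    have cpow: "c [^]\<^bsub>RS\<^esub> (m::nat) \<in> S" "c [^]\<^bsub>RS\<^esub> m \<noteq> \<zero>" for m
    proof -
      show cl: "c [^]\<^bsub>RS\<^esub> m \<in> S" for m :: nat using RS.nat_pow_closed[of c m] c RSc by simp
      show "c [^]\<^bsub>RS\<^esub> m \<noteq> \<zero>"
      proof (induction m)
        case (Suc m)
        then show ?case using RS.integral[of "c [^]\<^bsub>RS\<^esub> m" c] cl c RSc RSz by auto
      qed (use RS.one_not_zero RSz in simp)
    qed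
    \<comment> \<open>Suppose \<open>k\<close> had positive degree. Then c^m p = k w with w of
      smaller degree than \<open>p\<close>, so w is not a relation and \<open>k\<close> must be one.
      But \<open>k\<close> also divides a multiple c^m g, whose value at x is c^m r and is
      nonzero.\<close>
    have degk: "deg RS k = 0"
    proof (rule ccontr)
      assume dk: "deg RS k \<noteq> 0"
      obtain w m where w: "w \<in> carrier (UP RS)" "(c [^]\<^bsub>RS\<^esub> (m::nat)) \<odot>\<^bsub>UP RS\<^esub> p = k \<otimes>\<^bsub>UP RS\<^esub> w"
        using div_k[OF J_p] by blast
      have "ev k \<otimes> ev w = \<zero>"
        using arg_cong[OF w(2), of ev] w(1) pc kc cpow evp SL by (simp add: ev_smult ev_mult subsetD)
      then have kw: "ev k = \<zero> \<or> ev w = \<zero>" using L.integral ev_closed kc w by blast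
      have "deg RS p = deg RS ((c [^]\<^bsub>RS\<^esub> m) \<odot>\<^bsub>UP RS\<^esub> p)"
        using U.deg_smult[of "c [^]\<^bsub>RS\<^esub> m" p] cpow pc RSc RSz by auto
      moreover have wz: "w \<noteq> \<zero>\<^bsub>UP RS\<^esub>"
      proof
        assume "w = \<zero>\<^bsub>UP RS\<^esub>"
        then have "(c [^]\<^bsub>RS\<^esub> m) \<odot>\<^bsub>UP RS\<^esub> p = \<zero>\<^bsub>UP RS\<^esub>" using w kc by simp
        then have "up_ring.coeff (UP RS) ((c [^]\<^bsub>RS\<^esub> m) \<odot>\<^bsub>UP RS\<^esub> p) (deg RS p) = \<zero>\<^bsub>RS\<^esub>" by simp
        then have "c [^]\<^bsub>RS\<^esub> m \<otimes>\<^bsub>RS\<^esub> a = \<zero>\<^bsub>RS\<^esub>" using cpow pc RSc a_def by simp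
        then show False using RS.integral[of "c [^]\<^bsub>RS\<^esub> m" a] cpow a RSc RSz by auto
      qed
      ultimately have degs: "deg RS p = deg RS k + deg RS w"
        using w k kc U.deg_mult[of k w] by simp
      have "ev w \<noteq> \<zero>" using pmin[of w] w wz dk degs by (auto simp: rel_def)
      then have "ev k = \<zero>" using kw by blast
      obtain u m where u: "u \<in> carrier (UP RS)" "(c [^]\<^bsub>RS\<^esub> (m::nat)) \<odot>\<^bsub>UP RS\<^esub> g = k \<otimes>\<^bsub>UP RS\<^esub> u"
        using div_k[OF J_g] by blast
      have "c [^]\<^bsub>RS\<^esub> m \<otimes> r = \<zero>"
        using arg_cong[OF u(2), of ev] u(1) g kc cpow \<open>ev k = \<zero>\<close> ev_closed by (simp add: ev_smult ev_mult)
      then show False using L.integral[of "c [^]\<^bsub>RS\<^esub> m" r] cpow[of m] SL r(2) g ev_closed by auto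
    qed
    from k(1) obtain v u where vu: "v \<in> carrier (UP RS)" "u \<in> carrier (UP RS)"
      "k = v \<otimes>\<^bsub>UP RS\<^esub> g \<oplus>\<^bsub>UP RS\<^esub> u \<otimes>\<^bsub>UP RS\<^esub> p" unfolding J_def by blast
    have degp: "deg RS p > 0"
    proof (rule ccontr)
      assume "\<not> deg RS p > 0"
      then have "p = up_ring.monom (UP RS) a 0" using U.deg_zero_impl_monom[OF pc] by (simp add: a_def)
      then show False using ev_const[OF a(1)] evp a by simp
    qed
    \<comment> \<open>The required constant is a c. Nonvanishing of \<phi>(a) keeps the image of
      \<open>p\<close> nonconstant, so that it has a root \<xi>, and allows powers of a to be
      cancelled in a^m q = p u. Nonvanishing of \<phi>(c) keeps \<open>g\<close> nonzero at \<xi>,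
      since v g + u p = c.\<close>
    have "a \<otimes> c \<noteq> \<zero>" using L.integral[of a c] a c SL by auto
    moreover have "a \<otimes> c \<in> S" using subringE(6)[OF S] a c by blast
    moreover have "\<exists>\<xi>. (\<forall>q. rel q \<longrightarrow> UnivPoly.eval RS class_ring \<phi> \<xi> q = 0) \<and> UnivPoly.eval RS class_ring \<phi> \<xi> g \<noteq> 0"
      if \<phi>: "\<phi> \<in> Ring.ring_hom RS (class_ring :: 'k ring)" and nz: "\<phi> (a \<otimes> c) \<noteq> 0" for \<phi>
    proof -
      have "\<phi> (a \<otimes> c) = \<phi> a * \<phi> c" using ring_hom_mult[OF \<phi>, of a c] a c RSc by (simp add: RS_def)
      then have nz: "\<phi> a \<noteq> 0" "\<phi> c \<noteq> 0" using nz by auto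
      obtain \<xi> where \<xi>: "(\<Sum>i\<le>deg RS p. \<phi> (up_ring.coeff (UP RS) p i) * \<xi> ^ i) = 0"
        using alg_closed[of "deg RS p" "\<lambda>i. \<phi> (up_ring.coeff (UP RS) p i)"] degp nz(1) a_def by blast
      define ek where "ek = UnivPoly.eval RS (class_ring :: 'k ring) \<phi> \<xi>"
      interpret ek: ring_hom_cring "UP RS" "class_ring :: 'k ring" ek
        unfolding ek_def using hom[OF \<phi>] by blast
      interpret ek': UP_univ_prop RS "class_ring :: 'k ring" \<phi> "UP RS" \<xi> ek
        unfolding ek_def using hom[OF \<phi>] by simp
      have ekp: "ek p = 0" unfolding ek_def U.eval_class_ring[OF pc] by (rule \<xi>)
      have "ek q = 0" if q: "rel q" for q
      proof -
        have qc: "q \<in> carrier (UP RS)" using q by (simp add: rel_def)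
        obtain u m where u: "u \<in> carrier (UP RS)" "(a [^]\<^bsub>RS\<^esub> (m::nat)) \<odot>\<^bsub>UP RS\<^esub> q = p \<otimes>\<^bsub>UP RS\<^esub> u"
          using div_p[OF q] by blast
        have am: "a [^]\<^bsub>RS\<^esub> m \<in> carrier RS" using RS.nat_pow_closed[of a m] a RSc by simp
        have "\<phi> (a [^]\<^bsub>RS\<^esub> m) * ek q = ek p * ek u"
          using arg_cong[OF u(2), of ek] ek'.Eval_smult[OF am qc] ek.hom_mult[OF pc u(1)] by simp
        moreover have "\<phi> (a [^]\<^bsub>RS\<^esub> m) = \<phi> a ^ m"
          using ek'.hom_pow[of a m] a RSc by (simp add: class_ring_simps)
        ultimately show ?thesis using nz ekp by simp
      qed
      moreover have "ek g \<noteq> 0"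
      proof
        assume "ek g = 0"
        then have "ek k = 0" using vu g(1) pc ekp ek.hom_mult ek.hom_add by simp
        moreover have "k = up_ring.monom (UP RS) c 0" using U.deg_zero_impl_monom[OF kc degk] by (simp add: c_def degk)
        ultimately show False using ek'.eval_const[of \<xi> c] c RSc nz by (simp add: ek_def)
      qed
      ultimately show ?thesis unfolding ek_def by blast
    qed
    ultimately show ?thesis by blast
  qed
  then obtain t where t: "t \<in> S" "t \<noteq> \<zero>" and ext: "\<And>\<phi>. \<phi> \<in> Ring.ring_hom RS (class_ring :: 'k ring) \<Longrightarrow> \<phi> t \<noteq> 0 \<Longrightarrow>
     \<exists>\<xi>. (\<forall>q. rel q \<longrightarrow> UnivPoly.eval RS class_ring \<phi> \<xi> q = 0) \<and> UnivPoly.eval RS class_ring \<phi> \<xi> g \<noteq> 0" by blast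
  have "\<exists>\<xi>. (\<forall>q\<in>carrier (UP RS). ev q = \<zero> \<longrightarrow> UnivPoly.eval RS class_ring \<phi> \<xi> q = 0) \<and>
      (\<forall>g\<in>carrier (UP RS). ev g = r \<longrightarrow> UnivPoly.eval RS class_ring \<phi> \<xi> g \<noteq> 0)"
    if \<phi>: "\<phi> \<in> Ring.ring_hom RS (class_ring :: 'k ring)" and nz: "\<phi> t \<noteq> 0" for \<phi>
  proof -
    obtain \<xi> where \<xi>: "\<And>q. rel q \<Longrightarrow> UnivPoly.eval RS class_ring \<phi> \<xi> q = 0" "UnivPoly.eval RS class_ring \<phi> \<xi> g \<noteq> 0"
      using ext[OF \<phi> nz] by blast
    interpret ek: ring_hom_cring "UP RS" "class_ring :: 'k ring" "UnivPoly.eval RS class_ring \<phi> \<xi>"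
      using hom[OF \<phi>] by blast
    have "UnivPoly.eval RS class_ring \<phi> \<xi> h \<noteq> 0" if h: "h \<in> carrier (UP RS)" "ev h = r" for h
    proof -
      have "ev (h \<oplus>\<^bsub>UP RS\<^esub> \<ominus>\<^bsub>UP RS\<^esub> g) = \<zero>"
        using h g ev_closed eL.hom_a_inv[OF g(1)] ev_closed[OF g(1)] by (simp add: ev_add ev_def L.r_neg)
      then have "rel (h \<oplus>\<^bsub>UP RS\<^esub> \<ominus>\<^bsub>UP RS\<^esub> g)" using h g by (simp add: rel_def)
      then have "UnivPoly.eval RS class_ring \<phi> \<xi> (h \<oplus>\<^bsub>UP RS\<^esub> \<ominus>\<^bsub>UP RS\<^esub> g) = 0" by (rule \<xi>(1))
      then have "UnivPoly.eval RS class_ring \<phi> \<xi> h - UnivPoly.eval RS class_ring \<phi> \<xi> g = 0"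
        using h g ek.hom_add[of h "\<ominus>\<^bsub>UP RS\<^esub> g"] ek.hom_a_inv[OF g(1)] by (simp add: class_ring_simps)
      then show ?thesis using \<xi>(2) by simp
    qed
    then show ?thesis using \<xi> by (auto simp: rel_def)
  qed
  then show ?thesis using t unfolding ev_def RS_def by blast
qed

text \<open>\<open>S'\<close> is the ring S[x], and \<psi> evaluates polynomials at the \<xi> found
  before; it is well defined because every relation of x vanishes at \<xi>. The clause that
  \<open>r\<close> is not killed is what makes the statement composable: bare existence of
  extensions would give no control in the next step.\<close>

lemma extend_hom_adjoin:
  fixes L (structure)
  assumes "domain L" and S: "subring S L" and x: "x \<in> carrier L"
  obtains S' where "subring S' L" "S \<subseteq> S'" "x \<in> S'"
    "\<And>r. r \<in> S' \<Longrightarrow> r \<noteq> \<zero> \<Longrightarrow> \<exists>t\<in>S. t \<noteq> \<zero> \<and>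
      (\<forall>\<phi> \<in> Ring.ring_hom (subalg L S) (class_ring :: 'k::{alg_closed_field,field_char_0} ring). \<phi> t \<noteq> 0 \<longrightarrow>
        (\<exists>\<psi> \<in> Ring.ring_hom (subalg L S') (class_ring :: 'k ring). (\<forall>a\<in>S. \<psi> a = \<phi> a) \<and> \<psi> r \<noteq> 0))"
proof -
  interpret L: domain L by fact
  define RS where "RS = subalg L S"
  interpret RS: domain RS unfolding RS_def by (rule L.subring_is_domain[OF S])
  have SL: "S \<subseteq> carrier L" by (rule subringE(1)[OF S])
  interpret U: UP_domain RS "UP RS" by unfold_locales simp
  have id: "id \<in> Ring.ring_hom RS L" using SL by (auto simp: RS_def intro!: ring_hom_memI)
  define ev where "ev = UnivPoly.eval RS L id x"
  interpret eL: UP_univ_prop RS L id "UP RS" x ev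
    unfolding UP_univ_prop_def UP_univ_prop_axioms_def ev_def
    using UP_pre_univ_propI[OF RS.is_cring L.is_cring id] x by simp
  have evh: "ring_hom_ring (UP RS) L ev"
    by (rule ring_hom_ringI) (simp_all add: U.P.ring_axioms L.ring_axioms)
  define S' where "S' = ev ` carrier (UP RS)"
  have const: "ev (up_ring.monom (UP RS) c 0) = c" if "c \<in> S" for c
    unfolding ev_def using eL.eval_const[of x c] that x by (simp add: RS_def)
  have const_closed: "up_ring.monom (UP RS) c 0 \<in> carrier (UP RS)" if "c \<in> S" for c
    using that U.monom_closed[of c 0] by (simp add: RS_def)
  show ?thesis
  proof (rule that)
    show "subring S' L" unfolding S'_def by (rule ring_hom_ring.img_is_subring[OF evh U.P.carrier_is_subring])
    show "S \<subseteq> S'" unfolding S'_def using const const_closed by (metis image_eqI subsetI)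
    show "x \<in> S'" unfolding S'_def using eL.eval_monom1[OF x] U.monom_closed[OF RS.one_closed, of 1]
      by (metis ev_def image_eqI)
    fix r assume r: "r \<in> S'" "r \<noteq> \<zero>"
    then obtain t where t: "t \<in> S" "t \<noteq> \<zero>" and ext: "\<And>\<phi>. \<phi> \<in> Ring.ring_hom RS (class_ring :: 'k ring) \<Longrightarrow> \<phi> t \<noteq> 0 \<Longrightarrow>
        \<exists>\<xi>. (\<forall>q\<in>carrier (UP RS). ev q = \<zero> \<longrightarrow> UnivPoly.eval RS class_ring \<phi> \<xi> q = 0) \<and>
          (\<forall>g\<in>carrier (UP RS). ev g = r \<longrightarrow> UnivPoly.eval RS class_ring \<phi> \<xi> g \<noteq> 0)"
      using extend_hom_step[OF \<open>domain L\<close> S x, of r] unfolding S'_def ev_def RS_def by metis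
    have "\<exists>\<psi> \<in> Ring.ring_hom (subalg L S') (class_ring :: 'k ring). (\<forall>a\<in>S. \<psi> a = \<phi> a) \<and> \<psi> r \<noteq> 0"
      if \<phi>: "\<phi> \<in> Ring.ring_hom RS (class_ring :: 'k ring)" and nz: "\<phi> t \<noteq> 0" for \<phi>
    proof -
      obtain \<xi> where \<xi>: "\<And>q. q \<in> carrier (UP RS) \<Longrightarrow> ev q = \<zero> \<Longrightarrow> UnivPoly.eval RS class_ring \<phi> \<xi> q = 0"
          "\<And>g. g \<in> carrier (UP RS) \<Longrightarrow> ev g = r \<Longrightarrow> UnivPoly.eval RS class_ring \<phi> \<xi> g \<noteq> 0"
        using ext[OF \<phi> nz] by blast
      define ek where "ek = UnivPoly.eval RS (class_ring :: 'k ring) \<phi> \<xi>"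
      interpret ek: UP_univ_prop RS "class_ring :: 'k ring" \<phi> "UP RS" \<xi> ek
        unfolding UP_univ_prop_def UP_univ_prop_axioms_def ek_def
        using UP_pre_univ_propI[OF RS.is_cring class_cring.cring_axioms \<phi>] by simp
      have wd: "ek h = ek h'" if "h \<in> carrier (UP RS)" "h' \<in> carrier (UP RS)" "ev h = ev h'" for h h'
      proof -
        have "ev (h \<oplus>\<^bsub>UP RS\<^esub> \<ominus>\<^bsub>UP RS\<^esub> h') = \<zero>" using that by (simp add: L.r_neg)
        then have "ek (h \<oplus>\<^bsub>UP RS\<^esub> \<ominus>\<^bsub>UP RS\<^esub> h') = 0" using \<xi>(1) that unfolding ek_def by simp
        then have "ek h - ek h' = 0"
          using that ek.hom_add[of h "\<ominus>\<^bsub>UP RS\<^esub> h'"] ek.hom_a_inv[of h'] by (simp add: class_ring_simps)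
        then show ?thesis by simp
      qed
      define \<psi> where "\<psi> y = ek (SOME h. h \<in> carrier (UP RS) \<and> ev h = y)" for y
      have \<psi>: "\<psi> (ev h) = ek h" if "h \<in> carrier (UP RS)" for h
      proof -
        have "(SOME h'. h' \<in> carrier (UP RS) \<and> ev h' = ev h) \<in> carrier (UP RS) \<and>
            ev (SOME h'. h' \<in> carrier (UP RS) \<and> ev h' = ev h) = ev h"
          by (rule someI[of _ h]) (use that in simp)
        then show ?thesis unfolding \<psi>_def using that by (intro wd) auto
      qed
      have "\<psi> \<in> Ring.ring_hom (subalg L S') (class_ring :: 'k ring)"
      proof (rule ring_hom_memI)
        fix y z assume "y \<in> carrier (subalg L S')" "z \<in> carrier (subalg L S')"
        then obtain h h' where h: "h \<in> carrier (UP RS)" "y = ev h" "h' \<in> carrier (UP RS)" "z = ev h'"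
          by (auto simp: S'_def)
        show "\<psi> (y \<otimes>\<^bsub>subalg L S'\<^esub> z) = \<psi> y \<otimes>\<^bsub>class_ring\<^esub> \<psi> z"
          using \<psi>[of "h \<otimes>\<^bsub>UP RS\<^esub> h'"] h by (simp add: \<psi>)
        show "\<psi> (y \<oplus>\<^bsub>subalg L S'\<^esub> z) = \<psi> y \<oplus>\<^bsub>class_ring\<^esub> \<psi> z"
          using \<psi>[of "h \<oplus>\<^bsub>UP RS\<^esub> h'"] h by (simp add: \<psi>)
      next
        show "\<psi> \<one>\<^bsub>subalg L S'\<^esub> = \<one>\<^bsub>class_ring\<^esub>" using \<psi>[of "\<one>\<^bsub>UP RS\<^esub>"] by simp
      qed simp
      moreover have "\<psi> a = \<phi> a" if "a \<in> S" for a
        using \<psi>[OF const_closed[OF that]] const[OF that] ek.eval_const[of \<xi> a] that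
        by (simp add: ek_def RS_def)
      moreover have "\<psi> r \<noteq> 0" using r(1) \<psi> \<xi>(2) unfolding S'_def ek_def by auto
      ultimately show ?thesis by blast
    qed
    then show "\<exists>t\<in>S. t \<noteq> \<zero> \<and> (\<forall>\<phi> \<in> Ring.ring_hom (subalg L S) (class_ring :: 'k ring). \<phi> t \<noteq> 0 \<longrightarrow>
        (\<exists>\<psi> \<in> Ring.ring_hom (subalg L S') (class_ring :: 'k ring). (\<forall>a\<in>S. \<psi> a = \<phi> a) \<and> \<psi> r \<noteq> 0))"
      using t unfolding RS_def by blast
  qed
qed

text \<open>Adjoining one more generator translates the condition that \<open>r\<close> survives
  into one on an element \<open>t'\<close> of the intermediate ring, which the induction hypothesis
  translates further into one on S.\<close>

lemma extend_hom_finite: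
  fixes L (structure)
  assumes "domain L" and "finite Gs" "Gs \<subseteq> carrier L" and S: "subring S L"
  shows "\<exists>S'. subring S' L \<and> S \<subseteq> S' \<and> Gs \<subseteq> S' \<and>
    (\<forall>r\<in>S'. r \<noteq> \<zero> \<longrightarrow> (\<exists>t\<in>S. t \<noteq> \<zero> \<and>
      (\<forall>\<phi> \<in> Ring.ring_hom (subalg L S) (class_ring :: 'k::{alg_closed_field,field_char_0} ring). \<phi> t \<noteq> 0 \<longrightarrow>
        (\<exists>\<psi> \<in> Ring.ring_hom (subalg L S') (class_ring :: 'k ring). (\<forall>a\<in>S. \<psi> a = \<phi> a) \<and> \<psi> r \<noteq> 0))))"
  using assms(2,3)
proof (induction Gs rule: finite_induct)
  case empty
  show ?case using S by (intro exI[of _ S]) auto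
next
  case (insert x Gs)
  then obtain S' where S': "subring S' L" "S \<subseteq> S'" "Gs \<subseteq> S'" and ext: "\<And>r. r \<in> S' \<Longrightarrow> r \<noteq> \<zero> \<Longrightarrow> \<exists>t\<in>S. t \<noteq> \<zero> \<and>
      (\<forall>\<phi> \<in> Ring.ring_hom (subalg L S) (class_ring :: 'k ring). \<phi> t \<noteq> 0 \<longrightarrow>
        (\<exists>\<psi> \<in> Ring.ring_hom (subalg L S') (class_ring :: 'k ring). (\<forall>a\<in>S. \<psi> a = \<phi> a) \<and> \<psi> r \<noteq> 0))"
    by auto
  have "x \<in> carrier L" using insert by auto
  from extend_hom_adjoin[OF \<open>domain L\<close> S'(1) this, where 'k = 'k] obtain S'' where S'': "subring S'' L" "S' \<subseteq> S''" "x \<in> S''"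
    and ext': "\<And>r. r \<in> S'' \<Longrightarrow> r \<noteq> \<zero> \<Longrightarrow> \<exists>t\<in>S'. t \<noteq> \<zero> \<and>
      (\<forall>\<phi> \<in> Ring.ring_hom (subalg L S') (class_ring :: 'k ring). \<phi> t \<noteq> 0 \<longrightarrow>
        (\<exists>\<psi> \<in> Ring.ring_hom (subalg L S'') (class_ring :: 'k ring). (\<forall>a\<in>S'. \<psi> a = \<phi> a) \<and> \<psi> r \<noteq> 0))"
    by blast
  show ?case
  proof (intro exI[of _ S''] conjI ballI impI)
    fix r assume r: "r \<in> S''" "r \<noteq> \<zero>"
    obtain t' where t': "t' \<in> S'" "t' \<noteq> \<zero>" and e1: "\<And>\<phi>. \<phi> \<in> Ring.ring_hom (subalg L S') (class_ring :: 'k ring) \<Longrightarrow> \<phi> t' \<noteq> 0 \<Longrightarrow>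
        \<exists>\<psi> \<in> Ring.ring_hom (subalg L S'') (class_ring :: 'k ring). (\<forall>a\<in>S'. \<psi> a = \<phi> a) \<and> \<psi> r \<noteq> 0"
      using ext'[OF r] by blast
    obtain t where t: "t \<in> S" "t \<noteq> \<zero>" and e2: "\<And>\<phi>. \<phi> \<in> Ring.ring_hom (subalg L S) (class_ring :: 'k ring) \<Longrightarrow> \<phi> t \<noteq> 0 \<Longrightarrow>
        \<exists>\<psi> \<in> Ring.ring_hom (subalg L S') (class_ring :: 'k ring). (\<forall>a\<in>S. \<psi> a = \<phi> a) \<and> \<psi> t' \<noteq> 0"
      using ext[OF t'] by blast
    show "\<exists>t\<in>S. t \<noteq> \<zero> \<and> (\<forall>\<phi> \<in> Ring.ring_hom (subalg L S) (class_ring :: 'k ring). \<phi> t \<noteq> 0 \<longrightarrow>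
        (\<exists>\<psi> \<in> Ring.ring_hom (subalg L S'') (class_ring :: 'k ring). (\<forall>a\<in>S. \<psi> a = \<phi> a) \<and> \<psi> r \<noteq> 0))"
    proof (intro bexI[OF _ t(1)] conjI ballI impI t(2))
      fix \<phi> assume "\<phi> \<in> Ring.ring_hom (subalg L S) (class_ring :: 'k ring)" "\<phi> t \<noteq> 0"
      then obtain \<psi> where "\<psi> \<in> Ring.ring_hom (subalg L S') (class_ring :: 'k ring)" "\<forall>a\<in>S. \<psi> a = \<phi> a" "\<psi> t' \<noteq> 0"
        using e2 by blast
      moreover from this(1,3) obtain \<psi>' where "\<psi>' \<in> Ring.ring_hom (subalg L S'') (class_ring :: 'k ring)"
          "\<forall>a\<in>S'. \<psi>' a = \<psi> a" "\<psi>' r \<noteq> 0"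
        using e1 by blast
      ultimately show "\<exists>\<psi> \<in> Ring.ring_hom (subalg L S'') (class_ring :: 'k ring). (\<forall>a\<in>S. \<psi> a = \<phi> a) \<and> \<psi> r \<noteq> 0"
        using S'(2) by (intro bexI[of _ \<psi>']) auto
    qed
  qed (use S' S'' in auto)
qed

text \<open>The extension starts from the scalars k 1 with the homomorphism c 1 -> c and is asked
  not to kill 1. The condition obtained on k 1 concerns a nonzero scalar, so it holds. As the
  extension is prescribed on scalars, it is k-linear.\<close>

lemma character_of_affine_domain:
  fixes L :: "('k::{alg_closed_field,field_char_0}, 'a) module" (structure)
  assumes "k_algebra L" "domain L" and Gs: "finite Gs" "Gs \<subseteq> carrier L"
    and gen: "\<And>S. subring S L \<Longrightarrow> Gs \<subseteq> S \<Longrightarrow> range (\<lambda>c. c \<odot> \<one>) \<subseteq> S \<Longrightarrow> carrier L \<subseteq> S"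
  shows "\<exists>\<chi>. kalg.character L \<chi>"
proof -
  interpret kalg L using assms(1) by (rule kalgI)
  interpret L: domain L by fact
  define S where "S = range (\<lambda>c. c \<odot> \<one>)"
  have S: "subring S L"
  proof (rule subringI)
    show "S \<subseteq> carrier L" by (auto simp: S_def)
    show "\<one> \<in> S" unfolding S_def by (rule range_eqI[of _ _ 1]) simp
    fix y z assume "y \<in> S" "z \<in> S"
    then obtain c d where cd: "y = c \<odot> \<one>" "z = d \<odot> \<one>" by (auto simp: S_def)
    show "\<ominus> y \<in> S" unfolding S_def by (rule range_eqI[of _ _ "- c"]) (simp add: cd sm_minus)
    show "y \<oplus> z \<in> S" unfolding S_def by (rule range_eqI[of _ _ "c + d"]) (simp add: cd sm_l_distr)
    show "y \<otimes> z \<in> S" unfolding S_def by (rule range_eqI[of _ _ "c * d"]) (simp add: cd sm_mult_left sm_assoc)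
  qed
  have inj: "c = d" if "c \<odot> \<one> = d \<odot> \<one>" for c d
  proof (rule ccontr)
    assume "c \<noteq> d"
    have "(c - d) \<odot> \<one> = c \<odot> \<one> \<oplus> (- d) \<odot> \<one>" using sm_l_distr[of \<one> c "- d"] by simp
    also have "\<dots> = \<zero>" using that by (simp add: sm_minus r_neg)
    finally have "(c - d) \<odot> \<one> = (c - d) \<odot> \<zero>" by simp
    then show False using sm_cancel[of "c - d" \<one> \<zero>] \<open>c \<noteq> d\<close> by simp
  qed
  define \<phi> where "\<phi> y = (THE c. y = c \<odot> \<one>)" for y
  have \<phi>: "\<phi> (c \<odot> \<one>) = c" for c unfolding \<phi>_def by (rule the_equality) (auto dest: inj)
  have \<phi>hom: "\<phi> \<in> Ring.ring_hom (subalg L S) (class_ring :: 'k ring)"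
  proof (rule ring_hom_memI)
    fix y z assume "y \<in> carrier (subalg L S)" "z \<in> carrier (subalg L S)"
    then obtain c d where cd: "y = c \<odot> \<one>" "z = d \<odot> \<one>" by (auto simp: S_def)
    show "\<phi> (y \<otimes>\<^bsub>subalg L S\<^esub> z) = \<phi> y \<otimes>\<^bsub>class_ring\<^esub> \<phi> z"
      using \<phi>[of "c * d"] by (simp add: cd \<phi> sm_mult_left sm_assoc)
    show "\<phi> (y \<oplus>\<^bsub>subalg L S\<^esub> z) = \<phi> y \<oplus>\<^bsub>class_ring\<^esub> \<phi> z"
      using \<phi>[of "c + d"] by (simp add: cd \<phi> sm_l_distr)
  qed (use \<phi>[of 1] in simp_all)
  obtain S' where S'': "subring S' L \<and> S \<subseteq> S' \<and> Gs \<subseteq> S' \<and> (\<forall>r\<in>S'. r \<noteq> \<zero> \<longrightarrow> (\<exists>t\<in>S. t \<noteq> \<zero> \<and>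
      (\<forall>\<phi> \<in> Ring.ring_hom (subalg L S) (class_ring :: 'k ring). \<phi> t \<noteq> 0 \<longrightarrow>
        (\<exists>\<psi> \<in> Ring.ring_hom (subalg L S') (class_ring :: 'k ring). (\<forall>a\<in>S. \<psi> a = \<phi> a) \<and> \<psi> r \<noteq> 0))))"
    using extend_hom_finite[OF \<open>domain L\<close> Gs S, where 'k = 'k] by (rule exE)
  note S' = S''[THEN conjunct1] S''[THEN conjunct2, THEN conjunct1] S''[THEN conjunct2, THEN conjunct2, THEN conjunct1]
  note ext = S''[THEN conjunct2, THEN conjunct2, THEN conjunct2, rule_format]
  have S'L: "S' = carrier L" using gen[OF S'(1) S'(3)] S'(2) subringE(1)[OF S'(1)] by (auto simp: S_def)
  obtain t where t: "t \<in> S" "t \<noteq> \<zero>" "\<forall>\<phi> \<in> Ring.ring_hom (subalg L S) (class_ring :: 'k ring). \<phi> t \<noteq> 0 \<longrightarrow>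
        (\<exists>\<psi> \<in> Ring.ring_hom (subalg L S') (class_ring :: 'k ring). (\<forall>a\<in>S. \<psi> a = \<phi> a) \<and> \<psi> \<one> \<noteq> 0)"
    using ext[of \<one>] S'L by auto
  from t(1) obtain c where c: "t = c \<odot> \<one>" by (auto simp: S_def)
  then have "\<phi> t \<noteq> 0" using t(2) \<phi>[of c] by auto
  then obtain \<psi> where \<psi>: "\<psi> \<in> Ring.ring_hom (subalg L S') (class_ring :: 'k ring)" "\<forall>a\<in>S. \<psi> a = \<phi> a"
    using t(3) \<phi>hom by blast
  have mult: "\<psi> (y \<otimes> z) = \<psi> y * \<psi> z" if "y \<in> carrier L" "z \<in> carrier L" for y z
    using ring_hom_mult[OF \<psi>(1), of y z] that S'L by simp
  have "\<psi> (d \<odot> y) = d * \<psi> y" if "y \<in> carrier L" for d y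
  proof -
    have "d \<odot> \<one> \<in> S" by (simp add: S_def)
    then have "\<psi> (d \<odot> \<one>) = d" using \<psi>(2) \<phi> by auto
    then show ?thesis using mult[of "d \<odot> \<one>" y] that by (simp add: sm_one_mult)
  qed
  then have "character \<psi>"
    unfolding character_def linear_fun_def
    using ring_hom_add[OF \<psi>(1)] ring_hom_one[OF \<psi>(1)] mult S'L by auto
  then show ?thesis by blast
qed

text \<open>The quotient by \<open>m\<close> enters as a domain generated by finitely many elements
  over the scalars. A character of it pulls back to a character of D whose kernel is a proper ideal
  containing \<open>m\<close>, hence equal to \<open>m\<close>.\<close>

theorem maximal_ideal_is_kernel:
  fixes D :: "('k::{alg_closed_field,field_char_0}, 'a) module" (structure)
  assumes "k_algebra D" "cring D" "affine_algebra D" and m: "maximalideal m D"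
  shows "\<exists>\<chi>. kalg.character D \<chi> \<and> m = {x \<in> carrier D. \<chi> x = 0}"
proof -
  interpret D: kalg D using assms(1) by (rule kalgI)
  interpret Dc: cring D by fact
  interpret m: maximalideal m D by fact
  interpret kalg_ideal D m by unfold_locales
  interpret Q: kalg Q by (rule kalgI) (rule quot_k_algebra)
  have prime: "primeideal m D" using Dc.maximalideal_prime[OF m] .
  interpret p: primeideal m D by fact
  have "cring Q"
    by (rule cring.intro[OF Q.ring_axioms], unfold_locales)
      (elim quot_cases, simp add: coset_mult Dc.m_comm)
  then have dom: "domain Q"
  proof (rule domain.intro, unfold_locales)
    show "\<one>\<^bsub>Q\<^esub> \<noteq> \<zero>\<^bsub>Q\<^esub>"
      using coset_eq_zero_iff[of \<one>] m.I_notcarr m.one_imp_carrier by (auto simp: coset_one)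
    fix C E assume CE: "C \<otimes>\<^bsub>Q\<^esub> E = \<zero>\<^bsub>Q\<^esub>" "C \<in> carrier Q" "E \<in> carrier Q"
    obtain x y where xy: "x \<in> carrier D" "C = m +> x" "y \<in> carrier D" "E = m +> y"
      using CE(2,3) by (elim quot_cases)
    then have "x \<otimes> y \<in> m" using CE(1) coset_eq_zero_iff[of "x \<otimes> y"] by (simp add: coset_mult)
    then have "x \<in> m \<or> y \<in> m" using xy p.I_prime by blast
    then show "C = \<zero>\<^bsub>Q\<^esub> \<or> E = \<zero>\<^bsub>Q\<^esub>" using xy coset_eq_zero_iff by simp
  qed
  from \<open>affine_algebra D\<close> obtain Gs where Gs: "finite Gs" "Gs \<subseteq> carrier D"
    "generate_ring D (Gs \<union> range (\<lambda>c. c \<odot> \<one>)) = carrier D"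
    unfolding affine_algebra_def by blast
  let ?\<pi> = "\<lambda>x. m +> x"
  have "\<exists>\<chi>. Q.character \<chi>"
  proof (rule character_of_affine_domain[OF quot_k_algebra dom])
    show "finite (?\<pi> ` Gs)" using Gs by simp
    show "?\<pi> ` Gs \<subseteq> carrier Q" using Gs by (auto intro!: coset_closed)
    fix S assume S: "subring S Q" "?\<pi> ` Gs \<subseteq> S" "range (\<lambda>c. c \<odot>\<^bsub>Q\<^esub> \<one>\<^bsub>Q\<^esub>) \<subseteq> S"
    have "?\<pi> y \<in> S" if "y \<in> generate_ring D (Gs \<union> range (\<lambda>c. c \<odot> \<one>))" for y
      using that
    proof induction
      case one
      then show ?case using subringE(3)[OF S(1)] by (simp add: coset_one)
    next
      case (incl h)
      then show ?case
      proof
        assume "h \<in> range (\<lambda>c. c \<odot> \<one>)"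
        then obtain c where "h = c \<odot> \<one>" by auto
        then have "?\<pi> h = c \<odot>\<^bsub>Q\<^esub> \<one>\<^bsub>Q\<^esub>" by (simp add: coset_one sm_coset)
        then show ?thesis using S(3) by auto
      qed (use S in auto)
    next
      case (a_inv h)
      then have h: "h \<in> carrier D" using Gs(3) by auto
      have "?\<pi> (\<ominus> h) = \<ominus>\<^bsub>Q\<^esub> ?\<pi> h"
        using h by (intro Q.minus_equality[symmetric]) (auto simp: coset_add coset_closed coset_zero D.l_neg)
      then show ?case using subringE(5)[OF S(1)] a_inv by simp
    next
      case (eng_add h1 h2)
      then have "h1 \<in> carrier D" "h2 \<in> carrier D" using Gs(3) by auto
      then show ?case using subringE(7)[OF S(1)] eng_add by (simp add: coset_add[symmetric])
    next
      case (eng_mult h1 h2)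
      then have "h1 \<in> carrier D" "h2 \<in> carrier D" using Gs(3) by auto
      then show ?case using subringE(6)[OF S(1)] eng_mult by (simp add: coset_mult[symmetric])
    qed
    then show "carrier Q \<subseteq> S" using Gs(3) by (auto elim!: quot_cases)
  qed
  then obtain \<psi> where \<psi>: "Q.character \<psi>" by blast
  define \<chi> where "\<chi> x = \<psi> (?\<pi> x)" for x
  have hom: "alg_hom D Q ?\<pi>"
    by (rule alg_homI) (simp_all add: coset_closed coset_add coset_mult coset_one sm_coset)
  have \<chi>: "D.character \<chi>" unfolding \<chi>_def by (rule Q.character_alg_hom[OF \<psi> hom assms(1)])
  note \<chi>D = D.characterD[OF \<chi>]
  let ?K = "{x \<in> carrier D. \<chi> x = 0}"
  have "ideal ?K D" by (rule D.ideal_criterion) (auto simp: \<chi>D)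
  moreover have "m \<subseteq> ?K"
  proof
    fix x assume x: "x \<in> m"
    then have "?\<pi> x = \<zero>\<^bsub>Q\<^esub>" using coset_eq_zero_iff m.Icarr by blast
    then show "x \<in> ?K" using x m.Icarr Q.characterD(5)[OF \<psi>] by (simp add: \<chi>_def)
  qed
  moreover have "?K \<noteq> carrier D" using \<chi>D(4) by force
  ultimately have "m = ?K" using m.I_maximal[of ?K] by auto
  then show ?thesis using \<chi> by blast
qed

section \<open>Cyclic and irreducible modules\<close>

definition left_ideal :: "('u, 'z) ring_scheme \<Rightarrow> 'u set \<Rightarrow> bool" where
  "left_ideal U L \<longleftrightarrow> L \<subseteq> carrier U \<and> \<zero>\<^bsub>U\<^esub> \<in> L \<and> (\<forall>x\<in>L. \<forall>y\<in>L. x \<oplus>\<^bsub>U\<^esub> y \<in> L) \<and>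
     (\<forall>a\<in>carrier U. \<forall>x\<in>L. a \<otimes>\<^bsub>U\<^esub> x \<in> L)"

lemma maximal_left_ideal_exists:
  assumes L0: "left_ideal U L0" "\<one>\<^bsub>U\<^esub> \<notin> L0"
  obtains L where "left_ideal U L" "L0 \<subseteq> L" "\<one>\<^bsub>U\<^esub> \<notin> L"
    "\<And>L'. left_ideal U L' \<Longrightarrow> L \<subseteq> L' \<Longrightarrow> \<one>\<^bsub>U\<^esub> \<notin> L' \<Longrightarrow> L' = L"
proof -
  let ?A = "{L. left_ideal U L \<and> L0 \<subseteq> L \<and> \<one>\<^bsub>U\<^esub> \<notin> L}"
  have "\<exists>M\<in>?A. \<forall>N\<in>?A. M \<subseteq> N \<longrightarrow> N = M"
  proof (rule subset_Zorn_nonempty)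
    show "?A \<noteq> {}" using L0 by auto
    fix C assume C: "C \<noteq> {}" "subset.chain ?A C"
    have "left_ideal U (\<Union>C)"
      unfolding left_ideal_def
    proof (intro conjI ballI)
      fix x y assume "x \<in> \<Union>C" "y \<in> \<Union>C"
      then obtain M N where MN: "M \<in> C" "N \<in> C" "x \<in> M" "y \<in> N" by auto
      then have "M \<subseteq> N \<or> N \<subseteq> M" using C(2) by (auto simp: subset_chain_def)
      then obtain K where "K \<in> C" "x \<in> K" "y \<in> K" using MN by auto
      moreover have "left_ideal U K" using C(2) \<open>K \<in> C\<close> by (auto simp: subset_chain_def)
      ultimately show "x \<oplus>\<^bsub>U\<^esub> y \<in> \<Union>C" by (auto simp: left_ideal_def)
    next
      fix a x assume "a \<in> carrier U" "x \<in> \<Union>C"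
      then obtain K where "K \<in> C" "x \<in> K" by auto
      moreover have "left_ideal U K" using C(2) \<open>K \<in> C\<close> by (auto simp: subset_chain_def)
      ultimately have "a \<otimes>\<^bsub>U\<^esub> x \<in> K" using \<open>a \<in> carrier U\<close> by (auto simp: left_ideal_def)
      then show "a \<otimes>\<^bsub>U\<^esub> x \<in> \<Union>C" using \<open>K \<in> C\<close> by auto
    qed (use C in \<open>auto simp: subset_chain_def left_ideal_def\<close>)
    then show "\<Union>C \<in> ?A" using C by (auto simp: subset_chain_def)
  qed
  then obtain M where M: "M \<in> ?A" "\<forall>N\<in>?A. M \<subseteq> N \<longrightarrow> N = M" by blast
  show ?thesis
  proof (rule that[of M])
    fix L' assume "left_ideal U L'" "M \<subseteq> L'" "\<one>\<^bsub>U\<^esub> \<notin> L'"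
    then show "L' = M" using M by auto
  qed (use M(1) in auto)
qed

text \<open>The module U/L. The entries for multiplication and unit only fill the record. The scalar
  multiple is a union over representatives, which all give the same coset because \<open>L\<close>
  absorbs left multiplication.\<close>

definition quot_mod :: "('u, 'z) ring_scheme \<Rightarrow> 'u set \<Rightarrow> ('u, 'u set) module" where
  "quot_mod U L = \<lparr>carrier = a_rcosets\<^bsub>U\<^esub> L, monoid.mult = (\<lambda>_ _. L), one = L,
     ring.zero = L, add = set_add U, smult = (\<lambda>a C. \<Union>x\<in>C. L +>\<^bsub>U\<^esub> (a \<otimes>\<^bsub>U\<^esub> x))\<rparr>"

locale left_quotient = ring U for U (structure) + fixes L assumes L: "left_ideal U L"
begin

abbreviation "T \<equiv> quot_mod U L"

lemma LD: "L \<subseteq> carrier U" "\<zero> \<in> L" "x \<in> L \<Longrightarrow> y \<in> L \<Longrightarrow> x \<oplus> y \<in> L"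
  "a \<in> carrier U \<Longrightarrow> x \<in> L \<Longrightarrow> a \<otimes> x \<in> L"
  using L by (auto simp: left_ideal_def)

lemma L_minus: "x \<in> L \<Longrightarrow> \<ominus> x \<in> L"
  using LD(4)[of "\<ominus> \<one>" x] LD(1) by (auto simp: l_minus)

sublocale S: abelian_subgroup L U
proof (rule abelian_subgroupI3)
  show "additive_subgroup L U"
    unfolding additive_subgroup_def
    by (rule add.subgroupI) (use LD L_minus in \<open>auto simp: a_inv_def\<close>)
  show "abelian_group U" by unfold_locales
qed

lemma cos_eq_iff: "x \<in> carrier U \<Longrightarrow> y \<in> carrier U \<Longrightarrow> L +> x = L +> y \<longleftrightarrow> x \<ominus> y \<in> L"
proof
  assume xy: "x \<in> carrier U" "y \<in> carrier U"
  { assume "L +> x = L +> y"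
    then have "x \<in> L +> y" using xy S.a_rcos_self by blast
    then show "x \<ominus> y \<in> L" using xy S.a_rcos_module_imp by (simp add: a_minus_def) }
  assume "x \<ominus> y \<in> L"
  then have "x \<in> L +> y" using xy S.a_rcos_module_rev[of y x] by (simp add: a_minus_def)
  then show "L +> x = L +> y" using xy S.a_repr_independence' by blast
qed

lemma T_cases: "C \<in> carrier T \<Longrightarrow> (\<And>x. x \<in> carrier U \<Longrightarrow> C = L +> x \<Longrightarrow> P) \<Longrightarrow> P"
  by (auto simp: quot_mod_def A_RCOSETS_def')

lemma cos_closed: "x \<in> carrier U \<Longrightarrow> L +> x \<in> carrier T"
  by (auto simp: quot_mod_def A_RCOSETS_def')

lemma cos_add: "x \<in> carrier U \<Longrightarrow> y \<in> carrier U \<Longrightarrow> (L +> x) \<oplus>\<^bsub>T\<^esub> (L +> y) = L +> (x \<oplus> y)"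
  by (simp add: quot_mod_def S.a_rcos_sum)

lemma cos_zero: "\<zero>\<^bsub>T\<^esub> = L +> \<zero>"
  using S.a_rcos_const[OF LD(2)] by (simp add: quot_mod_def)

lemma cos_smult:
  assumes a: "a \<in> carrier U" and x: "x \<in> carrier U"
  shows "a \<odot>\<^bsub>T\<^esub> (L +> x) = L +> (a \<otimes> x)"
proof -
  have "L +> (a \<otimes> y) = L +> (a \<otimes> x)" if "y \<in> L +> x" for y
  proof -
    have y: "y \<in> carrier U" using that x S.a_elemrcos_carrier by blast
    have "y \<ominus> x \<in> L" using that x y S.a_rcos_module_imp by (simp add: a_minus_def)
    then have "a \<otimes> (y \<ominus> x) \<in> L" using a by (rule LD(4)[rotated])
    then show ?thesis using a x y by (simp add: cos_eq_iff a_minus_def r_distr r_minus)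
  qed
  moreover have "x \<in> L +> x" using x by (rule S.a_rcos_self)
  ultimately have "(\<Union>y\<in>L +> x. L +> (a \<otimes> y)) = L +> (a \<otimes> x)"
    by (metis (no_types, lifting) SUP_eq_const empty_iff)
  then show ?thesis by (simp add: quot_mod_def)
qed

lemma T_left_module: "left_module U T"
proof (intro left_module.intro left_module_axioms.intro)
  show "abelian_group T"
  proof (rule abelian_groupI)
    fix C assume "C \<in> carrier T"
    then obtain x where x: "x \<in> carrier U" "C = L +> x" by (rule T_cases)
    then show "\<exists>D\<in>carrier T. D \<oplus>\<^bsub>T\<^esub> C = \<zero>\<^bsub>T\<^esub>"
      by (intro bexI[of _ "L +> (\<ominus> x)"]) (simp_all add: cos_add cos_zero cos_closed l_neg)
  next
    show "\<zero>\<^bsub>T\<^esub> \<in> carrier T" by (simp add: cos_zero cos_closed)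
  qed (elim T_cases, simp add: cos_add cos_closed cos_zero a_ac l_zero; fail)+
  show "ring U" by (rule ring_axioms)
qed (elim T_cases, simp add: cos_add cos_closed cos_smult l_distr r_distr m_assoc; fail)+

lemma cos_eq_zero_iff: "x \<in> carrier U \<Longrightarrow> L +> x = \<zero>\<^bsub>T\<^esub> \<longleftrightarrow> x \<in> L"
  by (simp add: cos_zero cos_eq_iff a_minus_def)

lemma T_generator: "t \<in> carrier T \<Longrightarrow> \<exists>u\<in>carrier U. t = u \<odot>\<^bsub>T\<^esub> (L +> \<one>)"
  by (elim T_cases) (auto simp: cos_smult)

text \<open>The elements whose coset lies in a submodule form a left ideal above \<open>L\<close>.
  If it contains 1, the submodule contains the generator and is everything; otherwise maximality
  makes it \<open>L\<close>, and the submodule is zero.\<close>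

lemma T_irreducible:
  assumes one: "\<one> \<notin> L" and max: "\<And>L'. left_ideal U L' \<Longrightarrow> L \<subseteq> L' \<Longrightarrow> \<one> \<notin> L' \<Longrightarrow> L' = L"
  shows "irreducible_module U T"
  unfolding irreducible_module_def
proof (intro conjI allI impI T_left_module)
  show "carrier T \<noteq> {\<zero>\<^bsub>T\<^esub>}" using cos_closed[of \<one>] cos_eq_zero_iff[of \<one>] one by auto
  fix N assume N: "left_submodule U N T"
  interpret T: left_module U T by (rule T_left_module)
  interpret N: additive_subgroup N T using N by (simp add: left_submodule_def)
  let ?L = "{x \<in> carrier U. L +> x \<in> N}"
  have Nsm: "a \<odot>\<^bsub>T\<^esub> x \<in> N" if "a \<in> carrier U" "x \<in> N" for a x using N that by (simp add: left_submodule_def)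
  have L': "left_ideal U ?L"
    unfolding left_ideal_def
  proof (intro conjI ballI)
    show "\<zero> \<in> ?L" using N.zero_closed by (simp add: cos_zero)
    fix x y assume "x \<in> ?L" "y \<in> ?L"
    then show "x \<oplus> y \<in> ?L" using N.a_closed[of "L +> x" "L +> y"] by (simp add: cos_add)
  next
    fix a x assume "a \<in> carrier U" "x \<in> ?L"
    then show "a \<otimes> x \<in> ?L" using Nsm[of a "L +> x"] by (simp add: cos_smult)
  qed auto
  have sub: "L \<subseteq> ?L"
  proof
    fix x assume "x \<in> L"
    moreover then have "x \<in> carrier U" using LD(1) by auto
    ultimately show "x \<in> ?L" using cos_eq_zero_iff[of x] N.zero_closed by simp
  qed
  show "N = {\<zero>\<^bsub>T\<^esub>} \<or> N = carrier T"
  proof (cases "\<one> \<in> ?L")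
    case True
    have "carrier T \<subseteq> N"
    proof
      fix t assume "t \<in> carrier T"
      then obtain u where "u \<in> carrier U" "t = u \<odot>\<^bsub>T\<^esub> (L +> \<one>)" using T_generator by blast
      then show "t \<in> N" using True Nsm by simp
    qed
    then show ?thesis using N.a_subset by auto
  next
    case False
    then have "?L = L" using max[OF L' sub] by simp
    then have "t = \<zero>\<^bsub>T\<^esub>" if "t \<in> N" for t
    proof -
      obtain x where x: "x \<in> carrier U" "t = L +> x" using \<open>t \<in> N\<close> N.a_subset by (blast elim: T_cases)
      then have "x \<in> ?L" using that by simp
      then have "x \<in> L" using \<open>?L = L\<close> by blast
      then show ?thesis using x cos_eq_zero_iff by simp
    qed
    then show ?thesis using N.zero_closed by blast
  qed
qed

end

lemma left_module_restrict:
  assumes M: "left_module U M" and \<Gamma>: "ring \<Gamma>" and f: "f \<in> Ring.ring_hom \<Gamma> U"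
  shows "left_module \<Gamma> (restrict_scalars f M)"
proof -
  interpret M: left_module U M by fact
  note h = ring_hom_closed[OF f] ring_hom_add[OF f] ring_hom_mult[OF f] ring_hom_one[OF f]
  have "abelian_group (restrict_scalars f M)"
  proof (rule abelian_groupI)
    fix x assume "x \<in> carrier (restrict_scalars f M)"
    then show "\<exists>y\<in>carrier (restrict_scalars f M). y \<oplus>\<^bsub>restrict_scalars f M\<^esub> x = \<zero>\<^bsub>restrict_scalars f M\<^esub>"
      by (intro bexI[of _ "\<ominus>\<^bsub>M\<^esub> x"]) (auto simp: restrict_scalars_def M.M.l_neg)
  qed (auto simp: restrict_scalars_def M.M.a_ac)
  then show ?thesis
    by (intro left_module.intro left_module_axioms.intro \<Gamma>)
      (simp_all add: restrict_scalars_def h M.smult_closed M.smult_l_distr M.smult_r_distr M.smult_assoc M.smult_one)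
qed

context left_module
begin

lemma smult_zero_right: "a \<in> carrier R \<Longrightarrow> a \<odot>\<^bsub>M\<^esub> \<zero>\<^bsub>M\<^esub> = \<zero>\<^bsub>M\<^esub>"
  using smult_r_distr[of a "\<zero>\<^bsub>M\<^esub>" "\<zero>\<^bsub>M\<^esub>"] smult_closed[of a "\<zero>\<^bsub>M\<^esub>"] M.add.l_cancel_one'[of "a \<odot>\<^bsub>M\<^esub> \<zero>\<^bsub>M\<^esub>" "a \<odot>\<^bsub>M\<^esub> \<zero>\<^bsub>M\<^esub>"]
  by simp

lemma smult_zero_left: "x \<in> carrier M \<Longrightarrow> \<zero>\<^bsub>R\<^esub> \<odot>\<^bsub>M\<^esub> x = \<zero>\<^bsub>M\<^esub>"
  using smult_l_distr[of "\<zero>\<^bsub>R\<^esub>" "\<zero>\<^bsub>R\<^esub>" x] smult_closed[of "\<zero>\<^bsub>R\<^esub>" x] M.add.l_cancel_one'[of "\<zero>\<^bsub>R\<^esub> \<odot>\<^bsub>M\<^esub> x" "\<zero>\<^bsub>R\<^esub> \<odot>\<^bsub>M\<^esub> x"]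
  by simp

lemma smult_minus_right: "a \<in> carrier R \<Longrightarrow> x \<in> carrier M \<Longrightarrow> a \<odot>\<^bsub>M\<^esub> (\<ominus>\<^bsub>M\<^esub> x) = \<ominus>\<^bsub>M\<^esub> (a \<odot>\<^bsub>M\<^esub> x)"
  using smult_r_distr[of a "\<ominus>\<^bsub>M\<^esub> x" x] smult_closed
  by (intro M.minus_equality[symmetric]) (simp_all add: M.l_neg smult_zero_right)

lemma smult_minus_left: "a \<in> carrier R \<Longrightarrow> x \<in> carrier M \<Longrightarrow> (\<ominus>\<^bsub>R\<^esub> a) \<odot>\<^bsub>M\<^esub> x = \<ominus>\<^bsub>M\<^esub> (a \<odot>\<^bsub>M\<^esub> x)"
  using smult_l_distr[of "\<ominus>\<^bsub>R\<^esub> a" a x] smult_closed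
  by (intro M.minus_equality[symmetric]) (simp_all add: R.l_neg smult_zero_left)

lemma smult_finsum:
  assumes "finite F" "a \<in> carrier R" "f \<in> F \<rightarrow> carrier M"
  shows "a \<odot>\<^bsub>M\<^esub> (\<Oplus>\<^bsub>M\<^esub>i\<in>F. f i) = (\<Oplus>\<^bsub>M\<^esub>i\<in>F. a \<odot>\<^bsub>M\<^esub> f i)"
  using assms
proof (induction F rule: finite_induct)
  case (insert i F)
  then show ?case
    by (subst (1 2) M.finsum_insert) (auto simp: smult_r_distr Pi_def intro!: smult_closed M.finsum_closed)
qed (simp add: smult_zero_right)

end

section \<open>Generalized weight spaces\<close>

lemma (in ring) ideal_power_ideal: "ideal I R \<Longrightarrow> ideal (ideal_power R I N) R"
proof (induction N)
  case 0
  then show ?case by (simp add: ideal_power_def oneideal)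
next
  case (Suc N)
  then show ?case using ideal_prod_is_ideal[of I "ideal_power R I N"] by (simp add: ideal_power_def)
qed

lemma (in ring) ideal_power_Suc: "ideal_power R I (Suc N) = ideal_prod R I (ideal_power R I N)"
  by (simp add: ideal_power_def)

lemma (in ring) ideal_power_antimono:
  assumes I: "ideal I R" and "N \<le> N'" shows "ideal_power R I N' \<subseteq> ideal_power R I N"
  using assms(2)
proof (induction rule: dec_induct)
  case (step k)
  then show ?case
    using ideal_prod_inter[OF I ideal_power_ideal[OF I, of k]] by (auto simp: ideal_power_Suc)
qed simp

lemma (in ring) ideal_power_1_subset: "ideal I R \<Longrightarrow> ideal_power R I 1 \<subseteq> I"
  using ideal_prod_inter[OF _ oneideal, of I] ideal_power_Suc[of I 0] by (simp add: ideal_power_def One_nat_def)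

lemma (in ring) pow_in_ideal_power: "ideal I R \<Longrightarrow> x \<in> I \<Longrightarrow> x [^] (N::nat) \<in> ideal_power R I N"
proof (induction N)
  case 0
  then show ?case by (simp add: ideal_power_def)
next
  case (Suc N)
  then have "x \<in> carrier R" by (meson ideal.Icarr)
  then have "x [^] Suc N = x \<otimes> x [^] N" by (rule nat_pow_Suc2)
  then show ?case using Suc by (simp add: ideal_power_Suc ideal_prod.prod)
qed

section \<open>Generalized weight spaces over a commutative ring: independence and direct
  sums\<close>

locale comm_left_module = left_module R M + cring R for R :: "('u, 'z) ring_scheme" (structure) and M :: "('u, 'm) module"
begin

abbreviation gws where "gws \<equiv> generalized_weight_space R M"

lemma gws_sub: "gws \<nn> \<subseteq> carrier M"
  by (auto simp: generalized_weight_space_def)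

lemma gws_closed:
  assumes "ideal \<nn> R"
  shows "\<zero>\<^bsub>M\<^esub> \<in> gws \<nn>" "x \<in> gws \<nn> \<Longrightarrow> y \<in> gws \<nn> \<Longrightarrow> x \<oplus>\<^bsub>M\<^esub> y \<in> gws \<nn>"
    "a \<in> carrier R \<Longrightarrow> x \<in> gws \<nn> \<Longrightarrow> a \<odot>\<^bsub>M\<^esub> x \<in> gws \<nn>" "x \<in> gws \<nn> \<Longrightarrow> \<ominus>\<^bsub>M\<^esub> x \<in> gws \<nn>"
proof -
  have P: "ideal (ideal_power R \<nn> N) R" for N using assms by (rule ideal_power_ideal)
  note car = ideal.Icarr[OF P]
  show "\<zero>\<^bsub>M\<^esub> \<in> gws \<nn>" using car by (auto simp: generalized_weight_space_def smult_zero_right)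
  show "x \<oplus>\<^bsub>M\<^esub> y \<in> gws \<nn>" if xy: "x \<in> gws \<nn>" "y \<in> gws \<nn>"
  proof -
    obtain N N' where N: "x \<in> carrier M" "y \<in> carrier M" "N > 0" "N' > 0"
      "\<forall>c\<in>ideal_power R \<nn> N. c \<odot>\<^bsub>M\<^esub> x = \<zero>\<^bsub>M\<^esub>" "\<forall>c\<in>ideal_power R \<nn> N'. c \<odot>\<^bsub>M\<^esub> y = \<zero>\<^bsub>M\<^esub>"
      using xy by (auto simp: generalized_weight_space_def)
    have "\<forall>c\<in>ideal_power R \<nn> (max N N'). c \<odot>\<^bsub>M\<^esub> (x \<oplus>\<^bsub>M\<^esub> y) = \<zero>\<^bsub>M\<^esub>"
    proof
      fix c assume c: "c \<in> ideal_power R \<nn> (max N N')"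
      then have "c \<in> ideal_power R \<nn> N" "c \<in> ideal_power R \<nn> N'"
        using ideal_power_antimono[OF assms, of N "max N N'"] ideal_power_antimono[OF assms, of N' "max N N'"] by auto
      then show "c \<odot>\<^bsub>M\<^esub> (x \<oplus>\<^bsub>M\<^esub> y) = \<zero>\<^bsub>M\<^esub>" using N car[OF c] by (simp add: smult_r_distr)
    qed
    then show ?thesis using N by (auto simp: generalized_weight_space_def intro!: exI[of _ "max N N'"])
  qed
  show sm: "a \<odot>\<^bsub>M\<^esub> x \<in> gws \<nn>" if a: "a \<in> carrier R" and x: "x \<in> gws \<nn>" for a x
  proof -
    obtain N where N: "x \<in> carrier M" "N > 0" "\<forall>c\<in>ideal_power R \<nn> N. c \<odot>\<^bsub>M\<^esub> x = \<zero>\<^bsub>M\<^esub>"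
      using x by (auto simp: generalized_weight_space_def)
    have "c \<odot>\<^bsub>M\<^esub> (a \<odot>\<^bsub>M\<^esub> x) = \<zero>\<^bsub>M\<^esub>" if c: "c \<in> ideal_power R \<nn> N" for c
      using N c car[OF c] a ideal.I_r_closed[OF P c a] smult_assoc[of c a x] by simp
    then show ?thesis using N a by (auto simp: generalized_weight_space_def intro!: smult_closed exI[of _ N])
  qed
  show "\<ominus>\<^bsub>M\<^esub> x \<in> gws \<nn>" if x: "x \<in> gws \<nn>"
    using sm[OF _ x, of "\<ominus> \<one>"] subsetD[OF gws_sub x] smult_minus_left[of \<one> x] smult_one[of x] by simp
qed

lemma weight_vector_gws:
  assumes "ideal \<nn> R" "x \<in> carrier M" "\<And>c. c \<in> \<nn> \<Longrightarrow> c \<odot>\<^bsub>M\<^esub> x = \<zero>\<^bsub>M\<^esub>"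
  shows "x \<in> gws \<nn>"
  using assms ideal_power_1_subset[OF assms(1)]
  by (auto simp: generalized_weight_space_def intro!: exI[of _ 1])

lemma gws_annihilate:
  assumes \<nn>: "ideal \<nn> R" and x: "x \<in> gws \<nn>" and c: "c \<in> \<nn>"
  shows "\<exists>N::nat. (c [^] N) \<odot>\<^bsub>M\<^esub> x = \<zero>\<^bsub>M\<^esub>"
  using x pow_in_ideal_power[OF \<nn> c] by (auto simp: generalized_weight_space_def)

text \<open>An element \<open>e\<close> outside \<open>\<nn>\<close> that annihilates \<open>x \<in> M(\<nn>)\<close> forces \<open>x = 0\<close>: choosing \<open>f\<close> with
  \<open>1 - e f \<in> \<nn>\<close>, this element fixes \<open>x\<close>, whereas its powers eventually annihilate \<open>x\<close>.\<close>
lemma gws_outside_zero: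
  assumes \<nn>: "maximalideal \<nn> R" and x: "x \<in> gws \<nn>" and e: "e \<in> carrier R" "e \<notin> \<nn>"
    and ex: "e \<odot>\<^bsub>M\<^esub> x = \<zero>\<^bsub>M\<^esub>"
  shows "x = \<zero>\<^bsub>M\<^esub>"
proof -
  interpret n: maximalideal \<nn> R by fact
  have xM: "x \<in> carrier M" using x gws_sub by auto
  let ?J = "{a \<oplus> e \<otimes> f | a f. a \<in> \<nn> \<and> f \<in> carrier R}"
  have J1: "ideal ?J R"
  proof (rule ideal_criterion)
    show "?J \<subseteq> carrier R" using e n.Icarr by auto
    show "\<zero> \<in> ?J" using e n.zero_closed by (auto intro!: exI[of _ \<zero>])
    fix y z assume y: "y \<in> ?J"
    then obtain a f where y': "y = a \<oplus> e \<otimes> f" "a \<in> \<nn>" "f \<in> carrier R" by auto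
    note car = n.Icarr[OF y'(2)]
    { assume "z \<in> ?J"
      then obtain a' f' where z': "z = a' \<oplus> e \<otimes> f'" "a' \<in> \<nn>" "f' \<in> carrier R" by auto
      have "y \<oplus> z = (a \<oplus> a') \<oplus> e \<otimes> (f \<oplus> f')" unfolding y' z'
        using y'(3) z'(3) car n.Icarr[OF z'(2)] e(1) by algebra
      then show "y \<oplus> z \<in> ?J" using y' z' n.a_closed by blast }
    assume z: "z \<in> carrier R"
    have "z \<otimes> y = z \<otimes> a \<oplus> e \<otimes> (z \<otimes> f)" unfolding y' using y'(3) car e(1) z by algebra
    then show "z \<otimes> y \<in> ?J" using y' z n.I_l_closed by blast
    then show "y \<otimes> z \<in> ?J" using z y' car e m_comm[of y z] by simp
  qed
  have J2: "\<nn> \<subseteq> ?J"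
  proof
    fix a assume "a \<in> \<nn>"
    then have "a = a \<oplus> e \<otimes> \<zero>" using e n.Icarr by simp
    then show "a \<in> ?J" using \<open>a \<in> \<nn>\<close> by blast
  qed
  have J4: "e \<in> ?J"
  proof -
    have "e = \<zero> \<oplus> e \<otimes> \<one>" using e by simp
    then show ?thesis using n.zero_closed by blast
  qed
  have J3: "?J \<subseteq> carrier R" using e n.Icarr by auto
  have "?J \<noteq> \<nn>"
  proof
    assume "?J = \<nn>"
    then have "e \<in> \<nn>" using J4 by (rule subst)
    with e(2) show False by contradiction
  qed
  then have J5: "?J = carrier R" by (rule disjE[OF n.I_maximal[OF J1 J2 J3] notE]) assumption+
  have "\<one> \<in> ?J" unfolding J5 by (rule one_closed)
  then obtain a f where af: "\<one> = a \<oplus> e \<otimes> f" "a \<in> \<nn>" "f \<in> carrier R" by blast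
  have a: "a \<in> carrier R" using af n.Icarr by auto
  have "x = \<one> \<odot>\<^bsub>M\<^esub> x" using xM by (simp add: smult_one)
  also have "\<dots> = a \<odot>\<^bsub>M\<^esub> x \<oplus>\<^bsub>M\<^esub> f \<odot>\<^bsub>M\<^esub> (e \<odot>\<^bsub>M\<^esub> x)"
    unfolding af(1) using a e af xM by (simp add: smult_l_distr m_comm[of e f] smult_assoc)
  also have "\<dots> = a \<odot>\<^bsub>M\<^esub> x" using a af xM by (simp add: ex smult_zero_right smult_closed)
  finally have ax: "a \<odot>\<^bsub>M\<^esub> x = x" by simp
  have "(a [^] N) \<odot>\<^bsub>M\<^esub> x = x" for N :: nat
    by (induction N) (use a xM ax in \<open>simp_all add: smult_one smult_assoc\<close>)
  then show ?thesis using gws_annihilate[OF n.is_ideal x af(2)] by auto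
qed

text \<open>For each other ideal \<nn> a power of some c in \<nn> but not in \<mm> annihilates the
  component at \<nn>. The product e of these powers avoids \<mm>, which is prime, and kills every
  component except the one at \<mm>. Applied to the vanishing sum, it kills that one too, which must
  then be zero.\<close>

lemma gws_independent:
  assumes fin: "finite F" and max: "\<And>\<nn>. \<nn> \<in> F \<Longrightarrow> maximalideal \<nn> R"
    and f: "\<And>\<nn>. \<nn> \<in> F \<Longrightarrow> f \<nn> \<in> gws \<nn>" and sum: "(\<Oplus>\<^bsub>M\<^esub>\<nn>\<in>F. f \<nn>) = \<zero>\<^bsub>M\<^esub>" and \<mm>: "\<mm> \<in> F"
  shows "f \<mm> = \<zero>\<^bsub>M\<^esub>"
proof -
  interpret m: maximalideal \<mm> R using max[OF \<mm>] .
  have prime: "primeideal \<mm> R" by (rule maximalideal_prime[OF max[OF \<mm>]])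
  have fM: "f \<nn> \<in> carrier M" if "\<nn> \<in> F" for \<nn> using f[OF that] gws_sub by auto
  have ex: "\<exists>c\<in>carrier R. c \<notin> \<mm> \<and> c \<odot>\<^bsub>M\<^esub> f \<nn> = \<zero>\<^bsub>M\<^esub>" if \<nn>: "\<nn> \<in> F" "\<nn> \<noteq> \<mm>" for \<nn>
  proof -
    interpret n: maximalideal \<nn> R using max[OF \<nn>(1)] .
    have "\<not> \<nn> \<subseteq> \<mm>"
      using n.I_maximal[OF m.is_ideal] m.a_subset m.I_notcarr \<nn> by auto
    then obtain c where c: "c \<in> \<nn>" "c \<notin> \<mm>" by auto
    obtain N :: nat where N: "(c [^] N) \<odot>\<^bsub>M\<^esub> f \<nn> = \<zero>\<^bsub>M\<^esub>"
      using gws_annihilate[OF n.is_ideal f[OF \<nn>(1)] c(1)] by auto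
    have cR: "c \<in> carrier R" using c n.Icarr by auto
    have "c [^] k \<notin> \<mm>" for k :: nat
    proof (induction k)
      case 0
      then show ?case using m.one_imp_carrier m.I_notcarr by auto
    next
      case (Suc k)
      then show ?case using primeideal.I_prime[OF prime, of "c [^] k" c] c cR by auto
    qed
    then show ?thesis using N cR by blast
  qed
  have "\<exists>e\<in>carrier R. e \<notin> \<mm> \<and> (\<forall>\<nn>\<in>F'. e \<odot>\<^bsub>M\<^esub> f \<nn> = \<zero>\<^bsub>M\<^esub>)" if "F' \<subseteq> F - {\<mm>}" for F'
    using finite_subset[OF that] that fin
  proof (induction F' rule: infinite_finite_induct)
    case empty
    then show ?case using m.one_imp_carrier m.I_notcarr by (intro bexI[of _ \<one>]) auto
  next
    case (insert \<nn> F')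
    then obtain e where e: "e \<in> carrier R" "e \<notin> \<mm>" "\<forall>\<nn>\<in>F'. e \<odot>\<^bsub>M\<^esub> f \<nn> = \<zero>\<^bsub>M\<^esub>" by auto
    obtain c where c: "c \<in> carrier R" "c \<notin> \<mm>" "c \<odot>\<^bsub>M\<^esub> f \<nn> = \<zero>\<^bsub>M\<^esub>" using ex[of \<nn>] insert by auto
    have "c \<otimes> e \<notin> \<mm>" using primeideal.I_prime[OF prime, of c e] c e by auto
    moreover have "(c \<otimes> e) \<odot>\<^bsub>M\<^esub> f \<nn>' = \<zero>\<^bsub>M\<^esub>" if "\<nn>' \<in> F'" for \<nn>'
      using e c fM[of \<nn>'] that insert.prems by (auto simp: smult_assoc smult_zero_right)
    moreover have "(c \<otimes> e) \<odot>\<^bsub>M\<^esub> f \<nn> = \<zero>\<^bsub>M\<^esub>"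
      using e c fM[of \<nn>] insert.prems by (auto simp: m_comm[of c e] smult_assoc smult_zero_right)
    ultimately show ?case using c e by (intro bexI[of _ "c \<otimes> e"]) auto
  qed auto
  from this[of "F - {\<mm>}"] obtain e where e: "e \<in> carrier R" "e \<notin> \<mm>" "\<forall>\<nn>\<in>F - {\<mm>}. e \<odot>\<^bsub>M\<^esub> f \<nn> = \<zero>\<^bsub>M\<^esub>" by auto
  have "insert \<mm> (F - {\<mm>}) = F" using \<mm> by auto
  then have "(\<Oplus>\<^bsub>M\<^esub>\<nn>\<in>F. f \<nn>) = f \<mm> \<oplus>\<^bsub>M\<^esub> (\<Oplus>\<^bsub>M\<^esub>\<nn>\<in>F - {\<mm>}. f \<nn>)"
    using fin fM M.finsum_insert[of "F - {\<mm>}" \<mm> f] \<mm> by auto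
  then have eq: "f \<mm> \<oplus>\<^bsub>M\<^esub> (\<Oplus>\<^bsub>M\<^esub>\<nn>\<in>F - {\<mm>}. f \<nn>) = \<zero>\<^bsub>M\<^esub>" using sum by simp
  have cl: "(\<Oplus>\<^bsub>M\<^esub>\<nn>\<in>F - {\<mm>}. f \<nn>) \<in> carrier M" using fM by (intro M.finsum_closed) auto
  have "e \<odot>\<^bsub>M\<^esub> (\<Oplus>\<^bsub>M\<^esub>\<nn>\<in>F - {\<mm>}. f \<nn>) = (\<Oplus>\<^bsub>M\<^esub>\<nn>\<in>F - {\<mm>}. e \<odot>\<^bsub>M\<^esub> f \<nn>)"
    using fin e fM by (intro smult_finsum) auto
  also have "\<dots> = (\<Oplus>\<^bsub>M\<^esub>\<nn>\<in>F - {\<mm>}. \<zero>\<^bsub>M\<^esub>)" using e by (intro M.finsum_cong') auto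
  also have "\<dots> = \<zero>\<^bsub>M\<^esub>" by simp
  finally have "e \<odot>\<^bsub>M\<^esub> f \<mm> = \<zero>\<^bsub>M\<^esub>"
    using smult_r_distr[OF e(1) fM[OF \<mm>] cl] eq e(1) smult_closed[OF e(1) fM[OF \<mm>]] by (simp add: smult_zero_right)
  then show ?thesis using gws_outside_zero[OF max[OF \<mm>] f[OF \<mm>] e(1,2)] by simp
qed

text \<open>Hypothesis \<open>gen\<close> says in the form of an induction rule that the weight
  spaces span M additively. The modules to which this is applied come with induction rules over
  spanning vectors, which match this form directly.\<close>

lemma internal_direct_sum_gws:
  assumes I: "\<And>\<nn>. \<nn> \<in> I \<Longrightarrow> maximalideal \<nn> R"
    and gen: "\<And>x Q. x \<in> carrier M \<Longrightarrow> Q \<zero>\<^bsub>M\<^esub> \<Longrightarrow> (\<And>\<nn> w. \<nn> \<in> I \<Longrightarrow> w \<in> gws \<nn> \<Longrightarrow> Q w) \<Longrightarrow>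
      (\<And>y z. y \<in> carrier M \<Longrightarrow> z \<in> carrier M \<Longrightarrow> Q y \<Longrightarrow> Q z \<Longrightarrow> Q (y \<oplus>\<^bsub>M\<^esub> z)) \<Longrightarrow> Q x"
  shows "internal_direct_sum M I gws"
  unfolding internal_direct_sum_def
proof (intro conjI ballI)
  note idl = maximalideal.axioms(1)[OF I]
  fix \<nn> assume "\<nn> \<in> I"
  note cl = gws_closed[OF idl[OF this]]
  show "additive_subgroup (gws \<nn>) M"
    unfolding additive_subgroup_def
    by (rule M.add.subgroupI) (use cl gws_sub in \<open>auto simp: a_inv_def\<close>)
next
  note idl = maximalideal.axioms(1)[OF I]
  \<comment> \<open>The components are extended by zero off a finite index set, so that two
    decompositions can be added over the union of their index sets.\<close>
  let ?dec = "\<lambda>F f x. finite F \<and> F \<subseteq> I \<and> (\<forall>\<nn>\<in>I. f \<nn> \<in> gws \<nn>) \<and> (\<forall>\<nn>. \<nn> \<notin> F \<longrightarrow> f \<nn> = \<zero>\<^bsub>M\<^esub>) \<and> x = (\<Oplus>\<^bsub>M\<^esub>\<nn>\<in>F. f \<nn>)"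
  have fM: "f \<nn> \<in> carrier M" if "\<forall>\<nn>\<in>I. f \<nn> \<in> gws \<nn>" "\<nn> \<in> I" for f \<nn> using that gws_sub by blast
  fix x assume x: "x \<in> carrier M"
  have "\<exists>F f. ?dec F f x"
  proof (rule gen[OF x])
    show "\<exists>F f. ?dec F f \<zero>\<^bsub>M\<^esub>"
      by (rule exI[of _ "{}"], rule exI[of _ "\<lambda>_. \<zero>\<^bsub>M\<^esub>"]) (auto intro: gws_closed[OF idl])
  next
    fix \<nn> w assume "\<nn> \<in> I" "w \<in> gws \<nn>"
    then show "\<exists>F f. ?dec F f w" using gws_sub
      by (intro exI[of _ "{\<nn>}"] exI[of _ "\<lambda>\<mm>. if \<mm> = \<nn> then w else \<zero>\<^bsub>M\<^esub>"])
        (auto intro: gws_closed[OF idl] simp: M.finsum_insert subset_iff)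
  next
    fix y z assume "\<exists>F f. ?dec F f y" "\<exists>F f. ?dec F f z"
    then obtain F f F' f' where *: "?dec F f y" "?dec F' f' z" by blast
    have ext: "(\<Oplus>\<^bsub>M\<^esub>\<nn>\<in>F. f \<nn>) = (\<Oplus>\<^bsub>M\<^esub>\<nn>\<in>F''. f \<nn>)" if "?dec F f y" "F \<subseteq> F''" "finite F''" "F'' \<subseteq> I" for F F'' f y
      using that fM[of f] by (intro M.add.finprod_mono_neutral_cong_left) auto
    have "(\<Oplus>\<^bsub>M\<^esub>\<nn>\<in>F \<union> F'. f \<nn> \<oplus>\<^bsub>M\<^esub> f' \<nn>) = (\<Oplus>\<^bsub>M\<^esub>\<nn>\<in>F \<union> F'. f \<nn>) \<oplus>\<^bsub>M\<^esub> (\<Oplus>\<^bsub>M\<^esub>\<nn>\<in>F \<union> F'. f' \<nn>)"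
      using * fM[of f] fM[of f'] by (intro M.finsum_addf) auto
    also have "\<dots> = y \<oplus>\<^bsub>M\<^esub> z"
      using * ext[OF *(1), of "F \<union> F'"] ext[OF *(2), of "F \<union> F'"] by auto
    finally show "\<exists>F f. ?dec F f (y \<oplus>\<^bsub>M\<^esub> z)"
      using * by (intro exI[of _ "F \<union> F'"] exI[of _ "\<lambda>\<nn>. f \<nn> \<oplus>\<^bsub>M\<^esub> f' \<nn>"]) (auto intro: gws_closed[OF idl])
  qed
  then obtain F f where dec: "?dec F f x" by blast
  define g where "g = restrict f I"
  have supp: "{i \<in> I. g i \<noteq> \<zero>\<^bsub>M\<^esub>} \<subseteq> F" using dec by (auto simp: g_def)
  let ?P = "\<lambda>f. f \<in> (\<Pi>\<^sub>E i\<in>I. gws i) \<and> finite {i \<in> I. f i \<noteq> \<zero>\<^bsub>M\<^esub>} \<and>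
        x = (\<Oplus>\<^bsub>M\<^esub>i\<in>{i \<in> I. f i \<noteq> \<zero>\<^bsub>M\<^esub>}. f i)"
  show "\<exists>!f. ?P f"
  proof (rule ex1I[of ?P g])
    have "g \<in> (\<Pi>\<^sub>E i\<in>I. gws i)" using dec by (auto simp: g_def)
    moreover have "finite {i \<in> I. g i \<noteq> \<zero>\<^bsub>M\<^esub>}" using supp dec finite_subset by blast
    moreover have "(\<Oplus>\<^bsub>M\<^esub>i\<in>{i \<in> I. g i \<noteq> \<zero>\<^bsub>M\<^esub>}. g i) = (\<Oplus>\<^bsub>M\<^esub>i\<in>F. f i)"
      using dec fM[of f] supp
      by (intro M.add.finprod_mono_neutral_cong_left) (auto simp: g_def)
    ultimately show "?P g" using dec by simp
  next
    \<comment> \<open>Two decompositions are compared over the union of their supports; their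
      difference is a vanishing sum of generalized weight vectors.\<close>
    have unique: "h = h'" if h: "?P h" and h': "?P h'" for h h'
    proof -
      let ?F = "{i \<in> I. h i \<noteq> \<zero>\<^bsub>M\<^esub>} \<union> {i \<in> I. h' i \<noteq> \<zero>\<^bsub>M\<^esub>}"
      have hg: "h i \<in> gws i" "h' i \<in> gws i" "h i \<in> carrier M" "h' i \<in> carrier M" if "i \<in> I" for i
      proof -
        show "h i \<in> gws i" "h' i \<in> gws i" using h h' that by (auto simp: PiE_iff)
        then show "h i \<in> carrier M" "h' i \<in> carrier M" using gws_sub by auto
      qed
      have fin: "finite ?F" using h h' by blast
      have 1: "x = (\<Oplus>\<^bsub>M\<^esub>i\<in>?F. h i)"
        using h fin hg by (auto intro!: M.add.finprod_mono_neutral_cong_left)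
      have 2: "x = (\<Oplus>\<^bsub>M\<^esub>i\<in>?F. h' i)"
        using h' fin hg by (auto intro!: M.add.finprod_mono_neutral_cong_left)
      have "(\<Oplus>\<^bsub>M\<^esub>i\<in>?F. h i \<oplus>\<^bsub>M\<^esub> \<ominus>\<^bsub>M\<^esub> h' i) \<oplus>\<^bsub>M\<^esub> x = (\<Oplus>\<^bsub>M\<^esub>i\<in>?F. (h i \<oplus>\<^bsub>M\<^esub> \<ominus>\<^bsub>M\<^esub> h' i) \<oplus>\<^bsub>M\<^esub> h' i)"
        unfolding 2 using hg by (intro M.finsum_addf[symmetric]) auto
      also have "\<dots> = (\<Oplus>\<^bsub>M\<^esub>i\<in>?F. h i)"
        using hg by (intro M.finsum_cong') (auto simp: M.a_assoc M.l_neg)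
      also have "\<dots> = x" using 1 by simp
      finally have sum0: "(\<Oplus>\<^bsub>M\<^esub>i\<in>?F. h i \<oplus>\<^bsub>M\<^esub> \<ominus>\<^bsub>M\<^esub> h' i) = \<zero>\<^bsub>M\<^esub>"
        using x hg by (subst (asm) M.add.r_cancel_one) (auto intro!: M.finsum_closed)
      have *: "h i \<oplus>\<^bsub>M\<^esub> \<ominus>\<^bsub>M\<^esub> h' i = \<zero>\<^bsub>M\<^esub>" if "i \<in> ?F" for i
      proof (rule gws_independent[OF fin _ _ sum0 that])
        fix \<nn> assume "\<nn> \<in> ?F"
        then have n: "\<nn> \<in> I" by auto
        then show "maximalideal \<nn> R" by (rule I)
        show "h \<nn> \<oplus>\<^bsub>M\<^esub> \<ominus>\<^bsub>M\<^esub> h' \<nn> \<in> gws \<nn>" using hg[OF n] gws_closed[OF idl[OF n]] by blast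
      qed
      have "h i = h' i" if "i \<in> I" for i
      proof (cases "i \<in> ?F")
        case True
        then show ?thesis using *[OF True] hg[OF that] M.minus_equality[of "h i" "\<ominus>\<^bsub>M\<^esub> h' i"] by simp
      qed (use that in auto)
      then show "h = h'" using h h' by (intro PiE_ext[of h I gws h']) blast+
    qed
    have "?P g"
    proof -
      have "g \<in> (\<Pi>\<^sub>E i\<in>I. gws i)" using dec by (auto simp: g_def)
      moreover have "finite {i \<in> I. g i \<noteq> \<zero>\<^bsub>M\<^esub>}" using supp dec finite_subset by blast
      moreover have "(\<Oplus>\<^bsub>M\<^esub>i\<in>{i \<in> I. g i \<noteq> \<zero>\<^bsub>M\<^esub>}. g i) = (\<Oplus>\<^bsub>M\<^esub>i\<in>F. f i)"
        using dec fM[of f] supp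
        by (intro M.add.finprod_mono_neutral_cong_left) (auto simp: g_def)
      ultimately show ?thesis using dec by simp
    qed
    then show "h = g" if "?P h" for h using that unique by blast
  qed
qed

end

text \<open>Being a direct sum of subgroups depends on the addition alone. This reconciles weight
  spaces formed over \<Gamma> with a sum that is formed in the U-module.\<close>

lemma internal_direct_sum_restrict:
  "internal_direct_sum (restrict_scalars f M) I N = internal_direct_sum M I N"
  by (simp add: internal_direct_sum_def restrict_scalars_def additive_subgroup_def finsum_def
      finprod_def subgroup_def m_inv_def)

text \<open>Since x - \<chi>(x) 1 always lies in the kernel, the quotient is spanned by the class of
  1. For the same reason a larger ideal contains a nonzero multiple of 1.\<close>

lemma (in kalg) character_kernel:
  assumes "character \<chi>"
  shows "{x \<in> carrier A. \<chi> x = 0} \<in> cofinite_maximal_ideals A"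
proof -
  note \<chi>D = characterD[OF assms]
  define K where "K = {x \<in> carrier A. \<chi> x = 0}"
  have KI: "x \<in> carrier A \<Longrightarrow> \<chi> x = 0 \<Longrightarrow> x \<in> K" and KD: "x \<in> K \<Longrightarrow> \<chi> x = 0" for x by (simp_all add: K_def)
  have K: "ideal K A" unfolding K_def by (rule ideal_criterion) (auto simp: \<chi>D)
  interpret kalg_ideal A K unfolding kalg_ideal_def kalg_ideal_axioms_def using K kalg_axioms by simp
  interpret Q: kalg Q by (rule kalgI) (rule quot_k_algebra)
  have diff: "x \<ominus> (\<chi> x \<odot> \<one>) \<in> K" if "x \<in> carrier A" for x
  proof -
    have c: "\<chi> x \<odot> \<one> \<in> carrier A" by (rule sm_closed[OF one_closed])
    have "\<chi> (x \<oplus> \<ominus> (\<chi> x \<odot> \<one>)) = \<chi> x + - (\<chi> x * 1)"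
      unfolding \<chi>D(1)[OF that a_inv_closed[OF c]] \<chi>D(6)[OF c] \<chi>D(3)[OF one_closed] \<chi>D(4) by (rule refl)
    then show ?thesis using minus_closed[OF that c] by (intro KI) (simp_all add: a_minus_def)
  qed
  have "maximalideal K A"
  proof (rule maximalidealI[OF K])
    have "\<one> \<notin> K" using \<chi>D(4) KD by force
    then show "carrier A \<noteq> K" using one_closed by blast
    fix J assume J: "ideal J A" "K \<subseteq> J" "J \<subseteq> carrier A"
    interpret J: ideal J A by fact
    show "J = K \<or> J = carrier A"
    proof (rule disjCI)
      assume "J \<noteq> carrier A"
      have "\<chi> x = 0" if x: "x \<in> J" for x
      proof (rule ccontr)
        assume nz: "\<chi> x \<noteq> 0"
        have xA: "x \<in> carrier A" using x by (rule J.Icarr)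
        have "\<ominus> (x \<ominus> (\<chi> x \<odot> \<one>)) \<oplus> x \<in> J" using diff[OF xA] J(2) x by blast
        also have "\<ominus> (x \<ominus> (\<chi> x \<odot> \<one>)) \<oplus> x = \<chi> x \<odot> \<one>"
          using xA by (simp add: a_minus_def minus_add a_ac l_neg r_neg2)
        finally have "(inverse (\<chi> x) \<odot> \<one>) \<otimes> (\<chi> x \<odot> \<one>) \<in> J" by (intro J.I_l_closed) auto
        then have "\<one> \<in> J" using nz by (simp add: sm_mult_left sm_assoc)
        then show False using J.one_imp_carrier \<open>J \<noteq> carrier A\<close> by simp
      qed
      then show "J = K" using J KI by blast
    qed
  qed
  moreover have "vectorspace.fin_dim (class_ring :: 'k ring) Q"
  proof -
  interpret QV: vectorspace "class_ring :: 'k ring" Q by (rule Q.vectorspace)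
  show ?thesis
    unfolding QV.fin_dim_def
  proof (intro exI conjI)
    show "finite {\<one>\<^bsub>Q\<^esub>}" "{\<one>\<^bsub>Q\<^esub>} \<subseteq> carrier Q" by simp_all
    have sub: "submodule class_ring (QV.span {\<one>\<^bsub>Q\<^esub>}) Q" by (rule QV.span_is_submodule) simp
    have "C \<in> QV.span {\<one>\<^bsub>Q\<^esub>}" if C: "C \<in> carrier Q" for C
    proof -
      obtain x where x: "x \<in> carrier A" "C = K +> x" using C by (rule quot_cases)
      have "C = K +> (\<chi> x \<odot> \<one>)" using x diff by (simp add: coset_eq_iff)
      then have "C = \<chi> x \<odot>\<^bsub>Q\<^esub> \<one>\<^bsub>Q\<^esub>" by (simp add: coset_one sm_coset)
      moreover have "\<one>\<^bsub>Q\<^esub> \<in> QV.span {\<one>\<^bsub>Q\<^esub>}" using QV.in_own_span[of "{\<one>\<^bsub>Q\<^esub>}"] by simp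
      ultimately show ?thesis using submodule.smult_closed[OF sub] by simp
    qed
    then show "QV.gen_set {\<one>\<^bsub>Q\<^esub>}" using QV.span_is_subset2[of "{\<one>\<^bsub>Q\<^esub>}"] by (intro equalityI subsetI) blast+
  qed
  qed
  ultimately show ?thesis
    unfolding cofinite_maximal_ideals_def K_def[symmetric] by (intro CollectI conjI)
qed

section \<open>Growth of modules\<close>

context vectorspace
begin

lemma span_minimal: "submodule K W V \<Longrightarrow> S \<subseteq> W \<Longrightarrow> span S \<subseteq> W"
  by (rule span_is_subset)

text \<open>The comparison takes place inside the span of S, regarded as a vector space of dimension
  at most the size of S.\<close>

lemma li_in_span_bound:
  assumes S: "finite S" "S \<subseteq> carrier V" and A: "A \<subseteq> span S" "lin_indpt A"
  shows "finite A" "card A \<le> card S"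
proof -
  have sub: "submodule K (span S) V" by (rule span_is_submodule[OF S(2)])
  have SS: "S \<subseteq> span S" by (rule in_own_span[OF S(2)])
  interpret W: vectorspace K "vs (span S)" by (rule subspace_is_vs[OF span_is_subspace[OF S(2)]])
  have gen: "W.gen_set S" using span_li_not_depend(1)[OF SS sub] by simp
  have fd: "W.fin_dim" unfolding W.fin_dim_def using S SS gen by auto
  have li: "W.lin_indpt A" using span_li_not_depend(2)[OF A(1) sub] A(2) by simp
  have "A \<subseteq> carrier (vs (span S))" using A by simp
  note 1 = W.li_le_dim[OF fd this li]
  show "finite A" by (rule 1(1))
  have "W.dim \<le> card S" by (rule W.gen_ge_dim[OF S(1) _ gen]) (use SS in simp)
  with 1(2) show "card A \<le> card S" by simp
qed

text \<open>\<open>S\<close> need not lie in \<open>W\<close>: it bounds the size of independent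
  subsets, so a maximal one exists and is a basis. Subspaces of a filtration step are measured in
  this way by a spanning set of the whole step.\<close>

lemma submodule_basis:
  assumes S: "finite S" "S \<subseteq> carrier V" and W: "submodule K W V" "W \<subseteq> span S"
  obtains B where "finite B" "B \<subseteq> W" "lin_indpt B" "span B = W" "card B \<le> card S"
    "vectorspace.fin_dim K (vs W)" "vectorspace.dim K (vs W) = card B"
proof -
  interpret W: vectorspace K "vs W" by (rule subspace_is_vs) (simp add: subspace_def W vectorspace_axioms)
  have li: "W.lin_indpt A \<longleftrightarrow> lin_indpt A" if "A \<subseteq> W" for A using span_li_not_depend(2)[OF that W(1)] by simp
  have bound: "finite A \<and> card A \<le> card S" if "A \<subseteq> W" "lin_indpt A" for A
    using li_in_span_bound[OF S, of A] that W(2) by auto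
  have empty: "W.lin_indpt {}" by (simp add: W.lin_dep_def)
  have "\<exists>B. finite B \<and> maximal B (\<lambda>A. A \<subseteq> carrier (vs W) \<and> W.lin_indpt A)"
    by (rule maximal_exists[of _ "card S" "{}"]) (use bound li empty in auto)
  then obtain B where B: "finite B" "maximal B (\<lambda>A. A \<subseteq> carrier (vs W) \<and> W.lin_indpt A)" by blast
  then have b: "W.basis B" by (intro W.max_li_is_basis)
  then have BW: "B \<subseteq> W" and Bli: "lin_indpt B" and gen: "W.span B = W" using li by (auto simp: W.basis_def)
  show ?thesis
  proof (rule that[OF B(1) BW Bli])
    show "span B = W" using span_li_not_depend(1)[OF BW W(1)] gen by simp
    show "card B \<le> card S" using bound[OF BW Bli] by simp
    show "W.fin_dim" unfolding W.fin_dim_def using B(1) BW gen by auto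
    show "W.dim = card B" by (rule W.dim_basis[OF B(1) b])
  qed
qed

end

lemma fin_dim_subspaces_iff:
  fixes E :: "('k::field, 'm) module"
  assumes "vectorspace (class_ring :: 'k ring) E"
  shows "W \<in> fin_dim_subspaces E \<longleftrightarrow> (\<exists>A. finite A \<and> A \<subseteq> carrier E \<and> W = module.span (class_ring :: 'k ring) E A)"
proof -
  interpret E: vectorspace "class_ring :: 'k ring" E by fact
  show ?thesis
  proof
    assume "W \<in> fin_dim_subspaces E"
    then have W: "submodule class_ring W E" and fd: "vectorspace.fin_dim (class_ring :: 'k ring) (E.vs W)"
      by (auto simp: fin_dim_subspaces_def subspace_def)
    interpret W: vectorspace "class_ring :: 'k ring" "E.vs W"
      by (rule E.subspace_is_vs) (simp add: subspace_def W E.vectorspace_axioms)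
    obtain A where A: "finite A" "A \<subseteq> W" "W.span A = W" using fd unfolding W.fin_dim_def by auto
    have "A \<subseteq> carrier E" using A(2) submodule.subset[OF W] by simp
    moreover have "W = E.span A" using E.span_li_not_depend(1)[OF A(2) W] A(3) by simp
    ultimately show "\<exists>A. finite A \<and> A \<subseteq> carrier E \<and> W = E.span A" using A(1) by blast
  next
    assume "\<exists>A. finite A \<and> A \<subseteq> carrier E \<and> W = E.span A"
    then obtain A where A: "finite A" "A \<subseteq> carrier E" "W = E.span A" by blast
    have sub: "submodule class_ring W E" unfolding A(3) by (rule E.span_is_submodule[OF A(2)])
    obtain B where "vectorspace.fin_dim class_ring (E.vs W)"
      using E.submodule_basis[OF A(1,2) sub] A(3) by blast
    then show "W \<in> fin_dim_subspaces E"
      using sub E.vectorspace_axioms by (simp add: fin_dim_subspaces_def subspace_def)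
  qed
qed

lemma submoduleI:
  fixes E :: "('k::field, 'm) module"
  assumes "vectorspace (class_ring :: 'k ring) E" "W \<subseteq> carrier E" "\<zero>\<^bsub>E\<^esub> \<in> W"
    "\<And>x y. x \<in> W \<Longrightarrow> y \<in> W \<Longrightarrow> x \<oplus>\<^bsub>E\<^esub> y \<in> W" "\<And>c x. x \<in> W \<Longrightarrow> c \<odot>\<^bsub>E\<^esub> x \<in> W"
  shows "submodule (class_ring :: 'k ring) W E"
proof -
  interpret E: vectorspace "class_ring :: 'k ring" E by fact
  show ?thesis using assms(2-) E.module_axioms by (intro submodule.intro) auto
qed

section \<open>Modules over an algebra as vector spaces, and the subspaces V^N F\<close>

locale kalg_module = U: kalg U + left_module U M for U :: "('k::field, 'u) module" and M :: "('u, 'm) module"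
begin

abbreviation "E \<equiv> underlying_space U M"

lemma E_simps: "carrier E = carrier M" "\<zero>\<^bsub>E\<^esub> = \<zero>\<^bsub>M\<^esub>" "x \<oplus>\<^bsub>E\<^esub> y = x \<oplus>\<^bsub>M\<^esub> y"
  "c \<odot>\<^bsub>E\<^esub> x = (c \<odot>\<^bsub>U\<^esub> \<one>\<^bsub>U\<^esub>) \<odot>\<^bsub>M\<^esub> x"
  by (simp_all add: underlying_space_def restrict_scalars_def)

lemma E_vectorspace: "vectorspace (class_ring :: 'k ring) E"
proof (rule vs_criteria)
  show "field (class_ring :: 'k ring)" by (rule class_field.field_axioms)
  show "\<forall>v\<in>carrier E. \<exists>w\<in>carrier E. v \<oplus>\<^bsub>E\<^esub> w = \<zero>\<^bsub>E\<^esub>"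
    using M.a_inv_closed M.r_neg by (fastforce simp: E_simps)
qed (auto simp: E_simps M.a_ac smult_closed smult_r_distr smult_one U.sm_l_distr smult_l_distr
     smult_assoc[symmetric] U.sm_mult_left U.sm_assoc)

sublocale E: vectorspace "class_ring :: 'k ring" E
  by (rule E_vectorspace)

lemma smult_sc: "u \<in> carrier U \<Longrightarrow> x \<in> carrier M \<Longrightarrow> u \<odot>\<^bsub>M\<^esub> (c \<odot>\<^bsub>E\<^esub> x) = c \<odot>\<^bsub>E\<^esub> (u \<odot>\<^bsub>M\<^esub> x)"
  by (simp add: E_simps smult_assoc[symmetric] U.sm_mult_left U.sm_mult_right)

lemma sc_smult: "u \<in> carrier U \<Longrightarrow> x \<in> carrier M \<Longrightarrow> (c \<odot>\<^bsub>U\<^esub> u) \<odot>\<^bsub>M\<^esub> x = c \<odot>\<^bsub>E\<^esub> (u \<odot>\<^bsub>M\<^esub> x)"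
  by (simp add: E_simps smult_assoc[symmetric] U.sm_mult_left)

text \<open>The elements of U that send \<open>x\<close> into \<open>W\<close> form a subspace, so
  it suffices to test them on a spanning set.\<close>

lemma smult_span_left:
  assumes "submodule class_ring W E" and A: "A \<subseteq> carrier U" and x: "x \<in> carrier M"
    and "\<And>a. a \<in> A \<Longrightarrow> a \<odot>\<^bsub>M\<^esub> x \<in> W" and u: "u \<in> module.span (class_ring :: 'k ring) U A"
  shows "u \<odot>\<^bsub>M\<^esub> x \<in> W"
proof -
  interpret UV: vectorspace "class_ring :: 'k ring" U by (rule U.vectorspace)
  interpret W: submodule "class_ring :: 'k ring" W E by fact
  have "UV.span A \<subseteq> {u \<in> carrier U. u \<odot>\<^bsub>M\<^esub> x \<in> W}"
  proof (rule UV.span_minimal)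
    show "submodule class_ring {u \<in> carrier U. u \<odot>\<^bsub>M\<^esub> x \<in> W} U"
      using x W.zero_closed W.m_closed W.smult_closed
      by (intro submoduleI U.vectorspace) (auto simp: E_simps smult_zero_left smult_l_distr sc_smult)
  qed (use assms in auto)
  then show ?thesis using u by auto
qed

lemma smult_span_right:
  assumes "submodule class_ring W E" and A: "A \<subseteq> carrier M" and u: "u \<in> carrier U"
    and "\<And>a. a \<in> A \<Longrightarrow> u \<odot>\<^bsub>M\<^esub> a \<in> W" and x: "x \<in> E.span A"
  shows "u \<odot>\<^bsub>M\<^esub> x \<in> W"
proof -
  interpret W: submodule "class_ring :: 'k ring" W E by fact
  have "E.span A \<subseteq> {x \<in> carrier M. u \<odot>\<^bsub>M\<^esub> x \<in> W}"
  proof (rule E.span_minimal)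
    show "submodule class_ring {x \<in> carrier M. u \<odot>\<^bsub>M\<^esub> x \<in> W} E"
      using u W.zero_closed W.m_closed W.smult_closed
      by (intro submoduleI E_vectorspace)
        (auto simp: E_simps(1-3) smult_zero_right smult_r_distr smult_sc intro: E.smult_closed[simplified, unfolded E_simps(1)])
  qed (use assms in auto)
  then show ?thesis using x by auto
qed

lemma span_closedM: "A \<subseteq> carrier M \<Longrightarrow> E.span A \<subseteq> carrier M"
  using E.span_is_subset2[of A] by (simp add: E_simps)

lemma span_submodule: "A \<subseteq> carrier M \<Longrightarrow> submodule class_ring (E.span A) E"
  using E.span_is_submodule[of A] by (simp add: E_simps)

lemma power_space_closed:
  assumes "V \<subseteq> carrier U" "F \<subseteq> carrier M"
  shows "power_space U M V F N \<subseteq> carrier M"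
proof (induction N)
  case (Suc N)
  then show ?case using assms span_closedM by (auto intro!: span_closedM smult_closed)
qed (use assms in simp)

lemma power_space_Suc_sub:
  assumes "V \<subseteq> carrier U" "F \<subseteq> carrier M" "v \<in> V" "x \<in> power_space U M V F N"
  shows "v \<odot>\<^bsub>M\<^esub> x \<in> power_space U M V F (Suc N)"
proof -
  have "{v \<odot>\<^bsub>M\<^esub> x |v x. v \<in> V \<and> x \<in> power_space U M V F N} \<subseteq> carrier E"
    using assms power_space_closed[of V F N] by (auto simp: E_simps intro!: smult_closed)
  from E.in_own_span[OF this] show ?thesis using assms(3,4) by (simp only: power_space.simps) blast
qed

lemma power_space_submodule:
  assumes "V \<subseteq> carrier U" "submodule class_ring F E"
  shows "submodule class_ring (power_space U M V F N) E"
proof (cases N)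
  case (Suc n)
  have "F \<subseteq> carrier M" using submodule.subset[OF assms(2)] by (simp add: E_simps)
  then show ?thesis unfolding Suc power_space.simps
    using assms power_space_closed[of V F n] by (intro span_submodule) (auto intro!: smult_closed)
qed (use assms in simp)

lemma power_space_fin_dim:
  assumes V: "V \<in> fin_dim_subspaces U" and F: "F \<in> fin_dim_subspaces E"
  shows "\<exists>A. finite A \<and> A \<subseteq> carrier M \<and> power_space U M V F N = E.span A"
proof (induction N)
  case 0
  then show ?case using F fin_dim_subspaces_iff[OF E_vectorspace] by (simp add: E_simps)
next
  case (Suc N)
  interpret UV: vectorspace "class_ring :: 'k ring" U by (rule U.vectorspace)
  obtain A where A: "finite A" "A \<subseteq> carrier M" "power_space U M V F N = E.span A" using Suc by blast
  obtain Vs where Vs: "finite Vs" "Vs \<subseteq> carrier U" "V = UV.span Vs"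
    using V fin_dim_subspaces_iff[OF U.vectorspace] by blast
  let ?P = "(\<lambda>(v, x). v \<odot>\<^bsub>M\<^esub> x) ` (Vs \<times> A)"
  have P: "?P \<subseteq> carrier M" using A Vs by (auto intro!: smult_closed)
  have VU: "V \<subseteq> carrier U" using UV.span_is_subset2[OF Vs(2)] Vs(3) by simp
  have sub: "submodule class_ring (E.span ?P) E" by (rule span_submodule[OF P])
  have 1: "v \<odot>\<^bsub>M\<^esub> x \<in> E.span ?P" if "v \<in> V" "x \<in> E.span A" for v x
  proof (rule smult_span_left[OF sub Vs(2)])
    show "x \<in> carrier M" using that span_closedM[OF A(2)] by auto
    show "v \<in> UV.span Vs" using that Vs by simp
    fix w assume w: "w \<in> Vs"
    show "w \<odot>\<^bsub>M\<^esub> x \<in> E.span ?P"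
    proof (rule smult_span_right[OF sub A(2) _ _ that(2)])
      show "w \<in> carrier U" using w Vs by auto
      fix a assume "a \<in> A"
      then show "w \<odot>\<^bsub>M\<^esub> a \<in> E.span ?P"
        using w E.in_own_span[of ?P] P by (auto simp: E_simps)
    qed
  qed
  let ?Q = "{v \<odot>\<^bsub>M\<^esub> x |v x. v \<in> V \<and> x \<in> power_space U M V F N}"
  have Q: "?Q \<subseteq> carrier M" using VU A(3) span_closedM[OF A(2)] by (auto intro!: smult_closed)
  have "E.span ?Q \<subseteq> E.span ?P" by (rule E.span_minimal[OF sub]) (use 1 A(3) in auto)
  moreover have "Vs \<subseteq> V" using UV.in_own_span[OF Vs(2)] Vs(3) by simp
  then have "?P \<subseteq> ?Q" using E.in_own_span[of A] A by (auto simp: E_simps)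
  then have "E.span ?P \<subseteq> E.span ?Q" by (rule E.span_is_monotone)
  ultimately show ?case using A Vs P by (intro exI[of _ ?P]) auto
qed

end

subsection \<open>Bounds for the Gelfand-Kirillov dimension\<close>

text \<open>The logarithm of a constant to base N is ln c / ln N and tends to 0. Constant factors in
  growth estimates thus leave the Gelfand-Kirillov dimension unchanged.\<close>

lemma log_const_tendsto: "(\<lambda>N. log (real N) c + d) \<longlonglongrightarrow> d"
proof -
  have "filterlim (\<lambda>N. ln (real N)) at_top sequentially"
    by (rule filterlim_compose[OF ln_at_top filterlim_real_sequentially])
  then have "(\<lambda>N. ln c / ln (real N)) \<longlonglongrightarrow> 0"
    by (intro real_tendsto_divide_at_top[OF tendsto_const])
  then have "(\<lambda>N. ln c / ln (real N) + d) \<longlonglongrightarrow> 0 + d" by (intro tendsto_add tendsto_const)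
  then show ?thesis by (simp add: log_def)
qed

lemma GK_dim_lower:
  assumes "V \<in> fin_dim_subspaces U" "\<one>\<^bsub>U\<^esub> \<in> V" "F \<in> fin_dim_subspaces (underlying_space U M)" and c: "c > 0"
    and bound: "\<And>N. c * (real N + 1) ^ n \<le> real (vectorspace.dim (class_ring :: 'k::field ring)
       ((underlying_space U M)\<lparr>carrier := power_space U M V F N\<rparr>))"
  shows "ereal (real n) \<le> GK_dim U M"
proof -
  define d where "d N = real (vectorspace.dim (class_ring :: 'k ring)
       ((underlying_space U M)\<lparr>carrier := power_space U M V F N\<rparr>))" for N
  have "log (real N) c + real n \<le> log (real N) (d N)" if N: "N \<ge> 2" for N
  proof -
    have "c * real N ^ n \<le> c * (real N + 1) ^ n" using c by (intro mult_left_mono power_mono) auto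
    also have "\<dots> \<le> d N" using bound unfolding d_def by blast
    finally have "c * real N ^ n \<le> d N" .
    moreover have pos: "c * real N ^ n > 0" using c N by simp
    ultimately have "log (real N) (c * real N ^ n) \<le> log (real N) (d N)" using N by simp
    moreover have "log (real N) (c * real N ^ n) = log (real N) c + real n"
      using c N by (simp add: log_mult log_nat_power)
    ultimately show ?thesis by simp
  qed
  \<comment> \<open>Bases 0 and 1 are excluded, as the logarithm is increasing only for a base above
    1.\<close>
  then have ev: "eventually (\<lambda>N. ereal (log (real N) c + real n) \<le> ereal (log (real N) (d N))) sequentially"
    by (intro eventually_sequentiallyI[of 2]) simp
  have "limsup (\<lambda>N. ereal (log (real N) c + real n)) = ereal (real n)"
    by (intro lim_imp_Limsup) (simp_all add: log_const_tendsto)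
  then have "ereal (real n) \<le> limsup (\<lambda>N. ereal (log (real N) (d N)))"
    using Limsup_mono[OF ev] by simp
  also have "\<dots> \<le> GK_dim U M"
    unfolding GK_dim_def d_def using assms by (intro SUP_upper2[of "(V, F)"]) auto
  finally show ?thesis .
qed

lemma GK_dim_upper:
  fixes U :: "('k::field, 'u) module" and M :: "('u, 'm) module"
  assumes bound: "\<And>V F. V \<in> fin_dim_subspaces U \<Longrightarrow> F \<in> fin_dim_subspaces (underlying_space U M) \<Longrightarrow>
      \<exists>c. \<forall>N. real (vectorspace.dim (class_ring :: 'k::field ring)
         ((underlying_space U M)\<lparr>carrier := power_space U M V F N\<rparr>)) \<le> c * (real N + 1) ^ n"
  shows "GK_dim U M \<le> ereal (real n)"
  unfolding GK_dim_def
proof (rule SUP_least, clarify)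
  fix V F assume VF: "V \<in> fin_dim_subspaces U" "F \<in> fin_dim_subspaces (underlying_space U M)"
  define d where "d N = real (vectorspace.dim (class_ring :: 'k ring)
       ((underlying_space U M)\<lparr>carrier := power_space U M V F N\<rparr>))" for N
  obtain c where c: "\<And>N. d N \<le> c * (real N + 1) ^ n" using bound[OF VF] unfolding d_def by blast
  \<comment> \<open>\<open>max 1 c\<close> ensures 1 <= C N^n, and 2^n comes from N + 1 <= 2
    N.\<close>
  define C where "C = max 1 c * 2 ^ n"
  have C: "C > 0" by (simp add: C_def)
  have "log (real N) (d N) \<le> log (real N) C + real n" if N: "N \<ge> 2" for N
  proof -
    have "d N \<le> max 1 c * (real N + 1) ^ n" using c[of N] by (rule order_trans) (intro mult_right_mono; simp)
    also have "\<dots> \<le> max 1 c * (2 * real N) ^ n" using N by (intro mult_left_mono power_mono) auto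
    finally have le: "d N \<le> C * real N ^ n" by (simp add: C_def power_mult_distrib)
    have C1: "C * real N ^ n \<ge> 1"
    proof -
      have "1 * 1 \<le> max 1 c * (2 * real N) ^ n" using N by (intro mult_mono one_le_power) auto
      then show ?thesis by (simp add: C_def power_mult_distrib)
    qed
    have eq: "log (real N) (C * real N ^ n) = log (real N) C + real n"
      using C N by (simp add: log_mult log_nat_power)
    show ?thesis
    proof (cases "d N > 0")
      case True
      then have "log (real N) (d N) \<le> log (real N) (C * real N ^ n)" using le N by simp
      then show ?thesis using eq by simp
    next
      \<comment> \<open>In dimension 0 the logarithm takes its conventional value 0, so the estimate
        rests on 1 <= C N^n in place of monotonicity.\<close>
      case False
      then have "d N = 0" by (simp add: d_def)
      then have "log (real N) (d N) = 0" by (simp add: log_def)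
      also have "0 \<le> log (real N) (C * real N ^ n)" using C1 N by simp
      finally show ?thesis using eq by simp
    qed
  qed
  then have ev: "eventually (\<lambda>N. ereal (log (real N) (d N)) \<le> ereal (log (real N) C + real n)) sequentially"
    by (intro eventually_sequentiallyI[of 2]) simp
  have "limsup (\<lambda>N. ereal (log (real N) C + real n)) = ereal (real n)"
    by (intro lim_imp_Limsup) (simp_all add: log_const_tendsto)
  then show "limsup (\<lambda>N. ereal (log (real N) (d N))) \<le> ereal (real n)"
    using Limsup_mono[OF ev] by simp
qed

text \<open>The filtration lives in an ambient space \<open>E'\<close>, so that the bound also applies to submodules
  over subrings.\<close>
lemma (in kalg_module) GK_dim_filtration:
  assumes E': "vectorspace (class_ring :: 'k ring) E'" "E = E'\<lparr>carrier := carrier M\<rparr>" "carrier M \<subseteq> carrier E'"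
    and S: "\<And>N. finite (S N)" "\<And>N. S N \<subseteq> carrier E'" "\<And>N. real (card (S N)) \<le> C * (real N + 1) ^ n"
    and mono: "\<And>N N'. N \<le> N' \<Longrightarrow> S N \<subseteq> S N'"
    and exh: "\<And>x. x \<in> carrier M \<Longrightarrow> \<exists>N. x \<in> module.span (class_ring :: 'k ring) E' (S N)"
    and act: "\<And>u. u \<in> carrier U \<Longrightarrow> \<exists>r. \<forall>N. \<forall>x\<in>carrier M. x \<in> module.span (class_ring :: 'k ring) E' (S N) \<longrightarrow>
        u \<odot>\<^bsub>M\<^esub> x \<in> module.span (class_ring :: 'k ring) E' (S (N + r))"
  shows "GK_dim U M \<le> ereal (real n)"
proof (rule GK_dim_upper)
  interpret E': vectorspace "class_ring :: 'k ring" E' by fact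
  interpret UV: vectorspace "class_ring :: 'k ring" U by (rule U.vectorspace)
  fix V F assume V: "V \<in> fin_dim_subspaces U" and F: "F \<in> fin_dim_subspaces E"
  have Es: "\<zero>\<^bsub>E'\<^esub> = \<zero>\<^bsub>M\<^esub>" "x \<oplus>\<^bsub>E'\<^esub> y = x \<oplus>\<^bsub>M\<^esub> y" "c \<odot>\<^bsub>E'\<^esub> x = c \<odot>\<^bsub>E\<^esub> x" for x y c
    using E_simps(2) E_simps(3)[of x y] E'(2) by simp_all
  have ECs: "c \<odot>\<^bsub>E\<^esub> x \<in> carrier M" if "x \<in> carrier M" for c x
    using that by (auto simp: E_simps intro!: smult_closed)
  define B where "B N = carrier M \<inter> E'.span (S N)" for N
  have spanS: "submodule class_ring (E'.span (S N)) E'" for N by (rule E'.span_is_submodule[OF S(2)])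
  have Bsub: "submodule class_ring (B N) E" for N
    using submodule.zero_closed[OF spanS, of N] submodule.m_closed[OF spanS, of _ N] submodule.smult_closed[OF spanS, of _ _ N] ECs
    unfolding B_def by (intro submoduleI E_vectorspace) (auto simp: Es E_simps(1-3))
  have Bmono: "B N \<subseteq> B N'" if "N \<le> N'" for N N'
    unfolding B_def using E'.span_is_monotone[OF mono[OF that]] by auto
  \<comment> \<open>Bounds that may be enlarged become uniform over a finite set; this is applied to
    generators of V and to generators of F.\<close>
  have common: "\<exists>r. \<forall>x\<in>A. P r x" if finA: "finite A" and ex: "\<And>x. x \<in> A \<Longrightarrow> \<exists>r. P r x"
     and mon: "\<And>r r' x. P r x \<Longrightarrow> r \<le> r' \<Longrightarrow> P r' x" for A :: "'c set" and P :: "nat \<Rightarrow> 'c \<Rightarrow> bool"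
  proof -
    obtain f where f: "\<And>x. x \<in> A \<Longrightarrow> P (f x) x" using ex by metis
    have "P (Max (insert 0 (f ` A))) x" if "x \<in> A" for x
      by (rule mon[OF f]) (use that finA in auto)
    then show ?thesis by blast
  qed
  obtain Vs where Vs: "finite Vs" "Vs \<subseteq> carrier U" "V = UV.span Vs"
    using V fin_dim_subspaces_iff[OF U.vectorspace] by blast
  obtain Fs where Fs: "finite Fs" "Fs \<subseteq> carrier M" "F = E.span Fs"
    using F fin_dim_subspaces_iff[OF E_vectorspace] by (auto simp: E_simps)
  have VU: "V \<subseteq> carrier U" using UV.span_is_subset2[OF Vs(2)] Vs(3) by simp
  have "\<exists>r. \<forall>u\<in>Vs. \<forall>N. \<forall>x\<in>B N. u \<odot>\<^bsub>M\<^esub> x \<in> B (N + r)"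
  proof (rule common[OF Vs(1)])
    fix u assume "u \<in> Vs"
    then have u: "u \<in> carrier U" using Vs by auto
    then show "\<exists>r. \<forall>N. \<forall>x\<in>B N. u \<odot>\<^bsub>M\<^esub> x \<in> B (N + r)"
      using act[OF u] smult_closed[OF u] unfolding B_def by blast
  next
    fix r r' :: nat and u assume *: "\<forall>N. \<forall>x\<in>B N. u \<odot>\<^bsub>M\<^esub> x \<in> B (N + r)" "r \<le> r'"
    then show "\<forall>N. \<forall>x\<in>B N. u \<odot>\<^bsub>M\<^esub> x \<in> B (N + r')"
      using Bmono[of "N + r" "N + r'" for N] by (meson add_left_mono subsetD)
  qed
  then obtain r where r: "\<And>u N x. u \<in> Vs \<Longrightarrow> x \<in> B N \<Longrightarrow> u \<odot>\<^bsub>M\<^esub> x \<in> B (N + r)" by blast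
  have "\<exists>N0. \<forall>x\<in>Fs. x \<in> B N0"
  proof (rule common[OF Fs(1)])
    show "\<exists>N. x \<in> B N" if "x \<in> Fs" for x using exh[of x] that Fs unfolding B_def by blast
    show "x \<in> B N'" if "x \<in> B N" "N \<le> N'" for N N' x using Bmono that by blast
  qed
  then obtain N0 where N0: "Fs \<subseteq> B N0" by blast
  \<comment> \<open>Each application of V raises the filtration index by at most r, so N
    applications lead from N0 to N0 + r N. A linear change of index affects the constant but not the
    exponent n.\<close>
  have PS: "power_space U M V F N \<subseteq> B (N0 + r * N)" for N
  proof (induction N)
    case 0
    then show ?case using E.span_minimal[OF Bsub N0] Fs(3) by simp
  next
    case (Suc N)
    have "v \<odot>\<^bsub>M\<^esub> x \<in> B (N0 + r * Suc N)" if "v \<in> V" "x \<in> B (N0 + r * N)" for v x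
    proof (rule smult_span_left[OF Bsub Vs(2)])
      show "x \<in> carrier M" using that by (simp add: B_def)
      show "v \<in> UV.span Vs" using that Vs by simp
      show "u \<odot>\<^bsub>M\<^esub> x \<in> B (N0 + r * Suc N)" if "u \<in> Vs" for u
        using r[OF that \<open>x \<in> B (N0 + r * N)\<close>] by (simp add: algebra_simps)
    qed
    then show ?case unfolding power_space.simps using Suc by (intro E.span_minimal Bsub) auto
  qed
  have Fsub: "submodule class_ring F E" unfolding Fs(3) by (rule span_submodule[OF Fs(2)])
  have "real (vectorspace.dim (class_ring :: 'k ring) (E\<lparr>carrier := power_space U M V F N\<rparr>))
      \<le> (\<bar>C\<bar> * (real N0 + real r + 1) ^ n) * (real N + 1) ^ n" for N
  proof -
    let ?W = "power_space U M V F N"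
    have W: "submodule class_ring ?W E" by (rule power_space_submodule[OF VU Fsub])
    have W': "submodule class_ring ?W E'"
    proof (rule submoduleI[OF E'(1)])
      show "?W \<subseteq> carrier E'" using submodule.subset[OF W] E'(3) unfolding E_simps(1) by (rule subset_trans)
      show "\<zero>\<^bsub>E'\<^esub> \<in> ?W" using submodule.zero_closed[OF W] unfolding E_simps(2) Es(1) .
      show "x \<oplus>\<^bsub>E'\<^esub> y \<in> ?W" if "x \<in> ?W" "y \<in> ?W" for x y
        using submodule.m_closed[OF W that] unfolding E_simps(3) Es(2) .
      show "c \<odot>\<^bsub>E'\<^esub> x \<in> ?W" if "x \<in> ?W" for c x
        using submodule.smult_closed[OF W _ that, of c] unfolding Es(3) by simp
    qed
    have sub: "?W \<subseteq> E'.span (S (N0 + r * N))"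
      using PS[of N] unfolding B_def by (rule order_trans) (rule Int_lower2)
    obtain D :: "'m set" where D: "card D \<le> card (S (N0 + r * N))" "vectorspace.dim class_ring (E'.vs ?W) = card D"
    proof (rule E'.submodule_basis[OF S(1,2) W' sub])
      fix D :: "'m set" assume "card D \<le> card (S (N0 + r * N))" "vectorspace.dim class_ring (E'.vs ?W) = card D"
      then show thesis by (rule that)
    qed
    have eq: "E\<lparr>carrier := ?W\<rparr> = E'.vs ?W" unfolding E'(2) by simp
    have "real (vectorspace.dim (class_ring :: 'k ring) (E\<lparr>carrier := ?W\<rparr>)) \<le> C * (real (N0 + r * N) + 1) ^ n"
      unfolding eq D(2) using S(3)[of "N0 + r * N"] D(1) by simp
    also have "\<dots> \<le> \<bar>C\<bar> * ((real N0 + real r + 1) * (real N + 1)) ^ n"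
    proof (intro mult_mono power_mono)
      show "real (N0 + r * N) + 1 \<le> (real N0 + real r + 1) * (real N + 1)" by (simp add: algebra_simps)
    qed auto
    finally show ?thesis by (simp add: power_mult_distrib mult.assoc)
  qed
  then show "\<exists>c. \<forall>N. real (vectorspace.dim (class_ring :: 'k ring) (E\<lparr>carrier := power_space U M V F N\<rparr>)) \<le> c * (real N + 1) ^ n"
    by blast
qed

section \<open>Weight modules over skew group rings\<close>

lemma invariant_k_algebra:
  assumes A: "k_algebra A" and act: "\<And>g. g \<in> carrier G \<Longrightarrow> alg_hom A A (act g)"
  shows "k_algebra (invariant_alg A G act)"
proof -
  interpret A: kalg A using A by (rule kalgI)
  note h = alg_homD[OF act]
  have zero: "act g \<zero>\<^bsub>A\<^esub> = \<zero>\<^bsub>A\<^esub>" if "g \<in> carrier G" for g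
    using h(5)[OF that, of "\<zero>\<^bsub>A\<^esub>" 0] by (simp add: h(1)[OF that])
  show ?thesis
  proof (rule k_algebraI)
    show "ring (invariant_alg A G act)"
    proof (rule ringI)
      show "abelian_group (invariant_alg A G act)"
      proof (rule abelian_groupI)
        fix x assume x: "x \<in> carrier (invariant_alg A G act)"
        then show "\<exists>y\<in>carrier (invariant_alg A G act). y \<oplus>\<^bsub>invariant_alg A G act\<^esub> x = \<zero>\<^bsub>invariant_alg A G act\<^esub>"
          using h(5)[of _ x "-1"]
          by (intro bexI[of _ "(-1) \<odot>\<^bsub>A\<^esub> x"]) (simp_all add: invariant_alg_def A.sm_minus A.l_neg)
      qed (simp_all add: invariant_alg_def zero h A.a_ac)
      show "Group.monoid (invariant_alg A G act)"
        by (rule monoidI) (simp_all add: invariant_alg_def h A.m_assoc)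
    qed (simp_all add: invariant_alg_def h A.l_distr A.r_distr)
  qed (simp_all add: invariant_alg_def h A.sm_l_distr A.sm_r_distr A.sm_assoc A.sm_mult_left A.sm_mult_right)
qed

lemma invariant_simps: "carrier (invariant_alg A G act) = {a \<in> carrier A. \<forall>g\<in>carrier G. act g a = a}"
  "x \<oplus>\<^bsub>invariant_alg A G act\<^esub> y = x \<oplus>\<^bsub>A\<^esub> y" "x \<otimes>\<^bsub>invariant_alg A G act\<^esub> y = x \<otimes>\<^bsub>A\<^esub> y"
  "\<zero>\<^bsub>invariant_alg A G act\<^esub> = \<zero>\<^bsub>A\<^esub>" "\<one>\<^bsub>invariant_alg A G act\<^esub> = \<one>\<^bsub>A\<^esub>"
  "c \<odot>\<^bsub>invariant_alg A G act\<^esub> x = c \<odot>\<^bsub>A\<^esub> x"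
  by (simp_all add: invariant_alg_def)

text \<open>The interface through which D(a,\<sigma>) * G is seen by the module theory.
  \<open>\<gamma> g\<close> are the group elements in the skew ring, and \<open>Y J\<close> are the
  monomials, whose exponents matter on {1..n} only. Spanning is expressed by the two induction
  rules, so that no tensors have to be handled.\<close>

locale skew_act = U: kalg U + A: kalg A + D: kalg D + Dc: cring D + G: group G
  for U :: "('k::field_char_0, 'u) module" and A :: "('k, 'a) module" and D :: "('k, 'd) module"
    and G :: "('g, 'z) monoid_scheme" +
  fixes j :: "'a \<Rightarrow> 'u" and \<gamma> :: "'g \<Rightarrow> 'u" and \<iota> :: "'d \<Rightarrow> 'a"
    and actA :: "'g \<Rightarrow> 'a \<Rightarrow> 'a" and actD :: "'g \<Rightarrow> 'd \<Rightarrow> 'd" and Y :: "(nat \<Rightarrow> int) \<Rightarrow> 'a" and n :: nat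
  assumes finG: "finite (carrier G)"
    and j_hom: "alg_hom A U j" and \<iota>_hom: "alg_hom D A \<iota>"
    and \<gamma>_closed [simp]: "g \<in> carrier G \<Longrightarrow> \<gamma> g \<in> carrier U"
    and \<gamma>_mult: "g \<in> carrier G \<Longrightarrow> h \<in> carrier G \<Longrightarrow> \<gamma> (g \<otimes>\<^bsub>G\<^esub> h) = \<gamma> g \<otimes>\<^bsub>U\<^esub> \<gamma> h"
    and \<gamma>_one: "\<gamma> \<one>\<^bsub>G\<^esub> = \<one>\<^bsub>U\<^esub>"
    and \<gamma>_j: "g \<in> carrier G \<Longrightarrow> a \<in> carrier A \<Longrightarrow> \<gamma> g \<otimes>\<^bsub>U\<^esub> j a = j (actA g a) \<otimes>\<^bsub>U\<^esub> \<gamma> g"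
    and actA_hom: "g \<in> carrier G \<Longrightarrow> alg_hom A A (actA g)"
    and actA_mult: "g \<in> carrier G \<Longrightarrow> h \<in> carrier G \<Longrightarrow> a \<in> carrier A \<Longrightarrow> actA (g \<otimes>\<^bsub>G\<^esub> h) a = actA g (actA h a)"
    and actA_one: "a \<in> carrier A \<Longrightarrow> actA \<one>\<^bsub>G\<^esub> a = a"
    and actD_hom: "g \<in> carrier G \<Longrightarrow> alg_hom D D (actD g)"
    and actD_mult: "g \<in> carrier G \<Longrightarrow> h \<in> carrier G \<Longrightarrow> d \<in> carrier D \<Longrightarrow> actD (g \<otimes>\<^bsub>G\<^esub> h) d = actD g (actD h d)"
    and actD_one: "d \<in> carrier D \<Longrightarrow> actD \<one>\<^bsub>G\<^esub> d = d"
    and \<iota>_act: "g \<in> carrier G \<Longrightarrow> d \<in> carrier D \<Longrightarrow> \<iota> (actD g d) = actA g (\<iota> d)"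
    and U_induct: "\<And>u Q. u \<in> carrier U \<Longrightarrow> (\<And>a g. a \<in> carrier A \<Longrightarrow> g \<in> carrier G \<Longrightarrow> Q (j a \<otimes>\<^bsub>U\<^esub> \<gamma> g)) \<Longrightarrow>
        (\<And>x y. x \<in> carrier U \<Longrightarrow> y \<in> carrier U \<Longrightarrow> Q x \<Longrightarrow> Q y \<Longrightarrow> Q (x \<oplus>\<^bsub>U\<^esub> y)) \<Longrightarrow> Q u"
    and A_induct: "\<And>a Q. a \<in> carrier A \<Longrightarrow> (\<And>d J. d \<in> carrier D \<Longrightarrow> Q (\<iota> d \<otimes>\<^bsub>A\<^esub> Y J)) \<Longrightarrow>
        (\<And>x y. x \<in> carrier A \<Longrightarrow> y \<in> carrier A \<Longrightarrow> Q x \<Longrightarrow> Q y \<Longrightarrow> Q (x \<oplus>\<^bsub>A\<^esub> y)) \<Longrightarrow> Q a"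
    and Y_closed [simp]: "Y J \<in> carrier A"
    and Y_zero: "Y (\<lambda>_. 0) = \<one>\<^bsub>A\<^esub>"
    and Y_restrict: "Y (restrict J {1..n}) = Y J"
    and \<iota>_Y: "d \<in> carrier D \<Longrightarrow> \<exists>d'\<in>carrier D. \<iota> d \<otimes>\<^bsub>A\<^esub> Y J = Y J \<otimes>\<^bsub>A\<^esub> \<iota> d'"
    and Y_mult: "\<exists>c\<in>carrier D. Y J \<otimes>\<^bsub>A\<^esub> Y K = \<iota> c \<otimes>\<^bsub>A\<^esub> Y (\<lambda>i. J i + K i)"
    and actA_Y: "g \<in> carrier G \<Longrightarrow> \<exists>p. p permutes {1..n} \<and> (\<forall>J. actA g (Y J) = Y (J \<circ> p))"
begin

lemmas jD = alg_homD[OF j_hom] and \<iota>D = alg_homD[OF \<iota>_hom] and actAD = alg_homD[OF actA_hom] and actDD = alg_homD[OF actD_hom]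

text \<open>Not divided by the order of G. In characteristic zero the factor |G| is invertible and
  is removed where an actual average is wanted.\<close>

definition sumG :: 'u where "sumG = (\<Oplus>\<^bsub>U\<^esub>g\<in>carrier G. \<gamma> g)"

lemma sumG_closed [simp]: "sumG \<in> carrier U"
  unfolding sumG_def by (rule U.finsum_closed) auto

lemma \<gamma>_sumG: "g \<in> carrier G \<Longrightarrow> \<gamma> g \<otimes>\<^bsub>U\<^esub> sumG = sumG"
proof -
  assume g: "g \<in> carrier G"
  have "\<gamma> g \<otimes>\<^bsub>U\<^esub> sumG = (\<Oplus>\<^bsub>U\<^esub>h\<in>carrier G. \<gamma> g \<otimes>\<^bsub>U\<^esub> \<gamma> h)"
    unfolding sumG_def using g finG by (intro U.finsum_rdistr) auto
  also have "\<dots> = (\<Oplus>\<^bsub>U\<^esub>h\<in>carrier G. \<gamma> (g \<otimes>\<^bsub>G\<^esub> h))"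
    using g by (intro U.finsum_cong') (auto simp: \<gamma>_mult)
  also have "\<dots> = (\<Oplus>\<^bsub>U\<^esub>h\<in>(\<lambda>h. g \<otimes>\<^bsub>G\<^esub> h) ` carrier G. \<gamma> h)"
    using g by (intro U.finsum_reindex[symmetric]) (auto simp: inj_on_def)
  also have "(\<lambda>h. g \<otimes>\<^bsub>G\<^esub> h) ` carrier G = carrier G"
    using g G.surj_const_mult by simp
  finally show ?thesis by (simp add: sumG_def)
qed

definition AG :: "('k, 'a) module" where "AG = invariant_alg A G actA"
definition DG :: "('k, 'd) module" where "DG = invariant_alg D G actD"

lemma AG_simps: "carrier AG = {a \<in> carrier A. \<forall>g\<in>carrier G. actA g a = a}"
  "x \<oplus>\<^bsub>AG\<^esub> y = x \<oplus>\<^bsub>A\<^esub> y" "x \<otimes>\<^bsub>AG\<^esub> y = x \<otimes>\<^bsub>A\<^esub> y"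
  "\<zero>\<^bsub>AG\<^esub> = \<zero>\<^bsub>A\<^esub>" "\<one>\<^bsub>AG\<^esub> = \<one>\<^bsub>A\<^esub>" "c \<odot>\<^bsub>AG\<^esub> a = c \<odot>\<^bsub>A\<^esub> a"
  by (simp_all add: AG_def invariant_simps)

lemma DG_simps: "carrier DG = {a \<in> carrier D. \<forall>g\<in>carrier G. actD g a = a}"
  "d \<oplus>\<^bsub>DG\<^esub> d' = d \<oplus>\<^bsub>D\<^esub> d'" "d \<otimes>\<^bsub>DG\<^esub> d' = d \<otimes>\<^bsub>D\<^esub> d'"
  "\<zero>\<^bsub>DG\<^esub> = \<zero>\<^bsub>D\<^esub>" "\<one>\<^bsub>DG\<^esub> = \<one>\<^bsub>D\<^esub>" "c \<odot>\<^bsub>DG\<^esub> d = c \<odot>\<^bsub>D\<^esub> d"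
  by (simp_all add: DG_def invariant_simps)

sublocale AG: kalg AG
  unfolding AG_def by (rule kalgI, rule invariant_k_algebra[OF A.k_algebra actA_hom])

sublocale DG: kalg DG
  unfolding DG_def by (rule kalgI, rule invariant_k_algebra[OF D.k_algebra actD_hom])

lemma DG_cring: "cring DG"
  by (rule cring.intro[OF DG.ring_axioms], unfold_locales) (auto simp: DG_simps Dc.m_comm)

text \<open>On a fixed vector a product of \<open>sumG\<close> with a * h acts as the trace of a,
  the sum of all g(a), which is invariant. One trace serves all fixed vectors, which is why the
  statement extends additively from the products a * h to all of U.\<close>

lemma trace_exists:
  assumes M: "left_module U M" and u: "u \<in> carrier U"
  shows "\<exists>y\<in>carrier AG. \<forall>t\<in>carrier M. (\<forall>g\<in>carrier G. \<gamma> g \<odot>\<^bsub>M\<^esub> t = t) \<longrightarrow> sumG \<odot>\<^bsub>M\<^esub> (u \<odot>\<^bsub>M\<^esub> t) = j y \<odot>\<^bsub>M\<^esub> t"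
  using u
proof (rule U_induct)
  interpret M: left_module U M by fact
  fix a h assume a: "a \<in> carrier A" and h: "h \<in> carrier G"
  define y where "y = (\<Oplus>\<^bsub>A\<^esub>g\<in>carrier G. actA g a)"
  have yA: "y \<in> carrier A" unfolding y_def using a by (auto intro!: A.finsum_closed simp: actAD)
  have "actA g y = y" if g: "g \<in> carrier G" for g
  proof -
    have sum: "actA g (\<Oplus>\<^bsub>A\<^esub>h\<in>F. actA h a) = (\<Oplus>\<^bsub>A\<^esub>h\<in>F. actA g (actA h a))" if "finite F" "F \<subseteq> carrier G" for F
      using that
    proof (induction F rule: finite_induct)
      case empty
      have "actA g (0 \<odot>\<^bsub>A\<^esub> \<zero>\<^bsub>A\<^esub>) = 0 \<odot>\<^bsub>A\<^esub> actA g \<zero>\<^bsub>A\<^esub>" using g by (simp only: actAD A.zero_closed)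
      then show ?case using g by (simp add: actAD)
    next
      case (insert x F)
      then have "(\<Oplus>\<^bsub>A\<^esub>h\<in>F. actA h a) \<in> carrier A" using a by (auto intro!: A.finsum_closed simp: actAD)
      with insert show ?case using g a by (subst (1 2) A.finsum_insert) (auto simp: actAD)
    qed
    have "actA g y = (\<Oplus>\<^bsub>A\<^esub>h\<in>carrier G. actA g (actA h a))" unfolding y_def by (rule sum) (use finG in auto)
    also have "\<dots> = (\<Oplus>\<^bsub>A\<^esub>h\<in>carrier G. actA (g \<otimes>\<^bsub>G\<^esub> h) a)"
      using g a by (intro A.finsum_cong') (auto simp: actA_mult actAD)
    also have "\<dots> = (\<Oplus>\<^bsub>A\<^esub>h\<in>(\<lambda>h. g \<otimes>\<^bsub>G\<^esub> h) ` carrier G. actA h a)"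
      using g a by (intro A.finsum_reindex[symmetric]) (auto simp: inj_on_def actAD)
    also have "(\<lambda>h. g \<otimes>\<^bsub>G\<^esub> h) ` carrier G = carrier G"
      using g G.surj_const_mult by simp
    finally show ?thesis by (simp add: y_def)
  qed
  then have "y \<in> carrier AG" using yA by (simp add: AG_simps)
  moreover have "sumG \<odot>\<^bsub>M\<^esub> ((j a \<otimes>\<^bsub>U\<^esub> \<gamma> h) \<odot>\<^bsub>M\<^esub> t) = j y \<odot>\<^bsub>M\<^esub> t"
    if t: "t \<in> carrier M" "\<forall>g\<in>carrier G. \<gamma> g \<odot>\<^bsub>M\<^esub> t = t" for t
  proof -
    have fin: "(\<Oplus>\<^bsub>U\<^esub>g\<in>F. \<gamma> g) \<odot>\<^bsub>M\<^esub> (j a \<odot>\<^bsub>M\<^esub> t) = j (\<Oplus>\<^bsub>A\<^esub>g\<in>F. actA g a) \<odot>\<^bsub>M\<^esub> t"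
      if "finite F" "F \<subseteq> carrier G" for F
      using that
    proof (induction F rule: finite_induct)
      case empty
      have "j (0 \<odot>\<^bsub>A\<^esub> \<zero>\<^bsub>A\<^esub>) = 0 \<odot>\<^bsub>U\<^esub> j \<zero>\<^bsub>A\<^esub>" by (simp only: jD A.zero_closed)
      then have "j \<zero>\<^bsub>A\<^esub> = \<zero>\<^bsub>U\<^esub>" by (simp add: jD)
      then show ?case using a t by (simp add: M.smult_zero_left M.smult_closed jD)
    next
      case (insert g F)
      have g: "g \<in> carrier G" and F: "F \<subseteq> carrier G" using insert by auto
      have cl: "(\<Oplus>\<^bsub>U\<^esub>g\<in>F. \<gamma> g) \<in> carrier U" "(\<Oplus>\<^bsub>A\<^esub>g\<in>F. actA g a) \<in> carrier A"
        using F a by (auto intro!: U.finsum_closed A.finsum_closed simp: actAD)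
      have e1: "(\<Oplus>\<^bsub>U\<^esub>g\<in>insert g F. \<gamma> g) = \<gamma> g \<oplus>\<^bsub>U\<^esub> (\<Oplus>\<^bsub>U\<^esub>g\<in>F. \<gamma> g)"
        using insert g F by (intro U.finsum_insert) auto
      have e2: "(\<Oplus>\<^bsub>A\<^esub>g\<in>insert g F. actA g a) = actA g a \<oplus>\<^bsub>A\<^esub> (\<Oplus>\<^bsub>A\<^esub>g\<in>F. actA g a)"
        using insert g F a by (intro A.finsum_insert) (auto simp: actAD)
      have "\<gamma> g \<odot>\<^bsub>M\<^esub> (j a \<odot>\<^bsub>M\<^esub> t) = j (actA g a) \<odot>\<^bsub>M\<^esub> (\<gamma> g \<odot>\<^bsub>M\<^esub> t)"
      proof -
        have "\<gamma> g \<odot>\<^bsub>M\<^esub> (j a \<odot>\<^bsub>M\<^esub> t) = (j (actA g a) \<otimes>\<^bsub>U\<^esub> \<gamma> g) \<odot>\<^bsub>M\<^esub> t"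
          using g a t M.smult_assoc[of "\<gamma> g" "j a" t] by (simp add: jD \<gamma>_j)
        also have "\<dots> = j (actA g a) \<odot>\<^bsub>M\<^esub> (\<gamma> g \<odot>\<^bsub>M\<^esub> t)"
          using g a t by (intro M.smult_assoc) (auto simp: jD actAD)
        finally show ?thesis .
      qed
      then show ?case unfolding e1 e2 using g a t cl insert.IH[OF F]
        by (simp add: M.smult_l_distr M.smult_closed jD actAD)
    qed
    have "(j a \<otimes>\<^bsub>U\<^esub> \<gamma> h) \<odot>\<^bsub>M\<^esub> t = j a \<odot>\<^bsub>M\<^esub> t" using a h t by (simp add: M.smult_assoc jD)
    then show ?thesis using fin[OF finG] by (simp add: sumG_def y_def)
  qed
  ultimately show "\<exists>y\<in>carrier AG. (\<forall>t\<in>carrier M. (\<forall>g\<in>carrier G. \<gamma> g \<odot>\<^bsub>M\<^esub> t = t) \<longrightarrow>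
     sumG \<odot>\<^bsub>M\<^esub> ((j a \<otimes>\<^bsub>U\<^esub> \<gamma> h) \<odot>\<^bsub>M\<^esub> t) = j y \<odot>\<^bsub>M\<^esub> t)" by blast
next
  interpret M: left_module U M by fact
  fix x x' assume x: "x \<in> carrier U" "x' \<in> carrier U"
    and IH: "\<exists>y\<in>carrier AG. (\<forall>t\<in>carrier M. (\<forall>g\<in>carrier G. \<gamma> g \<odot>\<^bsub>M\<^esub> t = t) \<longrightarrow>
        sumG \<odot>\<^bsub>M\<^esub> (x \<odot>\<^bsub>M\<^esub> t) = j y \<odot>\<^bsub>M\<^esub> t)"
      "\<exists>y\<in>carrier AG. (\<forall>t\<in>carrier M. (\<forall>g\<in>carrier G. \<gamma> g \<odot>\<^bsub>M\<^esub> t = t) \<longrightarrow>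
        sumG \<odot>\<^bsub>M\<^esub> (x' \<odot>\<^bsub>M\<^esub> t) = j y \<odot>\<^bsub>M\<^esub> t)"
  obtain y where y: "y \<in> carrier AG" "\<And>t. t \<in> carrier M \<Longrightarrow> \<forall>g\<in>carrier G. \<gamma> g \<odot>\<^bsub>M\<^esub> t = t \<Longrightarrow>
        sumG \<odot>\<^bsub>M\<^esub> (x \<odot>\<^bsub>M\<^esub> t) = j y \<odot>\<^bsub>M\<^esub> t" using IH(1) by blast
  obtain y' where y': "y' \<in> carrier AG" "\<And>t. t \<in> carrier M \<Longrightarrow> \<forall>g\<in>carrier G. \<gamma> g \<odot>\<^bsub>M\<^esub> t = t \<Longrightarrow>
        sumG \<odot>\<^bsub>M\<^esub> (x' \<odot>\<^bsub>M\<^esub> t) = j y' \<odot>\<^bsub>M\<^esub> t" using IH(2) by blast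
  have yA: "y \<in> carrier A" "y' \<in> carrier A" using y y' by (simp_all add: AG_simps)
  show "\<exists>y\<in>carrier AG. (\<forall>t\<in>carrier M. (\<forall>g\<in>carrier G. \<gamma> g \<odot>\<^bsub>M\<^esub> t = t) \<longrightarrow>
        sumG \<odot>\<^bsub>M\<^esub> ((x \<oplus>\<^bsub>U\<^esub> x') \<odot>\<^bsub>M\<^esub> t) = j y \<odot>\<^bsub>M\<^esub> t)"
  proof (intro bexI[of _ "y \<oplus>\<^bsub>AG\<^esub> y'"] allI impI ballI)
    fix t assume t: "t \<in> carrier M" "\<forall>g\<in>carrier G. \<gamma> g \<odot>\<^bsub>M\<^esub> t = t"
    show "sumG \<odot>\<^bsub>M\<^esub> ((x \<oplus>\<^bsub>U\<^esub> x') \<odot>\<^bsub>M\<^esub> t) = j (y \<oplus>\<^bsub>AG\<^esub> y') \<odot>\<^bsub>M\<^esub> t"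
      using x t y(2)[OF t] y'(2)[OF t] yA
      by (simp add: M.smult_l_distr M.smult_r_distr M.smult_closed AG_simps jD)
  qed (use y y' in \<open>simp add: AG.a_closed\<close>)
qed

subsection \<open>The two-sided ideal of the averaging element\<close>

text \<open>An element of the two-sided ideal generated by \<open>sumG\<close> is kept as the list
  of its summands, because the finitely many outer factors in an expression of 1 are needed again
  when T is compared with its fixed vectors.\<close>

fun ideal_sum :: "('u \<times> 'u) list \<Rightarrow> 'u" where
  "ideal_sum [] = \<zero>\<^bsub>U\<^esub>"
| "ideal_sum ((a, w) # xs) = a \<otimes>\<^bsub>U\<^esub> sumG \<otimes>\<^bsub>U\<^esub> w \<oplus>\<^bsub>U\<^esub> ideal_sum xs"

abbreviation pairs where "pairs \<equiv> lists (carrier U \<times> carrier U)"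

lemma ideal_sum_closed [simp]: "xs \<in> pairs \<Longrightarrow> ideal_sum xs \<in> carrier U"
  by (induction xs rule: ideal_sum.induct) auto

lemma ideal_sum_append: "xs \<in> pairs \<Longrightarrow> ys \<in> pairs \<Longrightarrow> ideal_sum (xs @ ys) = ideal_sum xs \<oplus>\<^bsub>U\<^esub> ideal_sum ys"
  by (induction xs rule: ideal_sum.induct) (auto simp: U.a_assoc)

lemma ideal_sum_left: "xs \<in> pairs \<Longrightarrow> u \<in> carrier U \<Longrightarrow> ideal_sum (map (\<lambda>(a, w). (u \<otimes>\<^bsub>U\<^esub> a, w)) xs) = u \<otimes>\<^bsub>U\<^esub> ideal_sum xs"
  by (induction xs rule: ideal_sum.induct) (auto simp: U.r_distr U.m_assoc)

lemma ideal_sum_right: "xs \<in> pairs \<Longrightarrow> u \<in> carrier U \<Longrightarrow> ideal_sum (map (\<lambda>(a, w). (a, w \<otimes>\<^bsub>U\<^esub> u)) xs) = ideal_sum xs \<otimes>\<^bsub>U\<^esub> u"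
  by (induction xs rule: ideal_sum.induct) (auto simp: U.l_distr U.m_assoc)

definition sumG_ideal :: "'u set" where "sumG_ideal = ideal_sum ` pairs"

lemma sumG_ideal_closed: "x \<in> sumG_ideal \<Longrightarrow> y \<in> sumG_ideal \<Longrightarrow> x \<oplus>\<^bsub>U\<^esub> y \<in> sumG_ideal"
  "x \<in> sumG_ideal \<Longrightarrow> u \<in> carrier U \<Longrightarrow> u \<otimes>\<^bsub>U\<^esub> x \<in> sumG_ideal"
  "x \<in> sumG_ideal \<Longrightarrow> u \<in> carrier U \<Longrightarrow> x \<otimes>\<^bsub>U\<^esub> u \<in> sumG_ideal"
  "\<zero>\<^bsub>U\<^esub> \<in> sumG_ideal" "sumG \<in> sumG_ideal" "sumG_ideal \<subseteq> carrier U"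
proof -
  show "x \<in> sumG_ideal \<Longrightarrow> y \<in> sumG_ideal \<Longrightarrow> x \<oplus>\<^bsub>U\<^esub> y \<in> sumG_ideal"
  proof -
    assume "x \<in> sumG_ideal" "y \<in> sumG_ideal"
    then obtain xs ys where xs: "xs \<in> pairs" "x = ideal_sum xs" "ys \<in> pairs" "y = ideal_sum ys"
      by (auto simp: sumG_ideal_def)
    then show ?thesis unfolding sumG_ideal_def xs(2,4) ideal_sum_append[OF xs(1,3), symmetric] by auto
  qed
  show "x \<in> sumG_ideal \<Longrightarrow> u \<in> carrier U \<Longrightarrow> u \<otimes>\<^bsub>U\<^esub> x \<in> sumG_ideal"
  proof -
    assume "x \<in> sumG_ideal" and u: "u \<in> carrier U"
    then obtain xs where xs: "xs \<in> pairs" "x = ideal_sum xs" by (auto simp: sumG_ideal_def)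
    have "map (\<lambda>(a, w). (u \<otimes>\<^bsub>U\<^esub> a, w)) xs \<in> pairs" using xs u by (auto simp: in_lists_conv_set)
    then show ?thesis unfolding sumG_ideal_def xs(2) ideal_sum_left[OF xs(1) u, symmetric] by (rule imageI)
  qed
  show "x \<in> sumG_ideal \<Longrightarrow> u \<in> carrier U \<Longrightarrow> x \<otimes>\<^bsub>U\<^esub> u \<in> sumG_ideal"
  proof -
    assume "x \<in> sumG_ideal" and u: "u \<in> carrier U"
    then obtain xs where xs: "xs \<in> pairs" "x = ideal_sum xs" by (auto simp: sumG_ideal_def)
    have "map (\<lambda>(a, w). (a, w \<otimes>\<^bsub>U\<^esub> u)) xs \<in> pairs" using xs u by (auto simp: in_lists_conv_set)
    then show ?thesis unfolding sumG_ideal_def xs(2) ideal_sum_right[OF xs(1) u, symmetric] by (rule imageI)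
  qed
  show "\<zero>\<^bsub>U\<^esub> \<in> sumG_ideal" unfolding sumG_ideal_def by (rule image_eqI[of _ _ "[]"]) auto
  show "sumG \<in> sumG_ideal" unfolding sumG_ideal_def
    by (rule image_eqI[of _ _ "[(\<one>\<^bsub>U\<^esub>, \<one>\<^bsub>U\<^esub>)]"]) auto
  show "sumG_ideal \<subseteq> carrier U" unfolding sumG_ideal_def by (rule image_subsetI) (rule ideal_sum_closed)
qed

text \<open>Commuting with elements of \<open>D\<close> successively removes all group elements \<open>g \<noteq> 1\<close> from the
  averaging element; what remains is \<open>\<Prod>\<^bsub>g\<noteq>1\<^esub> (d\<^sub>g - g d\<^sub>g)\<close>, on which \<open>\<chi>\<close> does not vanish.\<close>
lemma one_in_sumG_ideal:
  assumes simple: "simple_ring A" and \<chi>: "D.character \<chi>"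
    and ker: "\<And>d. d \<in> carrier D \<Longrightarrow> \<iota> d = \<zero>\<^bsub>A\<^esub> \<Longrightarrow> \<chi> d = 0"
    and sep: "\<And>g. g \<in> carrier G \<Longrightarrow> g \<noteq> \<one>\<^bsub>G\<^esub> \<Longrightarrow> \<exists>d\<in>carrier D. \<chi> (actD g d) \<noteq> \<chi> d"
  shows "\<one>\<^bsub>U\<^esub> \<in> sumG_ideal"
proof -
  have step: "\<exists>f. (\<forall>g\<in>carrier G. f g \<in> carrier D) \<and> \<chi> (f \<one>\<^bsub>G\<^esub>) \<noteq> 0 \<and> (\<forall>g\<in>F. f g = \<zero>\<^bsub>D\<^esub>) \<and>
     (\<Oplus>\<^bsub>U\<^esub>g\<in>carrier G. j (\<iota> (f g)) \<otimes>\<^bsub>U\<^esub> \<gamma> g) \<in> sumG_ideal"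
    if "finite F" "F \<subseteq> carrier G - {\<one>\<^bsub>G\<^esub>}" for F
    using that
  proof (induction F rule: finite_induct)
    case empty
    have "(\<Oplus>\<^bsub>U\<^esub>g\<in>carrier G. j (\<iota> \<one>\<^bsub>D\<^esub>) \<otimes>\<^bsub>U\<^esub> \<gamma> g) = sumG"
      unfolding sumG_def by (intro U.finsum_cong') (auto simp: jD \<iota>D)
    then show ?case using sumG_ideal_closed(5) D.characterD(4)[OF \<chi>] by (intro exI[of _ "\<lambda>_. \<one>\<^bsub>D\<^esub>"]) auto
  next
    case (insert h F)
    then obtain f where f: "\<And>g. g \<in> carrier G \<Longrightarrow> f g \<in> carrier D" "\<chi> (f \<one>\<^bsub>G\<^esub>) \<noteq> 0" "\<And>g. g \<in> F \<Longrightarrow> f g = \<zero>\<^bsub>D\<^esub>"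
      "(\<Oplus>\<^bsub>U\<^esub>g\<in>carrier G. j (\<iota> (f g)) \<otimes>\<^bsub>U\<^esub> \<gamma> g) \<in> sumG_ideal" by auto
    have h: "h \<in> carrier G" "h \<noteq> \<one>\<^bsub>G\<^esub>" using insert by auto
    obtain d where d: "d \<in> carrier D" "\<chi> (actD h d) \<noteq> \<chi> d" using sep[OF h] by blast
    define z where "z = (\<Oplus>\<^bsub>U\<^esub>g\<in>carrier G. j (\<iota> (f g)) \<otimes>\<^bsub>U\<^esub> \<gamma> g)"
    define d' where "d' = \<ominus>\<^bsub>D\<^esub> actD h d"
    have d': "d' \<in> carrier D" using d h by (simp add: d'_def actDD)
    \<comment> \<open>The coefficient at g of z d - (h d) z is f(g) times g d - h d. It vanishes at
      g = h, keeps the earlier zeros, and at g = 1 multiplies f(1) by d - h d, on which \<chi> is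
      nonzero.\<close>
    define f' where "f' g = f g \<otimes>\<^bsub>D\<^esub> actD g d \<oplus>\<^bsub>D\<^esub> d' \<otimes>\<^bsub>D\<^esub> f g" for g
    have zU: "z \<in> carrier U" unfolding z_def using f by (auto intro!: U.finsum_closed simp: jD \<iota>D)
    have fin: "z \<otimes>\<^bsub>U\<^esub> j (\<iota> d) = (\<Oplus>\<^bsub>U\<^esub>g\<in>carrier G. j (\<iota> (f g)) \<otimes>\<^bsub>U\<^esub> \<gamma> g \<otimes>\<^bsub>U\<^esub> j (\<iota> d))"
      unfolding z_def using f d finG by (intro U.finsum_ldistr) (auto simp: jD \<iota>D)
    have fin': "j (\<iota> d') \<otimes>\<^bsub>U\<^esub> z = (\<Oplus>\<^bsub>U\<^esub>g\<in>carrier G. j (\<iota> d') \<otimes>\<^bsub>U\<^esub> (j (\<iota> (f g)) \<otimes>\<^bsub>U\<^esub> \<gamma> g))"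
      unfolding z_def using f d' finG by (intro U.finsum_rdistr) (auto simp: jD \<iota>D)
    have "z \<otimes>\<^bsub>U\<^esub> j (\<iota> d) \<oplus>\<^bsub>U\<^esub> j (\<iota> d') \<otimes>\<^bsub>U\<^esub> z = (\<Oplus>\<^bsub>U\<^esub>g\<in>carrier G.
        j (\<iota> (f g)) \<otimes>\<^bsub>U\<^esub> \<gamma> g \<otimes>\<^bsub>U\<^esub> j (\<iota> d) \<oplus>\<^bsub>U\<^esub> j (\<iota> d') \<otimes>\<^bsub>U\<^esub> (j (\<iota> (f g)) \<otimes>\<^bsub>U\<^esub> \<gamma> g))"
      unfolding fin fin' using f d d' by (intro U.finsum_addf[symmetric]) (auto simp: jD \<iota>D)
    also have "\<dots> = (\<Oplus>\<^bsub>U\<^esub>g\<in>carrier G. j (\<iota> (f' g)) \<otimes>\<^bsub>U\<^esub> \<gamma> g)"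
    proof (rule U.finsum_cong'[OF refl])
      show "(\<lambda>g. j (\<iota> (f' g)) \<otimes>\<^bsub>U\<^esub> \<gamma> g) \<in> carrier G \<rightarrow> carrier U"
        using f d d' by (auto simp: f'_def jD \<iota>D actDD)
      fix g assume g: "g \<in> carrier G"
      note cl = f(1)[OF g] d(1) d' actDD(1)[OF g d(1)]
      have "j (\<iota> (f g)) \<otimes>\<^bsub>U\<^esub> \<gamma> g \<otimes>\<^bsub>U\<^esub> j (\<iota> d) = j (\<iota> (f g)) \<otimes>\<^bsub>U\<^esub> (j (\<iota> (actD g d)) \<otimes>\<^bsub>U\<^esub> \<gamma> g)"
        using g cl by (simp add: U.m_assoc jD \<iota>D \<gamma>_j \<iota>_act)
      then show "j (\<iota> (f g)) \<otimes>\<^bsub>U\<^esub> \<gamma> g \<otimes>\<^bsub>U\<^esub> j (\<iota> d) \<oplus>\<^bsub>U\<^esub> j (\<iota> d') \<otimes>\<^bsub>U\<^esub> (j (\<iota> (f g)) \<otimes>\<^bsub>U\<^esub> \<gamma> g) = j (\<iota> (f' g)) \<otimes>\<^bsub>U\<^esub> \<gamma> g"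
        using g cl by (simp add: f'_def jD \<iota>D U.l_distr U.m_assoc)
    qed
    finally have "(\<Oplus>\<^bsub>U\<^esub>g\<in>carrier G. j (\<iota> (f' g)) \<otimes>\<^bsub>U\<^esub> \<gamma> g) = z \<otimes>\<^bsub>U\<^esub> j (\<iota> d) \<oplus>\<^bsub>U\<^esub> j (\<iota> d') \<otimes>\<^bsub>U\<^esub> z" by simp
    moreover have "z \<otimes>\<^bsub>U\<^esub> j (\<iota> d) \<oplus>\<^bsub>U\<^esub> j (\<iota> d') \<otimes>\<^bsub>U\<^esub> z \<in> sumG_ideal"
      using f(4) d d' sumG_ideal_closed(1-3) unfolding z_def by (auto simp: jD \<iota>D)
    ultimately have 1: "(\<Oplus>\<^bsub>U\<^esub>g\<in>carrier G. j (\<iota> (f' g)) \<otimes>\<^bsub>U\<^esub> \<gamma> g) \<in> sumG_ideal" by simp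
    have f'D: "f' g \<in> carrier D" if "g \<in> carrier G" for g
      using f(1)[OF that] d d' that by (simp add: f'_def actDD)
    have "f' h = \<zero>\<^bsub>D\<^esub>"
      using f(1)[OF h(1)] actDD(1)[OF h(1) d(1)] by (simp add: f'_def d'_def Dc.m_comm[of "f h"] D.l_minus D.r_neg)
    moreover have "f' g = \<zero>\<^bsub>D\<^esub>" if "g \<in> F" for g
      using f(3)[OF that] d d' that insert.prems by (auto simp: f'_def actDD)
    moreover have "\<chi> (f' \<one>\<^bsub>G\<^esub>) \<noteq> 0"
      using f(1)[of "\<one>\<^bsub>G\<^esub>"] f(2) d h actDD(1)[OF h(1) d(1)] actDD(1)[OF G.one_closed d(1)]
      by (simp add: f'_def d'_def actD_one D.characterD[OF \<chi>])
    ultimately show ?case using 1 f'D by (intro exI[of _ f']) auto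
  qed
  obtain f where f: "\<And>g. g \<in> carrier G \<Longrightarrow> f g \<in> carrier D" "\<chi> (f \<one>\<^bsub>G\<^esub>) \<noteq> 0" "\<And>g. g \<in> carrier G - {\<one>\<^bsub>G\<^esub>} \<Longrightarrow> f g = \<zero>\<^bsub>D\<^esub>"
      "(\<Oplus>\<^bsub>U\<^esub>g\<in>carrier G. j (\<iota> (f g)) \<otimes>\<^bsub>U\<^esub> \<gamma> g) \<in> sumG_ideal"
    using step[of "carrier G - {\<one>\<^bsub>G\<^esub>}"] finG by auto
  have z: "j \<zero>\<^bsub>A\<^esub> = \<zero>\<^bsub>U\<^esub>" using jD(5)[of "\<zero>\<^bsub>A\<^esub>" 0] by (simp add: jD)
  have \<iota>z: "\<iota> \<zero>\<^bsub>D\<^esub> = \<zero>\<^bsub>A\<^esub>" using \<iota>D(5)[of "\<zero>\<^bsub>D\<^esub>" 0] by (simp add: \<iota>D)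
  have "(\<Oplus>\<^bsub>U\<^esub>g\<in>carrier G. j (\<iota> (f g)) \<otimes>\<^bsub>U\<^esub> \<gamma> g) = (\<Oplus>\<^bsub>U\<^esub>g\<in>{\<one>\<^bsub>G\<^esub>}. j (\<iota> (f g)) \<otimes>\<^bsub>U\<^esub> \<gamma> g)"
    using f finG by (intro U.add.finprod_mono_neutral_cong_right) (auto simp: jD \<iota>D z \<iota>z)
  also have "\<dots> = j (\<iota> (f \<one>\<^bsub>G\<^esub>))" using f(1)[OF G.one_closed] by (simp add: \<gamma>_one jD \<iota>D U.finsum_insert)
  finally have in_ideal: "j (\<iota> (f \<one>\<^bsub>G\<^esub>)) \<in> sumG_ideal" using f(4) by simp
  \<comment> \<open>The ideal is contracted to A. There it contains the image of f(1), which is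
    nonzero because \<chi> vanishes on the kernel of \<iota>; simplicity of A then makes the
    contraction everything.\<close>
  let ?I = "{a \<in> carrier A. j a \<in> sumG_ideal}"
  have "ideal ?I A"
    by (rule A.ideal_criterion) (auto simp: z jD sumG_ideal_closed)
  moreover have "\<iota> (f \<one>\<^bsub>G\<^esub>) \<in> ?I" using in_ideal f(1) by (simp add: \<iota>D)
  moreover have "\<iota> (f \<one>\<^bsub>G\<^esub>) \<noteq> \<zero>\<^bsub>A\<^esub>" using ker f by auto
  ultimately have "?I = carrier A" using simple unfolding simple_ring_def by blast
  then have "j \<one>\<^bsub>A\<^esub> \<in> sumG_ideal" by auto
  then show ?thesis by (simp add: jD)
qed

end

lemma (in comm_left_module) weight_in_gws:
  fixes \<psi> :: "'u \<Rightarrow> 'k::field"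
  assumes ideal: "ideal K R" and K: "\<And>c. c \<in> K \<Longrightarrow> c \<in> carrier R \<and> \<psi> c = 0" and x: "x \<in> carrier M"
    and w: "\<And>c. c \<in> carrier R \<Longrightarrow> c \<odot>\<^bsub>M\<^esub> x = sc (\<psi> c)" and z: "sc 0 = \<zero>\<^bsub>M\<^esub>"
  shows "x \<in> gws K"
  by (rule weight_vector_gws[OF ideal x]) (use K w z in auto)

section \<open>Irreducible modules generated by a weight vector\<close>

locale skew_module = skew_act U A D G j \<gamma> \<iota> actA actD Y n + T: kalg_module U T
  for U :: "('k::field_char_0, 'u) module" and A :: "('k, 'a) module" and D :: "('k, 'd) module"
    and G :: "('g, 'z) monoid_scheme" and j \<gamma> \<iota> actA actD Y n and T :: "('u, 'm) module" +
  fixes \<chi> :: "'d \<Rightarrow> 'k" and v :: 'm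
  assumes irr: "irreducible_module U T"
    and \<chi>: "D.character \<chi>" and v: "v \<in> carrier T" "v \<noteq> \<zero>\<^bsub>T\<^esub>"
    and weight: "d \<in> carrier D \<Longrightarrow> j (\<iota> d) \<odot>\<^bsub>T\<^esub> v = \<chi> d \<odot>\<^bsub>T.E\<^esub> v"
begin

lemma submodule_full: "left_submodule U N T \<Longrightarrow> x \<in> N \<Longrightarrow> x \<noteq> \<zero>\<^bsub>T\<^esub> \<Longrightarrow> N = carrier T"
  using irr by (auto simp: irreducible_module_def)

lemma generated:
  assumes x: "x \<in> carrier T" "x \<noteq> \<zero>\<^bsub>T\<^esub>" and t: "t \<in> carrier T"
  shows "\<exists>u\<in>carrier U. t = u \<odot>\<^bsub>T\<^esub> x"
proof -
  let ?N = "(\<lambda>u. u \<odot>\<^bsub>T\<^esub> x) ` carrier U"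
  have "left_submodule U ?N T"
    unfolding left_submodule_def additive_subgroup_def
  proof (intro conjI ballI T.M.add.subgroupI)
    show "?N \<subseteq> carrier T" using x by (auto intro!: T.smult_closed)
    show "?N \<noteq> {}" by auto
    fix y assume "y \<in> ?N"
    then obtain u where u: "u \<in> carrier U" "y = u \<odot>\<^bsub>T\<^esub> x" by auto
    show "\<ominus>\<^bsub>T\<^esub> y \<in> ?N" using u x T.smult_minus_left[of u x] by (intro image_eqI[of _ _ "\<ominus>\<^bsub>U\<^esub> u"]) auto
    fix z assume "z \<in> ?N"
    then obtain w where w: "w \<in> carrier U" "z = w \<odot>\<^bsub>T\<^esub> x" by auto
    show "y \<oplus>\<^bsub>T\<^esub> z \<in> ?N" using u w x T.smult_l_distr[of u w x] by (intro image_eqI[of _ _ "u \<oplus>\<^bsub>U\<^esub> w"]) auto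
  next
    fix a y assume "a \<in> carrier U" "y \<in> ?N"
    then show "a \<odot>\<^bsub>T\<^esub> y \<in> ?N" using x by (auto simp: T.smult_assoc[symmetric])
  qed
  moreover have "x \<in> ?N" using x by (intro image_eqI[of _ _ "\<one>\<^bsub>U\<^esub>"]) (auto simp: T.smult_one)
  ultimately show ?thesis using submodule_full[of ?N x] x t by auto
qed

lemma sc_closed [simp]: "x \<in> carrier T \<Longrightarrow> c \<odot>\<^bsub>T.E\<^esub> x \<in> carrier T"
  by (auto simp: T.E_simps intro!: T.smult_closed)

lemma sc_sc: "x \<in> carrier T \<Longrightarrow> c \<odot>\<^bsub>T.E\<^esub> (d \<odot>\<^bsub>T.E\<^esub> x) = (c * d) \<odot>\<^bsub>T.E\<^esub> x"
  using T.E.smult_assoc1[of c d x] by (simp add: T.E_simps(1))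

lemma sc_add: "x \<in> carrier T \<Longrightarrow> c \<odot>\<^bsub>T.E\<^esub> x \<oplus>\<^bsub>T\<^esub> d \<odot>\<^bsub>T.E\<^esub> x = (c + d) \<odot>\<^bsub>T.E\<^esub> x"
  using T.E.smult_l_distr[of c d x] by (simp add: T.E_simps(1,3))

lemma sc_one: "x \<in> carrier T \<Longrightarrow> 1 \<odot>\<^bsub>T.E\<^esub> x = x"
  using T.E.smult_one[of x] by (simp add: T.E_simps(1))

lemma sc_0: "x \<in> carrier T \<Longrightarrow> 0 \<odot>\<^bsub>T.E\<^esub> x = \<zero>\<^bsub>T\<^esub>"
  by (simp add: T.E_simps T.smult_zero_left)

lemma sc_zero: "c \<odot>\<^bsub>T.E\<^esub> \<zero>\<^bsub>T\<^esub> = \<zero>\<^bsub>T\<^esub>"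
  by (simp add: T.E_simps T.smult_zero_right)

lemma sc_eq_zero: "c \<odot>\<^bsub>T.E\<^esub> x = \<zero>\<^bsub>T\<^esub> \<Longrightarrow> x \<in> carrier T \<Longrightarrow> c \<noteq> 0 \<Longrightarrow> x = \<zero>\<^bsub>T\<^esub>"
  using sc_sc[of x "inverse c" c] sc_zero[of "inverse c"] sc_one[of x] by simp

lemma sc_inj: "x \<in> carrier T \<Longrightarrow> x \<noteq> \<zero>\<^bsub>T\<^esub> \<Longrightarrow> c \<odot>\<^bsub>T.E\<^esub> x = d \<odot>\<^bsub>T.E\<^esub> x \<Longrightarrow> c = d"
proof (rule ccontr)
  assume x: "x \<in> carrier T" "x \<noteq> \<zero>\<^bsub>T\<^esub>" and eq: "c \<odot>\<^bsub>T.E\<^esub> x = d \<odot>\<^bsub>T.E\<^esub> x" and "c \<noteq> d"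
  have "(c + - d) \<odot>\<^bsub>T.E\<^esub> x = d \<odot>\<^bsub>T.E\<^esub> x \<oplus>\<^bsub>T\<^esub> (- d) \<odot>\<^bsub>T.E\<^esub> x"
    using sc_add[OF x(1), of c "- d"] eq by simp
  also have "\<dots> = \<zero>\<^bsub>T\<^esub>" using sc_add[OF x(1), of d "- d"] sc_0[OF x(1)] by simp
  finally show False using sc_eq_zero[of "c + - d" x] x \<open>c \<noteq> d\<close> by simp
qed

definition b :: "(nat \<Rightarrow> int) \<Rightarrow> 'g \<Rightarrow> 'm" where "b J g = j (Y J) \<odot>\<^bsub>T\<^esub> (\<gamma> g \<odot>\<^bsub>T\<^esub> v)"

lemma b_closed [simp]: "g \<in> carrier G \<Longrightarrow> b J g \<in> carrier T"
  unfolding b_def using v by (auto intro!: T.smult_closed simp: jD)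

text \<open>Moving d past g replaces it by its transform under the inverse of g, so the vector g v
  has weight \<chi> composed with the action of that inverse.\<close>

lemma \<gamma>_weight:
  assumes d: "d \<in> carrier D" and g: "g \<in> carrier G"
  shows "\<exists>c. j (\<iota> d) \<odot>\<^bsub>T\<^esub> (\<gamma> g \<odot>\<^bsub>T\<^esub> v) = c \<odot>\<^bsub>T.E\<^esub> (\<gamma> g \<odot>\<^bsub>T\<^esub> v)"
proof -
  let ?d = "actD (inv\<^bsub>G\<^esub> g) d"
  have d': "?d \<in> carrier D" "actD g ?d = d"
    using actDD(1)[of "inv\<^bsub>G\<^esub> g"] d g actD_mult[of g "inv\<^bsub>G\<^esub> g" d] actD_one[of d] by auto
  have "j (\<iota> d) \<odot>\<^bsub>T\<^esub> (\<gamma> g \<odot>\<^bsub>T\<^esub> v) = (j (\<iota> d) \<otimes>\<^bsub>U\<^esub> \<gamma> g) \<odot>\<^bsub>T\<^esub> v"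
    using d g v by (intro T.smult_assoc[symmetric]) (auto simp: jD \<iota>D)
  also have "j (\<iota> d) \<otimes>\<^bsub>U\<^esub> \<gamma> g = \<gamma> g \<otimes>\<^bsub>U\<^esub> j (\<iota> ?d)"
    using \<gamma>_j[OF g, of "\<iota> ?d"] \<iota>_act[OF g d'(1)] d' by (simp add: \<iota>D)
  also have "(\<gamma> g \<otimes>\<^bsub>U\<^esub> j (\<iota> ?d)) \<odot>\<^bsub>T\<^esub> v = \<gamma> g \<odot>\<^bsub>T\<^esub> (\<chi> ?d \<odot>\<^bsub>T.E\<^esub> v)"
    using d' g v weight[OF d'(1)] T.smult_assoc[of "\<gamma> g" "j (\<iota> ?d)" v] by (simp add: jD \<iota>D)
  also have "\<dots> = \<chi> ?d \<odot>\<^bsub>T.E\<^esub> (\<gamma> g \<odot>\<^bsub>T\<^esub> v)" using g v by (intro T.smult_sc) auto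
  finally show ?thesis by blast
qed

lemma Y_weight:
  assumes d: "d \<in> carrier D" "d' \<in> carrier D" "\<iota> d \<otimes>\<^bsub>A\<^esub> Y J = Y J \<otimes>\<^bsub>A\<^esub> \<iota> d'"
    and x: "x \<in> carrier T" "j (\<iota> d') \<odot>\<^bsub>T\<^esub> x = c \<odot>\<^bsub>T.E\<^esub> x"
  shows "j (\<iota> d) \<odot>\<^bsub>T\<^esub> (j (Y J) \<odot>\<^bsub>T\<^esub> x) = c \<odot>\<^bsub>T.E\<^esub> (j (Y J) \<odot>\<^bsub>T\<^esub> x)"
proof -
  have "j (\<iota> d) \<odot>\<^bsub>T\<^esub> (j (Y J) \<odot>\<^bsub>T\<^esub> x) = (j (\<iota> d \<otimes>\<^bsub>A\<^esub> Y J)) \<odot>\<^bsub>T\<^esub> x"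
    using d(1) x(1) by (simp add: jD \<iota>D T.smult_assoc)
  also have "\<dots> = j (Y J) \<odot>\<^bsub>T\<^esub> (j (\<iota> d') \<odot>\<^bsub>T\<^esub> x)"
    unfolding d(3) using d(1,2) x(1) by (simp add: jD \<iota>D T.smult_assoc)
  finally show ?thesis unfolding x(2) using x by (simp add: T.smult_sc jD)
qed

lemma b_weight: "d \<in> carrier D \<Longrightarrow> g \<in> carrier G \<Longrightarrow> \<exists>c. j (\<iota> d) \<odot>\<^bsub>T\<^esub> b J g = c \<odot>\<^bsub>T.E\<^esub> b J g"
proof -
  assume d: "d \<in> carrier D" and g: "g \<in> carrier G"
  obtain d' where d': "d' \<in> carrier D" "\<iota> d \<otimes>\<^bsub>A\<^esub> Y J = Y J \<otimes>\<^bsub>A\<^esub> \<iota> d'" using \<iota>_Y[OF d] by blast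
  obtain c where "j (\<iota> d') \<odot>\<^bsub>T\<^esub> (\<gamma> g \<odot>\<^bsub>T\<^esub> v) = c \<odot>\<^bsub>T.E\<^esub> (\<gamma> g \<odot>\<^bsub>T\<^esub> v)" using \<gamma>_weight[OF d'(1) g] by blast
  moreover have "\<gamma> g \<odot>\<^bsub>T\<^esub> v \<in> carrier T" using g v by (simp add: T.smult_closed)
  ultimately show ?thesis unfolding b_def using Y_weight[OF d d'] by blast
qed

text \<open>T equals U v, and U is spanned by the products d Y^J g. As d acts on Y^J g v by a
  scalar, no coefficients from D remain.\<close>

lemma T_induct [consumes 1, case_names basis add]:
  assumes t: "t \<in> carrier T" and basis: "\<And>c J g. g \<in> carrier G \<Longrightarrow> Q (c \<odot>\<^bsub>T.E\<^esub> b J g)"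
    and add: "\<And>x y. x \<in> carrier T \<Longrightarrow> y \<in> carrier T \<Longrightarrow> Q x \<Longrightarrow> Q y \<Longrightarrow> Q (x \<oplus>\<^bsub>T\<^esub> y)"
  shows "Q t"
proof -
  obtain u where u: "u \<in> carrier U" "t = u \<odot>\<^bsub>T\<^esub> v" using generated[OF v t] by blast
  from u(1) have "Q (u \<odot>\<^bsub>T\<^esub> v)"
  proof (rule U_induct)
    fix a g assume a: "a \<in> carrier A" and g: "g \<in> carrier G"
    then have gv: "\<gamma> g \<odot>\<^bsub>T\<^esub> v \<in> carrier T" using v by (simp add: T.smult_closed)
    from a have "Q (j a \<odot>\<^bsub>T\<^esub> (\<gamma> g \<odot>\<^bsub>T\<^esub> v))"
    proof (rule A_induct)
      fix d J assume d: "d \<in> carrier D"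
      obtain c where "j (\<iota> d) \<odot>\<^bsub>T\<^esub> b J g = c \<odot>\<^bsub>T.E\<^esub> b J g" using b_weight[OF d g] by blast
      moreover have "j (\<iota> d \<otimes>\<^bsub>A\<^esub> Y J) \<odot>\<^bsub>T\<^esub> (\<gamma> g \<odot>\<^bsub>T\<^esub> v) = j (\<iota> d) \<odot>\<^bsub>T\<^esub> b J g"
        using d gv by (simp add: b_def jD \<iota>D T.smult_assoc)
      ultimately show "Q (j (\<iota> d \<otimes>\<^bsub>A\<^esub> Y J) \<odot>\<^bsub>T\<^esub> (\<gamma> g \<odot>\<^bsub>T\<^esub> v))" using basis[OF g] by simp
    next
      fix x y assume xy: "x \<in> carrier A" "y \<in> carrier A" "Q (j x \<odot>\<^bsub>T\<^esub> (\<gamma> g \<odot>\<^bsub>T\<^esub> v))" "Q (j y \<odot>\<^bsub>T\<^esub> (\<gamma> g \<odot>\<^bsub>T\<^esub> v))"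
      then show "Q (j (x \<oplus>\<^bsub>A\<^esub> y) \<odot>\<^bsub>T\<^esub> (\<gamma> g \<odot>\<^bsub>T\<^esub> v))"
        using add[OF _ _ xy(3,4)] gv by (simp add: jD T.smult_l_distr T.smult_closed)
    qed
    then show "Q ((j a \<otimes>\<^bsub>U\<^esub> \<gamma> g) \<odot>\<^bsub>T\<^esub> v)" using a g v by (simp add: T.smult_assoc jD)
  next
    fix x y assume xy: "x \<in> carrier U" "y \<in> carrier U" "Q (x \<odot>\<^bsub>T\<^esub> v)" "Q (y \<odot>\<^bsub>T\<^esub> v)"
    then show "Q ((x \<oplus>\<^bsub>U\<^esub> y) \<odot>\<^bsub>T\<^esub> v)" using add[OF _ _ xy(3,4)] v by (simp add: T.smult_l_distr T.smult_closed)
  qed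
  then show ?thesis using u by simp
qed

text \<open>A nonzero common eigenvector determines its eigenvalues, and comparing the actions of
  sums and products makes the eigenvalue a character. The ring \<Gamma> is left open because both D
  and its invariants are needed.\<close>

lemma weight_character:
  assumes \<Gamma>: "k_algebra \<Gamma>" and f: "alg_hom \<Gamma> A f" and x: "x \<in> carrier T" "x \<noteq> \<zero>\<^bsub>T\<^esub>"
    and w: "\<And>d. d \<in> carrier \<Gamma> \<Longrightarrow> \<exists>c. j (f d) \<odot>\<^bsub>T\<^esub> x = c \<odot>\<^bsub>T.E\<^esub> x"
  shows "\<exists>\<psi>. kalg.character \<Gamma> \<psi> \<and> (\<forall>d\<in>carrier \<Gamma>. j (f d) \<odot>\<^bsub>T\<^esub> x = \<psi> d \<odot>\<^bsub>T.E\<^esub> x)"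
proof -
  interpret \<Gamma>: kalg \<Gamma> using \<Gamma> by (rule kalgI)
  note fD = alg_homD[OF f]
  define \<psi> where "\<psi> d = (THE c. j (f d) \<odot>\<^bsub>T\<^esub> x = c \<odot>\<^bsub>T.E\<^esub> x)" for d
  have \<psi>: "\<psi> d = c" if "j (f d) \<odot>\<^bsub>T\<^esub> x = c \<odot>\<^bsub>T.E\<^esub> x" for d c
    unfolding \<psi>_def by (rule the_equality, rule that, rule sc_inj[OF x], simp add: that)
  have \<psi>w: "j (f d) \<odot>\<^bsub>T\<^esub> x = \<psi> d \<odot>\<^bsub>T.E\<^esub> x" if "d \<in> carrier \<Gamma>" for d using w[OF that] \<psi> by auto
  have "\<Gamma>.character \<psi>"
    unfolding \<Gamma>.character_def \<Gamma>.linear_fun_def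
  proof (intro conjI ballI allI)
    fix y z assume yz: "y \<in> carrier \<Gamma>" "z \<in> carrier \<Gamma>"
    have "j (f (y \<oplus>\<^bsub>\<Gamma>\<^esub> z)) \<odot>\<^bsub>T\<^esub> x = (\<psi> y + \<psi> z) \<odot>\<^bsub>T.E\<^esub> x"
      using yz x \<psi>w[OF yz(1)] \<psi>w[OF yz(2)] sc_add[OF x(1), of "\<psi> y" "\<psi> z"] by (simp add: fD jD T.smult_l_distr)
    then show "\<psi> (y \<oplus>\<^bsub>\<Gamma>\<^esub> z) = \<psi> y + \<psi> z" by (rule \<psi>)
    have "j (f (y \<otimes>\<^bsub>\<Gamma>\<^esub> z)) \<odot>\<^bsub>T\<^esub> x = j (f y) \<odot>\<^bsub>T\<^esub> (\<psi> z \<odot>\<^bsub>T.E\<^esub> x)"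
      using yz x \<psi>w[OF yz(2)] by (simp add: fD jD T.smult_assoc)
    also have "\<dots> = \<psi> z \<odot>\<^bsub>T.E\<^esub> (\<psi> y \<odot>\<^bsub>T.E\<^esub> x)"
      using yz x \<psi>w[OF yz(1)] by (simp add: T.smult_sc fD jD)
    also have "\<dots> = (\<psi> y * \<psi> z) \<odot>\<^bsub>T.E\<^esub> x" using x by (simp add: sc_sc mult.commute)
    finally show "\<psi> (y \<otimes>\<^bsub>\<Gamma>\<^esub> z) = \<psi> y * \<psi> z" by (rule \<psi>)
  next
    fix c y assume y: "y \<in> carrier \<Gamma>"
    have "j (f (c \<odot>\<^bsub>\<Gamma>\<^esub> y)) \<odot>\<^bsub>T\<^esub> x = (c * \<psi> y) \<odot>\<^bsub>T.E\<^esub> x"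
      using y x \<psi>w[OF y] by (simp add: fD jD T.sc_smult sc_sc)
    then show "\<psi> (c \<odot>\<^bsub>\<Gamma>\<^esub> y) = c * \<psi> y" by (rule \<psi>)
  next
    have "j (f \<one>\<^bsub>\<Gamma>\<^esub>) \<odot>\<^bsub>T\<^esub> x = 1 \<odot>\<^bsub>T.E\<^esub> x" using x by (simp add: fD jD T.smult_one sc_one)
    then show "\<psi> \<one>\<^bsub>\<Gamma>\<^esub> = 1" by (rule \<psi>)
  qed
  then show ?thesis using \<psi>w by blast
qed

text \<open>\<open>N\<close> stands for T or for its fixed vectors with scalars restricted to
  \<Gamma>; hence it is a separate record whose action is assumed to agree with that of T.\<close>

lemma weight_vector_in_gws:
  assumes \<Gamma>: "k_algebra \<Gamma>" "cring \<Gamma>" and f: "alg_hom \<Gamma> A f"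
    and N: "left_module \<Gamma> N" "\<And>d y. d \<odot>\<^bsub>N\<^esub> y = j (f d) \<odot>\<^bsub>T\<^esub> y" "\<zero>\<^bsub>N\<^esub> = \<zero>\<^bsub>T\<^esub>"
    and x: "x \<in> carrier N" "x \<in> carrier T"
    and \<psi>: "kalg.character \<Gamma> \<psi>" and w: "\<And>d. d \<in> carrier \<Gamma> \<Longrightarrow> j (f d) \<odot>\<^bsub>T\<^esub> x = \<psi> d \<odot>\<^bsub>T.E\<^esub> x"
  shows "x \<in> generalized_weight_space \<Gamma> N {d \<in> carrier \<Gamma>. \<psi> d = 0}"
proof -
  interpret \<Gamma>: kalg \<Gamma> using \<Gamma>(1) by (rule kalgI)
  interpret N: comm_left_module \<Gamma> N
    using N(1) \<Gamma>(2) by (simp add: comm_left_module_def)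
  have K: "{d \<in> carrier \<Gamma>. \<psi> d = 0} \<in> cofinite_maximal_ideals \<Gamma>" by (rule \<Gamma>.character_kernel[OF \<psi>])
  show ?thesis
  proof (rule N.weight_in_gws[where \<psi> = \<psi> and sc = "\<lambda>c. c \<odot>\<^bsub>T.E\<^esub> x"])
    show "ideal {d \<in> carrier \<Gamma>. \<psi> d = 0} \<Gamma>"
      using K by (auto simp: cofinite_maximal_ideals_def dest: maximalideal.axioms(1))
  qed (use N x w in \<open>auto simp: sc_0\<close>)
qed

lemma D_left_module: "left_module D (restrict_scalars (j \<circ> \<iota>) T)"
  by (rule left_module_restrict[OF T.left_module_axioms D.ring_axioms])
    (auto intro!: ring_hom_memI simp: jD \<iota>D)

lemma gws_T:
  assumes "x \<in> carrier T" "D.character \<psi>" "\<And>d. d \<in> carrier D \<Longrightarrow> j (\<iota> d) \<odot>\<^bsub>T\<^esub> x = \<psi> d \<odot>\<^bsub>T.E\<^esub> x"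
  shows "x \<in> generalized_weight_space D (restrict_scalars (j \<circ> \<iota>) T) {d \<in> carrier D. \<psi> d = 0}"
  by (rule weight_vector_in_gws[OF D.k_algebra Dc.cring_axioms \<iota>_hom D_left_module])
    (use assms in \<open>simp_all add: restrict_scalars_def\<close>)

lemma fin_gen_T: "fin_gen_module U T"
  unfolding fin_gen_module_def using v submodule_full by (intro exI[of _ "{v}"]) auto

lemma harish_chandra_T: "harish_chandra_module U D (j \<circ> \<iota>) T"
  unfolding harish_chandra_module_def
proof (intro conjI T.left_module_axioms fin_gen_T)
  interpret N: comm_left_module D "restrict_scalars (j \<circ> \<iota>) T"
    using D_left_module Dc.cring_axioms by (simp add: comm_left_module_def)
  have "internal_direct_sum (restrict_scalars (j \<circ> \<iota>) T) (cofinite_maximal_ideals D) N.gws"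
  proof (rule N.internal_direct_sum_gws)
    show "maximalideal \<nn> D" if "\<nn> \<in> cofinite_maximal_ideals D" for \<nn>
      using that by (simp add: cofinite_maximal_ideals_def)
    fix x Q assume x: "x \<in> carrier (restrict_scalars (j \<circ> \<iota>) T)" and zero: "Q \<zero>\<^bsub>restrict_scalars (j \<circ> \<iota>) T\<^esub>"
      and gws: "\<And>\<nn> w. \<nn> \<in> cofinite_maximal_ideals D \<Longrightarrow> w \<in> N.gws \<nn> \<Longrightarrow> Q w"
      and Qadd: "\<And>y z. y \<in> carrier (restrict_scalars (j \<circ> \<iota>) T) \<Longrightarrow> z \<in> carrier (restrict_scalars (j \<circ> \<iota>) T) \<Longrightarrow>
         Q y \<Longrightarrow> Q z \<Longrightarrow> Q (y \<oplus>\<^bsub>restrict_scalars (j \<circ> \<iota>) T\<^esub> z)"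
    from x have "x \<in> carrier T" by (simp add: restrict_scalars_def)
    then show "Q x"
    proof (induction rule: T_induct)
      case (basis c J g)
      show ?case
      \<comment> \<open>A spanning vector that happens to be zero has no weight and is covered by
        the zero clause of the rule.\<close>
      proof (cases "c \<odot>\<^bsub>T.E\<^esub> b J g = \<zero>\<^bsub>T\<^esub>")
        case True
        then show ?thesis using zero by (simp add: restrict_scalars_def)
      next
        case False
        have x: "c \<odot>\<^bsub>T.E\<^esub> b J g \<in> carrier T" using basis by simp
        have "\<exists>c'. j (\<iota> d) \<odot>\<^bsub>T\<^esub> (c \<odot>\<^bsub>T.E\<^esub> b J g) = c' \<odot>\<^bsub>T.E\<^esub> (c \<odot>\<^bsub>T.E\<^esub> b J g)" if d: "d \<in> carrier D" for d
        proof -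
          obtain c' where c': "j (\<iota> d) \<odot>\<^bsub>T\<^esub> b J g = c' \<odot>\<^bsub>T.E\<^esub> b J g" using b_weight[OF d basis] by blast
          have "j (\<iota> d) \<odot>\<^bsub>T\<^esub> (c \<odot>\<^bsub>T.E\<^esub> b J g) = c \<odot>\<^bsub>T.E\<^esub> (c' \<odot>\<^bsub>T.E\<^esub> b J g)"
            using d basis by (simp add: T.smult_sc jD \<iota>D c')
          also have "\<dots> = c' \<odot>\<^bsub>T.E\<^esub> (c \<odot>\<^bsub>T.E\<^esub> b J g)" using basis by (simp add: sc_sc mult.commute)
          finally show ?thesis by blast
        qed
        from weight_character[OF D.k_algebra \<iota>_hom x False this] obtain \<psi> where
          \<psi>: "D.character \<psi>" "\<And>d. d \<in> carrier D \<Longrightarrow> j (\<iota> d) \<odot>\<^bsub>T\<^esub> (c \<odot>\<^bsub>T.E\<^esub> b J g) = \<psi> d \<odot>\<^bsub>T.E\<^esub> (c \<odot>\<^bsub>T.E\<^esub> b J g)"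
          by blast
        show ?thesis by (rule gws[OF D.character_kernel[OF \<psi>(1)] gws_T[OF x \<psi>]])
      qed
    next
      case (add x y)
      then show ?case using Qadd[of x y] by (simp add: restrict_scalars_def)
    qed
  qed
  then show "internal_direct_sum T (cofinite_maximal_ideals D) N.gws"
    by (simp add: internal_direct_sum_restrict)
qed

lemma support_T: "{d \<in> carrier D. \<chi> d = 0} \<in> hc_support D (j \<circ> \<iota>) T"
  using D.character_kernel[OF \<chi>] gws_T[OF v(1) \<chi> weight] v(2) by (auto simp: hc_support_def)

subsection \<open>The fixed vectors\<close>

definition TG :: "('a, 'm) module" where
  "TG = (restrict_scalars j T)\<lparr>carrier := {t \<in> carrier T. \<forall>g\<in>carrier G. \<gamma> g \<odot>\<^bsub>T\<^esub> t = t}\<rparr>"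

lemma TG_simps: "carrier TG = {t \<in> carrier T. \<forall>g\<in>carrier G. \<gamma> g \<odot>\<^bsub>T\<^esub> t = t}"
  "\<zero>\<^bsub>TG\<^esub> = \<zero>\<^bsub>T\<^esub>" "x \<oplus>\<^bsub>TG\<^esub> y = x \<oplus>\<^bsub>T\<^esub> y" "a \<odot>\<^bsub>TG\<^esub> x = j a \<odot>\<^bsub>T\<^esub> x"
  by (simp_all add: TG_def restrict_scalars_def)

lemma \<gamma>_sc: "g \<in> carrier G \<Longrightarrow> x \<in> carrier T \<Longrightarrow> \<gamma> g \<odot>\<^bsub>T\<^esub> (c \<odot>\<^bsub>T.E\<^esub> x) = c \<odot>\<^bsub>T.E\<^esub> (\<gamma> g \<odot>\<^bsub>T\<^esub> x)"
  by (simp add: T.smult_sc)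

lemma j_fixed:
  assumes a: "a \<in> carrier AG" and t: "t \<in> carrier T" and g: "g \<in> carrier G"
  shows "\<gamma> g \<odot>\<^bsub>T\<^esub> (j a \<odot>\<^bsub>T\<^esub> t) = j a \<odot>\<^bsub>T\<^esub> (\<gamma> g \<odot>\<^bsub>T\<^esub> t)"
proof -
  have aA: "a \<in> carrier A" "actA g a = a" using a g by (simp_all add: AG_simps)
  have "\<gamma> g \<odot>\<^bsub>T\<^esub> (j a \<odot>\<^bsub>T\<^esub> t) = (\<gamma> g \<otimes>\<^bsub>U\<^esub> j a) \<odot>\<^bsub>T\<^esub> t" using aA t g by (simp add: T.smult_assoc jD)
  also have "\<dots> = j a \<odot>\<^bsub>T\<^esub> (\<gamma> g \<odot>\<^bsub>T\<^esub> t)" unfolding \<gamma>_j[OF g aA(1)] aA(2) using aA t g by (simp add: T.smult_assoc jD)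
  finally show ?thesis .
qed

lemma TG_left_module: "left_module AG TG"
proof (intro left_module.intro left_module_axioms.intro AG.ring_axioms)
  show "abelian_group TG"
  proof (rule abelian_groupI)
    fix x assume x: "x \<in> carrier TG"
    then have "\<ominus>\<^bsub>T\<^esub> x \<in> carrier TG" by (simp add: TG_simps T.smult_minus_right)
    then show "\<exists>y\<in>carrier TG. y \<oplus>\<^bsub>TG\<^esub> x = \<zero>\<^bsub>TG\<^esub>"
      using x by (intro bexI[of _ "\<ominus>\<^bsub>T\<^esub> x"]) (simp_all add: TG_simps T.M.l_neg)
  qed (simp_all add: TG_simps T.M.a_ac T.smult_r_distr T.smult_zero_right)
  fix a x assume "a \<in> carrier AG" "x \<in> carrier TG"
  then show "a \<odot>\<^bsub>TG\<^esub> x \<in> carrier TG"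
    by (auto simp: TG_simps j_fixed) (auto simp: AG_simps jD intro!: T.smult_closed)
qed (simp_all add: TG_simps AG_simps jD T.smult_l_distr T.smult_r_distr T.smult_assoc T.smult_one)

sublocale TG: kalg_module AG TG
  by (intro kalg_module.intro AG.kalg_axioms TG_left_module)

text \<open>The vector space structure of the fixed vectors is inherited from T, so spans and
  dimensions for both can be compared in one ambient space.\<close>

lemma TG_E: "TG.E = T.E\<lparr>carrier := carrier TG\<rparr>"
  by (simp add: underlying_space_def restrict_scalars_def TG_def AG_simps jD)

lemma sumG_fixed: "t \<in> carrier T \<Longrightarrow> sumG \<odot>\<^bsub>T\<^esub> t \<in> carrier TG"
proof -
  assume t: "t \<in> carrier T"
  have "\<gamma> g \<odot>\<^bsub>T\<^esub> (sumG \<odot>\<^bsub>T\<^esub> t) = sumG \<odot>\<^bsub>T\<^esub> t" if g: "g \<in> carrier G" for g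
    using t g T.smult_assoc[of "\<gamma> g" sumG t] by (simp add: \<gamma>_sumG)
  then show ?thesis using t by (simp add: TG_simps T.smult_closed)
qed

lemma sumG_on_fixed: "t \<in> carrier TG \<Longrightarrow> sumG \<odot>\<^bsub>T\<^esub> t = of_nat (card (carrier G)) \<odot>\<^bsub>T.E\<^esub> t"
proof -
  assume t: "t \<in> carrier TG"
  then have tT: "t \<in> carrier T" by (simp add: TG_simps)
  have "(\<Oplus>\<^bsub>U\<^esub>g\<in>F. \<gamma> g) \<odot>\<^bsub>T\<^esub> t = of_nat (card F) \<odot>\<^bsub>T.E\<^esub> t" if "finite F" "F \<subseteq> carrier G" for F
    using that
  proof (induction F rule: finite_induct)
    case (insert g F)
    then have "(\<Oplus>\<^bsub>U\<^esub>g\<in>insert g F. \<gamma> g) = \<gamma> g \<oplus>\<^bsub>U\<^esub> (\<Oplus>\<^bsub>U\<^esub>g\<in>F. \<gamma> g)" by (intro U.finsum_insert) auto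
    moreover have "(\<Oplus>\<^bsub>U\<^esub>g\<in>F. \<gamma> g) \<in> carrier U" using insert by (auto intro!: U.finsum_closed)
    moreover have "\<gamma> g \<odot>\<^bsub>T\<^esub> t = 1 \<odot>\<^bsub>T.E\<^esub> t" using t insert tT by (simp add: TG_simps sc_one)
    ultimately show ?case using insert tT by (simp add: T.smult_l_distr sc_add)
  qed (simp add: tT T.smult_zero_left sc_0)
  from this[OF finG] show ?thesis by (simp add: sumG_def)
qed

lemma card_G: "of_nat (card (carrier G)) \<noteq> (0 :: 'k)"
  using finG G.one_closed by (auto simp: card_eq_0_iff)

text \<open>Write y = u x by irreducibility of T and apply the sum over G: the left side becomes |G|
  y, the right side the trace of u applied to x. Dividing by |G| uses characteristic zero.\<close>

lemma TG_generated:
  assumes x: "x \<in> carrier TG" "x \<noteq> \<zero>\<^bsub>T\<^esub>" and y: "y \<in> carrier TG"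
  shows "\<exists>a\<in>carrier AG. y = j a \<odot>\<^bsub>T\<^esub> x"
proof -
  let ?c = "of_nat (card (carrier G)) :: 'k"
  have T: "x \<in> carrier T" "y \<in> carrier T" "\<forall>g\<in>carrier G. \<gamma> g \<odot>\<^bsub>T\<^esub> x = x" using x y by (simp_all add: TG_simps)
  obtain u where u: "u \<in> carrier U" "y = u \<odot>\<^bsub>T\<^esub> x" using generated[OF T(1) x(2) T(2)] by blast
  obtain a where a: "a \<in> carrier AG" "sumG \<odot>\<^bsub>T\<^esub> (u \<odot>\<^bsub>T\<^esub> x) = j a \<odot>\<^bsub>T\<^esub> x"
    using trace_exists[OF T.left_module_axioms u(1)] T by blast
  have aA: "a \<in> carrier A" using a by (simp add: AG_simps)
  have "?c \<odot>\<^bsub>T.E\<^esub> y = j a \<odot>\<^bsub>T\<^esub> x" using sumG_on_fixed[OF y] a u by simp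
  then have "y = inverse ?c \<odot>\<^bsub>T.E\<^esub> (j a \<odot>\<^bsub>T\<^esub> x)" using sc_sc[OF T(2), of "inverse ?c" ?c] sc_one[OF T(2)] card_G by simp
  also have "\<dots> = j (inverse ?c \<odot>\<^bsub>AG\<^esub> a) \<odot>\<^bsub>T\<^esub> x" using aA T by (simp add: AG_simps jD T.sc_smult)
  finally show ?thesis using AG.sm_closed[OF a(1)] by blast
qed

lemma TG_irreducible: "x \<in> carrier TG \<Longrightarrow> x \<noteq> \<zero>\<^bsub>T\<^esub> \<Longrightarrow> irreducible_module AG TG"
  unfolding irreducible_module_def
proof (intro conjI allI impI TG_left_module)
  assume x: "x \<in> carrier TG" "x \<noteq> \<zero>\<^bsub>T\<^esub>"
  show "carrier TG \<noteq> {\<zero>\<^bsub>TG\<^esub>}" using x by (auto simp: TG_simps(2))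
  fix N assume N: "left_submodule AG N TG"
  then interpret N: additive_subgroup N TG by (simp add: left_submodule_def)
  show "N = {\<zero>\<^bsub>TG\<^esub>} \<or> N = carrier TG"
  proof (cases "N \<subseteq> {\<zero>\<^bsub>TG\<^esub>}")
    case True
    then show ?thesis using N.zero_closed by auto
  next
    case False
    then obtain y where y: "y \<in> N" "y \<noteq> \<zero>\<^bsub>T\<^esub>" by (auto simp: TG_simps(2))
    have "z \<in> N" if z: "z \<in> carrier TG" for z
    proof -
      have "y \<in> carrier TG" using y N.a_subset by auto
      from TG_generated[OF this y(2) z] obtain a where "a \<in> carrier AG" "z = j a \<odot>\<^bsub>T\<^esub> y" by blast
      then show ?thesis using N y(1) by (simp add: left_submodule_def TG_simps(4))
    qed
    then show ?thesis using N.a_subset by auto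
  qed
qed

lemma \<iota>_DG: "alg_hom DG AG \<iota>"
  by (rule alg_homI) (auto simp: DG_simps AG_simps \<iota>D \<iota>_act[symmetric])

lemma \<iota>_DG': "alg_hom DG A \<iota>"
  by (rule alg_homI) (auto simp: DG_simps \<iota>D)

lemma DG_left_module: "left_module DG (restrict_scalars \<iota> TG)"
  by (rule left_module_restrict[OF TG_left_module DG.ring_axioms])
    (use \<iota>_DG in \<open>simp add: alg_hom_def\<close>)

lemma harish_chandra_TG:
  assumes x: "x \<in> carrier TG" "x \<noteq> \<zero>\<^bsub>T\<^esub>"
  shows "harish_chandra_module AG DG \<iota> TG" "fin_gen_module AG TG"
proof -
  show fg: "fin_gen_module AG TG"
    unfolding fin_gen_module_def
    using x TG_irreducible[OF x] by (intro exI[of _ "{x}"]) (auto simp: irreducible_module_def TG_simps(2))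
  interpret N: comm_left_module DG "restrict_scalars \<iota> TG"
    using DG_left_module DG_cring by (simp add: comm_left_module_def)
  let ?N = "restrict_scalars \<iota> TG"
  have Ns: "carrier ?N = carrier TG" "\<zero>\<^bsub>?N\<^esub> = \<zero>\<^bsub>T\<^esub>" "y \<oplus>\<^bsub>?N\<^esub> z = y \<oplus>\<^bsub>T\<^esub> z" "d \<odot>\<^bsub>?N\<^esub> y = j (\<iota> d) \<odot>\<^bsub>T\<^esub> y" for y z d
    by (simp_all add: restrict_scalars_def TG_simps)
  have TGT: "y \<in> carrier TG \<Longrightarrow> y \<in> carrier T" for y by (simp add: TG_simps)
  let ?c = "of_nat (card (carrier G)) :: 'k"
  have "internal_direct_sum ?N (cofinite_maximal_ideals DG) N.gws"
  proof (rule N.internal_direct_sum_gws)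
    show "maximalideal \<nn> DG" if "\<nn> \<in> cofinite_maximal_ideals DG" for \<nn>
      using that by (simp add: cofinite_maximal_ideals_def)
    fix t Q assume t: "t \<in> carrier ?N" and zero: "Q \<zero>\<^bsub>?N\<^esub>"
      and gws: "\<And>\<nn> w. \<nn> \<in> cofinite_maximal_ideals DG \<Longrightarrow> w \<in> N.gws \<nn> \<Longrightarrow> Q w"
      and Qadd: "\<And>y z. y \<in> carrier ?N \<Longrightarrow> z \<in> carrier ?N \<Longrightarrow> Q y \<Longrightarrow> Q z \<Longrightarrow> Q (y \<oplus>\<^bsub>?N\<^esub> z)"
    have tT: "t \<in> carrier T" and tTG: "t \<in> carrier TG" using t TGT by (simp_all add: Ns(1))
    \<comment> \<open>A fixed vector is its own average, so it suffices to treat averages of the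
      spanning vectors of T. Invariant elements of D commute with the sum over G, hence such an
      average is zero or a weight vector for them.\<close>
    have "Q (sumG \<odot>\<^bsub>T\<^esub> y)" if "y \<in> carrier T" for y
      using that
    proof (induction rule: T_induct)
      case (basis c J g)
      define w where "w = c \<odot>\<^bsub>T.E\<^esub> b J g"
      have w: "w \<in> carrier T" using basis by (simp add: w_def)
      have sw: "sumG \<odot>\<^bsub>T\<^esub> w \<in> carrier TG" by (rule sumG_fixed[OF w])
      show ?case
      proof (cases "sumG \<odot>\<^bsub>T\<^esub> w = \<zero>\<^bsub>T\<^esub>")
        case True
        then show ?thesis using zero by (simp add: Ns(2) w_def)
      next
        case False
        have "\<exists>c'. j (\<iota> d) \<odot>\<^bsub>T\<^esub> (sumG \<odot>\<^bsub>T\<^esub> w) = c' \<odot>\<^bsub>T.E\<^esub> (sumG \<odot>\<^bsub>T\<^esub> w)" if d: "d \<in> carrier DG" for d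
        proof -
          have dD: "d \<in> carrier D" and \<iota>d: "\<iota> d \<in> carrier AG" using d alg_homD(1)[OF \<iota>_DG] by (simp_all add: DG_simps)
          obtain c' where c': "j (\<iota> d) \<odot>\<^bsub>T\<^esub> b J g = c' \<odot>\<^bsub>T.E\<^esub> b J g" using b_weight[OF dD basis] by blast
          have "j (\<iota> d) \<odot>\<^bsub>T\<^esub> w = c \<odot>\<^bsub>T.E\<^esub> (c' \<odot>\<^bsub>T.E\<^esub> b J g)"
            unfolding w_def using dD basis by (simp add: T.smult_sc jD \<iota>D c')
          also have "\<dots> = c' \<odot>\<^bsub>T.E\<^esub> w" unfolding w_def using basis by (simp add: sc_sc mult.commute)
          finally have dw: "j (\<iota> d) \<odot>\<^bsub>T\<^esub> w = c' \<odot>\<^bsub>T.E\<^esub> w" .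
          have jd: "j (\<iota> d) \<in> carrier U" using dD by (simp add: jD \<iota>D)
          have "j (\<iota> d) \<otimes>\<^bsub>U\<^esub> sumG = (\<Oplus>\<^bsub>U\<^esub>g\<in>carrier G. j (\<iota> d) \<otimes>\<^bsub>U\<^esub> \<gamma> g)"
            unfolding sumG_def using jd finG by (intro U.finsum_rdistr) auto
          also have "\<dots> = (\<Oplus>\<^bsub>U\<^esub>g\<in>carrier G. \<gamma> g \<otimes>\<^bsub>U\<^esub> j (\<iota> d))"
            using \<iota>d jd by (intro U.finsum_cong') (auto simp: \<gamma>_j AG_simps)
          also have "\<dots> = sumG \<otimes>\<^bsub>U\<^esub> j (\<iota> d)"
            unfolding sumG_def using jd finG by (intro U.finsum_ldistr[symmetric]) auto
          finally have comm: "j (\<iota> d) \<otimes>\<^bsub>U\<^esub> sumG = sumG \<otimes>\<^bsub>U\<^esub> j (\<iota> d)" .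
          have "j (\<iota> d) \<odot>\<^bsub>T\<^esub> (sumG \<odot>\<^bsub>T\<^esub> w) = sumG \<odot>\<^bsub>T\<^esub> (j (\<iota> d) \<odot>\<^bsub>T\<^esub> w)"
            using jd w comm T.smult_assoc[of "j (\<iota> d)" sumG w] T.smult_assoc[of sumG "j (\<iota> d)" w] by simp
          also have "\<dots> = c' \<odot>\<^bsub>T.E\<^esub> (sumG \<odot>\<^bsub>T\<^esub> w)" unfolding dw using w by (simp add: T.smult_sc)
          finally show ?thesis by blast
        qed
        from weight_character[OF DG.k_algebra \<iota>_DG' TGT[OF sw] False this] obtain \<psi> where
          \<psi>: "DG.character \<psi>" "\<And>d. d \<in> carrier DG \<Longrightarrow> j (\<iota> d) \<odot>\<^bsub>T\<^esub> (sumG \<odot>\<^bsub>T\<^esub> w) = \<psi> d \<odot>\<^bsub>T.E\<^esub> (sumG \<odot>\<^bsub>T\<^esub> w)"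
          by blast
        have "sumG \<odot>\<^bsub>T\<^esub> w \<in> N.gws {d \<in> carrier DG. \<psi> d = 0}"
          by (rule weight_vector_in_gws[OF DG.k_algebra DG_cring \<iota>_DG' DG_left_module])
            (use Ns sw TGT \<psi> in auto)
        then have "Q (sumG \<odot>\<^bsub>T\<^esub> w)" by (rule gws[OF DG.character_kernel[OF \<psi>(1)]])
        then show ?thesis by (simp add: w_def)
      qed
    next
      case (add y z)
      then show ?case using Qadd[of "sumG \<odot>\<^bsub>T\<^esub> y" "sumG \<odot>\<^bsub>T\<^esub> z"] sumG_fixed
        by (simp add: Ns T.smult_r_distr)
    qed
    from this[of "inverse ?c \<odot>\<^bsub>T.E\<^esub> t"] tT have "Q (sumG \<odot>\<^bsub>T\<^esub> (inverse ?c \<odot>\<^bsub>T.E\<^esub> t))" by simp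
    moreover have "sumG \<odot>\<^bsub>T\<^esub> (inverse ?c \<odot>\<^bsub>T.E\<^esub> t) = t"
      using tT sumG_on_fixed[OF tTG] card_G by (simp add: T.smult_sc sc_sc sc_one)
    ultimately show "Q t" by simp
  qed
  then show "harish_chandra_module AG DG \<iota> TG"
    unfolding harish_chandra_module_def using TG_left_module fg by (simp add: internal_direct_sum_restrict)
qed

end

subsection \<open>Growth of the modules\<close>

lemma finsum_restrict_scalars: "finsum (restrict_scalars f M) = finsum M"
  by (simp add: fun_eq_iff finsum_def finprod_def restrict_scalars_def)

context skew_module
begin

text \<open>Exponents are taken as extensional functions, which makes the box finite;
  \<open>Y_restrict\<close> ensures that every monomial with exponents in the box is
  represented.\<close>

definition layer :: "nat \<Rightarrow> 'm set" where
  "layer N = (\<lambda>(J, g). b J g) ` ((\<Pi>\<^sub>E i\<in>{1..n}. {- int N..int N}) \<times> carrier G)"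

lemma b_restrict: "b (restrict J {1..n}) g = b J g"
  by (simp only: b_def Y_restrict)

lemma b_layer: "(\<And>i. i \<in> {1..n} \<Longrightarrow> \<bar>J i\<bar> \<le> int N) \<Longrightarrow> g \<in> carrier G \<Longrightarrow> b J g \<in> layer N"
  unfolding layer_def
  by (rule image_eqI[of _ _ "(restrict J {1..n}, g)"]) (force simp: b_restrict)+

lemma layer_cases:
  assumes "x \<in> layer N"
  obtains J g where "x = b J g" "g \<in> carrier G" "\<And>i. i \<in> {1..n} \<Longrightarrow> \<bar>J i\<bar> \<le> int N"
proof -
  obtain J g where J: "x = b J g" "g \<in> carrier G" "J \<in> (\<Pi>\<^sub>E i\<in>{1..n}. {- int N..int N})"
    using assms unfolding layer_def by auto
  have "\<bar>J i\<bar> \<le> int N" if "i \<in> {1..n}" for i using PiE_mem[OF J(3) that] by auto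
  with J(1,2) show thesis by (rule that)
qed

lemma layer_finite: "finite (layer N)"
  unfolding layer_def using finG by (intro finite_imageI finite_SigmaI finite_PiE) auto

lemma layer_closed: "layer N \<subseteq> carrier T"
  by (auto elim: layer_cases)

text \<open>The box has (2 N + 1)^n points for each of the |G| group elements, and 2 N + 1 <= 2 (N +
  1).\<close>

lemma layer_card: "real (card (layer N)) \<le> (real (card (carrier G)) * 2 ^ n) * (real N + 1) ^ n"
proof -
  have "card (layer N) \<le> card ((\<Pi>\<^sub>E i\<in>{1..n}. {- int N..int N}) \<times> carrier G)"
    unfolding layer_def using finG by (intro card_image_le finite_SigmaI finite_PiE) auto
  also have "\<dots> = (2 * N + 1) ^ n * card (carrier G)"
  proof -
    have "nat (2 * int N + 1) = 2 * N + 1" by simp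
    then show ?thesis by (simp add: card_PiE card_cartesian_product del: nat_add_distrib)
  qed
  finally have "real (card (layer N)) \<le> real ((2 * N + 1) ^ n * card (carrier G))" by (rule of_nat_mono)
  also have "\<dots> = (2 * real N + 1) ^ n * real (card (carrier G))" by simp
  also have "\<dots> \<le> (2 * (real N + 1)) ^ n * real (card (carrier G))"
    by (intro mult_right_mono power_mono) auto
  finally show ?thesis by (simp only: power_mult_distrib mult_ac)
qed

lemma layer_mono: "N \<le> N' \<Longrightarrow> layer N \<subseteq> layer N'"
proof
  fix x assume "N \<le> N'" "x \<in> layer N"
  then show "x \<in> layer N'" by (elim layer_cases) (simp, intro b_layer, force+)
qed

abbreviation lspan where "lspan N \<equiv> T.E.span (layer N)"

lemma lspan_submodule: "submodule class_ring (lspan N) T.E"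
  by (rule T.span_submodule[OF layer_closed])

lemma lspan_closed: "lspan N \<subseteq> carrier T"
  by (rule T.span_closedM[OF layer_closed])

lemma lspan_add: "x \<in> lspan N \<Longrightarrow> y \<in> lspan N \<Longrightarrow> x \<oplus>\<^bsub>T\<^esub> y \<in> lspan N"
  using submodule.m_closed[OF lspan_submodule] by (simp add: T.E_simps(3))

lemma lspan_sc: "x \<in> lspan N \<Longrightarrow> c \<odot>\<^bsub>T.E\<^esub> x \<in> lspan N"
  using submodule.smult_closed[OF lspan_submodule, of c x N] by simp

lemma lspan_mono: "N \<le> N' \<Longrightarrow> lspan N \<subseteq> lspan N'"
  by (rule T.E.span_is_monotone[OF layer_mono])

lemma layer_lspan: "layer N \<subseteq> lspan N"
  using T.E.in_own_span[of "layer N"] layer_closed by (simp add: T.E_simps(1))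

lemma sup_norm_bound: "\<exists>r. \<forall>i\<in>{1..n}. \<bar>J i\<bar> \<le> int r" for J :: "nat \<Rightarrow> int"
proof -
  have "\<bar>J i\<bar> \<le> int (Max (insert 0 ((\<lambda>i. nat \<bar>J i\<bar>) ` {1..n})))" if "i \<in> {1..n}" for i
  proof -
    have "nat \<bar>J i\<bar> \<le> Max (insert 0 ((\<lambda>i. nat \<bar>J i\<bar>) ` {1..n}))" using that by (intro Max_ge) auto
    then show ?thesis by linarith
  qed
  then show ?thesis by blast
qed

lemma lspan_exhausts: "t \<in> carrier T \<Longrightarrow> \<exists>N. t \<in> lspan N"
proof (induction rule: T_induct)
  case (basis c J g)
  obtain N where "\<forall>i\<in>{1..n}. \<bar>J i\<bar> \<le> int N" using sup_norm_bound by blast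
  then have "b J g \<in> layer N" using basis by (intro b_layer) auto
  then show ?case using layer_lspan lspan_sc by blast
next
  case (add x y)
  then obtain N N' where "x \<in> lspan N" "y \<in> lspan N'" by blast
  then have "x \<in> lspan (max N N')" "y \<in> lspan (max N N')"
    using lspan_mono[of N "max N N'"] lspan_mono[of N' "max N N'"] by auto
  then show ?case using lspan_add by blast
qed

text \<open>Multiplying by Y^K shifts the exponents by K, hence enlarges the box by the sup norm of
  K. The base elements that arise act on the resulting weight vector by scalars and cost
  nothing.\<close>

lemma j_lspan: "a \<in> carrier A \<Longrightarrow> \<exists>r. \<forall>N. \<forall>x\<in>lspan N. j a \<odot>\<^bsub>T\<^esub> x \<in> lspan (N + r)"
proof (erule A_induct)
  fix d K assume d: "d \<in> carrier D"
  obtain r where r: "\<forall>i\<in>{1..n}. \<bar>K i\<bar> \<le> int r" using sup_norm_bound by blast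
  have "j (\<iota> d \<otimes>\<^bsub>A\<^esub> Y K) \<odot>\<^bsub>T\<^esub> x \<in> lspan (N + r)" if x: "x \<in> lspan N" for N x
  proof (rule T.smult_span_right[OF lspan_submodule layer_closed _ _ x])
    show "j (\<iota> d \<otimes>\<^bsub>A\<^esub> Y K) \<in> carrier U" using d by (simp add: jD \<iota>D)
    fix y assume "y \<in> layer N"
    then obtain J g where J: "y = b J g" "g \<in> carrier G" "\<And>i. i \<in> {1..n} \<Longrightarrow> \<bar>J i\<bar> \<le> int N" by (rule layer_cases) blast
    have gv: "\<gamma> g \<odot>\<^bsub>T\<^esub> v \<in> carrier T" using J(2) v by (simp add: T.smult_closed)
    let ?b = "b (\<lambda>i. K i + J i) g"
    have "?b \<in> layer (N + r)"
    proof (rule b_layer[OF _ J(2)])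
      fix i assume i: "i \<in> {1..n}"
      show "\<bar>K i + J i\<bar> \<le> int (N + r)" using bspec[OF r i] J(3)[OF i] by linarith
    qed
    then have bs: "?b \<in> lspan (N + r)" using layer_lspan by blast
    obtain c where c: "c \<in> carrier D" "Y K \<otimes>\<^bsub>A\<^esub> Y J = \<iota> c \<otimes>\<^bsub>A\<^esub> Y (\<lambda>i. K i + J i)" using Y_mult by blast
    obtain k where k: "j (\<iota> c) \<odot>\<^bsub>T\<^esub> ?b = k \<odot>\<^bsub>T.E\<^esub> ?b" using b_weight[OF c(1) J(2)] by blast
    obtain k' where k': "j (\<iota> d) \<odot>\<^bsub>T\<^esub> ?b = k' \<odot>\<^bsub>T.E\<^esub> ?b" using b_weight[OF d J(2)] by blast
    have "j (\<iota> d \<otimes>\<^bsub>A\<^esub> Y K) \<odot>\<^bsub>T\<^esub> y = j (\<iota> d) \<odot>\<^bsub>T\<^esub> (j (Y K \<otimes>\<^bsub>A\<^esub> Y J) \<odot>\<^bsub>T\<^esub> (\<gamma> g \<odot>\<^bsub>T\<^esub> v))"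
      using d gv by (simp add: J(1) b_def jD \<iota>D T.smult_assoc T.smult_closed)
    also have "j (Y K \<otimes>\<^bsub>A\<^esub> Y J) \<odot>\<^bsub>T\<^esub> (\<gamma> g \<odot>\<^bsub>T\<^esub> v) = j (\<iota> c) \<odot>\<^bsub>T\<^esub> ?b"
      unfolding c(2) using c(1) gv by (simp add: b_def jD \<iota>D T.smult_assoc)
    also have "j (\<iota> d) \<odot>\<^bsub>T\<^esub> (j (\<iota> c) \<odot>\<^bsub>T\<^esub> ?b) = k \<odot>\<^bsub>T.E\<^esub> (k' \<odot>\<^bsub>T.E\<^esub> ?b)"
      unfolding k using d J(2) by (simp add: T.smult_sc jD \<iota>D k')
    finally show "j (\<iota> d \<otimes>\<^bsub>A\<^esub> Y K) \<odot>\<^bsub>T\<^esub> y \<in> lspan (N + r)" using lspan_sc[OF lspan_sc[OF bs]] by simp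
  qed
  then show "\<exists>r. \<forall>N. \<forall>x\<in>lspan N. j (\<iota> d \<otimes>\<^bsub>A\<^esub> Y K) \<odot>\<^bsub>T\<^esub> x \<in> lspan (N + r)" by blast
next
  fix x y assume xy: "x \<in> carrier A" "y \<in> carrier A"
    "\<exists>r. \<forall>N. \<forall>z\<in>lspan N. j x \<odot>\<^bsub>T\<^esub> z \<in> lspan (N + r)" "\<exists>r. \<forall>N. \<forall>z\<in>lspan N. j y \<odot>\<^bsub>T\<^esub> z \<in> lspan (N + r)"
  then obtain r r' where r: "\<And>N z. z \<in> lspan N \<Longrightarrow> j x \<odot>\<^bsub>T\<^esub> z \<in> lspan (N + r)"
    "\<And>N z. z \<in> lspan N \<Longrightarrow> j y \<odot>\<^bsub>T\<^esub> z \<in> lspan (N + r')" by blast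
  have "j (x \<oplus>\<^bsub>A\<^esub> y) \<odot>\<^bsub>T\<^esub> z \<in> lspan (N + max r r')" if z: "z \<in> lspan N" for N z
  proof -
    have "z \<in> carrier T" using z lspan_closed by blast
    then have "j (x \<oplus>\<^bsub>A\<^esub> y) \<odot>\<^bsub>T\<^esub> z = j x \<odot>\<^bsub>T\<^esub> z \<oplus>\<^bsub>T\<^esub> j y \<odot>\<^bsub>T\<^esub> z"
      using xy by (simp add: jD T.smult_l_distr)
    moreover have "j x \<odot>\<^bsub>T\<^esub> z \<in> lspan (N + max r r')" "j y \<odot>\<^bsub>T\<^esub> z \<in> lspan (N + max r r')"
      using r(1)[OF z] r(2)[OF z] lspan_mono[of "N + r" "N + max r r'"] lspan_mono[of "N + r'" "N + max r r'"] by auto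
    ultimately show ?thesis using lspan_add by simp
  qed
  then show "\<exists>r. \<forall>N. \<forall>z\<in>lspan N. j (x \<oplus>\<^bsub>A\<^esub> y) \<odot>\<^bsub>T\<^esub> z \<in> lspan (N + r)" by blast
qed

text \<open>A group element permutes the exponents of a monomial, and the box is symmetric under
  permutations of the slots.\<close>

lemma \<gamma>_lspan:
  assumes g: "g \<in> carrier G" and x: "x \<in> lspan N" shows "\<gamma> g \<odot>\<^bsub>T\<^esub> x \<in> lspan N"
proof (rule T.smult_span_right[OF lspan_submodule layer_closed _ _ x])
  fix y assume "y \<in> layer N"
  then obtain J h where J: "y = b J h" "h \<in> carrier G" "\<And>i. i \<in> {1..n} \<Longrightarrow> \<bar>J i\<bar> \<le> int N" by (rule layer_cases) blast
  obtain p where p: "p permutes {1..n}" "\<And>J. actA g (Y J) = Y (J \<circ> p)" using actA_Y[OF g] by blast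
  have "\<gamma> g \<odot>\<^bsub>T\<^esub> y = (\<gamma> g \<otimes>\<^bsub>U\<^esub> j (Y J)) \<odot>\<^bsub>T\<^esub> (\<gamma> h \<odot>\<^bsub>T\<^esub> v)"
    using g J(2) v unfolding J(1) b_def by (intro T.smult_assoc[symmetric]) (auto simp: jD intro!: T.smult_closed)
  also have "\<dots> = (j (Y (J \<circ> p)) \<otimes>\<^bsub>U\<^esub> \<gamma> g) \<odot>\<^bsub>T\<^esub> (\<gamma> h \<odot>\<^bsub>T\<^esub> v)" using g by (simp only: \<gamma>_j[OF g Y_closed] p(2))
  also have "\<dots> = j (Y (J \<circ> p)) \<odot>\<^bsub>T\<^esub> ((\<gamma> g \<otimes>\<^bsub>U\<^esub> \<gamma> h) \<odot>\<^bsub>T\<^esub> v)"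
    using g J(2) v by (simp add: T.smult_assoc jD T.smult_closed)
  also have "\<dots> = b (J \<circ> p) (g \<otimes>\<^bsub>G\<^esub> h)" using g J(2) by (simp add: b_def \<gamma>_mult)
  finally have eq: "\<gamma> g \<odot>\<^bsub>T\<^esub> y = b (J \<circ> p) (g \<otimes>\<^bsub>G\<^esub> h)" .
  have "b (J \<circ> p) (g \<otimes>\<^bsub>G\<^esub> h) \<in> layer N"
    using g J(2,3) permutes_in_image[OF p(1)] by (intro b_layer) auto
  then show "\<gamma> g \<odot>\<^bsub>T\<^esub> y \<in> lspan N" unfolding eq using layer_lspan by blast
qed (use g in simp)

lemma U_lspan: "u \<in> carrier U \<Longrightarrow> \<exists>r. \<forall>N. \<forall>x\<in>lspan N. u \<odot>\<^bsub>T\<^esub> x \<in> lspan (N + r)"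
proof (erule U_induct)
  fix a g assume a: "a \<in> carrier A" and g: "g \<in> carrier G"
  obtain r where r: "\<And>N x. x \<in> lspan N \<Longrightarrow> j a \<odot>\<^bsub>T\<^esub> x \<in> lspan (N + r)" using j_lspan[OF a] by blast
  have "(j a \<otimes>\<^bsub>U\<^esub> \<gamma> g) \<odot>\<^bsub>T\<^esub> x \<in> lspan (N + r)" if x: "x \<in> lspan N" for N x
  proof -
    have "x \<in> carrier T" using x lspan_closed by blast
    then show ?thesis using r[OF \<gamma>_lspan[OF g x]] a g T.smult_assoc[of "j a" "\<gamma> g" x] by (simp add: jD)
  qed
  then show "\<exists>r. \<forall>N. \<forall>x\<in>lspan N. (j a \<otimes>\<^bsub>U\<^esub> \<gamma> g) \<odot>\<^bsub>T\<^esub> x \<in> lspan (N + r)" by blast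
next
  fix x y assume xy: "x \<in> carrier U" "y \<in> carrier U"
    "\<exists>r. \<forall>N. \<forall>z\<in>lspan N. x \<odot>\<^bsub>T\<^esub> z \<in> lspan (N + r)" "\<exists>r. \<forall>N. \<forall>z\<in>lspan N. y \<odot>\<^bsub>T\<^esub> z \<in> lspan (N + r)"
  then obtain r r' where r: "\<And>N z. z \<in> lspan N \<Longrightarrow> x \<odot>\<^bsub>T\<^esub> z \<in> lspan (N + r)"
    "\<And>N z. z \<in> lspan N \<Longrightarrow> y \<odot>\<^bsub>T\<^esub> z \<in> lspan (N + r')" by blast
  have "(x \<oplus>\<^bsub>U\<^esub> y) \<odot>\<^bsub>T\<^esub> z \<in> lspan (N + max r r')" if z: "z \<in> lspan N" for N z
  proof -
    have "z \<in> carrier T" using z lspan_closed by blast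
    then have "(x \<oplus>\<^bsub>U\<^esub> y) \<odot>\<^bsub>T\<^esub> z = x \<odot>\<^bsub>T\<^esub> z \<oplus>\<^bsub>T\<^esub> y \<odot>\<^bsub>T\<^esub> z"
      using xy by (simp add: T.smult_l_distr)
    moreover have "x \<odot>\<^bsub>T\<^esub> z \<in> lspan (N + max r r')" "y \<odot>\<^bsub>T\<^esub> z \<in> lspan (N + max r r')"
      using r(1)[OF z] r(2)[OF z] lspan_mono[of "N + r" "N + max r r'"] lspan_mono[of "N + r'" "N + max r r'"] by auto
    ultimately show ?thesis using lspan_add by simp
  qed
  then show "\<exists>r. \<forall>N. \<forall>z\<in>lspan N. (x \<oplus>\<^bsub>U\<^esub> y) \<odot>\<^bsub>T\<^esub> z \<in> lspan (N + r)" by blast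
qed

lemma GK_dim_T_le: "GK_dim U T \<le> ereal (real n)"
proof (rule T.GK_dim_filtration[OF T.E_vectorspace _ _ layer_finite _ layer_card layer_mono])
  show "T.E = T.E\<lparr>carrier := carrier T\<rparr>" by (simp add: underlying_space_def restrict_scalars_def)
  show "layer N \<subseteq> carrier T.E" for N using layer_closed by (simp add: T.E_simps(1))
  show "\<exists>N. x \<in> lspan N" if "x \<in> carrier T" for x using lspan_exhausts[OF that] .
  show "\<exists>r. \<forall>N. \<forall>x\<in>carrier T. x \<in> lspan N \<longrightarrow> u \<odot>\<^bsub>T\<^esub> x \<in> lspan (N + r)" if "u \<in> carrier U" for u
    using U_lspan[OF that] by blast
qed (simp_all add: T.E_simps(1))

text \<open>The layers of T are reused as an ambient filtration: they need not consist of fixed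
  vectors, since only their spans are intersected with the fixed vectors.\<close>

lemma GK_dim_TG_le: "GK_dim AG TG \<le> ereal (real n)"
proof (rule TG.GK_dim_filtration[OF T.E_vectorspace TG_E _ layer_finite _ layer_card layer_mono])
  show "carrier TG \<subseteq> carrier T.E" by (auto simp: TG_simps T.E_simps(1))
  show "layer N \<subseteq> carrier T.E" for N using layer_closed by (simp add: T.E_simps(1))
  show "\<exists>N. x \<in> lspan N" if "x \<in> carrier TG" for x using lspan_exhausts[of x] that by (simp add: TG_simps(1))
  show "\<exists>r. \<forall>N. \<forall>x\<in>carrier TG. x \<in> lspan N \<longrightarrow> a \<odot>\<^bsub>TG\<^esub> x \<in> lspan (N + r)" if "a \<in> carrier AG" for a
    unfolding TG_simps(4) using j_lspan[of a] that by (auto simp: AG_simps(1))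
qed simp_all

end

lemma (in kalg_module) power_space_dim_ge:
  assumes V: "V \<in> fin_dim_subspaces U" and F: "F \<in> fin_dim_subspaces E"
    and Ls: "Ls \<subseteq> power_space U M V F N" "E.lin_indpt Ls"
  shows "card Ls \<le> vectorspace.dim (class_ring :: 'k ring) (E\<lparr>carrier := power_space U M V F N\<rparr>)"
proof -
  obtain A0 where A0: "finite A0" "A0 \<subseteq> carrier M" "power_space U M V F N = E.span A0"
    using power_space_fin_dim[OF V F] by blast
  have sub: "submodule class_ring (power_space U M V F N) E" unfolding A0(3) by (rule span_submodule[OF A0(2)])
  have A0': "A0 \<subseteq> carrier E" using A0(2) by (simp add: E_simps(1))
  show ?thesis
  proof (rule E.submodule_basis[OF A0(1) A0' sub])
    show "power_space U M V F N \<subseteq> E.span A0" by (simp add: A0(3))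
    fix B assume B: "finite B" "B \<subseteq> power_space U M V F N" "E.span B = power_space U M V F N"
      "vectorspace.dim (class_ring :: 'k ring) (E\<lparr>carrier := power_space U M V F N\<rparr>) = card B"
    have "B \<subseteq> carrier E" using B(2) submodule.subset[OF sub] by simp
    from E.li_in_span_bound(2)[OF B(1) this _ Ls(2)] Ls(1) show ?thesis unfolding B(3,4) by simp
  qed
qed

text \<open>\<open>\<epsilon> i\<close> selects in slot i the generator whose powers can be undone
  on \<open>v\<close> up to a nonzero scalar. The character \<open>\<chi>'\<close> is kept apart
  from \<chi>: it must be moved by every nontrivial element of G, whereas \<chi> is dictated by the
  given maximal ideal and may have a stabilizer.\<close>

locale skew_module_simple = skew_module U A D G j \<gamma> \<iota> actA actD Y n T \<chi> v
  for U :: "('k::field_char_0, 'u) module" and A :: "('k, 'a) module" and D :: "('k, 'd) module"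
    and G :: "('g, 'z) monoid_scheme" and j \<gamma> \<iota> actA actD Y n and T :: "('u, 'm) module" and \<chi> v +
  fixes \<epsilon> :: "nat \<Rightarrow> int" and \<chi>' :: "'d \<Rightarrow> 'k"
  assumes sign: "\<epsilon> i = 1 \<or> \<epsilon> i = -1"
    and Y_sign: "Y (\<lambda>i. \<epsilon> i * int (p i)) \<otimes>\<^bsub>A\<^esub> Y (\<lambda>i. \<epsilon> i * int (q i)) = Y (\<lambda>i. \<epsilon> i * int (p i + q i))"
    and Y_inverse: "\<exists>c\<in>carrier D. Y (\<lambda>i. - (\<epsilon> i * int (p i))) \<otimes>\<^bsub>A\<^esub> Y (\<lambda>i. \<epsilon> i * int (p i)) = \<iota> c \<and> \<chi> c \<noteq> 0"
    and Y_separate: "i \<in> {1..n} \<Longrightarrow> p i \<noteq> q i \<Longrightarrow> \<exists>d\<in>carrier D. \<exists>d'\<in>carrier D. \<exists>d''\<in>carrier D.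
       \<iota> d \<otimes>\<^bsub>A\<^esub> Y (\<lambda>i. \<epsilon> i * int (p i)) = Y (\<lambda>i. \<epsilon> i * int (p i)) \<otimes>\<^bsub>A\<^esub> \<iota> d' \<and>
       \<iota> d \<otimes>\<^bsub>A\<^esub> Y (\<lambda>i. \<epsilon> i * int (q i)) = Y (\<lambda>i. \<epsilon> i * int (q i)) \<otimes>\<^bsub>A\<^esub> \<iota> d'' \<and> \<chi> d' \<noteq> \<chi> d''"
    and simple: "simple_ring A" and \<chi>': "D.character \<chi>'"
    and \<chi>'_ker: "d \<in> carrier D \<Longrightarrow> \<iota> d = \<zero>\<^bsub>A\<^esub> \<Longrightarrow> \<chi>' d = 0"
    and \<chi>'_sep: "g \<in> carrier G \<Longrightarrow> g \<noteq> \<one>\<^bsub>G\<^esub> \<Longrightarrow> \<exists>d\<in>carrier D. \<chi>' (actD g d) \<noteq> \<chi>' d"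
begin

section \<open>The lower bound for the growth of T\<close>

definition w :: "(nat \<Rightarrow> nat) \<Rightarrow> 'm" where "w p = j (Y (\<lambda>i. \<epsilon> i * int (p i))) \<odot>\<^bsub>T\<^esub> v"

lemma w_closed [simp]: "w p \<in> carrier T"
  using v by (simp add: w_def T.smult_closed jD)

text \<open>The opposite monomial brings this vector back to a multiple of \<open>v\<close> by
  \<chi>(c), which is nonzero.\<close>

lemma w_nonzero: "w p \<noteq> \<zero>\<^bsub>T\<^esub>"
proof
  assume 0: "w p = \<zero>\<^bsub>T\<^esub>"
  obtain c where c: "c \<in> carrier D" "Y (\<lambda>i. - (\<epsilon> i * int (p i))) \<otimes>\<^bsub>A\<^esub> Y (\<lambda>i. \<epsilon> i * int (p i)) = \<iota> c" "\<chi> c \<noteq> 0"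
    using Y_inverse by blast
  have "j (\<iota> c) \<odot>\<^bsub>T\<^esub> v = j (Y (\<lambda>i. - (\<epsilon> i * int (p i)))) \<odot>\<^bsub>T\<^esub> w p"
    unfolding c(2)[symmetric] w_def using v by (simp add: jD T.smult_assoc)
  also have "\<dots> = \<zero>\<^bsub>T\<^esub>" unfolding 0 by (simp add: T.smult_zero_right jD)
  finally show False using weight[OF c(1)] sc_eq_zero[of "\<chi> c" v] v c(3) by simp
qed

lemma w_weight: "d \<in> carrier D \<Longrightarrow> \<exists>c. j (\<iota> d) \<odot>\<^bsub>T\<^esub> w p = c \<odot>\<^bsub>T.E\<^esub> w p"
proof -
  assume d: "d \<in> carrier D"
  obtain d' where d': "d' \<in> carrier D" "\<iota> d \<otimes>\<^bsub>A\<^esub> Y (\<lambda>i. \<epsilon> i * int (p i)) = Y (\<lambda>i. \<epsilon> i * int (p i)) \<otimes>\<^bsub>A\<^esub> \<iota> d'"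
    using \<iota>_Y[OF d] by blast
  from Y_weight[OF d d' v(1) weight[OF d'(1)]] show ?thesis unfolding w_def by blast
qed

lemma w_separate:
  assumes "i \<in> {1..n}" "p i \<noteq> q i"
  shows "\<exists>d\<in>carrier D. \<exists>c c'. j (\<iota> d) \<odot>\<^bsub>T\<^esub> w p = c \<odot>\<^bsub>T.E\<^esub> w p \<and> j (\<iota> d) \<odot>\<^bsub>T\<^esub> w q = c' \<odot>\<^bsub>T.E\<^esub> w q \<and> c \<noteq> c'"
proof -
  obtain d d' d'' where d: "d \<in> carrier D" "d' \<in> carrier D" "d'' \<in> carrier D"
    "\<iota> d \<otimes>\<^bsub>A\<^esub> Y (\<lambda>i. \<epsilon> i * int (p i)) = Y (\<lambda>i. \<epsilon> i * int (p i)) \<otimes>\<^bsub>A\<^esub> \<iota> d'"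
    "\<iota> d \<otimes>\<^bsub>A\<^esub> Y (\<lambda>i. \<epsilon> i * int (q i)) = Y (\<lambda>i. \<epsilon> i * int (q i)) \<otimes>\<^bsub>A\<^esub> \<iota> d''" "\<chi> d' \<noteq> \<chi> d''"
    using Y_separate[of i p q, OF assms] by blast
  show ?thesis
    using Y_weight[OF d(1,2,4) v(1) weight[OF d(2)]] Y_weight[OF d(1,3,5) v(1) weight[OF d(3)]] d(1,6)
    unfolding w_def by blast
qed

definition ws :: "nat \<Rightarrow> 'm set" where "ws N = w ` (\<Pi>\<^sub>E i\<in>{1..n}. {0..N})"

lemma ws_separate:
  assumes "x \<in> ws N" "y \<in> ws N" "x \<noteq> y"
  shows "\<exists>d\<in>carrier D. \<exists>c c'. j (\<iota> d) \<odot>\<^bsub>T\<^esub> x = c \<odot>\<^bsub>T.E\<^esub> x \<and> j (\<iota> d) \<odot>\<^bsub>T\<^esub> y = c' \<odot>\<^bsub>T.E\<^esub> y \<and> c \<noteq> c'"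
proof -
  obtain p q where pq: "x = w p" "y = w q" "p \<in> (\<Pi>\<^sub>E i\<in>{1..n}. {0..N})" "q \<in> (\<Pi>\<^sub>E i\<in>{1..n}. {0..N})"
    using assms by (auto simp: ws_def)
  obtain i where "i \<in> {1..n}" "p i \<noteq> q i" using pq assms(3) PiE_ext[OF pq(3,4)] by blast
  from w_separate[of i p q, OF this] show ?thesis unfolding pq(1,2) .
qed

lemma card_ws: "card (ws N) = (N + 1) ^ n"
proof -
  have "inj_on w (\<Pi>\<^sub>E i\<in>{1..n}. {0..N})"
  proof (rule inj_onI)
    fix p q assume pq: "p \<in> (\<Pi>\<^sub>E i\<in>{1..n}. {0..N})" "q \<in> (\<Pi>\<^sub>E i\<in>{1..n}. {0..N})" "w p = w q"
    show "p = q"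
    proof (rule ccontr)
      assume "p \<noteq> q"
      then obtain i where "i \<in> {1..n}" "p i \<noteq> q i" using PiE_ext[OF pq(1,2)] by blast
      from w_separate[of i p q, OF this] obtain c c' where "c \<odot>\<^bsub>T.E\<^esub> w p = c' \<odot>\<^bsub>T.E\<^esub> w p" "c \<noteq> c'"
        unfolding pq(3) by metis
      then show False using sc_inj[OF w_closed w_nonzero] by blast
    qed
  qed
  then show ?thesis unfolding ws_def by (simp add: card_image card_PiE Suc_eq_plus1 del: add_Suc_right)
qed

text \<open>Eigenvectors of pairwise distinct weights. The weights are represented by their kernels
  in D, so that the independence of generalized weight spaces applies.\<close>

lemma ws_lin_indpt: "T.E.lin_indpt (ws N)"
proof (rule T.E.finite_lin_indpt2)
  have fin: "finite (ws N)" unfolding ws_def by (intro finite_imageI finite_PiE) auto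
  then show "finite (ws N)" .
  have wsT: "x \<in> carrier T" "x \<noteq> \<zero>\<^bsub>T\<^esub>" if "x \<in> ws N" for x using that w_nonzero by (auto simp: ws_def)
  then show "ws N \<subseteq> carrier T.E" by (auto simp: T.E_simps(1))
  fix a :: "'m \<Rightarrow> 'k" assume 0: "T.E.lincomb a (ws N) = \<zero>\<^bsub>T.E\<^esub>"
  have "\<exists>\<psi>. D.character \<psi> \<and> (\<forall>d\<in>carrier D. j (\<iota> d) \<odot>\<^bsub>T\<^esub> x = \<psi> d \<odot>\<^bsub>T.E\<^esub> x)" if x: "x \<in> ws N" for x
    by (rule weight_character[OF D.k_algebra \<iota>_hom wsT[OF x]]) (use x w_weight in \<open>auto simp: ws_def\<close>)
  then obtain \<psi> where \<psi>: "\<And>x. x \<in> ws N \<Longrightarrow> D.character (\<psi> x)"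
      "\<And>x d. x \<in> ws N \<Longrightarrow> d \<in> carrier D \<Longrightarrow> j (\<iota> d) \<odot>\<^bsub>T\<^esub> x = \<psi> x d \<odot>\<^bsub>T.E\<^esub> x" by metis
  define \<kappa> where "\<kappa> x = {d \<in> carrier D. \<psi> x d = 0}" for x
  have inj: "inj_on \<kappa> (ws N)"
  proof (rule inj_onI)
    fix x y assume xy: "x \<in> ws N" "y \<in> ws N" "\<kappa> x = \<kappa> y"
    show "x = y"
    proof (rule ccontr)
      assume "x \<noteq> y"
      from ws_separate[OF xy(1,2) this] obtain d c c' where d: "d \<in> carrier D" "j (\<iota> d) \<odot>\<^bsub>T\<^esub> x = c \<odot>\<^bsub>T.E\<^esub> x"
        "j (\<iota> d) \<odot>\<^bsub>T\<^esub> y = c' \<odot>\<^bsub>T.E\<^esub> y" "c \<noteq> c'" by blast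
      have c: "c = \<psi> x d" "c' = \<psi> y d"
        using \<psi>(2)[OF xy(1) d(1)] \<psi>(2)[OF xy(2) d(1)] d sc_inj[OF wsT[OF xy(1)]] sc_inj[OF wsT[OF xy(2)]] by metis+
      \<comment> \<open>Subtracting the eigenvalue on x gives an element in the kernel of the weight
        of x but not in that of y, so distinct weights have distinct kernels.\<close>
      let ?e = "d \<oplus>\<^bsub>D\<^esub> (- c) \<odot>\<^bsub>D\<^esub> \<one>\<^bsub>D\<^esub>"
      have e: "\<psi> x ?e = \<psi> x d - c" "\<psi> y ?e = \<psi> y d - c" "?e \<in> carrier D"
        using d(1) D.characterD[OF \<psi>(1)[OF xy(1)]] D.characterD[OF \<psi>(1)[OF xy(2)]] by simp_all
      have "?e \<in> \<kappa> x" unfolding \<kappa>_def using e c by simp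
      then have "\<psi> y ?e = 0" unfolding xy(3) by (simp add: \<kappa>_def)
      then show False using e c d(4) by simp
    qed
  qed
  interpret N: comm_left_module D "restrict_scalars (j \<circ> \<iota>) T"
    using D_left_module Dc.cring_axioms by (simp add: comm_left_module_def)
  \<comment> \<open>The linear combination is reindexed by kernels, since independence is stated for
    families indexed by ideals.\<close>
  define f where "f k = (let x = the_inv_into (ws N) \<kappa> k in a x \<odot>\<^bsub>T.E\<^esub> x)" for k
  have f: "f (\<kappa> x) = a x \<odot>\<^bsub>T.E\<^esub> x" if "x \<in> ws N" for x
    unfolding f_def by (simp add: the_inv_into_f_f[OF inj that])
  have "(\<Oplus>\<^bsub>T\<^esub>k\<in>\<kappa> ` ws N. f k) = (\<Oplus>\<^bsub>T\<^esub>x\<in>ws N. f (\<kappa> x))"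
    using f wsT by (intro T.M.finsum_reindex[OF _ inj]) auto
  also have "\<dots> = (\<Oplus>\<^bsub>T\<^esub>x\<in>ws N. a x \<odot>\<^bsub>T.E\<^esub> x)"
    using f wsT by (intro T.M.finsum_cong') auto
  also have "\<dots> = T.E.lincomb a (ws N)"
    unfolding T.E.lincomb_def by (simp only: underlying_space_def finsum_restrict_scalars)
  also have "\<dots> = \<zero>\<^bsub>T\<^esub>" using 0 by (simp add: T.E_simps(2))
  finally have sum: "(\<Oplus>\<^bsub>T\<^esub>k\<in>\<kappa> ` ws N. f k) = \<zero>\<^bsub>T\<^esub>" .
  show "\<forall>x\<in>ws N. a x = \<zero>\<^bsub>class_ring\<^esub>"
  proof
    fix x assume x: "x \<in> ws N"
    have "f (\<kappa> x) = \<zero>\<^bsub>restrict_scalars (j \<circ> \<iota>) T\<^esub>"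
    proof (rule N.gws_independent[of "\<kappa> ` ws N"])
      show "finite (\<kappa> ` ws N)" using fin by simp
      show "maximalideal \<nn> D" if "\<nn> \<in> \<kappa> ` ws N" for \<nn>
        using that D.character_kernel[OF \<psi>(1)] by (auto simp: \<kappa>_def cofinite_maximal_ideals_def)
      show "f \<nn> \<in> N.gws \<nn>" if \<nn>: "\<nn> \<in> \<kappa> ` ws N" for \<nn>
      proof -
        obtain y where y: "y \<in> ws N" "\<nn> = \<kappa> y" using \<nn> by blast
        have "a y \<odot>\<^bsub>T.E\<^esub> y \<in> N.gws (\<kappa> y)"
          unfolding \<kappa>_def
        proof (rule gws_T[OF _ \<psi>(1)[OF y(1)]])
          show "a y \<odot>\<^bsub>T.E\<^esub> y \<in> carrier T" using wsT[OF y(1)] by simp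
          fix d assume d: "d \<in> carrier D"
          have "j (\<iota> d) \<odot>\<^bsub>T\<^esub> (a y \<odot>\<^bsub>T.E\<^esub> y) = a y \<odot>\<^bsub>T.E\<^esub> (\<psi> y d \<odot>\<^bsub>T.E\<^esub> y)"
            using d wsT[OF y(1)] \<psi>(2)[OF y(1) d] by (simp add: T.smult_sc jD \<iota>D)
          then show "j (\<iota> d) \<odot>\<^bsub>T\<^esub> (a y \<odot>\<^bsub>T.E\<^esub> y) = \<psi> y d \<odot>\<^bsub>T.E\<^esub> (a y \<odot>\<^bsub>T.E\<^esub> y)"
            using wsT[OF y(1)] by (simp add: sc_sc mult.commute)
        qed
        then show ?thesis unfolding y(2) f[OF y(1)] .
      qed
      show "(\<Oplus>\<^bsub>restrict_scalars (j \<circ> \<iota>) T\<^esub>\<nn>\<in>\<kappa> ` ws N. f \<nn>) = \<zero>\<^bsub>restrict_scalars (j \<circ> \<iota>) T\<^esub>"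
        unfolding finsum_restrict_scalars using sum by (simp add: restrict_scalars_def)
    qed (use x in simp)
    then have "a x \<odot>\<^bsub>T.E\<^esub> x = \<zero>\<^bsub>T\<^esub>" unfolding f[OF x] by (simp add: restrict_scalars_def)
    then show "a x = \<zero>\<^bsub>class_ring\<^esub>" using sc_eq_zero[of "a x" x] wsT[OF x] by auto
  qed
qed

text \<open>With exponents in {-1, 0, 1} a single application may advance all slots at once. Then N
  applications reach every point of {0..N}^n, and (N + 1)^n vectors are obtained without any loss
  from the number of slots.\<close>

definition Vs :: "'u set" where
  "Vs = insert \<one>\<^bsub>U\<^esub> ((\<lambda>J. j (Y J)) ` (\<Pi>\<^sub>E i\<in>{1..n}. {- 1..1}))"

definition V :: "'u set" where "V = module.span (class_ring :: 'k ring) U Vs"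
definition F :: "'m set" where "F = T.E.span {v}"

lemma Vs: "finite Vs" "Vs \<subseteq> carrier U"
  unfolding Vs_def by (auto intro!: finite_imageI finite_PiE simp: jD)

lemma V: "V \<in> fin_dim_subspaces U" "\<one>\<^bsub>U\<^esub> \<in> V" "Vs \<subseteq> V" "V \<subseteq> carrier U"
proof -
  interpret UV: vectorspace "class_ring :: 'k ring" U by (rule U.vectorspace)
  show "V \<in> fin_dim_subspaces U" using fin_dim_subspaces_iff[OF U.vectorspace] Vs unfolding V_def by blast
  show VsV: "Vs \<subseteq> V" unfolding V_def by (rule UV.in_own_span[OF Vs(2)])
  then show "\<one>\<^bsub>U\<^esub> \<in> V" by (auto simp: Vs_def)
  show "V \<subseteq> carrier U" unfolding V_def by (rule UV.span_is_subset2[OF Vs(2)])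
qed

lemma F: "F \<in> fin_dim_subspaces T.E" "v \<in> F" "F \<subseteq> carrier T"
proof -
  have v': "{v} \<subseteq> carrier T.E" using v by (simp add: T.E_simps(1))
  then show "F \<in> fin_dim_subspaces T.E"
    unfolding F_def fin_dim_subspaces_iff[OF T.E_vectorspace] by (intro exI[of _ "{v}"]) simp
  show "v \<in> F" unfolding F_def using T.E.in_own_span[OF v'] by simp
  show "F \<subseteq> carrier T" unfolding F_def by (rule T.span_closedM) (use v in simp)
qed

lemma w_power_space: "(\<And>i. i \<in> {1..n} \<Longrightarrow> p i \<le> N) \<Longrightarrow> w p \<in> power_space U T V F N"
proof (induction N arbitrary: p)
  case 0
  have "Y (\<lambda>i. \<epsilon> i * int (p i)) = Y (restrict (\<lambda>i. \<epsilon> i * int (p i)) {1..n})" by (simp only: Y_restrict)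
  also have "restrict (\<lambda>i. \<epsilon> i * int (p i)) {1..n} = restrict (\<lambda>_. 0) {1..n}" using 0 by auto
  also have "Y \<dots> = \<one>\<^bsub>A\<^esub>" by (simp only: Y_restrict Y_zero)
  finally have "w p = v" using v by (simp add: w_def jD T.smult_one)
  then show ?case using F by simp
next
  case (Suc N)
  \<comment> \<open>One step is split off in every slot that still has a step to make; the remaining
    exponents are at most N.\<close>
  define q where "q i = min 1 (p i)" for i
  define r where "r i = p i - q i" for i
  have pqr: "p i = q i + r i" for i by (simp add: q_def r_def)
  have eq: "Y (\<lambda>i. \<epsilon> i * int (p i)) = Y (\<lambda>i. \<epsilon> i * int (q i)) \<otimes>\<^bsub>A\<^esub> Y (\<lambda>i. \<epsilon> i * int (r i))"
    by (simp only: Y_sign pqr)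
  have "w r \<in> power_space U T V F N"
  proof (rule Suc.IH)
    show "r i \<le> N" if "i \<in> {1..n}" for i using Suc.prems[OF that] by (auto simp: r_def q_def min_def)
  qed
  moreover have "j (Y (\<lambda>i. \<epsilon> i * int (q i))) \<in> Vs"
  proof -
    have "restrict (\<lambda>i. \<epsilon> i * int (q i)) {1..n} \<in> (\<Pi>\<^sub>E i\<in>{1..n}. {- 1..1})"
    proof (rule restrict_PiE_iff[THEN iffD2], rule ballI)
      fix i
      have "q i = 0 \<or> q i = 1" unfolding q_def by linarith
      then show "\<epsilon> i * int (q i) \<in> {- 1..1}" using sign[of i] by auto
    qed
    then have "j (Y (restrict (\<lambda>i. \<epsilon> i * int (q i)) {1..n})) \<in> Vs" unfolding Vs_def by blast
    then show ?thesis by (simp only: Y_restrict)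
  qed
  ultimately have "j (Y (\<lambda>i. \<epsilon> i * int (q i))) \<odot>\<^bsub>T\<^esub> w r \<in> power_space U T V F (Suc N)"
    using V(3) by (intro T.power_space_Suc_sub[OF V(4) F(3)]) auto
  moreover have "w p = j (Y (\<lambda>i. \<epsilon> i * int (q i))) \<odot>\<^bsub>T\<^esub> w r"
    unfolding w_def eq using v by (simp add: jD T.smult_assoc)
  ultimately show ?case by simp
qed

lemma ws_power_space: "ws N \<subseteq> power_space U T V F N"
  unfolding ws_def by (auto intro!: w_power_space)

lemma GK_dim_T: "GK_dim U T = ereal (real n)"
proof (rule antisym[OF GK_dim_T_le])
  show "ereal (real n) \<le> GK_dim U T"
  proof (rule GK_dim_lower[OF V(1,2) F(1), of 1])
    fix N
    have "real ((N + 1) ^ n) \<le> real (vectorspace.dim (class_ring :: 'k ring) (T.E\<lparr>carrier := power_space U T V F N\<rparr>))"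
      using T.power_space_dim_ge[OF V(1) F(1) ws_power_space ws_lin_indpt, of N] unfolding card_ws by (rule of_nat_mono)
    then show "1 * (real N + 1) ^ n \<le> real (vectorspace.dim (class_ring :: 'k ring) (T.E\<lparr>carrier := power_space U T V F N\<rparr>))"
      by (simp add: add.commute)
  qed simp
qed

section \<open>Transfer of nonvanishing and growth to the fixed vectors\<close>

lemma one_decomposition: "\<exists>xs\<in>pairs. ideal_sum xs = \<one>\<^bsub>U\<^esub>"
  using one_in_sumG_ideal[OF simple \<chi>' \<chi>'_ker \<chi>'_sep] unfolding sumG_ideal_def by auto

text \<open>Membership is tested summand by summand. When the sum of the list is 1, this transfers
  information about images of averaging to \<open>t\<close> itself.\<close>

lemma decompose:
  assumes xs: "xs \<in> pairs" and W: "submodule (class_ring :: 'k ring) W T.E" and t: "t \<in> carrier T"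
    and mem: "\<And>a u. (a, u) \<in> set xs \<Longrightarrow> a \<odot>\<^bsub>T\<^esub> (sumG \<odot>\<^bsub>T\<^esub> (u \<odot>\<^bsub>T\<^esub> t)) \<in> W"
  shows "ideal_sum xs \<odot>\<^bsub>T\<^esub> t \<in> W"
  using xs mem
proof (induction xs rule: ideal_sum.induct)
  case 1
  then show ?case using submodule.zero_closed[OF W] t by (simp add: T.smult_zero_left T.E_simps(2))
next
  case (2 a u xs)
  then have au: "a \<in> carrier U" "u \<in> carrier U" "xs \<in> pairs" by auto
  have "ideal_sum xs \<odot>\<^bsub>T\<^esub> t \<in> W" using 2 by auto
  moreover have "a \<odot>\<^bsub>T\<^esub> (sumG \<odot>\<^bsub>T\<^esub> (u \<odot>\<^bsub>T\<^esub> t)) \<in> W" using 2 by auto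
  moreover have "ideal_sum ((a, u) # xs) \<odot>\<^bsub>T\<^esub> t = a \<odot>\<^bsub>T\<^esub> (sumG \<odot>\<^bsub>T\<^esub> (u \<odot>\<^bsub>T\<^esub> t)) \<oplus>\<^bsub>T\<^esub> ideal_sum xs \<odot>\<^bsub>T\<^esub> t"
    using au t by (simp add: T.smult_l_distr T.smult_assoc T.smult_closed)
  ultimately show ?case using submodule.m_closed[OF W] by (simp add: T.E_simps(3))
qed

text \<open>All images of the sum over G are fixed vectors. If these were all zero, each summand in
  the expression of 1 would kill \<open>v\<close>, and so would 1.\<close>

lemma TG_nonzero: "\<exists>x\<in>carrier TG. x \<noteq> \<zero>\<^bsub>T\<^esub>"
proof (rule ccontr)
  assume "\<not> ?thesis"
  then have z: "x = \<zero>\<^bsub>T\<^esub>" if "x \<in> carrier TG" for x using that by blast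
  obtain xs where xs: "xs \<in> pairs" "ideal_sum xs = \<one>\<^bsub>U\<^esub>" using one_decomposition by blast
  have "ideal_sum xs \<odot>\<^bsub>T\<^esub> v \<in> T.E.span {}"
  proof (rule decompose[OF xs(1) T.span_submodule v(1)])
    fix a u assume "(a, u) \<in> set xs"
    then have au: "a \<in> carrier U" "u \<in> carrier U" using xs(1) by auto
    then have "sumG \<odot>\<^bsub>T\<^esub> (u \<odot>\<^bsub>T\<^esub> v) = \<zero>\<^bsub>T\<^esub>" using v by (intro z sumG_fixed) (simp add: T.smult_closed)
    then show "a \<odot>\<^bsub>T\<^esub> (sumG \<odot>\<^bsub>T\<^esub> (u \<odot>\<^bsub>T\<^esub> v)) \<in> T.E.span {}"
      using au submodule.zero_closed[OF T.span_submodule[of "{}"]] by (simp add: T.smult_zero_right T.E_simps(2))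
  qed simp
  moreover have "T.E.span {} = {\<zero>\<^bsub>T\<^esub>}" by (simp add: T.E.span_empty T.E_simps(2))
  ultimately show False using xs(2) v by (simp add: T.smult_one)
qed

text \<open>Since \<open>1 = \<Sum> a\<^sub>i s u\<^sub>i\<close> with \<open>s\<close> the sum over \<open>G\<close>, the filtration of \<open>T\<close> is covered by finitely
  many translates of a filtration of the fixed vectors.\<close>
lemma GK_dim_TG: "GK_dim AG TG = ereal (real n)"
proof (rule antisym[OF GK_dim_TG_le])
  obtain xs where xs: "xs \<in> pairs" "ideal_sum xs = \<one>\<^bsub>U\<^esub>" using one_decomposition by blast
  have pairs: "a \<in> carrier U" "u \<in> carrier U" if "(a, u) \<in> set xs" for a u using that xs(1) by auto
  \<comment> \<open>An invariant element that acts on every fixed vector as \<open>u\<close>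
    followed by the sum over G does; it is the trace found in \<open>trace_exists\<close>.\<close>
  define y where "y u = (SOME y. y \<in> carrier AG \<and> (\<forall>t\<in>carrier T. (\<forall>g\<in>carrier G. \<gamma> g \<odot>\<^bsub>T\<^esub> t = t) \<longrightarrow> sumG \<odot>\<^bsub>T\<^esub> (u \<odot>\<^bsub>T\<^esub> t) = j y \<odot>\<^bsub>T\<^esub> t))" for u
  have y': "y u \<in> carrier AG \<and> (\<forall>t\<in>carrier T. (\<forall>g\<in>carrier G. \<gamma> g \<odot>\<^bsub>T\<^esub> t = t) \<longrightarrow> sumG \<odot>\<^bsub>T\<^esub> (u \<odot>\<^bsub>T\<^esub> t) = j (y u) \<odot>\<^bsub>T\<^esub> t)"
    if "u \<in> carrier U" for u
    unfolding y_def by (rule someI_ex, insert trace_exists[OF T.left_module_axioms that], blast)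
  have y: "y u \<in> carrier AG" if "u \<in> carrier U" for u using y'[OF that] by (rule conjunct1)
  have y2: "sumG \<odot>\<^bsub>T\<^esub> (u \<odot>\<^bsub>T\<^esub> t) = j (y u) \<odot>\<^bsub>T\<^esub> t" if "u \<in> carrier U" "t \<in> carrier TG" for u t
    using y'[OF that(1)] that(2) unfolding TG_simps(1) mem_Collect_eq by blast
  define As where "As = fst ` set xs"
  define Us where "Us = snd ` set xs"
  have As: "finite As" "As \<subseteq> carrier U" and Us: "finite Us" "Us \<subseteq> carrier U"
    using pairs by (auto simp: As_def Us_def)
  interpret AV: vectorspace "class_ring :: 'k ring" AG by (rule AG.vectorspace)
  \<comment> \<open>The generators are dictated by one step of the comparison. For x fixed, writing
    1 as a sum of terms a' sumG u' in front of u (a x) gives summands a' applied to y(u' u a) x, so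
    these traces take over the role of u on translates.\<close>
  define Vs' where "Vs' = insert \<one>\<^bsub>AG\<^esub> ((\<lambda>(u', u, a). y (u' \<otimes>\<^bsub>U\<^esub> (u \<otimes>\<^bsub>U\<^esub> a))) ` (Us \<times> Vs \<times> As))"
  define V' where "V' = AV.span Vs'"
  define Fs' where "Fs' = (\<lambda>u. sumG \<odot>\<^bsub>T\<^esub> (u \<odot>\<^bsub>T\<^esub> v)) ` Us"
  define F' where "F' = TG.E.span Fs'"
  have Vs': "finite Vs'" "Vs' \<subseteq> carrier AG"
    unfolding Vs'_def using Us Vs As y AG.one_closed by (auto simp: subset_iff)
  have Fs': "finite Fs'" "Fs' \<subseteq> carrier TG"
    unfolding Fs'_def using Us v by (auto intro!: sumG_fixed T.smult_closed)
  have V': "V' \<in> fin_dim_subspaces AG" "\<one>\<^bsub>AG\<^esub> \<in> V'" "Vs' \<subseteq> V'" "V' \<subseteq> carrier AG"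
  proof -
    show "V' \<in> fin_dim_subspaces AG" using fin_dim_subspaces_iff[OF AG.vectorspace] Vs' unfolding V'_def by blast
    show "Vs' \<subseteq> V'" unfolding V'_def by (rule AV.in_own_span[OF Vs'(2)])
    then show "\<one>\<^bsub>AG\<^esub> \<in> V'" by (auto simp: Vs'_def)
    show "V' \<subseteq> carrier AG" unfolding V'_def by (rule AV.span_is_subset2[OF Vs'(2)])
  qed
  have Fs'E: "Fs' \<subseteq> carrier TG.E" using Fs'(2) by (simp add: TG.E_simps(1))
  have F': "F' \<in> fin_dim_subspaces TG.E" "Fs' \<subseteq> F'" "F' \<subseteq> carrier TG"
  proof -
    show "F' \<in> fin_dim_subspaces TG.E" using fin_dim_subspaces_iff[OF TG.E_vectorspace] Fs'(1) Fs'E unfolding F'_def by blast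
    show "Fs' \<subseteq> F'" unfolding F'_def by (rule TG.E.in_own_span[OF Fs'E])
    show "F' \<subseteq> carrier TG" unfolding F'_def by (rule TG.span_closedM[OF Fs'(2)])
  qed
  let ?P = "power_space AG TG V' F'"
  have PTG: "?P N \<subseteq> carrier TG" for N by (rule TG.power_space_closed[OF V'(4) F'(3)])
  have TGT: "carrier TG \<subseteq> carrier T" by (auto simp: TG_simps)
  define Zs where "Zs X0 = (\<lambda>(a, x). a \<odot>\<^bsub>T\<^esub> x) ` (As \<times> X0)" for X0
  have Zs: "Zs X0 \<subseteq> carrier T" if "X0 \<subseteq> carrier T" for X0
    unfolding Zs_def using that As by (auto intro!: T.smult_closed)
  have PT: "?P N \<subseteq> carrier T" for N using PTG TGT by blast
  note ZsP = Zs[OF PT]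
  have Zsub: "submodule class_ring (T.E.span (Zs (?P N))) T.E" for N by (rule T.span_submodule[OF ZsP])
  have ZZ: "Zs (?P N) \<subseteq> T.E.span (Zs (?P N))" for N using T.E.in_own_span[of "Zs (?P N)"] ZsP by (simp add: T.E_simps(1))
  \<comment> \<open>The same N occurs on both sides: each step in T costs one step in the fixed
    vectors. The dimensions then differ by at most the number of translates.\<close>
  have cover: "power_space U T V F N \<subseteq> T.E.span (Zs (?P N))" for N
  proof (induction N)
    case 0
    have "ideal_sum xs \<odot>\<^bsub>T\<^esub> v \<in> T.E.span (Zs (?P 0))"
    proof (rule decompose[OF xs(1) Zsub v(1)])
      fix a u assume au: "(a, u) \<in> set xs"
      have "sumG \<odot>\<^bsub>T\<^esub> (u \<odot>\<^bsub>T\<^esub> v) \<in> Fs'" using au unfolding Fs'_def Us_def by force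
      then have "sumG \<odot>\<^bsub>T\<^esub> (u \<odot>\<^bsub>T\<^esub> v) \<in> ?P 0" using F'(2) by auto
      moreover have "a \<in> As" using au unfolding As_def by force
      ultimately have "a \<odot>\<^bsub>T\<^esub> (sumG \<odot>\<^bsub>T\<^esub> (u \<odot>\<^bsub>T\<^esub> v)) \<in> Zs (?P 0)" unfolding Zs_def by force
      then show "a \<odot>\<^bsub>T\<^esub> (sumG \<odot>\<^bsub>T\<^esub> (u \<odot>\<^bsub>T\<^esub> v)) \<in> T.E.span (Zs (?P 0))" using ZZ by blast
    qed
    then have "v \<in> T.E.span (Zs (?P 0))" using xs(2) v by (simp add: T.smult_one)
    then show ?case unfolding power_space.simps(1) F_def by (intro T.E.span_minimal[OF Zsub[of 0, unfolded power_space.simps(1)]]) simp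
  next
    case (Suc N)
    let ?Z = "T.E.span (Zs (?P (Suc N)))"
    have gen: "u \<odot>\<^bsub>T\<^esub> (a \<odot>\<^bsub>T\<^esub> x) \<in> ?Z" if u: "u \<in> Vs" and a: "a \<in> As" and x: "x \<in> ?P N" for u a x
    proof -
      have cl: "u \<in> carrier U" "a \<in> carrier U" "x \<in> carrier T" "x \<in> carrier TG"
        using u a Vs As subsetD[OF PT x] subsetD[OF PTG x] by auto
      have "ideal_sum xs \<odot>\<^bsub>T\<^esub> (u \<odot>\<^bsub>T\<^esub> (a \<odot>\<^bsub>T\<^esub> x)) \<in> ?Z"
      proof (rule decompose[OF xs(1) Zsub])
        show "u \<odot>\<^bsub>T\<^esub> (a \<odot>\<^bsub>T\<^esub> x) \<in> carrier T" using cl by (simp add: T.smult_closed)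
        fix a' u' assume au: "(a', u') \<in> set xs"
        have u': "u' \<in> carrier U" using pairs[OF au] by simp
        have "u' \<odot>\<^bsub>T\<^esub> (u \<odot>\<^bsub>T\<^esub> (a \<odot>\<^bsub>T\<^esub> x)) = (u' \<otimes>\<^bsub>U\<^esub> (u \<otimes>\<^bsub>U\<^esub> a)) \<odot>\<^bsub>T\<^esub> x"
          using cl u' by (simp add: T.smult_assoc T.smult_closed)
        then have eq: "sumG \<odot>\<^bsub>T\<^esub> (u' \<odot>\<^bsub>T\<^esub> (u \<odot>\<^bsub>T\<^esub> (a \<odot>\<^bsub>T\<^esub> x))) = y (u' \<otimes>\<^bsub>U\<^esub> (u \<otimes>\<^bsub>U\<^esub> a)) \<odot>\<^bsub>TG\<^esub> x"
          using y2[of "u' \<otimes>\<^bsub>U\<^esub> (u \<otimes>\<^bsub>U\<^esub> a)" x] cl u' by (simp add: TG_simps(4))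
        have "u' \<in> Us" "a' \<in> As" using au unfolding Us_def As_def by force+
        then have "y (u' \<otimes>\<^bsub>U\<^esub> (u \<otimes>\<^bsub>U\<^esub> a)) \<in> Vs'" unfolding Vs'_def using u a by force
        then have "y (u' \<otimes>\<^bsub>U\<^esub> (u \<otimes>\<^bsub>U\<^esub> a)) \<odot>\<^bsub>TG\<^esub> x \<in> ?P (Suc N)"
          using V'(3) x by (intro TG.power_space_Suc_sub[OF V'(4) F'(3)]) auto
        then have "a' \<odot>\<^bsub>T\<^esub> (y (u' \<otimes>\<^bsub>U\<^esub> (u \<otimes>\<^bsub>U\<^esub> a)) \<odot>\<^bsub>TG\<^esub> x) \<in> Zs (?P (Suc N))"
          unfolding Zs_def using \<open>a' \<in> As\<close> by force
        then show "a' \<odot>\<^bsub>T\<^esub> (sumG \<odot>\<^bsub>T\<^esub> (u' \<odot>\<^bsub>T\<^esub> (u \<odot>\<^bsub>T\<^esub> (a \<odot>\<^bsub>T\<^esub> x)))) \<in> ?Z" unfolding eq using ZZ by blast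
      qed
      then show ?thesis using xs(2) cl by (simp add: T.smult_one T.smult_closed)
    qed
    have "u \<odot>\<^bsub>T\<^esub> z \<in> ?Z" if u: "u \<in> V" and z: "z \<in> T.E.span (Zs (?P N))" for u z
    proof (rule T.smult_span_left[OF Zsub Vs(2)])
      show "z \<in> carrier T" using z T.span_closedM[OF ZsP] by blast
      show "u \<in> module.span (class_ring :: 'k ring) U Vs" using u unfolding V_def .
      fix u' assume u': "u' \<in> Vs"
      show "u' \<odot>\<^bsub>T\<^esub> z \<in> ?Z"
      proof (rule T.smult_span_right[OF Zsub ZsP _ _ z])
        show "u' \<in> carrier U" using u' Vs by blast
        fix z' assume "z' \<in> Zs (?P N)"
        then obtain a x where "a \<in> As" "x \<in> ?P N" and z': "z' = a \<odot>\<^bsub>T\<^esub> x" unfolding Zs_def by auto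
        then show "u' \<odot>\<^bsub>T\<^esub> z' \<in> ?Z" unfolding z' by (intro gen[OF u'])
      qed
    qed
    then show ?case unfolding power_space.simps(2)[of U T V F] using Suc by (intro T.E.span_minimal[OF Zsub]) blast
  qed
  have TGsub: "submodule class_ring (carrier TG) T.E"
    by (intro submoduleI T.E_vectorspace)
      (auto simp: TG_simps(1) T.E_simps(1-3) T.smult_r_distr T.smult_zero_right \<gamma>_sc)
  have F'sub: "submodule class_ring F' TG.E" unfolding F'_def by (rule TG.span_submodule[OF Fs'(2)])
  show "ereal (real n) \<le> GK_dim AG TG"
  \<comment> \<open>Adding 1 to the number of translates keeps the denominator visibly
    positive.\<close>
  proof (rule GK_dim_lower[OF V'(1,2) F'(1), of "1 / (real (card As) + 1)"])
    fix N
    let ?d = "vectorspace.dim (class_ring :: 'k ring) (TG.E\<lparr>carrier := ?P N\<rparr>)"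
    obtain A0 where A0: "finite A0" "A0 \<subseteq> carrier TG" "?P N = TG.E.span A0"
      using TG.power_space_fin_dim[OF V'(1) F'(1)] by blast
    have A0E: "A0 \<subseteq> carrier TG.E" using A0(2) by (simp add: TG.E_simps(1))
    have Psub: "submodule class_ring (?P N) TG.E" by (rule TG.power_space_submodule[OF V'(4) F'sub])
    have "(N + 1) ^ n \<le> (card As + 1) * ?d"
    proof (rule TG.E.submodule_basis[OF A0(1) A0E Psub])
      show "?P N \<subseteq> TG.E.span A0" using A0(3) by simp
      fix B0 assume B0: "finite B0" "B0 \<subseteq> ?P N" "TG.E.span B0 = ?P N" "?d = card B0"
      have B0TG: "B0 \<subseteq> carrier TG" using B0(2) PTG by blast
      have B0T: "B0 \<subseteq> carrier T" using B0TG TGT by blast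
      have span_eq: "T.E.span B0 = ?P N"
        using T.E.span_li_not_depend(1)[OF B0TG TGsub] B0(3) unfolding TG_E by simp
      have ZB: "Zs B0 \<subseteq> carrier T" by (rule Zs[OF B0T])
      have ZBfin: "finite (Zs B0)" unfolding Zs_def using As B0(1) by simp
      have "T.E.span (Zs (?P N)) \<subseteq> T.E.span (Zs B0)"
      proof (rule T.E.span_minimal[OF T.span_submodule[OF ZB]])
        show "Zs (?P N) \<subseteq> T.E.span (Zs B0)"
        proof
          fix z assume "z \<in> Zs (?P N)"
          then obtain a x where ax: "a \<in> As" "x \<in> ?P N" "z = a \<odot>\<^bsub>T\<^esub> x" unfolding Zs_def by auto
          show "z \<in> T.E.span (Zs B0)" unfolding ax(3)
          proof (rule T.smult_span_right[OF T.span_submodule[OF ZB] B0T])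
            show "a \<in> carrier U" using ax As by auto
            show "x \<in> T.E.span B0" using ax span_eq by simp
            fix x' assume "x' \<in> B0"
            then have "a \<odot>\<^bsub>T\<^esub> x' \<in> Zs B0" unfolding Zs_def using ax by force
            then show "a \<odot>\<^bsub>T\<^esub> x' \<in> T.E.span (Zs B0)" using T.E.in_own_span[of "Zs B0"] ZB by (auto simp: T.E_simps(1))
          qed
        qed
      qed
      then have "ws N \<subseteq> T.E.span (Zs B0)" using ws_power_space cover by blast
      moreover have "Zs B0 \<subseteq> carrier T.E" using ZB by (simp add: T.E_simps(1))
      ultimately have "card (ws N) \<le> card (Zs B0)" using T.E.li_in_span_bound(2)[OF ZBfin _ _ ws_lin_indpt] by blast
      also have "card (Zs B0) \<le> card As * card B0"
        unfolding Zs_def using As B0(1) card_image_le[of "As \<times> B0" "\<lambda>(a, x). a \<odot>\<^bsub>T\<^esub> x"] by (simp add: card_cartesian_product)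
      also have "\<dots> \<le> (card As + 1) * card B0" by simp
      finally show "(N + 1) ^ n \<le> (card As + 1) * ?d" unfolding card_ws B0(4) .
    qed
    then have "real ((N + 1) ^ n) \<le> real ((card As + 1) * ?d)" by (rule of_nat_mono)
    then have "(real N + 1) ^ n \<le> (real (card As) + 1) * real ?d" by (simp add: add.commute)
    then show "1 / (real (card As) + 1) * (real N + 1) ^ n \<le> real ?d" by (simp add: field_simps)
  qed simp
qed

lemma holonomic_T: "holonomic n U T"
  unfolding holonomic_def using T.left_module_axioms fin_gen_T GK_dim_T by blast

lemma holonomic_TG: "holonomic n AG TG"
  unfolding holonomic_def using TG_left_module TG_nonzero harish_chandra_TG(2) GK_dim_TG by blast

end

section \<open>Skew group rings\<close>

locale skew_ring = A: kalg A + G: group G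
  for A :: "('k::field, 'a) module" and G :: "('g, 'z) monoid_scheme" +
  fixes act :: "'g \<Rightarrow> 'a \<Rightarrow> 'a"
  assumes finG: "finite (carrier G)"
    and act_hom: "g \<in> carrier G \<Longrightarrow> alg_hom A A (act g)"
    and act_mult: "g \<in> carrier G \<Longrightarrow> h \<in> carrier G \<Longrightarrow> a \<in> carrier A \<Longrightarrow> act (g \<otimes>\<^bsub>G\<^esub> h) a = act g (act h a)"
    and act_one: "a \<in> carrier A \<Longrightarrow> act \<one>\<^bsub>G\<^esub> a = a"
begin

abbreviation "U \<equiv> skew_group_ring A G act"
abbreviation "el \<equiv> skew_elt A G"

lemmas actD = alg_homD[OF act_hom]

lemma act_zero: "g \<in> carrier G \<Longrightarrow> act g \<zero>\<^bsub>A\<^esub> = \<zero>\<^bsub>A\<^esub>"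
  using actD(5)[of g "\<zero>\<^bsub>A\<^esub>" 0] by (simp add: actD)

lemma U_simps: "carrier U = carrier G \<rightarrow>\<^sub>E carrier A" "f \<oplus>\<^bsub>U\<^esub> h = (\<lambda>g\<in>carrier G. f g \<oplus>\<^bsub>A\<^esub> h g)"
  "\<zero>\<^bsub>U\<^esub> = (\<lambda>g\<in>carrier G. \<zero>\<^bsub>A\<^esub>)" "\<one>\<^bsub>U\<^esub> = el \<one>\<^bsub>A\<^esub> \<one>\<^bsub>G\<^esub>" "c \<odot>\<^bsub>U\<^esub> f = (\<lambda>g\<in>carrier G. c \<odot>\<^bsub>A\<^esub> f g)"
  using finG by (auto simp: skew_group_ring_def)

lemma comp_closed [simp]: "f \<in> carrier U \<Longrightarrow> g \<in> carrier G \<Longrightarrow> f g \<in> carrier A"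
  by (auto simp: U_simps)

lemma U_ext: "f \<in> carrier U \<Longrightarrow> h \<in> carrier U \<Longrightarrow> (\<And>g. g \<in> carrier G \<Longrightarrow> f g = h g) \<Longrightarrow> f = h"
  unfolding U_simps(1) by (rule PiE_ext)

lemma el_closed [simp]: "a \<in> carrier A \<Longrightarrow> el a g \<in> carrier U"
  by (auto simp: U_simps(1) skew_elt_def)

lemma el_apply: "h \<in> carrier G \<Longrightarrow> el a g h = (if h = g then a else \<zero>\<^bsub>A\<^esub>)"
  by (simp add: skew_elt_def)

lemma add_closed [simp]: "f \<in> carrier U \<Longrightarrow> h \<in> carrier U \<Longrightarrow> f \<oplus>\<^bsub>U\<^esub> h \<in> carrier U"
  by (auto simp: U_simps)

lemma add_apply: "g \<in> carrier G \<Longrightarrow> (f \<oplus>\<^bsub>U\<^esub> h) g = f g \<oplus>\<^bsub>A\<^esub> h g"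
  by (simp add: U_simps)

lemma sm_closed [simp]: "f \<in> carrier U \<Longrightarrow> c \<odot>\<^bsub>U\<^esub> f \<in> carrier U"
  by (auto simp: U_simps)

lemma sm_apply: "g \<in> carrier G \<Longrightarrow> (c \<odot>\<^bsub>U\<^esub> f) g = c \<odot>\<^bsub>A\<^esub> f g"
  by (simp add: U_simps)

lemma term_closed: "f \<in> carrier U \<Longrightarrow> h \<in> carrier U \<Longrightarrow> g \<in> carrier G \<Longrightarrow>
    (\<lambda>p. f p \<otimes>\<^bsub>A\<^esub> act p (h (inv\<^bsub>G\<^esub> p \<otimes>\<^bsub>G\<^esub> g))) \<in> carrier G \<rightarrow> carrier A"
  by (auto simp: actD)

text \<open>The terms outside the support of \<open>f\<close> vanish, so the sum may run over the
  whole group. A summation range independent of \<open>f\<close> makes the distributive laws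
  termwise.\<close>

lemma mult_apply:
  assumes fh: "f \<in> carrier U" "h \<in> carrier U" and g: "g \<in> carrier G"
  shows "(f \<otimes>\<^bsub>U\<^esub> h) g = (\<Oplus>\<^bsub>A\<^esub>p\<in>carrier G. f p \<otimes>\<^bsub>A\<^esub> act p (h (inv\<^bsub>G\<^esub> p \<otimes>\<^bsub>G\<^esub> g)))"
proof -
  have "(\<Oplus>\<^bsub>A\<^esub>p\<in>{p \<in> carrier G. f p \<noteq> \<zero>\<^bsub>A\<^esub>}. f p \<otimes>\<^bsub>A\<^esub> act p (h (inv\<^bsub>G\<^esub> p \<otimes>\<^bsub>G\<^esub> g))) =
      (\<Oplus>\<^bsub>A\<^esub>p\<in>carrier G. f p \<otimes>\<^bsub>A\<^esub> act p (h (inv\<^bsub>G\<^esub> p \<otimes>\<^bsub>G\<^esub> g)))"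
    by (rule A.add.finprod_mono_neutral_cong_left[OF finG _ _ _ term_closed[OF assms]])
      (use fh g in \<open>auto simp: actD\<close>)
  then show ?thesis using g by (simp add: skew_group_ring_def)
qed

lemma mult_closed [simp]: "f \<in> carrier U \<Longrightarrow> h \<in> carrier U \<Longrightarrow> f \<otimes>\<^bsub>U\<^esub> h \<in> carrier U"
proof -
  assume fh: "f \<in> carrier U" "h \<in> carrier U"
  have "(f \<otimes>\<^bsub>U\<^esub> h) g \<in> carrier A" if "g \<in> carrier G" for g
    unfolding mult_apply[OF fh that] by (rule A.finsum_closed[OF term_closed[OF fh that]])
  moreover have "f \<otimes>\<^bsub>U\<^esub> h \<in> extensional (carrier G)" by (simp add: skew_group_ring_def)
  ultimately show ?thesis unfolding U_simps(1) by (auto simp: PiE_iff)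
qed

lemma l_distr:
  assumes "f \<in> carrier U" "h \<in> carrier U" "k \<in> carrier U"
  shows "(f \<oplus>\<^bsub>U\<^esub> h) \<otimes>\<^bsub>U\<^esub> k = f \<otimes>\<^bsub>U\<^esub> k \<oplus>\<^bsub>U\<^esub> h \<otimes>\<^bsub>U\<^esub> k"
proof (rule U_ext)
  fix g assume g: "g \<in> carrier G"
  let ?t = "\<lambda>f p. f p \<otimes>\<^bsub>A\<^esub> act p (k (inv\<^bsub>G\<^esub> p \<otimes>\<^bsub>G\<^esub> g))"
  have "((f \<oplus>\<^bsub>U\<^esub> h) \<otimes>\<^bsub>U\<^esub> k) g = (\<Oplus>\<^bsub>A\<^esub>p\<in>carrier G. ?t f p \<oplus>\<^bsub>A\<^esub> ?t h p)"
    unfolding mult_apply[OF add_closed[OF assms(1,2)] assms(3) g]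
    by (rule A.finsum_cong') (use assms g in \<open>auto simp: add_apply A.l_distr actD\<close>)
  also have "\<dots> = (\<Oplus>\<^bsub>A\<^esub>p\<in>carrier G. ?t f p) \<oplus>\<^bsub>A\<^esub> (\<Oplus>\<^bsub>A\<^esub>p\<in>carrier G. ?t h p)"
    using assms by (intro A.finsum_addf term_closed g)
  finally show "((f \<oplus>\<^bsub>U\<^esub> h) \<otimes>\<^bsub>U\<^esub> k) g = (f \<otimes>\<^bsub>U\<^esub> k \<oplus>\<^bsub>U\<^esub> h \<otimes>\<^bsub>U\<^esub> k) g"
    using assms g by (simp add: add_apply mult_apply)
qed (use assms in simp_all)

lemma r_distr:
  assumes "f \<in> carrier U" "h \<in> carrier U" "k \<in> carrier U"
  shows "k \<otimes>\<^bsub>U\<^esub> (f \<oplus>\<^bsub>U\<^esub> h) = k \<otimes>\<^bsub>U\<^esub> f \<oplus>\<^bsub>U\<^esub> k \<otimes>\<^bsub>U\<^esub> h"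
proof (rule U_ext)
  fix g assume g: "g \<in> carrier G"
  let ?t = "\<lambda>f p. k p \<otimes>\<^bsub>A\<^esub> act p (f (inv\<^bsub>G\<^esub> p \<otimes>\<^bsub>G\<^esub> g))"
  have "(k \<otimes>\<^bsub>U\<^esub> (f \<oplus>\<^bsub>U\<^esub> h)) g = (\<Oplus>\<^bsub>A\<^esub>p\<in>carrier G. ?t f p \<oplus>\<^bsub>A\<^esub> ?t h p)"
    unfolding mult_apply[OF assms(3) add_closed[OF assms(1,2)] g]
    by (rule A.finsum_cong') (use assms g in \<open>auto simp: add_apply A.r_distr actD\<close>)
  also have "\<dots> = (\<Oplus>\<^bsub>A\<^esub>p\<in>carrier G. ?t f p) \<oplus>\<^bsub>A\<^esub> (\<Oplus>\<^bsub>A\<^esub>p\<in>carrier G. ?t h p)"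
    using assms by (intro A.finsum_addf term_closed g)
  finally show "(k \<otimes>\<^bsub>U\<^esub> (f \<oplus>\<^bsub>U\<^esub> h)) g = (k \<otimes>\<^bsub>U\<^esub> f \<oplus>\<^bsub>U\<^esub> k \<otimes>\<^bsub>U\<^esub> h) g"
    using assms g by (simp add: add_apply mult_apply)
qed (use assms in simp_all)

lemma el_mult:
  assumes "a \<in> carrier A" "c \<in> carrier A" "p \<in> carrier G" "q \<in> carrier G"
  shows "el a p \<otimes>\<^bsub>U\<^esub> el c q = el (a \<otimes>\<^bsub>A\<^esub> act p c) (p \<otimes>\<^bsub>G\<^esub> q)"
proof (rule U_ext)
  fix g assume g: "g \<in> carrier G"
  let ?t = "\<lambda>r. a \<otimes>\<^bsub>A\<^esub> act r (el c q (inv\<^bsub>G\<^esub> r \<otimes>\<^bsub>G\<^esub> g))"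
  have "(el a p \<otimes>\<^bsub>U\<^esub> el c q) g = (\<Oplus>\<^bsub>A\<^esub>r\<in>carrier G. if p = r then ?t r else \<zero>\<^bsub>A\<^esub>)"
    unfolding mult_apply[OF el_closed[OF assms(1)] el_closed[OF assms(2)] g]
    by (rule A.finsum_cong') (use assms g in \<open>auto simp: el_apply actD act_zero\<close>)
  also have "\<dots> = ?t p"
    by (rule A.finsum_singleton) (use assms g finG in \<open>auto simp: actD\<close>)
  also have "\<dots> = (if g = p \<otimes>\<^bsub>G\<^esub> q then a \<otimes>\<^bsub>A\<^esub> act p c else \<zero>\<^bsub>A\<^esub>)"
    using assms g G.inv_solve_left[of q p g] by (auto simp: el_apply act_zero)
  finally show "(el a p \<otimes>\<^bsub>U\<^esub> el c q) g = el (a \<otimes>\<^bsub>A\<^esub> act p c) (p \<otimes>\<^bsub>G\<^esub> q) g"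
    using g by (simp add: el_apply)
qed (use assms in \<open>simp_all add: actD\<close>)

lemma U_induct [consumes 1, case_names el add]:
  assumes f: "f \<in> carrier U"
    and el: "\<And>a g. a \<in> carrier A \<Longrightarrow> g \<in> carrier G \<Longrightarrow> Q (el a g)"
    and add: "\<And>x y. x \<in> carrier U \<Longrightarrow> y \<in> carrier U \<Longrightarrow> Q x \<Longrightarrow> Q y \<Longrightarrow> Q (x \<oplus>\<^bsub>U\<^esub> y)"
  shows "Q f"
proof -
  have "Q (\<lambda>p\<in>carrier G. if p \<in> S then f p else \<zero>\<^bsub>A\<^esub>)" if "finite S" "S \<subseteq> carrier G" for S
    using that
  proof (induction S rule: finite_induct)
    case empty
    have "(\<lambda>p\<in>carrier G. if p \<in> {} then f p else \<zero>\<^bsub>A\<^esub>) = el \<zero>\<^bsub>A\<^esub> \<one>\<^bsub>G\<^esub>" by (auto simp: skew_elt_def)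
    then show ?case using el[of "\<zero>\<^bsub>A\<^esub>" "\<one>\<^bsub>G\<^esub>"] by simp
  next
    case (insert g S)
    have eq: "(\<lambda>p\<in>carrier G. if p \<in> insert g S then f p else \<zero>\<^bsub>A\<^esub>) =
        el (f g) g \<oplus>\<^bsub>U\<^esub> (\<lambda>p\<in>carrier G. if p \<in> S then f p else \<zero>\<^bsub>A\<^esub>)"
      using insert f by (auto simp: U_simps(2) skew_elt_def fun_eq_iff)
    have "(\<lambda>p\<in>carrier G. if p \<in> S then f p else \<zero>\<^bsub>A\<^esub>) \<in> carrier U"
      using f by (auto simp: U_simps(1))
    moreover have "Q (\<lambda>p\<in>carrier G. if p \<in> S then f p else \<zero>\<^bsub>A\<^esub>)" by (rule insert.IH) (use insert.prems in simp)
    moreover have "f g \<in> carrier A" "g \<in> carrier G" using f insert.prems by auto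
    ultimately show ?case unfolding eq by (intro add el el_closed)
  qed
  from this[OF finG] have "Q (\<lambda>p\<in>carrier G. f p)" by (simp cong: restrict_cong)
  moreover have "(\<lambda>p\<in>carrier G. f p) = f" using f by (intro extensional_restrict) (simp add: U_simps(1) PiE_iff)
  ultimately show ?thesis by simp
qed

text \<open>By additivity in each of the three arguments the claim reduces to elements a * g, where
  it combines associativity in A and G with the action laws. The distributive laws come beforehand
  for this purpose.\<close>

lemma m_assoc:
  assumes "x \<in> carrier U" "y \<in> carrier U" "z \<in> carrier U"
  shows "x \<otimes>\<^bsub>U\<^esub> y \<otimes>\<^bsub>U\<^esub> z = x \<otimes>\<^bsub>U\<^esub> (y \<otimes>\<^bsub>U\<^esub> z)"
  using assms(1)
proof (induction rule: U_induct)
  case x: (el a g)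
  show ?case using assms(2)
  proof (induction rule: U_induct)
    case y: (el c h)
    show ?case using assms(3)
    proof (induction rule: U_induct)
      case (el e k)
      then show ?case using x y by (simp add: el_mult actD act_mult A.m_assoc G.m_assoc)
    next
      case (add u w)
      then show ?case using x y by (simp add: r_distr)
    qed
  next
    case (add u w)
    then show ?case using x assms(3) by (simp add: r_distr l_distr)
  qed
next
  case (add u w)
  then show ?case using assms(2,3) by (simp add: l_distr)
qed

lemma l_one: "x \<in> carrier U \<Longrightarrow> \<one>\<^bsub>U\<^esub> \<otimes>\<^bsub>U\<^esub> x = x"
proof (induction rule: U_induct)
  case (el a g)
  then show ?case by (simp add: U_simps(4) el_mult act_one)
next
  case (add x y)
  have "\<one>\<^bsub>U\<^esub> \<in> carrier U" unfolding U_simps(4) by simp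
  then show ?case using add by (simp add: r_distr)
qed

lemma r_one: "x \<in> carrier U \<Longrightarrow> x \<otimes>\<^bsub>U\<^esub> \<one>\<^bsub>U\<^esub> = x"
proof (induction rule: U_induct)
  case (el a g)
  then show ?case by (simp add: U_simps(4) el_mult actD)
next
  case (add x y)
  have "\<one>\<^bsub>U\<^esub> \<in> carrier U" unfolding U_simps(4) by simp
  then show ?case using add by (simp add: l_distr)
qed

lemma sm_add: "x \<in> carrier U \<Longrightarrow> y \<in> carrier U \<Longrightarrow> c \<odot>\<^bsub>U\<^esub> (x \<oplus>\<^bsub>U\<^esub> y) = c \<odot>\<^bsub>U\<^esub> x \<oplus>\<^bsub>U\<^esub> c \<odot>\<^bsub>U\<^esub> y"
  by (rule U_ext) (simp_all add: add_apply sm_apply A.sm_r_distr)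

lemma sm_el: "a \<in> carrier A \<Longrightarrow> c \<odot>\<^bsub>U\<^esub> el a g = el (c \<odot>\<^bsub>A\<^esub> a) g"
  by (rule U_ext) (simp_all add: sm_apply el_apply)

lemma sm_mult:
  assumes "x \<in> carrier U" "y \<in> carrier U"
  shows "(c \<odot>\<^bsub>U\<^esub> x) \<otimes>\<^bsub>U\<^esub> y = c \<odot>\<^bsub>U\<^esub> (x \<otimes>\<^bsub>U\<^esub> y) \<and> x \<otimes>\<^bsub>U\<^esub> (c \<odot>\<^bsub>U\<^esub> y) = c \<odot>\<^bsub>U\<^esub> (x \<otimes>\<^bsub>U\<^esub> y)"
  using assms(1)
proof (induction rule: U_induct)
  case x: (el a g)
  show ?case using assms(2)
  proof (induction rule: U_induct)
    case (el c h)
    then show ?case using x by (simp add: sm_el el_mult actD A.sm_mult_left A.sm_mult_right)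
  next
    case (add u w)
    then show ?case using x by (simp add: r_distr sm_add)
  qed
next
  case (add u w)
  then show ?case using assms(2) by (simp add: l_distr sm_add)
qed

lemma U_k_algebra: "k_algebra U"
proof (rule k_algebraI)
  show "ring U"
  proof (rule ringI)
    show "abelian_group U"
    proof (rule abelian_groupI)
      show "\<zero>\<^bsub>U\<^esub> \<in> carrier U" by (auto simp: U_simps)
      show "\<exists>y\<in>carrier U. y \<oplus>\<^bsub>U\<^esub> x = \<zero>\<^bsub>U\<^esub>" if x: "x \<in> carrier U" for x
      proof (intro bexI[of _ "\<lambda>g\<in>carrier G. \<ominus>\<^bsub>A\<^esub> x g"])
        show "(\<lambda>g\<in>carrier G. \<ominus>\<^bsub>A\<^esub> x g) \<in> carrier U" using x by (auto simp: U_simps)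
        show "(\<lambda>g\<in>carrier G. \<ominus>\<^bsub>A\<^esub> x g) \<oplus>\<^bsub>U\<^esub> x = \<zero>\<^bsub>U\<^esub>"
          unfolding U_simps(2,3) by (rule restrict_ext) (use x in \<open>simp add: A.l_neg\<close>)
      qed
      show "\<zero>\<^bsub>U\<^esub> \<oplus>\<^bsub>U\<^esub> x = x" if x: "x \<in> carrier U" for x
        by (rule U_ext) (use x in \<open>auto simp: U_simps\<close>)
      show "x \<oplus>\<^bsub>U\<^esub> y \<oplus>\<^bsub>U\<^esub> z = x \<oplus>\<^bsub>U\<^esub> (y \<oplus>\<^bsub>U\<^esub> z)" if "x \<in> carrier U" "y \<in> carrier U" "z \<in> carrier U" for x y z
        by (rule U_ext) (use that in \<open>simp_all add: add_apply A.a_assoc\<close>)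
      show "x \<oplus>\<^bsub>U\<^esub> y = y \<oplus>\<^bsub>U\<^esub> x" if "x \<in> carrier U" "y \<in> carrier U" for x y
        by (rule U_ext) (use that in \<open>simp_all add: add_apply A.a_comm\<close>)
    qed simp
    show "Group.monoid U" by (rule monoidI) (simp_all add: m_assoc l_one r_one, simp add: U_simps(4))
  qed (simp_all add: l_distr r_distr)
  show "(c + d) \<odot>\<^bsub>U\<^esub> x = c \<odot>\<^bsub>U\<^esub> x \<oplus>\<^bsub>U\<^esub> d \<odot>\<^bsub>U\<^esub> x" if "x \<in> carrier U" for c d x
    by (rule U_ext) (use that in \<open>simp_all add: add_apply sm_apply A.sm_l_distr\<close>)
  show "(c * d) \<odot>\<^bsub>U\<^esub> x = c \<odot>\<^bsub>U\<^esub> (d \<odot>\<^bsub>U\<^esub> x)" if "x \<in> carrier U" for c d x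
    by (rule U_ext) (use that in \<open>simp_all add: sm_apply A.sm_assoc\<close>)
  show "1 \<odot>\<^bsub>U\<^esub> x = x" if "x \<in> carrier U" for x
    by (rule U_ext) (use that in \<open>simp_all add: sm_apply\<close>)
qed (simp_all add: sm_add sm_mult)

sublocale U: kalg U by (rule kalgI[OF U_k_algebra])

lemma el_hom: "alg_hom A U (\<lambda>a. el a \<one>\<^bsub>G\<^esub>)"
proof (rule alg_homI)
  show "el (x \<oplus>\<^bsub>A\<^esub> y) \<one>\<^bsub>G\<^esub> = el x \<one>\<^bsub>G\<^esub> \<oplus>\<^bsub>U\<^esub> el y \<one>\<^bsub>G\<^esub>" if "x \<in> carrier A" "y \<in> carrier A" for x y
    by (rule U_ext) (use that in \<open>simp_all add: add_apply el_apply\<close>)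
qed (simp_all add: el_mult act_one sm_el U_simps(4))

lemma mult_el_at_one:
  assumes "f \<in> carrier U" "a \<in> carrier A"
  shows "(f \<otimes>\<^bsub>U\<^esub> el a \<one>\<^bsub>G\<^esub>) \<one>\<^bsub>G\<^esub> = f \<one>\<^bsub>G\<^esub> \<otimes>\<^bsub>A\<^esub> a"
  using assms(1)
proof (induction rule: U_induct)
  case (el c g)
  then show ?case using assms(2) by (auto simp: el_mult el_apply act_one)
next
  case (add x y)
  then show ?case using assms(2) by (simp add: l_distr add_apply A.l_distr)
qed

text \<open>The matrix coefficient \<open>u \<mapsto> \<phi> (u 1)\<close> shows that the weight \<open>\<chi>\<close> occurs in some cyclic module,
  hence in an irreducible quotient.\<close>
lemma weight_module_exists:
  assumes \<phi>: "A.linear_fun \<phi>" "\<phi> \<one>\<^bsub>A\<^esub> = 1"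
    and \<iota>: "alg_hom D A \<iota>" and D: "k_algebra D" and \<chi>: "kalg.character D \<chi>"
    and \<phi>\<chi>: "\<And>a d. a \<in> carrier A \<Longrightarrow> d \<in> carrier D \<Longrightarrow> \<phi> (a \<otimes>\<^bsub>A\<^esub> \<iota> d) = \<phi> a * \<chi> d"
  shows "\<exists>(T :: ('g \<Rightarrow> 'a, ('g \<Rightarrow> 'a) set) module) v. irreducible_module U T \<and> v \<in> carrier T \<and> v \<noteq> \<zero>\<^bsub>T\<^esub> \<and>
    (\<forall>d\<in>carrier D. el (\<iota> d) \<one>\<^bsub>G\<^esub> \<odot>\<^bsub>T\<^esub> v = \<chi> d \<odot>\<^bsub>underlying_space U T\<^esub> v)"
proof -
  interpret D: kalg D by (rule kalgI[OF D])
  note \<iota>D = alg_homD[OF \<iota>] and \<phi>D = A.linear_funD[OF \<phi>(1)] and \<chi>D = D.characterD[OF \<chi>] and elD = alg_homD[OF el_hom]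
  \<comment> \<open>The largest left ideal inside the kernel of u -> \<phi>(u(1)). It omits 1 since
    \<phi>(1) = 1, and the weight property of \<phi> places every d - \<chi>(d) 1 in it.\<close>
  define L0 where "L0 = {f \<in> carrier U. \<forall>u\<in>carrier U. \<phi> ((u \<otimes>\<^bsub>U\<^esub> f) \<one>\<^bsub>G\<^esub>) = 0}"
  have L0: "left_ideal U L0"
    unfolding left_ideal_def
  proof (intro conjI ballI)
    show "L0 \<subseteq> carrier U" by (auto simp: L0_def)
    show "\<zero>\<^bsub>U\<^esub> \<in> L0" unfolding L0_def by (simp add: U_simps(3) \<phi>D(3) U.r_null[unfolded U_simps(3)])
        (use U.zero_closed[unfolded U_simps(3)] in simp)
    fix x y assume "x \<in> L0" "y \<in> L0"
    then show "x \<oplus>\<^bsub>U\<^esub> y \<in> L0" by (simp add: L0_def r_distr add_apply \<phi>D(1))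
  next
    fix a x assume "a \<in> carrier U" "x \<in> L0"
    then show "a \<otimes>\<^bsub>U\<^esub> x \<in> L0" by (simp add: L0_def m_assoc[symmetric])
  qed
  have one: "\<one>\<^bsub>U\<^esub> \<notin> L0"
  proof
    assume "\<one>\<^bsub>U\<^esub> \<in> L0"
    then have "\<phi> ((\<one>\<^bsub>U\<^esub> \<otimes>\<^bsub>U\<^esub> \<one>\<^bsub>U\<^esub>) \<one>\<^bsub>G\<^esub>) = 0" unfolding L0_def by blast
    then show False by (simp add: U_simps(4) el_apply el_mult act_one \<phi>(2))
  qed
  obtain L where L: "left_ideal U L" "L0 \<subseteq> L" "\<one>\<^bsub>U\<^esub> \<notin> L"
    and max: "\<And>L'. left_ideal U L' \<Longrightarrow> L \<subseteq> L' \<Longrightarrow> \<one>\<^bsub>U\<^esub> \<notin> L' \<Longrightarrow> L' = L"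
    using maximal_left_ideal_exists[OF L0 one] by metis
  interpret L: left_quotient U L by (unfold_locales) (rule L(1))
  let ?v = "L +>\<^bsub>U\<^esub> \<one>\<^bsub>U\<^esub>"
  have "el (\<iota> d) \<one>\<^bsub>G\<^esub> \<odot>\<^bsub>L.T\<^esub> ?v = \<chi> d \<odot>\<^bsub>underlying_space U L.T\<^esub> ?v" if d: "d \<in> carrier D" for d
  proof -
    let ?e = "d \<oplus>\<^bsub>D\<^esub> (- \<chi> d) \<odot>\<^bsub>D\<^esub> \<one>\<^bsub>D\<^esub>"
    have e: "?e \<in> carrier D" "\<chi> ?e = 0" using d by (simp_all add: \<chi>D)
    have "el (\<iota> ?e) \<one>\<^bsub>G\<^esub> \<in> L0" unfolding L0_def using e by (simp add: mult_el_at_one \<iota>D \<phi>\<chi>)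
    also have "el (\<iota> ?e) \<one>\<^bsub>G\<^esub> = el (\<iota> d) \<one>\<^bsub>G\<^esub> \<ominus>\<^bsub>U\<^esub> \<chi> d \<odot>\<^bsub>U\<^esub> \<one>\<^bsub>U\<^esub>"
      using d by (simp add: \<iota>D elD U.sm_minus a_minus_def)
    finally have "el (\<iota> d) \<one>\<^bsub>G\<^esub> \<ominus>\<^bsub>U\<^esub> \<chi> d \<odot>\<^bsub>U\<^esub> \<one>\<^bsub>U\<^esub> \<in> L" using L(2) by blast
    then have "L +>\<^bsub>U\<^esub> el (\<iota> d) \<one>\<^bsub>G\<^esub> = L +>\<^bsub>U\<^esub> (\<chi> d \<odot>\<^bsub>U\<^esub> \<one>\<^bsub>U\<^esub>)"
      using d by (subst L.cos_eq_iff) (simp_all add: \<iota>D)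
    then show ?thesis using d by (simp add: underlying_space_def restrict_scalars_def L.cos_smult \<iota>D)
  qed
  moreover have "?v \<in> carrier L.T" "?v \<noteq> \<zero>\<^bsub>L.T\<^esub>"
    using L.cos_closed[of "\<one>\<^bsub>U\<^esub>"] L.cos_eq_zero_iff[of "\<one>\<^bsub>U\<^esub>"] L(3) by simp_all
  ultimately show ?thesis using L.T_irreducible[OF L(3) max] by blast
qed

end

section \<open>Tensor powers of generalized Weyl algebras\<close>

context tensor_pow
begin

lemma const_tup: "(\<lambda>i\<in>{1..n}. \<one>) \<in> tup"
  by auto

definition slot :: "nat \<Rightarrow> 'a \<Rightarrow> ('k, 'a) tensor" where
  "slot i x = pure n A ((\<lambda>j\<in>{1..n}. \<one>)(i := x))"

lemma slot_hom:
  assumes i: "i \<in> {1..n}" shows "alg_hom A TP (slot i)"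
proof (rule alg_homI)
  fix x y assume "x \<in> carrier A" "y \<in> carrier A"
  then show "slot i (x \<oplus> y) = slot i x \<oplus>\<^bsub>TP\<^esub> slot i y"
    unfolding slot_def by (intro pure_add const_tup i)
  have "slot i x \<otimes>\<^bsub>TP\<^esub> slot i y = pure n A (\<lambda>k\<in>{1..n}. ((\<lambda>j\<in>{1..n}. \<one>)(i := x)) k \<otimes> ((\<lambda>j\<in>{1..n}. \<one>)(i := y)) k)"
    unfolding slot_def using \<open>x \<in> carrier A\<close> \<open>y \<in> carrier A\<close> by (intro pure_mult tup_upd const_tup i)
  also have "(\<lambda>k\<in>{1..n}. ((\<lambda>j\<in>{1..n}. \<one>)(i := x)) k \<otimes> ((\<lambda>j\<in>{1..n}. \<one>)(i := y)) k) = (\<lambda>j\<in>{1..n}. \<one>)(i := x \<otimes> y)"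
    using i by (auto simp: fun_eq_iff)
  finally show "slot i (x \<otimes> y) = slot i x \<otimes>\<^bsub>TP\<^esub> slot i y" by (simp only: slot_def)
next
  have "(\<lambda>j\<in>{1..n}. \<one>)(i := \<one>) = (\<lambda>j\<in>{1..n}. \<one>)" using i by auto
  then show "slot i \<one> = \<one>\<^bsub>TP\<^esub>" by (simp add: slot_def pure_one)
next
  fix c x assume "x \<in> carrier A"
  then show "slot i (c \<odot> x) = c \<odot>\<^bsub>TP\<^esub> slot i x" unfolding slot_def by (intro pure_smult const_tup i)
next
  fix x assume "x \<in> carrier A"
  then show "slot i x \<in> carrier TP" unfolding slot_def by (intro pure_closed tup_upd const_tup i)
qed

lemma character_slot:
  assumes "TP.character \<chi>" "i \<in> {1..n}" shows "character (\<lambda>x. \<chi> (slot i x))"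
  by (rule TP.character_alg_hom[OF assms(1) slot_hom[OF assms(2)] k_algebra])

text \<open>A pure tensor is the product of its slots; the induction fills the slots one after
  another while the remaining ones hold 1.\<close>

lemma character_pure:
  assumes \<chi>: "TP.character \<chi>" and x: "x \<in> tup"
  shows "\<chi> (pure n A x) = (\<Prod>i\<in>{1..n}. \<chi> (slot i (x i)))"
proof -
  note \<chi>D = TP.characterD[OF \<chi>]
  have xc: "x i \<in> carrier A" if "i \<in> {1..n}" for i using x that by (auto simp: PiE_iff)
  have "\<chi> (pure n A (\<lambda>i\<in>{1..n}. if i \<le> k then x i else \<one>)) = (\<Prod>i\<in>{1..k}. \<chi> (slot i (x i)))" if "k \<le> n" for k
    using that
  proof (induction k)
    case 0
    have "(\<lambda>i\<in>{1..n}. if i \<le> 0 then x i else \<one>) = (\<lambda>i\<in>{1..n}. \<one>)" by auto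
    then have "\<chi> (pure n A (\<lambda>i\<in>{1..n}. if i \<le> 0 then x i else \<one>)) = \<chi> \<one>\<^bsub>TP\<^esub>" by (simp only: pure_one)
    also have "\<dots> = (\<Prod>i\<in>{1..0}. \<chi> (slot i (x i)))" by (simp add: \<chi>D)
    finally show ?case .
  next
    case (Suc k)
    let ?y = "\<lambda>i\<in>{1..n}. if i \<le> k then x i else \<one>" and ?z = "(\<lambda>j\<in>{1..n}. \<one>)(Suc k := x (Suc k))"
    have k: "Suc k \<in> {1..n}" using Suc.prems by auto
    have yz: "?y \<in> tup" "?z \<in> tup" using xc tup_upd[OF const_tup k xc[OF k]] by simp_all
    have "(\<lambda>i\<in>{1..n}. if i \<le> Suc k then x i else \<one>) = (\<lambda>i\<in>{1..n}. ?y i \<otimes> ?z i)"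
      using xc k by (auto simp: le_Suc_eq intro!: restrict_ext)
    then have eq: "\<chi> (pure n A (\<lambda>i\<in>{1..n}. if i \<le> Suc k then x i else \<one>)) = \<chi> (pure n A ?y) * \<chi> (slot (Suc k) (x (Suc k)))"
      unfolding slot_def using yz by (simp only: pure_mult[symmetric] \<chi>D pure_closed)
    have IH: "\<chi> (pure n A ?y) = (\<Prod>i\<in>{1..k}. \<chi> (slot i (x i)))" by (rule Suc.IH) (use Suc.prems in simp)
    show ?case unfolding eq IH by simp
  qed
  from this[OF le_refl]  have "\<chi> (pure n A (\<lambda>i\<in>{1..n}. if i \<le> n then x i else \<one>)) = (\<Prod>i\<in>{1..n}. \<chi> (slot i (x i)))" .
  moreover have "(\<lambda>i\<in>{1..n}. if i \<le> n then x i else \<one>) = x" using x by (auto simp: PiE_iff extensional_def)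
  ultimately show ?thesis by (simp only:)
qed

lemma tensor_character:
  assumes \<psi>: "\<And>i. i \<in> {1..n} \<Longrightarrow> character (\<psi> i)"
  shows "TP.character (tensor_fun n \<psi>)"
proof -
  have lin: "linear_fun (\<psi> i)" if "i \<in> {1..n}" for i using \<psi>[OF that] by (simp add: character_def)
  let ?\<Psi> = "tensor_fun n \<psi>"
  have \<Psi>: "TP.linear_fun ?\<Psi>" by (rule tensor_fun_linear) (rule lin)
  note L = TP.linear_funD[OF \<Psi>]
  have pure: "?\<Psi> (pure n A x) = (\<Prod>i\<in>{1..n}. \<psi> i (x i))" if "x \<in> tup" for x
    by (rule tensor_fun_pure[OF _ that]) (rule lin)
  have "?\<Psi> (s \<otimes>\<^bsub>TP\<^esub> t) = ?\<Psi> s * ?\<Psi> t" if "s \<in> carrier TP" "t \<in> carrier TP" for s t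
    using that(1)
  proof (induction rule: TP_induct)
    case x: (pure c x)
    show ?case using that(2)
    proof (induction rule: TP_induct)
      case y: (pure e y)
      have xy: "(\<lambda>i\<in>{1..n}. x i \<otimes> y i) \<in> tup" using x y by (auto simp: PiE_iff)
      have "?\<Psi> (pure n A x \<otimes>\<^bsub>TP\<^esub> pure n A y) = ?\<Psi> (pure n A x) * ?\<Psi> (pure n A y)"
        unfolding pure_mult[OF x y] pure[OF xy] pure[OF x] pure[OF y] prod.distrib[symmetric]
        using x y \<psi> by (intro prod.cong) (auto simp: PiE_iff characterD)
      then show ?case using x y by (simp add: TP.sm_mult_left TP.sm_mult_right TP.sm_assoc L)
    next
      case (add u v)
      then show ?case using x by (simp add: TP.r_distr L algebra_simps)
    qed
  next
    case (add u v)
    then show ?case using that(2) by (simp add: TP.l_distr L algebra_simps)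
  qed
  moreover have "?\<Psi> \<one>\<^bsub>TP\<^esub> = 1" unfolding pure_one pure[OF const_tup] using characterD(4)[OF \<psi>] by simp
  ultimately show ?thesis using \<Psi> by (simp add: TP.character_def)
qed

end

locale gwa_pow = gwa1 B s b for B :: "('k::field, 'b) module" and s b + fixes n :: nat
begin

sublocale H: tensor_pow_hom B R n \<beta>
  by (simp add: tensor_pow_hom_def tensor_pow_hom_axioms_def tensor_pow_def B.kalg_axioms R.kalg_axioms base_hom)

abbreviation "A \<equiv> gwa_power n B s b"
abbreviation "D \<equiv> tensor_power n B"
abbreviation "\<iota> \<equiv> gwa_power_base n B s b"

lemma A_eq: "A = tensor_power n R" and \<iota>_eq: "\<iota> = tensor_map n R \<beta>"
  by (simp_all add: gwa_power_def gwa_power_base_def fun_eq_iff)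

definition Yt :: "(nat \<Rightarrow> int) \<Rightarrow> ('k, 'b) gwa_power_elt" where
  "Yt J = pure n R (\<lambda>i\<in>{1..n}. Yp (J i))"

sublocale A: kalg A unfolding A_eq by (rule H.A.TP.kalg_axioms)

lemma \<iota>_hom: "alg_hom D A \<iota>" unfolding A_eq \<iota>_eq by (rule H.tensor_map_hom)

lemmas \<iota>D = alg_homD[OF \<iota>_hom]

lemma \<iota>_pure: "x \<in> H.B.tup \<Longrightarrow> \<iota> (pure n B x) = pure n R (\<lambda>i\<in>{1..n}. \<beta> (x i))"
  unfolding \<iota>_eq by (rule H.tensor_map_pure)

lemma \<iota>_pure_restrict:
  assumes "\<And>i. i \<in> {1..n} \<Longrightarrow> x i \<in> carrier B"
  shows "\<iota> (pure n B (\<lambda>i\<in>{1..n}. x i)) = pure n R (\<lambda>i\<in>{1..n}. \<beta> (x i))"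
proof -
  have x: "(\<lambda>i\<in>{1..n}. x i) \<in> H.B.tup" using assms by simp
  have "(\<lambda>i\<in>{1..n}. \<beta> ((\<lambda>i\<in>{1..n}. x i) i)) = (\<lambda>i\<in>{1..n}. \<beta> (x i))" by (rule restrict_ext) simp
  with \<iota>_pure[OF x] show ?thesis by simp
qed

lemma Yt_tup: "(\<lambda>i\<in>{1..n}. Yp (J i)) \<in> H.A.tup"
  by auto

lemma Yt_closed: "Yt J \<in> carrier A"
  unfolding A_eq Yt_def by (rule H.A.pure_closed[OF Yt_tup])

lemma Yt_zero: "Yt (\<lambda>_. 0) = \<one>\<^bsub>A\<^esub>"
  unfolding A_eq Yt_def H.A.pure_one by (simp add: Yp_0)

lemma Yt_restrict: "Yt (restrict J {1..n}) = Yt J"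
  unfolding Yt_def by (simp cong: restrict_cong)

lemma beta_tup: "x \<in> H.B.tup \<Longrightarrow> (\<lambda>i\<in>{1..n}. \<beta> (x i)) \<in> H.A.tup"
  by (auto simp: PiE_iff base_homD)

lemma pure_mult_restrict:
  assumes "\<And>i. i \<in> {1..n} \<Longrightarrow> f i \<in> carrier R" "\<And>i. i \<in> {1..n} \<Longrightarrow> g i \<in> carrier R"
  shows "pure n R (\<lambda>i\<in>{1..n}. f i) \<otimes>\<^bsub>A\<^esub> pure n R (\<lambda>i\<in>{1..n}. g i) = pure n R (\<lambda>i\<in>{1..n}. f i \<otimes>\<^bsub>R\<^esub> g i)"
proof -
  have "(\<lambda>i\<in>{1..n}. f i) \<in> H.A.tup" "(\<lambda>i\<in>{1..n}. g i) \<in> H.A.tup" using assms by simp_all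
  then show ?thesis unfolding A_eq by (simp add: H.A.pure_mult cong: restrict_cong)
qed

lemma \<iota>_Yt_pure:
  assumes x: "x \<in> H.B.tup"
  shows "\<iota> (pure n B x) \<otimes>\<^bsub>A\<^esub> Yt J = Yt J \<otimes>\<^bsub>A\<^esub> \<iota> (pure n B (\<lambda>i\<in>{1..n}. sz (- J i) (x i)))"
proof -
  have xc: "x i \<in> carrier B" if "i \<in> {1..n}" for i using x that by (auto simp: PiE_iff)
  have y: "\<iota> (pure n B (\<lambda>i\<in>{1..n}. sz (- J i) (x i))) = pure n R (\<lambda>i\<in>{1..n}. \<beta> (sz (- J i) (x i)))"
    using xc by (intro \<iota>_pure_restrict) (simp add: sz_homD)
  have "\<iota> (pure n B x) \<otimes>\<^bsub>A\<^esub> Yt J = pure n R (\<lambda>i\<in>{1..n}. \<beta> (x i) \<otimes>\<^bsub>R\<^esub> Yp (J i))"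
    unfolding \<iota>_pure[OF x] Yt_def using xc by (intro pure_mult_restrict) (simp_all add: base_homD)
  also have "(\<lambda>i\<in>{1..n}. \<beta> (x i) \<otimes>\<^bsub>R\<^esub> Yp (J i)) = (\<lambda>i\<in>{1..n}. Yp (J i) \<otimes>\<^bsub>R\<^esub> \<beta> (sz (- J i) (x i)))"
    using xc by (intro restrict_ext base_Yp)
  also have "pure n R \<dots> = Yt J \<otimes>\<^bsub>A\<^esub> \<iota> (pure n B (\<lambda>i\<in>{1..n}. sz (- J i) (x i)))"
    unfolding y Yt_def using xc by (intro pure_mult_restrict[symmetric]) (simp_all add: base_homD sz_homD)
  finally show ?thesis .
qed

lemma \<iota>_Yt: "d \<in> carrier D \<Longrightarrow> \<exists>d'\<in>carrier D. \<iota> d \<otimes>\<^bsub>A\<^esub> Yt J = Yt J \<otimes>\<^bsub>A\<^esub> \<iota> d'"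
proof (induction rule: H.B.TP_induct)
  case (pure c x)
  let ?y = "pure n B (\<lambda>i\<in>{1..n}. sz (- J i) (x i))"
  have y: "?y \<in> carrier D" using pure by (intro H.B.pure_closed) (auto simp: PiE_iff sz_homD)
  show ?case
    using \<iota>_Yt_pure[OF pure, of J] pure y
    by (intro bexI[of _ "c \<odot>\<^bsub>D\<^esub> ?y"]) (simp_all add: \<iota>D A.sm_mult_left A.sm_mult_right Yt_closed)
next
  case (add d e)
  then obtain d' e' where "d' \<in> carrier D" "\<iota> d \<otimes>\<^bsub>A\<^esub> Yt J = Yt J \<otimes>\<^bsub>A\<^esub> \<iota> d'"
    "e' \<in> carrier D" "\<iota> e \<otimes>\<^bsub>A\<^esub> Yt J = Yt J \<otimes>\<^bsub>A\<^esub> \<iota> e'" by blast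
  then show ?case using add(1,2)
    by (intro bexI[of _ "d' \<oplus>\<^bsub>D\<^esub> e'"]) (simp_all add: \<iota>D A.l_distr A.r_distr Yt_closed)
qed

lemma Yt_mult: "\<exists>c\<in>carrier D. Yt J \<otimes>\<^bsub>A\<^esub> Yt K = \<iota> c \<otimes>\<^bsub>A\<^esub> Yt (\<lambda>i. J i + K i)"
proof -
  have "\<forall>i. \<exists>c. c \<in> carrier B \<and> Yp (J i) \<otimes>\<^bsub>R\<^esub> Yp (K i) = \<beta> c \<otimes>\<^bsub>R\<^esub> Yp (J i + K i)" using Yp_mult by blast
  from choice[OF this] obtain c where "\<forall>i. c i \<in> carrier B \<and> Yp (J i) \<otimes>\<^bsub>R\<^esub> Yp (K i) = \<beta> (c i) \<otimes>\<^bsub>R\<^esub> Yp (J i + K i)" ..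
  then have c: "c i \<in> carrier B" "Yp (J i) \<otimes>\<^bsub>R\<^esub> Yp (K i) = \<beta> (c i) \<otimes>\<^bsub>R\<^esub> Yp (J i + K i)" for i by simp_all
  have ct: "(\<lambda>i\<in>{1..n}. c i) \<in> H.B.tup" using c by simp
  have "\<iota> (pure n B (\<lambda>i\<in>{1..n}. c i)) = pure n R (\<lambda>i\<in>{1..n}. \<beta> (c i))" using c(1) by (rule \<iota>_pure_restrict)
  then have "\<iota> (pure n B (\<lambda>i\<in>{1..n}. c i)) \<otimes>\<^bsub>A\<^esub> Yt (\<lambda>i. J i + K i) =
      pure n R (\<lambda>i\<in>{1..n}. \<beta> (c i) \<otimes>\<^bsub>R\<^esub> Yp (J i + K i))"
    using c(1) by (simp add: Yt_def pure_mult_restrict base_homD)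
  also have "\<dots> = Yt J \<otimes>\<^bsub>A\<^esub> Yt K"
    unfolding c(2)[symmetric] Yt_def by (rule pure_mult_restrict[symmetric]) simp_all
  finally show ?thesis using H.B.pure_closed[OF ct] by (intro bexI[of _ "pure n B (\<lambda>i\<in>{1..n}. c i)"]) simp_all
qed

text \<open>Slots are expanded into monomials one at a time, from the last to the first: slots above
  \<open>k\<close> are already monomials, slots up to \<open>k\<close> are still arbitrary. At k = 0
  the base coefficients and the exponents are collected into a single product.\<close>

lemma pure_generated:
  assumes mon: "\<And>d J. d \<in> carrier D \<Longrightarrow> Q (\<iota> d \<otimes>\<^bsub>A\<^esub> Yt J)"
    and add: "\<And>x y. x \<in> carrier A \<Longrightarrow> y \<in> carrier A \<Longrightarrow> Q x \<Longrightarrow> Q y \<Longrightarrow> Q (x \<oplus>\<^bsub>A\<^esub> y)"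
    and x: "x \<in> H.A.tup"
    and k: "\<And>i. i \<in> {1..n} \<Longrightarrow> i > k \<Longrightarrow> \<exists>d\<in>carrier B. \<exists>j. x i = \<beta> d \<otimes>\<^bsub>R\<^esub> Yp j"
  shows "Q (c \<odot>\<^bsub>A\<^esub> pure n R x)"
  using x k
proof (induction k arbitrary: x)
  case 0
  have "\<forall>i\<in>{1..n}. \<exists>dj. fst dj \<in> carrier B \<and> x i = \<beta> (fst dj) \<otimes>\<^bsub>R\<^esub> Yp (snd dj)"
    using 0(2) by fastforce
  from bchoice[OF this] obtain dj where dj: "\<forall>i\<in>{1..n}. fst (dj i) \<in> carrier B \<and> x i = \<beta> (fst (dj i)) \<otimes>\<^bsub>R\<^esub> Yp (snd (dj i))" ..
  define d J where "d = (\<lambda>i. fst (dj i))" and "J = (\<lambda>i. snd (dj i))"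
  have d: "d i \<in> carrier B" "x i = \<beta> (d i) \<otimes>\<^bsub>R\<^esub> Yp (J i)" if "i \<in> {1..n}" for i
    using dj that by (auto simp: d_def J_def)
  have dt: "(\<lambda>i\<in>{1..n}. d i) \<in> H.B.tup" using d by simp
  have "x = (\<lambda>i\<in>{1..n}. x i)" using 0(1) by (intro extensional_restrict[symmetric]) (auto simp: PiE_iff)
  also have "\<dots> = (\<lambda>i\<in>{1..n}. \<beta> (d i) \<otimes>\<^bsub>R\<^esub> Yp (J i))" using d by (intro restrict_ext)
  finally have xd: "x = (\<lambda>i\<in>{1..n}. \<beta> (d i) \<otimes>\<^bsub>R\<^esub> Yp (J i))" .
  have "\<iota> (pure n B (\<lambda>i\<in>{1..n}. d i)) = pure n R (\<lambda>i\<in>{1..n}. \<beta> (d i))" using d(1) by (rule \<iota>_pure_restrict)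
  then have "pure n R x = \<iota> (pure n B (\<lambda>i\<in>{1..n}. d i)) \<otimes>\<^bsub>A\<^esub> Yt J"
    unfolding xd Yt_def using d(1) by (simp only:) (intro pure_mult_restrict[symmetric], simp_all add: base_homD)
  then have "c \<odot>\<^bsub>A\<^esub> pure n R x = \<iota> (c \<odot>\<^bsub>D\<^esub> pure n B (\<lambda>i\<in>{1..n}. d i)) \<otimes>\<^bsub>A\<^esub> Yt J"
    using H.B.pure_closed[OF dt] by (simp add: \<iota>D A.sm_mult_left Yt_closed)
  then show ?case using mon H.B.pure_closed[OF dt] by simp
next
  case (Suc k)
  show ?case
  proof (cases "Suc k \<in> {1..n}")
    case False
    then have "\<not> k < i" if "i \<in> {1..n}" for i using that by auto
    then show ?thesis by (intro Suc.IH[OF Suc.prems(1)]) blast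
  next
    case True
    have upd: "x(Suc k := r) \<in> H.A.tup" if "r \<in> carrier R" for r by (rule H.A.tup_upd[OF Suc.prems(1) True that])
    have "x (Suc k) \<in> carrier R" using Suc.prems(1) True by (auto simp: PiE_iff)
    then have "Q (c \<odot>\<^bsub>A\<^esub> pure n R (x(Suc k := x (Suc k))))"
    proof (induction rule: R_induct)
      case (monomial d j)
      have r: "\<beta> d \<otimes>\<^bsub>R\<^esub> Yp j \<in> carrier R" using monomial by (simp add: base_homD)
      show ?case
      proof (rule Suc.IH[OF upd[OF r]])
        fix i assume i: "i \<in> {1..n}" "k < i"
        show "\<exists>d'\<in>carrier B. \<exists>j'. (x(Suc k := \<beta> d \<otimes>\<^bsub>R\<^esub> Yp j)) i = \<beta> d' \<otimes>\<^bsub>R\<^esub> Yp j'"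
          using Suc.prems(2)[OF i(1)] monomial i(2) by (cases "i = Suc k") auto
      qed
    next
      case (add y z)
      have "pure n R (x(Suc k := y \<oplus>\<^bsub>R\<^esub> z)) = pure n R (x(Suc k := y)) \<oplus>\<^bsub>A\<^esub> pure n R (x(Suc k := z))"
        unfolding A_eq by (rule H.A.pure_add[OF Suc.prems(1) True add(1,2)])
      moreover have yz: "pure n R (x(Suc k := y)) \<in> carrier A" "pure n R (x(Suc k := z)) \<in> carrier A"
        unfolding A_eq by (rule H.A.pure_closed[OF upd[OF add(1)]], rule H.A.pure_closed[OF upd[OF add(2)]])
      ultimately have eq: "c \<odot>\<^bsub>A\<^esub> pure n R (x(Suc k := y \<oplus>\<^bsub>R\<^esub> z)) =
          c \<odot>\<^bsub>A\<^esub> pure n R (x(Suc k := y)) \<oplus>\<^bsub>A\<^esub> c \<odot>\<^bsub>A\<^esub> pure n R (x(Suc k := z))"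
        by (simp only: A.sm_r_distr)
      show ?case unfolding eq by (rule assms(2)[OF A.sm_closed[OF yz(1)] A.sm_closed[OF yz(2)] add(3,4)])
    qed
    then show ?thesis by simp
  qed
qed

lemma A_induct:
  assumes "a \<in> carrier A" and mon: "\<And>d J. d \<in> carrier D \<Longrightarrow> Q (\<iota> d \<otimes>\<^bsub>A\<^esub> Yt J)"
    and add: "\<And>x y. x \<in> carrier A \<Longrightarrow> y \<in> carrier A \<Longrightarrow> Q x \<Longrightarrow> Q y \<Longrightarrow> Q (x \<oplus>\<^bsub>A\<^esub> y)"
  shows "Q a"
  using assms(1) unfolding A_eq
proof (induction rule: H.A.TP_induct)
  case (pure c x)
  show ?case using pure_generated[of Q x n c, OF mon add pure] unfolding A_eq by simp
next
  case (add u v)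
  then show ?case using assms(3) unfolding A_eq by blast
qed

lemma perm_act_Yt:
  assumes "\<pi> permutes {1..n}" shows "perm_act \<pi> (Yt J) = Yt (J \<circ> inv_into UNIV \<pi>)"
proof -
  interpret P: tensor_perm R n \<pi> by unfold_locales (rule assms)
  have "(\<lambda>i\<in>{1..n}. Yp (J i)) \<circ> inv_into UNIV \<pi> = (\<lambda>i\<in>{1..n}. Yp ((J \<circ> inv_into UNIV \<pi>) i))"
    using P.inv_bij by (auto simp: fun_eq_iff restrict_def)
  then show ?thesis unfolding Yt_def using P.perm_act_pure[OF Yt_tup] by simp
qed

lemma perm_act_homs:
  assumes "\<pi> permutes {1..n}" shows "alg_hom A A (perm_act \<pi>)" "alg_hom D D (perm_act \<pi>)"
proof -
  interpret P: tensor_perm R n \<pi> by unfold_locales (rule assms)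
  interpret PB: tensor_perm B n \<pi> by unfold_locales (rule assms)
  show "alg_hom A A (perm_act \<pi>)" unfolding A_eq by (rule P.perm_act_hom)
  show "alg_hom D D (perm_act \<pi>)" by (rule PB.perm_act_hom)
qed

text \<open>Take the product of the rank one weight functionals. The weight property is bilinear in
  a and d, and on pure tensors it holds slot by slot.\<close>

lemma tensor_weight_functional:
  assumes \<psi>: "\<And>i. i \<in> {1..n} \<Longrightarrow> B.character (\<psi> i)"
  shows "\<exists>f. A.linear_fun f \<and> f \<one>\<^bsub>A\<^esub> = 1 \<and> (\<forall>a\<in>carrier A. \<forall>d\<in>carrier D. f (a \<otimes>\<^bsub>A\<^esub> \<iota> d) = f a * tensor_fun n \<psi> d)"
proof -
  have "\<forall>i\<in>{1..n}. \<exists>f. R.linear_fun f \<and> f \<one>\<^bsub>R\<^esub> = 1 \<and> (\<forall>r\<in>carrier R. \<forall>d\<in>carrier B. f (r \<otimes>\<^bsub>R\<^esub> \<beta> d) = f r * \<psi> i d)"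
    using weight_functional_exists[OF \<psi>] by blast
  from bchoice[OF this] obtain f where f: "\<forall>i\<in>{1..n}. R.linear_fun (f i) \<and> f i \<one>\<^bsub>R\<^esub> = 1 \<and>
    (\<forall>r\<in>carrier R. \<forall>d\<in>carrier B. f i (r \<otimes>\<^bsub>R\<^esub> \<beta> d) = f i r * \<psi> i d)" ..
  then have lin: "R.linear_fun (f i)" if "i \<in> {1..n}" for i using that by blast
  have lin': "B.linear_fun (\<psi> i)" if "i \<in> {1..n}" for i using \<psi>[OF that] by (simp add: B.character_def)
  let ?f = "tensor_fun n f" and ?\<Psi> = "tensor_fun n \<psi>"
  have fl: "A.linear_fun ?f" unfolding A_eq by (rule H.A.tensor_fun_linear) (rule lin)
  have fl': "H.B.TP.linear_fun ?\<Psi>" by (rule H.B.tensor_fun_linear) (rule lin')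
  note L = A.linear_funD[OF fl] and L' = H.B.TP.linear_funD[OF fl']
  have pure: "?f (pure n R x) = (\<Prod>i\<in>{1..n}. f i (x i))" if "x \<in> H.A.tup" for x
    by (rule H.A.tensor_fun_pure[OF _ that]) (rule lin)
  have pure': "?\<Psi> (pure n B x) = (\<Prod>i\<in>{1..n}. \<psi> i (x i))" if "x \<in> H.B.tup" for x
    by (rule H.B.tensor_fun_pure[OF _ that]) (rule lin')
  have "?f (a \<otimes>\<^bsub>A\<^esub> \<iota> d) = ?f a * ?\<Psi> d" if a: "a \<in> carrier A" and d: "d \<in> carrier D" for a d
    using a[unfolded A_eq]
  proof (induction rule: H.A.TP_induct)
    case x: (pure c x)
    have xA: "pure n R x \<in> carrier A" unfolding A_eq by (rule H.A.pure_closed[OF x])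
    show ?case using d
    proof (induction rule: H.B.TP_induct)
      case y: (pure e y)
      have xy: "(\<lambda>i\<in>{1..n}. x i \<otimes>\<^bsub>R\<^esub> (\<lambda>i\<in>{1..n}. \<beta> (y i)) i) \<in> H.A.tup"
        using x y by (auto simp: PiE_iff base_homD)
      have "pure n R x \<otimes>\<^bsub>A\<^esub> \<iota> (pure n B y) = pure n R (\<lambda>i\<in>{1..n}. x i \<otimes>\<^bsub>R\<^esub> (\<lambda>i\<in>{1..n}. \<beta> (y i)) i)"
        unfolding \<iota>_pure[OF y] unfolding A_eq by (rule H.A.pure_mult[OF x beta_tup[OF y]])
      then have "?f (pure n R x \<otimes>\<^bsub>A\<^esub> \<iota> (pure n B y)) = (\<Prod>i\<in>{1..n}. f i (x i \<otimes>\<^bsub>R\<^esub> \<beta> (y i)))"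
        by (simp only: pure[OF xy]) (intro prod.cong refl, simp)
      also have "\<dots> = (\<Prod>i\<in>{1..n}. f i (x i) * \<psi> i (y i))"
      proof (intro prod.cong refl)
        fix i assume i: "i \<in> {1..n}"
        then have "x i \<in> carrier R" "y i \<in> carrier B" using x y by (auto simp: PiE_iff)
        then show "f i (x i \<otimes>\<^bsub>R\<^esub> \<beta> (y i)) = f i (x i) * \<psi> i (y i)" using bspec[OF f i] by simp
      qed
      also have "\<dots> = ?f (pure n R x) * ?\<Psi> (pure n B y)" by (simp only: prod.distrib pure[OF x] pure'[OF y])
      finally have "?f (pure n R x \<otimes>\<^bsub>A\<^esub> \<iota> (pure n B y)) = ?f (pure n R x) * ?\<Psi> (pure n B y)" .
      then show ?case unfolding A_eq[symmetric] using xA H.B.pure_closed[OF y]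
        by (simp add: A.sm_mult_left A.sm_mult_right A.sm_assoc L L' \<iota>D)
    next
      case (add u v)
      then show ?case unfolding A_eq[symmetric] using xA by (simp add: A.r_distr L L' \<iota>D algebra_simps)
    qed
  next
    case (add u v)
    then show ?case unfolding A_eq[symmetric] using d by (simp add: A.l_distr L \<iota>D algebra_simps)
  qed
  moreover have "?f \<one>\<^bsub>A\<^esub> = 1" unfolding A_eq H.A.pure_one pure[OF H.A.const_tup] using f by simp
  ultimately show ?thesis using fl by blast
qed

text \<open>Pure tensors span D, and a character of a pure tensor is the product over its slots.
  Hence rank one weight functionals suffice to realize an arbitrary character of D.\<close>

lemma character_eq_tensor:
  assumes \<chi>: "H.B.TP.character \<chi>" and d: "d \<in> carrier D"
  shows "\<chi> d = tensor_fun n (\<lambda>i x. \<chi> (H.B.slot i x)) d"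
proof -
  have lin: "B.linear_fun (\<lambda>x. \<chi> (H.B.slot i x))" if "i \<in> {1..n}" for i
    using H.B.character_slot[OF \<chi> that] by (simp add: B.character_def)
  have fl: "H.B.TP.linear_fun (tensor_fun n (\<lambda>i x. \<chi> (H.B.slot i x)))" by (rule H.B.tensor_fun_linear) (rule lin)
  note L = H.B.TP.linear_funD[OF fl]
  have pure: "tensor_fun n (\<lambda>i x. \<chi> (H.B.slot i x)) (pure n B x) = (\<Prod>i\<in>{1..n}. \<chi> (H.B.slot i (x i)))" if "x \<in> H.B.tup" for x
    by (rule H.B.tensor_fun_pure[OF _ that]) (rule lin)
  note \<chi>D = H.B.TP.characterD[OF \<chi>]
  show ?thesis using d
  proof (induction rule: H.B.TP_induct)
    case x: (pure c x)
    have "pure n B x \<in> carrier D" by (rule H.B.pure_closed[OF x])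
    then show ?case using H.B.character_pure[OF \<chi> x] pure[OF x] by (simp only: \<chi>D L)
  next
    case (add u v)
    then show ?case by (simp add: \<chi>D L)
  qed
qed

end

section \<open>Separation of weights and consequences of simplicity\<close>

text \<open>Take for h the standard variable. In the classical case \<chi>(s^m h) = \<chi>(h) - m,
  and m is nonzero in k. In the quantum case it is q^m \<chi>(h), where \<chi>(h) is nonzero because
  h is a unit and q is not a root of unity. The same h works for all characters.\<close>

lemma (in gwa1) orbit_separating_element:
  assumes type: "classical_type B s \<or> quantum_type B s" and char0: "\<And>m. m > 0 \<Longrightarrow> (of_nat m :: 'k) \<noteq> 0"
  shows "\<exists>h\<in>carrier B. \<forall>\<chi> i j. B.character \<chi> \<longrightarrow> \<chi> (sz i h) = \<chi> (sz j h) \<longrightarrow> i = j"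
proof -
  have less: "\<exists>h\<in>carrier B. \<forall>\<chi> i j. B.character \<chi> \<longrightarrow> \<chi> (sz i h) = \<chi> (sz j h) \<longrightarrow> i = j"
    if h: "h \<in> carrier B" and step: "\<And>\<chi> i m. B.character \<chi> \<Longrightarrow> m > 0 \<Longrightarrow> \<chi> (sz (i + int m) h) \<noteq> \<chi> (sz i h)" for h
  proof (intro bexI[OF _ h] allI impI)
    fix \<chi> i j assume \<chi>: "B.character \<chi>" "\<chi> (sz i h) = \<chi> (sz j h)"
    show "i = j"
    proof (rule linorder_cases[of i j])
      assume "i < j"
      then show ?thesis using step[OF \<chi>(1), of "nat (j - i)" i] \<chi>(2) by simp
    next
      assume "j < i"
      then show ?thesis using step[OF \<chi>(1), of "nat (i - j)" j] \<chi>(2) by simp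
    qed
  qed
  from type show ?thesis
  proof
    assume "classical_type B s"
    then obtain f where f: "f \<in> alg_iso poly_alg B" and sh: "s (f (monom 1 1)) = f (monom 1 1) \<ominus>\<^bsub>B\<^esub> \<one>\<^bsub>B\<^esub>"
      unfolding classical_type_def Let_def by blast
    define h where "h = f (monom 1 1)"
    have h: "h \<in> carrier B" using f by (auto simp: h_def alg_iso_def ring_iso_def Ring.ring_hom_def poly_alg_def)
    have sh: "s h = h \<oplus>\<^bsub>B\<^esub> \<ominus>\<^bsub>B\<^esub> \<one>\<^bsub>B\<^esub>" using sh unfolding h_def a_minus_def .
    show ?thesis
    proof (rule less[OF h])
      fix \<chi> i and m :: nat assume \<chi>: "B.character \<chi>" and m: "m > 0"
      note \<chi>i = B.characterD[OF B.character_alg_hom[OF \<chi> sz_hom B.k_algebra]]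
      have "\<chi> (sz (i + int m) h) = \<chi> (sz i h) - of_nat m" for m
      proof (induction m)
        case (Suc m)
        have "\<chi> (sz (i + int (Suc m)) h) = \<chi> (sz (i + int m) (s h))"
          using sz_succ'[OF h, of "i + int m"] by (simp add: algebra_simps)
        also have "\<dots> = \<chi> (sz (i + int m) h) - 1" unfolding sh using h by (simp add: \<chi>i)
        finally show ?case using Suc by simp
      qed simp
      then show "\<chi> (sz (i + int m) h) \<noteq> \<chi> (sz i h)" using char0[OF m] by simp
    qed
  next
    assume "quantum_type B s"
    then obtain f and q :: 'k where f: "f \<in> alg_iso laurent_alg B" and q: "q \<noteq> 0" "\<forall>m>0. q ^ m \<noteq> 1"
      and sh: "s (f (mon_elt 1)) = q \<odot>\<^bsub>B\<^esub> f (mon_elt 1)"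
      unfolding quantum_type_def Let_def by blast
    interpret Z: mon_alg "\<lparr>carrier = UNIV, monoid.mult = (+), one = 0\<rparr> :: int monoid"
      unfolding mon_alg_def by (rule monoidI) auto
    have hom: "f \<in> Ring.ring_hom (laurent_alg :: ('k, int \<Rightarrow> 'k) module) B"
      using f by (auto simp: alg_iso_def ring_iso_def)
    have c: "mon_elt z \<in> carrier (laurent_alg :: ('k, int \<Rightarrow> 'k) module)" for z
      unfolding laurent_alg_def by (rule Z.mon_closed) simp
    have u: "mon_elt 1 \<otimes>\<^bsub>laurent_alg\<^esub> mon_elt (- 1) = (\<one>\<^bsub>laurent_alg\<^esub> :: int \<Rightarrow> 'k)"
      unfolding laurent_alg_def by (subst Z.mon_mult) (simp_all add: Z.F_simps)
    define h k where "h = f (mon_elt 1)" and "k = f (mon_elt (- 1))"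
    have hk: "h \<in> carrier B" "k \<in> carrier B" unfolding h_def k_def by (rule ring_hom_closed[OF hom c])+
    have "h \<otimes>\<^bsub>B\<^esub> k = \<one>\<^bsub>B\<^esub>"
      unfolding h_def k_def ring_hom_mult[OF hom c c, symmetric] u by (rule ring_hom_one[OF hom])
    then have unit: "\<chi> h \<noteq> 0" if "B.character \<chi>" for \<chi>
      using B.characterD(2,4)[OF that] hk by (metis mult_zero_left zero_neq_one)
    have sh: "s h = q \<odot>\<^bsub>B\<^esub> h" using sh by (simp add: h_def)
    show ?thesis
    proof (rule less[OF hk(1)])
      fix \<chi> i and m :: nat assume \<chi>: "B.character \<chi>" and m: "m > 0"
      note ci = B.character_alg_hom[OF \<chi> sz_hom B.k_algebra]
      note \<chi>i = B.characterD[OF ci]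
      have "\<chi> (sz (i + int m) h) = q ^ m * \<chi> (sz i h)" for m
      proof (induction m)
        case (Suc m)
        have "\<chi> (sz (i + int (Suc m)) h) = \<chi> (sz (i + int m) (s h))"
          using sz_succ'[OF hk(1), of "i + int m"] by (simp add: algebra_simps)
        also have "\<dots> = q * \<chi> (sz (i + int m) h)" unfolding sh using hk by (simp add: \<chi>i)
        finally show ?case using Suc by simp
      qed simp
      then show "\<chi> (sz (i + int m) h) \<noteq> \<chi> (sz i h)" using q(2) m unit[OF ci, of i] by simp
    qed
  qed
qed

section \<open>Zeros of b along an orbit when the tensor power is simple\<close>

context gwa_pow
begin

text \<open>Let \<mu> be the n-fold product of a matrix coefficient for which a power of X+ is zero,
  and consider the largest ideal in the kernel of \<mu>. It misses 1 but contains the product of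
  these powers over all slots, contrary to simplicity.\<close>

lemma simple_unique_zero:
  assumes simple: "simple_ring A" and i: "i \<in> {1..n}" and \<chi>: "B.character \<chi>"
    and 0: "\<chi> (sz k b) = 0" "\<chi> (sz l b) = 0"
  shows "k = l"
proof -
  have no_less: False if kl: "k < l" "\<chi> (sz k b) = 0" "\<chi> (sz l b) = 0" for k l
  proof -
    have "\<exists>f m. R.linear_fun f \<and> f \<one>\<^bsub>R\<^esub> = 1 \<and> (\<forall>r\<in>carrier R. \<forall>r'\<in>carrier R. f (r \<otimes>\<^bsub>R\<^esub> Yp (int m) \<otimes>\<^bsub>R\<^esub> r') = 0)"
      using nilpotent_functional_exists[OF \<chi>, of "- l" "- k"] kl by simp
    then obtain f m where lin: "R.linear_fun f" and one: "f \<one>\<^bsub>R\<^esub> = 1"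
      and nil: "\<And>r r'. r \<in> carrier R \<Longrightarrow> r' \<in> carrier R \<Longrightarrow> f (r \<otimes>\<^bsub>R\<^esub> Yp (int m) \<otimes>\<^bsub>R\<^esub> r') = 0" by blast
    obtain g where g: "R.linear_fun g" "g (Yp (int m)) = 1" using Yp_functional_exists[OF \<chi>] by blast
    define \<mu> where "\<mu> = tensor_fun n (\<lambda>_::nat. f)"
    have \<mu>: "A.linear_fun \<mu>" unfolding \<mu>_def A_eq by (rule H.A.tensor_fun_linear) (rule lin)
    have pure: "\<mu> (pure n R x) = (\<Prod>i\<in>{1..n}. f (x i))" if "x \<in> H.A.tup" for x
      unfolding \<mu>_def by (rule H.A.tensor_fun_pure[OF _ that]) (rule lin)
    note \<mu>D = A.linear_funD[OF \<mu>]
    \<comment> \<open>The power (X+)^m placed in every slot. A product functional with value 1 on it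
      certifies that it is nonzero.\<close>
    define z where "z = Yt (\<lambda>_. int m)"
    have z: "z \<in> carrier A" unfolding z_def by (rule Yt_closed)
    have "tensor_fun n (\<lambda>_::nat. g) z = 1"
      unfolding z_def Yt_def using g by (subst H.A.tensor_fun_pure[OF _ Yt_tup]) simp_all
    moreover have "A.linear_fun (tensor_fun n (\<lambda>_::nat. g))" unfolding A_eq by (rule H.A.tensor_fun_linear) (rule g)
    ultimately have z0: "z \<noteq> \<zero>\<^bsub>A\<^esub>" using A.linear_funD(3) by fastforce
    define I where "I = {a \<in> carrier A. \<forall>x\<in>carrier A. \<forall>y\<in>carrier A. \<mu> (x \<otimes>\<^bsub>A\<^esub> a \<otimes>\<^bsub>A\<^esub> y) = 0}"
    have I: "a \<in> I \<longleftrightarrow> a \<in> carrier A \<and> (\<forall>x\<in>carrier A. \<forall>y\<in>carrier A. \<mu> (x \<otimes>\<^bsub>A\<^esub> a \<otimes>\<^bsub>A\<^esub> y) = 0)" for a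
      by (simp add: I_def)
    have "ideal I A"
    proof (rule A.ideal_criterion)
      show "I \<subseteq> carrier A" by (auto simp: I)
      show "\<zero>\<^bsub>A\<^esub> \<in> I" by (simp add: I \<mu>D)
      show "x \<oplus>\<^bsub>A\<^esub> y \<in> I" if "x \<in> I" "y \<in> I" for x y
        using that unfolding I by (simp add: A.r_distr A.l_distr \<mu>D)
      show "a \<otimes>\<^bsub>A\<^esub> x \<in> I" if x: "x \<in> I" and a: "a \<in> carrier A" for x a
        unfolding I
      proof (intro conjI ballI)
        fix u w assume uw: "u \<in> carrier A" "w \<in> carrier A"
        have "u \<otimes>\<^bsub>A\<^esub> (a \<otimes>\<^bsub>A\<^esub> x) \<otimes>\<^bsub>A\<^esub> w = (u \<otimes>\<^bsub>A\<^esub> a) \<otimes>\<^bsub>A\<^esub> x \<otimes>\<^bsub>A\<^esub> w" using x a uw by (simp add: I A.m_assoc)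
        then show "\<mu> (u \<otimes>\<^bsub>A\<^esub> (a \<otimes>\<^bsub>A\<^esub> x) \<otimes>\<^bsub>A\<^esub> w) = 0" using x a uw unfolding I by simp
      qed (use x a in \<open>simp add: I\<close>)
      show "x \<otimes>\<^bsub>A\<^esub> a \<in> I" if x: "x \<in> I" and a: "a \<in> carrier A" for x a
        unfolding I
      proof (intro conjI ballI)
        fix u w assume uw: "u \<in> carrier A" "w \<in> carrier A"
        have "u \<otimes>\<^bsub>A\<^esub> (x \<otimes>\<^bsub>A\<^esub> a) \<otimes>\<^bsub>A\<^esub> w = u \<otimes>\<^bsub>A\<^esub> x \<otimes>\<^bsub>A\<^esub> (a \<otimes>\<^bsub>A\<^esub> w)" using x a uw by (simp add: I A.m_assoc)
        then show "\<mu> (u \<otimes>\<^bsub>A\<^esub> (x \<otimes>\<^bsub>A\<^esub> a) \<otimes>\<^bsub>A\<^esub> w) = 0" using x a uw unfolding I by simp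
      qed (use x a in \<open>simp add: I\<close>)
    qed
    moreover have "\<mu> \<one>\<^bsub>A\<^esub> = 1" unfolding A_eq H.A.pure_one pure[OF H.A.const_tup] by (simp add: one)
    then have "\<one>\<^bsub>A\<^esub> \<notin> I" unfolding I by (metis A.one_closed A.r_one zero_neq_one)
    moreover have "z \<in> I"
      unfolding I
    proof (intro conjI ballI z)
      fix x y assume x: "x \<in> carrier A" and y: "y \<in> carrier A"
      show "\<mu> (x \<otimes>\<^bsub>A\<^esub> z \<otimes>\<^bsub>A\<^esub> y) = 0"
        using x[unfolded A_eq]
      proof (induction rule: H.A.TP_induct)
        case x: (pure c x)
        have xA: "pure n R x \<in> carrier A" unfolding A_eq by (rule H.A.pure_closed[OF x])
        show ?case using y[unfolded A_eq]
        proof (induction rule: H.A.TP_induct)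
          case y: (pure e y)
          have yA: "pure n R y \<in> carrier A" unfolding A_eq by (rule H.A.pure_closed[OF y])
          have cl: "x i \<in> carrier R" "y i \<in> carrier R" if "i \<in> {1..n}" for i using x y that by (auto simp: PiE_iff)
          have res: "(\<lambda>i\<in>{1..n}. x i) = x" "(\<lambda>i\<in>{1..n}. y i) = y"
            using x y by (simp_all add: PiE_iff extensional_restrict)
          have 1: "pure n R x \<otimes>\<^bsub>A\<^esub> z = pure n R (\<lambda>i\<in>{1..n}. x i \<otimes>\<^bsub>R\<^esub> Yp (int m))"
            unfolding z_def Yt_def by (subst res(1)[symmetric], rule pure_mult_restrict) (use cl in simp_all)
          have 2: "pure n R x \<otimes>\<^bsub>A\<^esub> z \<otimes>\<^bsub>A\<^esub> pure n R y = pure n R (\<lambda>i\<in>{1..n}. x i \<otimes>\<^bsub>R\<^esub> Yp (int m) \<otimes>\<^bsub>R\<^esub> y i)"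
            unfolding 1 by (subst res(2)[symmetric], rule pure_mult_restrict) (use cl in simp_all)
          have t: "(\<lambda>i\<in>{1..n}. x i \<otimes>\<^bsub>R\<^esub> Yp (int m) \<otimes>\<^bsub>R\<^esub> y i) \<in> H.A.tup" using cl by simp
          have "\<mu> (pure n R x \<otimes>\<^bsub>A\<^esub> z \<otimes>\<^bsub>A\<^esub> pure n R y) = 0"
            \<comment> \<open>One vanishing factor suffices, and slot \<open>i\<close> provides it;
              over an empty set of slots the product would be 1.\<close>
            unfolding 2 pure[OF t] by (rule prod_zero) (use i cl[OF i] nil in \<open>auto intro!: bexI[of _ i]\<close>)
          then show ?case unfolding A_eq[symmetric] using xA yA z
            by (simp add: A.sm_mult_left A.sm_mult_right A.sm_assoc \<mu>D)
        next
          case (add u w)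
          then show ?case unfolding A_eq[symmetric] using xA z by (simp add: A.r_distr \<mu>D)
        qed
      next
        case (add u w)
        then show ?case unfolding A_eq[symmetric] using y z by (simp add: A.l_distr \<mu>D)
      qed
    qed
    ultimately show False using simple z0 A.one_closed unfolding simple_ring_def by blast
  qed
  show ?thesis using no_less[of k l] no_less[of l k] 0 by (cases k l rule: linorder_cases) auto
qed

text \<open>The powers of X+ on a vector of weight \<chi> are obstructed by zeros of b at the
  exponents -t with t >= 0, those of X- by zeros at the exponents t + 1. With at most one zero on
  the orbit, one of the two directions is free.\<close>

lemma simple_sign:
  assumes simple: "simple_ring A" and i: "i \<in> {1..n}" and \<chi>: "B.character \<chi>"
  shows "\<exists>e. (e = 1 \<or> e = - 1) \<and> (\<forall>r. \<exists>c\<in>carrier B. Yp (- (e * int r)) \<otimes>\<^bsub>R\<^esub> Yp (e * int r) = \<beta> c \<and> \<chi> c \<noteq> 0)"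
proof (cases "\<exists>t::nat. \<chi> (sz (- int t) b) = 0")
  case True
  then obtain t :: nat where t: "\<chi> (sz (- int t) b) = 0" ..
  have "\<chi> (sz (int u + 1) b) \<noteq> 0" for u :: nat using simple_unique_zero[OF assms _ t, of "int u + 1"] by auto
  then show ?thesis using Yp_inverse_neg[OF \<chi>] by (intro exI[of _ "-1"]) simp
next
  case False
  then show ?thesis using Yp_inverse_pos[OF \<chi>] by (intro exI[of _ 1]) simp
qed

end

section \<open>Harish-Chandra modules over \<open>D(a,\<sigma>) * G\<close>\<close>

lemma (in tensor_pow) perm_act_slot:
  assumes \<pi>: "\<pi> permutes {1..n}" and i: "i \<in> {1..n}" and x: "x \<in> carrier A"
  shows "perm_act \<pi> (slot i x) = slot (\<pi> i) x"
proof -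
  interpret P: tensor_perm A n \<pi> by unfold_locales (rule \<pi>)
  have "(\<lambda>j\<in>{1..n}. \<one>) \<circ> inv_into UNIV \<pi> = (\<lambda>j\<in>{1..n}. \<one>)"
    using P.inv_bij by (auto simp: fun_eq_iff restrict_def)
  then have "((\<lambda>j\<in>{1..n}. \<one>)(i := x)) \<circ> inv_into UNIV \<pi> = (\<lambda>j\<in>{1..n}. \<one>)(\<pi> i := x)"
    by (simp only: P.upd_comp)
  then show ?thesis unfolding slot_def P.perm_act_pure[OF tup_upd[OF const_tup i x]] by (simp only:)
qed

lemma (in tensor_pow) tensor_fun_slot:
  assumes \<psi>: "\<And>k. k \<in> {1..n} \<Longrightarrow> character (\<psi> k)" and i: "i \<in> {1..n}" and x: "x \<in> carrier A"
  shows "tensor_fun n \<psi> (slot i x) = \<psi> i x"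
proof -
  have lin: "linear_fun (\<psi> k)" if "k \<in> {1..n}" for k using \<psi>[OF that] by (simp add: character_def)
  have "tensor_fun n \<psi> (slot i x) = (\<Prod>k\<in>{1..n}. \<psi> k (((\<lambda>j\<in>{1..n}. \<one>)(i := x)) k))"
    unfolding slot_def by (rule tensor_fun_pure[OF _ tup_upd[OF const_tup i x]]) (rule lin)
  also have "\<dots> = (\<Prod>k\<in>{1..n}. if k = i then \<psi> i x else 1)"
    by (rule prod.cong) (auto simp: characterD(4)[OF \<psi>])
  also have "\<dots> = \<psi> i x" using i by (simp add: prod.delta)
  finally show ?thesis .
qed

lemma (in gwa_pow) \<iota>_slot_Yt:
  assumes i: "i \<in> {1..n}" and h: "h \<in> carrier B"
  shows "\<iota> (H.B.slot i h) \<otimes>\<^bsub>A\<^esub> Yt J = Yt J \<otimes>\<^bsub>A\<^esub> \<iota> (H.B.slot i (sz (- J i) h))"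
proof -
  have "(\<lambda>k\<in>{1..n}. sz (- J k) (((\<lambda>j\<in>{1..n}. \<one>\<^bsub>B\<^esub>)(i := h)) k)) = (\<lambda>j\<in>{1..n}. \<one>\<^bsub>B\<^esub>)(i := sz (- J i) h)"
    using i by (auto simp: fun_eq_iff sz_homD)
  with \<iota>_Yt_pure[OF H.B.tup_upd[OF H.B.const_tup i h], of J] show ?thesis unfolding H.B.slot_def by (simp only:)
qed

section \<open>The permutation group and the concrete skew group ring\<close>

locale gwa_perm = gwa_pow B s b n for B :: "('k::field_char_0, 'b) module" and s b n +
  fixes Gs :: "(nat \<Rightarrow> nat) set"
  assumes Gs: "subgroup Gs (sym_group n)" and D_cring: "cring D"
begin

lemma Gs_permutes: "g \<in> Gs \<Longrightarrow> g permutes {1..n}"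
  using subgroup.subset[OF Gs] by (auto simp: sym_group_carrier)

lemma perm_group: "group (perm_group n Gs)"
  by (rule subgroup.subgroup_is_group[OF Gs sym_group_is_group])

lemma perm_group_simps: "carrier (perm_group n Gs) = Gs" "g \<otimes>\<^bsub>perm_group n Gs\<^esub> h = g \<circ> h" "\<one>\<^bsub>perm_group n Gs\<^esub> = id"
  by (simp_all add: sym_group_def)

lemma skew_ring: "skew_ring A (perm_group n Gs) perm_act"
proof (rule skew_ring.intro[OF A.kalg_axioms perm_group skew_ring_axioms.intro])
  show "finite (carrier (perm_group n Gs))" unfolding perm_group_simps
    by (rule finite_subset[OF _ finite_permutations[of "{1..n}"]]) (use Gs_permutes in auto)
  show "alg_hom A A (perm_act g)" if "g \<in> carrier (perm_group n Gs)" for g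
    using perm_act_homs(1) Gs_permutes that unfolding perm_group_simps by blast
  show "perm_act (g \<otimes>\<^bsub>perm_group n Gs\<^esub> h) a = perm_act g (perm_act h a)"
    if "g \<in> carrier (perm_group n Gs)" "h \<in> carrier (perm_group n Gs)" "a \<in> carrier A" for g h a
    using H.A.perm_act_comp Gs_permutes that unfolding perm_group_simps A_eq by blast
  show "perm_act \<one>\<^bsub>perm_group n Gs\<^esub> a = a" if "a \<in> carrier A" for a
    using that unfolding perm_group_simps A_eq by (rule H.A.perm_act_id)
qed

sublocale S: skew_ring A "perm_group n Gs" perm_act by (rule skew_ring)

abbreviation "j \<equiv> gwa_to_skew n B s b Gs"
abbreviation "\<gamma> \<equiv> S.el \<one>\<^bsub>A\<^esub>"

lemma j_eq: "j = (\<lambda>a. S.el a \<one>\<^bsub>perm_group n Gs\<^esub>)"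
  by (rule ext) (simp only: gwa_to_skew_def)

lemma skew_act: "skew_act S.U A D (perm_group n Gs) j \<gamma> \<iota> perm_act perm_act Yt n"
proof (rule skew_act.intro[OF S.U.kalg_axioms A.kalg_axioms H.B.TP.kalg_axioms D_cring perm_group skew_act_axioms.intro])
  have one: "\<one>\<^bsub>A\<^esub> \<in> carrier A" "\<one>\<^bsub>perm_group n Gs\<^esub> \<in> carrier (perm_group n Gs)" by (rule A.one_closed, rule S.G.one_closed)
  show "finite (carrier (perm_group n Gs))" by (rule S.finG)
  show "alg_hom A S.U j" unfolding j_eq by (rule S.el_hom)
  show "alg_hom D A \<iota>" by (rule \<iota>_hom)
  show "\<gamma> g \<in> carrier S.U" for g by (rule S.el_closed[OF one(1)])
  show "\<gamma> (g \<otimes>\<^bsub>perm_group n Gs\<^esub> h) = \<gamma> g \<otimes>\<^bsub>S.U\<^esub> \<gamma> h" if "g \<in> carrier (perm_group n Gs)" "h \<in> carrier (perm_group n Gs)" for g h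
    unfolding S.el_mult[OF one(1) one(1) that] S.actD(4)[OF that(1)] A.r_one[OF one(1)] ..
  show "\<gamma> \<one>\<^bsub>perm_group n Gs\<^esub> = \<one>\<^bsub>S.U\<^esub>" by (simp only: S.U_simps(4))
  \<comment> \<open>The element a * g is the product of a * 1 and 1 * g, which matches the elements
    of the skew group ring with the products in the abstract spanning rule.\<close>
  have split: "S.el a g = S.el a \<one>\<^bsub>perm_group n Gs\<^esub> \<otimes>\<^bsub>S.U\<^esub> \<gamma> g" if "a \<in> carrier A" "g \<in> carrier (perm_group n Gs)" for a g
    unfolding S.el_mult[OF that(1) one(1) one(2) that(2)] S.act_one[OF one(1)] A.r_one[OF that(1)] S.G.l_one[OF that(2)] ..
  show "\<gamma> g \<otimes>\<^bsub>S.U\<^esub> j a = j (perm_act g a) \<otimes>\<^bsub>S.U\<^esub> \<gamma> g" if "g \<in> carrier (perm_group n Gs)" "a \<in> carrier A" for g a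
  proof -
    have ga: "perm_act g a \<in> carrier A" by (rule S.actD(1)[OF that])
    show ?thesis unfolding j_eq split[OF ga that(1), symmetric]
      unfolding S.el_mult[OF one(1) that(2,1) one(2)] A.l_one[OF ga] S.G.r_one[OF that(1)] ..
  qed
  show "alg_hom A A (perm_act g)" if "g \<in> carrier (perm_group n Gs)" for g by (rule S.act_hom[OF that])
  show "perm_act (g \<otimes>\<^bsub>perm_group n Gs\<^esub> h) a = perm_act g (perm_act h a)"
    if "g \<in> carrier (perm_group n Gs)" "h \<in> carrier (perm_group n Gs)" "a \<in> carrier A" for g h a by (rule S.act_mult[OF that])
  show "perm_act \<one>\<^bsub>perm_group n Gs\<^esub> a = a" if "a \<in> carrier A" for a by (rule S.act_one[OF that])
  show "alg_hom D D (perm_act g)" if "g \<in> carrier (perm_group n Gs)" for g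
    using perm_act_homs(2) Gs_permutes that unfolding perm_group_simps by blast
  show "perm_act (g \<otimes>\<^bsub>perm_group n Gs\<^esub> h) a = perm_act g (perm_act h a)"
    if "g \<in> carrier (perm_group n Gs)" "h \<in> carrier (perm_group n Gs)" "a \<in> carrier D" for g h a
    using H.B.perm_act_comp Gs_permutes that unfolding perm_group_simps by blast
  show "perm_act \<one>\<^bsub>perm_group n Gs\<^esub> a = a" if "a \<in> carrier D" for a
    using H.B.perm_act_id[OF that] unfolding perm_group_simps .
  show "\<iota> (perm_act g d) = perm_act g (\<iota> d)" if "g \<in> carrier (perm_group n Gs)" "d \<in> carrier D" for g d
    using H.tensor_map_perm_act Gs_permutes that unfolding perm_group_simps \<iota>_eq by blast
  show "Q u" if u: "u \<in> carrier S.U" and mon: "\<And>a g. a \<in> carrier A \<Longrightarrow> g \<in> carrier (perm_group n Gs) \<Longrightarrow> Q (j a \<otimes>\<^bsub>S.U\<^esub> \<gamma> g)"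
    and add: "\<And>x y. x \<in> carrier S.U \<Longrightarrow> y \<in> carrier S.U \<Longrightarrow> Q x \<Longrightarrow> Q y \<Longrightarrow> Q (x \<oplus>\<^bsub>S.U\<^esub> y)" for u Q
    using u
  proof (induction rule: S.U_induct)
    case (el a g)
    show ?case unfolding split[OF el] using mon[OF el] unfolding j_eq .
  next
    case (add x y)
    then show ?case by (rule that(3))
  qed
  show "Q a" if "a \<in> carrier A" "\<And>d J. d \<in> carrier D \<Longrightarrow> Q (\<iota> d \<otimes>\<^bsub>A\<^esub> Yt J)"
    "\<And>x y. x \<in> carrier A \<Longrightarrow> y \<in> carrier A \<Longrightarrow> Q x \<Longrightarrow> Q y \<Longrightarrow> Q (x \<oplus>\<^bsub>A\<^esub> y)" for a Q
    using that by (rule A_induct)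
  show "\<exists>p. p permutes {1..n} \<and> (\<forall>J. perm_act g (Yt J) = Yt (J \<circ> p))" if "g \<in> carrier (perm_group n Gs)" for g
  proof (intro exI[of _ "inv_into UNIV g"] conjI allI)
    have g: "g permutes {1..n}" using Gs_permutes that unfolding perm_group_simps by blast
    show "inv_into UNIV g permutes {1..n}" by (rule permutes_inv[OF g])
    show "perm_act g (Yt J) = Yt (J \<circ> inv_into UNIV g)" for J by (rule perm_act_Yt[OF g])
  qed
qed (rule Yt_closed Yt_zero Yt_restrict Yt_mult | erule \<iota>_Yt)+

lemma skew_module_exists:
  assumes \<chi>: "H.B.TP.character \<chi>"
  shows "\<exists>(T :: (('k, 'b) gwa_skew_elt, ('k, 'b) gwa_skew_elt set) module) v.
    skew_module S.U A D (perm_group n Gs) j \<gamma> \<iota> perm_act perm_act Yt n T \<chi> v"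
proof -
  obtain f where f: "A.linear_fun f" "f \<one>\<^bsub>A\<^esub> = 1"
    "\<And>a d. a \<in> carrier A \<Longrightarrow> d \<in> carrier D \<Longrightarrow> f (a \<otimes>\<^bsub>A\<^esub> \<iota> d) = f a * tensor_fun n (\<lambda>i x. \<chi> (H.B.slot i x)) d"
    using tensor_weight_functional[of "\<lambda>i x. \<chi> (H.B.slot i x)", OF H.B.character_slot[OF \<chi>]] by blast
  have "f (a \<otimes>\<^bsub>A\<^esub> \<iota> d) = f a * \<chi> d" if "a \<in> carrier A" "d \<in> carrier D" for a d
    unfolding character_eq_tensor[OF \<chi> that(2)] by (rule f(3)[OF that])
  from S.weight_module_exists[OF f(1,2) \<iota>_hom H.B.TP.k_algebra \<chi> this]
  obtain T :: "(('k, 'b) gwa_skew_elt, ('k, 'b) gwa_skew_elt set) module" and v where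
    T: "irreducible_module S.U T" "v \<in> carrier T" "v \<noteq> \<zero>\<^bsub>T\<^esub>"
      "\<And>d. d \<in> carrier D \<Longrightarrow> j (\<iota> d) \<odot>\<^bsub>T\<^esub> v = \<chi> d \<odot>\<^bsub>underlying_space S.U T\<^esub> v" unfolding j_eq by blast
  have "kalg_module S.U T"
    using T(1) S.U.kalg_axioms by (simp add: kalg_module_def irreducible_module_def)
  moreover have "skew_module_axioms S.U D j \<iota> T \<chi> v" by (rule skew_module_axioms.intro) (rule T \<chi> | assumption)+
  ultimately have "skew_module S.U A D (perm_group n Gs) j \<gamma> \<iota> perm_act perm_act Yt n T \<chi> v"
    by (rule skew_module.intro[OF skew_act])
  then show ?thesis by (intro exI)
qed

lemma skew_module_simple:
  fixes T :: "(('k, 'b) gwa_skew_elt, 'm) module"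
  assumes T: "skew_module S.U A D (perm_group n Gs) j \<gamma> \<iota> perm_act perm_act Yt n T \<chi> v"
    and \<chi>: "H.B.TP.character \<chi>" and type: "classical_type B s \<or> quantum_type B s" and simple: "simple_ring A"
  shows "\<exists>\<epsilon> \<chi>'. skew_module_simple S.U A D (perm_group n Gs) j \<gamma> \<iota> perm_act perm_act Yt n T \<chi> v \<epsilon> \<chi>'"
proof -
  define ev where "ev = (\<lambda>i x. \<chi> (H.B.slot i x))"
  have Xc: "B.character (ev i)" if "i \<in> {1..n}" for i
    unfolding ev_def by (rule H.B.character_slot[OF \<chi> that])
  obtain h where h: "h \<in> carrier B" and sep: "\<And>\<chi> i j. B.character \<chi> \<Longrightarrow> \<chi> (sz i h) = \<chi> (sz j h) \<Longrightarrow> i = j"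
    using orbit_separating_element[OF type] by auto
  have "\<forall>i\<in>{1..n}. \<exists>e. (e = 1 \<or> e = - 1) \<and> (\<forall>r. \<exists>c\<in>carrier B. Yp (- (e * int r)) \<otimes>\<^bsub>R\<^esub> Yp (e * int r) = \<beta> c \<and> ev i c \<noteq> 0)"
    using simple_sign[OF simple _ Xc] by blast
  from bchoice[OF this] obtain e where e: "\<forall>i\<in>{1..n}. (e i = 1 \<or> e i = - 1) \<and>
    (\<forall>r. \<exists>c\<in>carrier B. Yp (- (e i * int r)) \<otimes>\<^bsub>R\<^esub> Yp (e i * int r) = \<beta> c \<and> ev i c \<noteq> 0)" ..
  \<comment> \<open>Indices outside the slots receive the value 1, as a sign is required at every
    index.\<close>
  define \<epsilon> where "\<epsilon> i = (if i \<in> {1..n} then e i else 1)" for i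
  have sign: "\<epsilon> i = 1 \<or> \<epsilon> i = - 1" for i using e by (simp add: \<epsilon>_def)
  have inv: "\<exists>c. c \<in> carrier B \<and> Yp (- (\<epsilon> i * int r)) \<otimes>\<^bsub>R\<^esub> Yp (\<epsilon> i * int r) = \<beta> c \<and> ev i c \<noteq> 0" if "i \<in> {1..n}" for i r
    using bspec[OF e that] that unfolding \<epsilon>_def by auto
  \<comment> \<open>The character in general position: slot i carries the i-th shift of a single
    rank one character. These shifts take pairwise distinct values on h, so a permutation moving i
    to another slot changes the tensor character on h placed in slot i.\<close>
  define \<psi> where "\<psi> = (\<lambda>i x. ev 1 (sz (int i) x))"
  have \<psi>: "B.character (\<psi> i)" if "i \<in> {1..n}" for i
    unfolding \<psi>_def by (rule B.character_alg_hom[OF Xc sz_hom B.k_algebra]) (use that in auto)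
  obtain f where f: "A.linear_fun f" "f \<one>\<^bsub>A\<^esub> = 1"
    "\<And>a d. a \<in> carrier A \<Longrightarrow> d \<in> carrier D \<Longrightarrow> f (a \<otimes>\<^bsub>A\<^esub> \<iota> d) = f a * tensor_fun n \<psi> d"
    using tensor_weight_functional[of \<psi>, OF \<psi>] by blast
  have "skew_module_simple_axioms A D (perm_group n Gs) \<iota> perm_act Yt n \<chi> \<epsilon> (tensor_fun n \<psi>)"
  proof (rule skew_module_simple_axioms.intro)
    show "\<epsilon> i = 1 \<or> \<epsilon> i = - 1" for i by (rule sign)
    show "Yt (\<lambda>i. \<epsilon> i * int (p i)) \<otimes>\<^bsub>A\<^esub> Yt (\<lambda>i. \<epsilon> i * int (q i)) = Yt (\<lambda>i. \<epsilon> i * int (p i + q i))" for p q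
      unfolding Yt_def Yp_mult_same_sign[OF sign, symmetric] by (rule pure_mult_restrict) simp_all
    show "\<exists>c\<in>carrier D. Yt (\<lambda>i. - (\<epsilon> i * int (p i))) \<otimes>\<^bsub>A\<^esub> Yt (\<lambda>i. \<epsilon> i * int (p i)) = \<iota> c \<and> \<chi> c \<noteq> 0" for p
    proof -
      have "\<forall>i\<in>{1..n}. \<exists>c. c \<in> carrier B \<and> Yp (- (\<epsilon> i * int (p i))) \<otimes>\<^bsub>R\<^esub> Yp (\<epsilon> i * int (p i)) = \<beta> c \<and> ev i c \<noteq> 0"
        using inv by blast
      from bchoice[OF this] obtain c where c': "\<forall>i\<in>{1..n}. c i \<in> carrier B \<and>
        Yp (- (\<epsilon> i * int (p i))) \<otimes>\<^bsub>R\<^esub> Yp (\<epsilon> i * int (p i)) = \<beta> (c i) \<and> ev i (c i) \<noteq> 0" ..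
      have c: "c i \<in> carrier B" "Yp (- (\<epsilon> i * int (p i))) \<otimes>\<^bsub>R\<^esub> Yp (\<epsilon> i * int (p i)) = \<beta> (c i)" "ev i (c i) \<noteq> 0"
        if "i \<in> {1..n}" for i using bspec[OF c' that] by blast+
      have ct: "(\<lambda>i\<in>{1..n}. c i) \<in> H.B.tup" using c(1) by simp
      let ?c = "pure n B (\<lambda>i\<in>{1..n}. c i)"
      have "Yt (\<lambda>i. - (\<epsilon> i * int (p i))) \<otimes>\<^bsub>A\<^esub> Yt (\<lambda>i. \<epsilon> i * int (p i)) =
          pure n R (\<lambda>i\<in>{1..n}. Yp (- (\<epsilon> i * int (p i))) \<otimes>\<^bsub>R\<^esub> Yp (\<epsilon> i * int (p i)))"
        unfolding Yt_def by (rule pure_mult_restrict) simp_all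
      also have "(\<lambda>i\<in>{1..n}. Yp (- (\<epsilon> i * int (p i))) \<otimes>\<^bsub>R\<^esub> Yp (\<epsilon> i * int (p i))) = (\<lambda>i\<in>{1..n}. \<beta> (c i))"
        by (rule restrict_ext) (rule c(2))
      also have "pure n R \<dots> = \<iota> ?c" by (rule \<iota>_pure_restrict[symmetric]) (rule c(1))
      finally have 1: "Yt (\<lambda>i. - (\<epsilon> i * int (p i))) \<otimes>\<^bsub>A\<^esub> Yt (\<lambda>i. \<epsilon> i * int (p i)) = \<iota> ?c" .
      have "\<chi> ?c = (\<Prod>i\<in>{1..n}. ev i (c i))"
        unfolding H.B.character_pure[OF \<chi> ct] ev_def by (rule prod.cong) simp_all
      then have 2: "\<chi> ?c \<noteq> 0" using c(3) by simp
      show ?thesis by (rule bexI[of _ ?c]) (use 1 2 H.B.pure_closed[OF ct] in blast)+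
    qed
    show "\<exists>d\<in>carrier D. \<exists>d'\<in>carrier D. \<exists>d''\<in>carrier D.
       \<iota> d \<otimes>\<^bsub>A\<^esub> Yt (\<lambda>i. \<epsilon> i * int (p i)) = Yt (\<lambda>i. \<epsilon> i * int (p i)) \<otimes>\<^bsub>A\<^esub> \<iota> d' \<and>
       \<iota> d \<otimes>\<^bsub>A\<^esub> Yt (\<lambda>i. \<epsilon> i * int (q i)) = Yt (\<lambda>i. \<epsilon> i * int (q i)) \<otimes>\<^bsub>A\<^esub> \<iota> d'' \<and> \<chi> d' \<noteq> \<chi> d''"
      if i: "i \<in> {1..n}" and pq: "p i \<noteq> q i" for i and p q :: "nat \<Rightarrow> nat"
    proof (intro bexI conjI)
      show "\<iota> (H.B.slot i h) \<otimes>\<^bsub>A\<^esub> Yt (\<lambda>i. \<epsilon> i * int (p i)) = Yt (\<lambda>i. \<epsilon> i * int (p i)) \<otimes>\<^bsub>A\<^esub> \<iota> (H.B.slot i (sz (- (\<epsilon> i * int (p i))) h))"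
        "\<iota> (H.B.slot i h) \<otimes>\<^bsub>A\<^esub> Yt (\<lambda>i. \<epsilon> i * int (q i)) = Yt (\<lambda>i. \<epsilon> i * int (q i)) \<otimes>\<^bsub>A\<^esub> \<iota> (H.B.slot i (sz (- (\<epsilon> i * int (q i))) h))"
        by (rule \<iota>_slot_Yt[OF i h])+
      have "- (\<epsilon> i * int (p i)) \<noteq> - (\<epsilon> i * int (q i))" using sign[of i] pq by auto
      then show "\<chi> (H.B.slot i (sz (- (\<epsilon> i * int (p i))) h)) \<noteq> \<chi> (H.B.slot i (sz (- (\<epsilon> i * int (q i))) h))"
        using sep[OF Xc[OF i]] unfolding ev_def by blast
    qed (rule alg_homD(1)[OF H.B.slot_hom[OF i]], (rule sz_homD(1))?, rule h)+
    show "simple_ring A" by (rule simple)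
    show "H.B.TP.character (tensor_fun n \<psi>)" by (rule H.B.tensor_character[OF \<psi>])
    show "tensor_fun n \<psi> d = 0" if d: "d \<in> carrier D" "\<iota> d = \<zero>\<^bsub>A\<^esub>" for d
    proof -
      \<comment> \<open>The weight functional evaluates \<iota> d to the value of the tensor
        character at d. An element killed by \<iota> is therefore killed by the character.\<close>
      have "f (\<one>\<^bsub>A\<^esub> \<otimes>\<^bsub>A\<^esub> \<iota> d) = tensor_fun n \<psi> d" using f(3)[OF A.one_closed d(1)] f(2) by simp
      then show ?thesis unfolding d(2) by (simp add: A.linear_funD(3)[OF f(1)])
    qed
    show "\<exists>d\<in>carrier D. tensor_fun n \<psi> (perm_act g d) \<noteq> tensor_fun n \<psi> d"
      if g: "g \<in> carrier (perm_group n Gs)" "g \<noteq> \<one>\<^bsub>perm_group n Gs\<^esub>" for g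
    proof -
      have gp: "g permutes {1..n}" and "g \<noteq> id" using g Gs_permutes unfolding perm_group_simps by blast+
      then obtain i where i: "g i \<noteq> i" by (auto simp: fun_eq_iff)
      then have in1: "i \<in> {1..n}" using gp by (metis permutes_not_in)
      then have in2: "g i \<in> {1..n}" using permutes_in_image[OF gp] by blast
      have "1 \<in> {1..n}" using in1 by auto
      then have ne: "\<psi> (g i) h \<noteq> \<psi> i h" using sep[OF Xc, of 1 "int (g i)" "int i"] i unfolding \<psi>_def by auto
      have slot: "tensor_fun n \<psi> (H.B.slot k h) = \<psi> k h" if "k \<in> {1..n}" for k
        by (rule H.B.tensor_fun_slot[OF _ that h]) (rule \<psi>)
      have "tensor_fun n \<psi> (perm_act g (H.B.slot i h)) \<noteq> tensor_fun n \<psi> (H.B.slot i h)"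
        unfolding H.B.perm_act_slot[OF gp in1 h] slot[OF in1] slot[OF in2] by (rule ne)
      then show ?thesis using alg_homD(1)[OF H.B.slot_hom[OF in1] h] by blast
    qed
  qed
  from skew_module_simple.intro[OF T this] show ?thesis by blast
qed

end

theorem theorem5p15:
  fixes B :: "('k :: {alg_closed_field, field_char_0}, 'b) module"
    and s :: "'b \<Rightarrow> 'b" and b :: 'b and n :: nat and G :: "(nat \<Rightarrow> nat) set"
  assumes "k_algebra B" and "domain B"
    and "s \<in> alg_iso B B"
    and "b \<in> carrier B" and "\<And>x. x \<in> carrier B \<Longrightarrow> b \<otimes>\<^bsub>B\<^esub> x = \<zero>\<^bsub>B\<^esub> \<Longrightarrow> x = \<zero>\<^bsub>B\<^esub>"
    and "affine_algebra (tensor_power n B)" and "domain (tensor_power n B)"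
    and "subgroup G (sym_group n)"
  shows "let D = tensor_power n B;
             A = gwa_power n B s b;
             U = gwa_skew n B s b G;
             DG = invariant_alg D (perm_group n G) perm_act;
             AG = invariant_alg A (perm_group n G) perm_act;
             D_in_A = gwa_power_base n B s b;
             D_in_U = gwa_to_skew n B s b G \<circ> D_in_A
         in \<forall>\<mm>. maximalideal \<mm> D \<longrightarrow>
              (\<exists>T :: (('k, 'b) gwa_skew_elt, ('k, 'b) gwa_skew_elt set) module.
                 irreducible_module U T \<and>
                 harish_chandra_module U D D_in_U T \<and>
                 \<mm> \<in> hc_support D D_in_U T \<and>
                 (simple_tensorial_classical_or_quantum n B s b \<longrightarrow>
                    holonomic n U T \<and>
                    irreducible_module AG (fixed_module n B s b G T) \<and>
                    harish_chandra_module AG DG D_in_A (fixed_module n B s b G T) \<and>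
                    holonomic n AG (fixed_module n B s b G T)))"
proof -
  have cr: "cring (tensor_power n B)" using assms(7) by (simp add: domain_def)
  interpret gwa_perm B s b n G
    by (intro gwa_perm.intro gwa_pow.intro gwa1.intro kalgI gwa1_axioms.intro gwa_perm_axioms.intro assms(1,3,4,8) cr)
  have U: "gwa_skew n B s b G = S.U" by (simp only: gwa_skew_def)
  show ?thesis
    unfolding Let_def U
  proof (intro allI impI)
    fix \<mm> assume "maximalideal \<mm> D"
    then obtain \<chi> where \<chi>: "H.B.TP.character \<chi>" and \<mm>: "\<mm> = {x \<in> carrier D. \<chi> x = 0}"
      using maximal_ideal_is_kernel[OF H.B.TP.k_algebra cr assms(6)] by blast
    obtain T :: "(('k, 'b) gwa_skew_elt, ('k, 'b) gwa_skew_elt set) module" and v where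
      T: "skew_module S.U A D (perm_group n G) j \<gamma> \<iota> perm_act perm_act Yt n T \<chi> v"
      using skew_module_exists[OF \<chi>] by blast
    note TG_def = skew_module.TG_def[OF T]
    let ?TG = "fixed_module n B s b G T"
    have TG: "skew_module.TG (perm_group n G) j \<gamma> T = ?TG"
      unfolding TG_def fixed_module_def perm_group_simps(1) ..
    have simple: "holonomic n S.U T \<and> irreducible_module (invariant_alg A (perm_group n G) perm_act) ?TG \<and>
        harish_chandra_module (invariant_alg A (perm_group n G) perm_act) (invariant_alg D (perm_group n G) perm_act) \<iota> ?TG \<and>
        holonomic n (invariant_alg A (perm_group n G) perm_act) ?TG"
      if "simple_tensorial_classical_or_quantum n B s b"
    proof -
      have "classical_type B s \<or> quantum_type B s" "simple_ring A"
        using that by (simp_all add: simple_tensorial_classical_or_quantum_def)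
      from skew_module_simple[OF T \<chi> this] obtain \<epsilon> \<chi>' where
        Ts: "skew_module_simple S.U A D (perm_group n G) j \<gamma> \<iota> perm_act perm_act Yt n T \<chi> v \<epsilon> \<chi>'" by blast
      obtain x where x: "x \<in> carrier ?TG" "x \<noteq> \<zero>\<^bsub>T\<^esub>"
        using skew_module_simple.TG_nonzero[OF Ts] unfolding TG by blast
      show ?thesis
        using skew_module_simple.holonomic_T[OF Ts] skew_module_simple.holonomic_TG[OF Ts]
          skew_module.TG_irreducible[OF T, unfolded TG, OF x] skew_module.harish_chandra_TG(1)[OF T, unfolded TG, OF x]
        unfolding TG skew_act.AG_def[OF skew_act] skew_act.DG_def[OF skew_act] by blast
    qed
    have "irreducible_module S.U T" using T by (simp add: skew_module_def skew_module_axioms_def)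
    then show "\<exists>T :: (('k, 'b) gwa_skew_elt, ('k, 'b) gwa_skew_elt set) module.
         irreducible_module S.U T \<and>
         harish_chandra_module S.U D (j \<circ> \<iota>) T \<and>
         \<mm> \<in> hc_support D (j \<circ> \<iota>) T \<and>
         (simple_tensorial_classical_or_quantum n B s b \<longrightarrow>
            holonomic n S.U T \<and>
            irreducible_module (invariant_alg A (perm_group n G) perm_act) (fixed_module n B s b G T) \<and>
            harish_chandra_module (invariant_alg A (perm_group n G) perm_act) (invariant_alg D (perm_group n G) perm_act) \<iota>
              (fixed_module n B s b G T) \<and>
            holonomic n (invariant_alg A (perm_group n G) perm_act) (fixed_module n B s b G T))"
      using skew_module.harish_chandra_T[OF T] skew_module.support_T[OF T] simple unfolding \<mm> by blast
  qed
qed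

end
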